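(* Let $\pi\colon P\to M$ be a principal $\mathbb{X}$-bundle for a Lie groupoid $\mathbb{X}=[X_1\rightrightarrows X_0]$ with an Ehresmann connection $\mathbb{H}$. Then $\mathcal{A}\mathfrak{t}(P)$, as defined in the context, is a diffeological groupoid, and $\bar\pi_{\mathcal{A}\mathfrak{t}(P)}\colon\mathcal{A}\mathfrak{t}(P)\to M$, $[p,u,v]\mapsto\pi(p)$, $([p,u,v],g)\mapsto\pi(p)$ is a smooth surjective functor to the discrete category $M$ such that the connected components of each fibre $\bar\pi^{-1}_{\mathcal{A}\mathfrak{t}(P)}(m)$, $m\in M$, form a graded vector space (with the operations given in the context).
   Context: Lie groupoid $\mathbb{X}=[X_1\rightrightarrows X_0]$: source $s$, target $t$ are submersions, $gh$ is defined when $s(g)=t(h)$, units $1_x$, inversion $i$. Right action on $P$ with anchor $a\colon P\to X_0$: $pg$ is defined when $a(p)=t(g)$, $a(pg)=s(g)$, $(pg)h=p(gh)$, $p1_{a(p)}=p$; for $(u,\beta)$ tangent to $P\times_{a,X_0,t}X_1$ at $(p,g)$, $u.\beta\in T_{pg}P$ is its image under the differential of the action. Principal $\mathbb{X}$-bundle: a surjective submersion $\pi\colon P\to M$ with a right action, $\pi(pg)=\pi(p)$, and $(p,g)\mapsto(p,pg)$ a diffeomorphism $P\times_{X_0}X_1\to P\times_MP$. Ehresmann connection: a subbundle $\mathbb{H}\subset TX_1$ with $TX_1=\mathbb{H}\oplus\ker ds$ and $\mathbb{H}_{1_x}=(d1)_x(T_xX_0)$; $\sigma_g\colon T_{s(g)}X_0\to\mathbb{H}_g$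 is the inverse of $ds|_{\mathbb{H}_g}$. $\lambda^1_g=(dt)_g\sigma_g\colon T_{s(g)}X_0\to T_{t(g)}X_0$. For $a(p)=t(g)$: $\tau^0_g\colon T_pP\to T_{pg}P$, $\tau^0_g(u)=u.(di)_{g^{-1}}\sigma_{g^{-1}}(da)_p(u)$, and $\tau^1_g=\lambda^1_{g^{-1}}\colon T_{a(p)}X_0\to T_{a(pg)}X_0$. $\mathcal{A}\mathfrak{t}(P)$: on the manifold $TP\oplus a^*TX_0$ put $(p,u,v)\sim(p',u',v')$ iff $p=p'$, $u-u'=\sum_{i=1}^n(\tau^0_{g_ih_i}-\tau^0_{h_i}\tau^0_{g_i})(u_i)$ and $v-v'=\sum_{i=1}^n(\tau^1_{g_ih_i}-\tau^1_{h_i}\tau^1_{g_i})(v_i)$ for some $n$, $p_i\in P$, $g_i,h_i\in X_1$, $u_i\in T_{p_i}P$, $v_i\in T_{a(p_i)}X_0$ with $p=p_ig_ih_i$. Objects: classes $[p,u,v]$, with the quotient diffeology. Morphisms: $([p,u,v],g)$ with $a(p)=t(g)$, with the fibre product diffeology on $\bigl((TP\oplus a^*TX_0)/\!\sim\bigr)\times_{X_0}X_1$. Source $[p,u,v]$, target $[pg,\tau^0_g(u),\tau^1_g(v)]$; unit arrow $([p,u,v],1_{a(p)})$; the composite of an arrow with component $g$ followed by one with component $h$ has component $gh$. A diffeological groupoid is a groupoid internal to diffeological spaces and smooth maps. $\langle[p,u,v]\rangle$ denotes the connected component (isomorphism class) in the fibre subgroupoid over $m$; for $q=pg$, $\langle[p,u,v]\rangle+\langle[q,u',v']\rangle=\langle[pg,\tau^0_g(u)+u',\tau^1_g(v)+v']\rangle$,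 and $c\langle[p,u,v]\rangle=\langle[p,cu,cv]\rangle$; the grading is by the $u$- and $v$-components. *)

theory Defs
  imports
    "HOL-Analysis.Analysis"
    "HOL-Library.Function_Algebras"
    "HOL-Algebra.Module"
begin

section \<open>Smooth functions on open subsets of \<open>\<real>\<^sup>n\<close>\<close>

text \<open>
  The space \<open>\<real>\<^sup>n\<close> is \<^const>\<open>Euclidean_space\<close> \<open>n\<close>: functions \<open>nat \<Rightarrow> real\<close> vanishing
  from index \<open>n\<close> on. The number \<open>n\<close> is a term, since diffeologies quantify over all \<open>n\<close>, and
  \<open>n = 0\<close> is allowed.
\<close>

definition partial :: "nat \<Rightarrow> ((nat \<Rightarrow> real) \<Rightarrow> real) \<Rightarrow> (nat \<Rightarrow> real) \<Rightarrow> real" where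
  "partial i f x = deriv (\<lambda>t. f (x(i := t))) (x i)"

primrec Ck_on :: "nat \<Rightarrow> nat \<Rightarrow> (nat \<Rightarrow> real) set \<Rightarrow> ((nat \<Rightarrow> real) \<Rightarrow> real) \<Rightarrow> bool" where
  "Ck_on n 0 U f \<longleftrightarrow> continuous_map (subtopology (Euclidean_space n) U) euclideanreal f"
| "Ck_on n (Suc k) U f \<longleftrightarrow>
     continuous_map (subtopology (Euclidean_space n) U) euclideanreal f \<and>
     (\<forall>i<n. (\<forall>x\<in>U. (\<lambda>t. f (x(i := t))) field_differentiable at (x i)) \<and>
            Ck_on n k U (partial i f))"

definition smooth_euc :: "nat \<Rightarrow> nat \<Rightarrow> (nat \<Rightarrow> real) set \<Rightarrow> ((nat \<Rightarrow> real) \<Rightarrow> (nat \<Rightarrow> real)) \<Rightarrow> bool" where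
  "smooth_euc n m U f \<longleftrightarrow> openin (Euclidean_space n) U \<and> f ` U \<subseteq> topspace (Euclidean_space m) \<and>
     (\<forall>j<m. \<forall>k. Ck_on n k U (\<lambda>x. f x j))"

definition jacobian_apply ::
  "nat \<Rightarrow> nat \<Rightarrow> ((nat \<Rightarrow> real) \<Rightarrow> (nat \<Rightarrow> real)) \<Rightarrow> (nat \<Rightarrow> real) \<Rightarrow> (nat \<Rightarrow> real) \<Rightarrow> (nat \<Rightarrow> real)" where
  "jacobian_apply n m f x v =
     (\<lambda>j. if j < m then \<Sum>i<n. partial i (\<lambda>y. f y j) x * v i else 0)"

definition concat_euc :: "nat \<Rightarrow> (nat \<Rightarrow> real) \<Rightarrow> (nat \<Rightarrow> real) \<Rightarrow> (nat \<Rightarrow> real)" where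
  "concat_euc n x y = (\<lambda>i. if i < n then x i else y (i - n))"


section \<open>Smooth manifolds\<close>

text \<open>
  A chart is a pair of its domain and its coordinate map. The topology of a manifold is the one
  determined by the atlas.
\<close>

type_synonym 'a chart = "'a set \<times> ('a \<Rightarrow> nat \<Rightarrow> real)"

record 'a mfd =
  mcarrier :: "'a set"
  mdim :: nat
  atlas :: "'a chart set"

definition chart_inv :: "'a chart \<Rightarrow> (nat \<Rightarrow> real) \<Rightarrow> 'a" where
  "chart_inv c = the_inv_into (fst c) (snd c)"

definition mopen :: "'a mfd \<Rightarrow> 'a set \<Rightarrow> bool" where
  "mopen N W \<longleftrightarrow> W \<subseteq> mcarrier N \<and>
     (\<forall>c\<in>atlas N. openin (Euclidean_space (mdim N)) (snd c ` (W \<inter> fst c)))"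

definition mtop :: "'a mfd \<Rightarrow> 'a topology" where
  "mtop N = topology (mopen N)"

definition coord_rep :: "'a chart \<Rightarrow> 'b chart \<Rightarrow> ('a \<Rightarrow> 'b) \<Rightarrow> (nat \<Rightarrow> real) \<Rightarrow> (nat \<Rightarrow> real)" where
  "coord_rep c c' f = snd c' \<circ> f \<circ> chart_inv c"

definition smooth_atlas :: "'a mfd \<Rightarrow> bool" where
  "smooth_atlas N \<longleftrightarrow>
     \<Union>(fst ` atlas N) = mcarrier N \<and>
     (\<forall>c\<in>atlas N. inj_on (snd c) (fst c) \<and>
        openin (Euclidean_space (mdim N)) (snd c ` fst c)) \<and>
     (\<forall>c\<in>atlas N. \<forall>c'\<in>atlas N.
        smooth_euc (mdim N) (mdim N) (snd c ` (fst c \<inter> fst c')) (coord_rep c c' (\<lambda>x. x)))"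

definition smooth_manifold :: "'a mfd \<Rightarrow> bool" where
  "smooth_manifold N \<longleftrightarrow>
     smooth_atlas N \<and> Hausdorff_space (mtop N) \<and> second_countable (mtop N)"

lemma openin_mtop:
  assumes "smooth_atlas N"
  shows "openin (mtop N) = mopen N"
proof -
  have inj: "inj_on (snd c) (fst c)" if "c \<in> atlas N" for c
    using assms that by (auto simp: smooth_atlas_def)
  have "istopology (mopen N)"
    unfolding istopology_def
  proof (intro conjI allI impI)
    fix S T assume S: "mopen N S" and T: "mopen N T"
    have "snd c ` (S \<inter> T \<inter> fst c) = snd c ` (S \<inter> fst c) \<inter> snd c ` (T \<inter> fst c)"
      if "c \<in> atlas N" for c
      using inj[OF that] by (auto simp: inj_on_def)
    with S T show "mopen N (S \<inter> T)" by (auto simp: mopen_def)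
  next
    fix K assume K: "\<forall>S\<in>K. mopen N S"
    have "snd c ` (\<Union>K \<inter> fst c) = (\<Union>S\<in>K. snd c ` (S \<inter> fst c))" for c :: "'a chart"
      by auto
    with K show "mopen N (\<Union>K)"
      unfolding mopen_def by (metis (no_types, lifting) Sup_le_iff imageE openin_Union)
  qed
  then show ?thesis by (simp add: mtop_def topology_inverse')
qed

text \<open>Smooth maps defined on an open subset of a manifold.\<close>

definition smooth_map_on :: "'a mfd \<Rightarrow> 'a set \<Rightarrow> 'b mfd \<Rightarrow> ('a \<Rightarrow> 'b) \<Rightarrow> bool" where
  "smooth_map_on N W N' f \<longleftrightarrow> openin (mtop N) W \<and> f ` W \<subseteq> mcarrier N' \<and>
     (\<forall>c\<in>atlas N. \<forall>c'\<in>atlas N'.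
        smooth_euc (mdim N) (mdim N') (snd c ` {x \<in> W \<inter> fst c. f x \<in> fst c'}) (coord_rep c c' f))"

abbreviation smooth_map :: "'a mfd \<Rightarrow> 'b mfd \<Rightarrow> ('a \<Rightarrow> 'b) \<Rightarrow> bool" where
  "smooth_map N N' f \<equiv> smooth_map_on N (mcarrier N) N' f"

text \<open>
  Smooth maps on an arbitrary subset: those which locally extend to smooth maps on open sets of the
  ambient manifold. All subsets used below are fibre products along submersions; these are embedded
  submanifolds of the product, for which this is smoothness with respect to the submanifold structure.
\<close>

definition smooth_ext :: "'a mfd \<Rightarrow> 'a set \<Rightarrow> 'b mfd \<Rightarrow> ('a \<Rightarrow> 'b) \<Rightarrow> 'a set \<Rightarrow> ('a \<Rightarrow> 'b) \<Rightarrow> bool" where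
  "smooth_ext N A N' f W F \<longleftrightarrow> smooth_map_on N W N' F \<and> (\<forall>x\<in>A \<inter> W. F x = f x)"

definition smooth_on_subset :: "'a mfd \<Rightarrow> 'a set \<Rightarrow> 'b mfd \<Rightarrow> ('a \<Rightarrow> 'b) \<Rightarrow> bool" where
  "smooth_on_subset N A N' f \<longleftrightarrow> A \<subseteq> mcarrier N \<and> f ` A \<subseteq> mcarrier N' \<and>
     (\<forall>x\<in>A. \<exists>W F. x \<in> W \<and> smooth_ext N A N' f W F)"

definition diffeo_subsets :: "'a mfd \<Rightarrow> 'a set \<Rightarrow> 'b mfd \<Rightarrow> 'b set \<Rightarrow> ('a \<Rightarrow> 'b) \<Rightarrow> bool" where
  "diffeo_subsets N A N' B f \<longleftrightarrow> bij_betw f A B \<and>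
     smooth_on_subset N A N' f \<and> smooth_on_subset N' B N (the_inv_into A f)"

definition euclidean_mfd :: "nat \<Rightarrow> (nat \<Rightarrow> real) mfd" where
  "euclidean_mfd n = \<lparr>mcarrier = topspace (Euclidean_space n), mdim = n,
     atlas = {(topspace (Euclidean_space n), \<lambda>x. x)}\<rparr>"

definition prod_mfd :: "'a mfd \<Rightarrow> 'b mfd \<Rightarrow> ('a \<times> 'b) mfd" where
  "prod_mfd N N' = \<lparr>mcarrier = mcarrier N \<times> mcarrier N', mdim = mdim N + mdim N',
     atlas = {(fst c \<times> fst c', \<lambda>(x, y). concat_euc (mdim N) (snd c x) (snd c' y)) | c c'.
                c \<in> atlas N \<and> c' \<in> atlas N'}\<rparr>"


section \<open>Tangent vectors\<close>

text \<open>
  A tangent vector at \<open>x\<close> is the family of its coordinate vectors in all charts around \<open>x\<close>, which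
  transform by the Jacobians of the coordinate changes; the value at any other pair is \<open>0\<close>, so that
  the vector space operations are pointwise.
\<close>

type_synonym 'a tvec = "'a chart \<Rightarrow> nat \<Rightarrow> real"

definition charts_at :: "'a mfd \<Rightarrow> 'a \<Rightarrow> 'a chart set" where
  "charts_at N x = {c \<in> atlas N. x \<in> fst c}"

definition tangent_space :: "'a mfd \<Rightarrow> 'a \<Rightarrow> 'a tvec set" where
  "tangent_space N x = {\<xi>.
     (\<forall>c. c \<notin> charts_at N x \<longrightarrow> \<xi> c = 0) \<and>
     (\<forall>c\<in>charts_at N x. \<xi> c \<in> topspace (Euclidean_space (mdim N))) \<and>
     (\<forall>c\<in>charts_at N x. \<forall>c'\<in>charts_at N x.
        \<xi> c' = jacobian_apply (mdim N) (mdim N) (coord_rep c c' (\<lambda>y. y)) (snd c x) (\<xi> c))}"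

definition tscale :: "real \<Rightarrow> 'a tvec \<Rightarrow> 'a tvec" where
  "tscale r \<xi> = (\<lambda>c i. r * \<xi> c i)"

definition differential :: "'a mfd \<Rightarrow> 'b mfd \<Rightarrow> ('a \<Rightarrow> 'b) \<Rightarrow> 'a \<Rightarrow> 'a tvec \<Rightarrow> 'b tvec" where
  "differential N N' f x \<xi> =
     (let c = (SOME c. c \<in> charts_at N x)
      in (\<lambda>c'. if c' \<in> charts_at N' (f x)
               then jacobian_apply (mdim N) (mdim N') (coord_rep c c' f) (snd c x) (\<xi> c) else 0))"

text \<open>
  The differential at \<open>x\<close> of a map that is smooth on an embedded submanifold \<open>A\<close>, applied to a vector
  tangent to \<open>A\<close>.
\<close>

definition differential_subset ::
  "'a mfd \<Rightarrow> 'a set \<Rightarrow> 'b mfd \<Rightarrow> ('a \<Rightarrow> 'b) \<Rightarrow> 'a \<Rightarrow> 'a tvec \<Rightarrow> 'b tvec" where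
  "differential_subset N A N' f x \<xi> =
     (THE \<eta>. \<exists>W F. x \<in> W \<and> smooth_ext N A N' f W F \<and> \<eta> = differential N N' F x \<xi>)"

text \<open>The identification \<open>T\<^sub>x N \<times> T\<^sub>y N' = T\<^sub>(\<^sub>x\<^sub>,\<^sub>y\<^sub>) (N \<times> N')\<close>.\<close>

definition tangent_pair :: "'a mfd \<Rightarrow> 'b mfd \<Rightarrow> 'a \<Rightarrow> 'b \<Rightarrow> 'a tvec \<Rightarrow> 'b tvec \<Rightarrow> ('a \<times> 'b) tvec" where
  "tangent_pair N N' x y \<xi> \<eta> =
     (THE \<zeta>. \<zeta> \<in> tangent_space (prod_mfd N N') (x, y) \<and>
        differential (prod_mfd N N') N fst (x, y) \<zeta> = \<xi> \<and>
        differential (prod_mfd N N') N' snd (x, y) \<zeta> = \<eta>)"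

definition tangent_bundle :: "'a mfd \<Rightarrow> ('a \<times> 'a tvec) mfd" where
  "tangent_bundle N = \<lparr>mcarrier = (SIGMA x:mcarrier N. tangent_space N x), mdim = 2 * mdim N,
     atlas = {((SIGMA x:fst c. tangent_space N x),
               \<lambda>(x, \<xi>). concat_euc (mdim N) (snd c x) (\<xi> c)) | c. c \<in> atlas N}\<rparr>"

definition submersion :: "'a mfd \<Rightarrow> 'b mfd \<Rightarrow> ('a \<Rightarrow> 'b) \<Rightarrow> bool" where
  "submersion N N' f \<longleftrightarrow> smooth_map N N' f \<and>
     (\<forall>x\<in>mcarrier N. differential N N' f x ` tangent_space N x = tangent_space N' (f x))"


section \<open>Lie groupoids, principal bundles and Ehresmann connections\<close>

text \<open>The product \<open>lmul X g h\<close> is defined for \<open>lsrc X g = ltgt X h\<close>.\<close>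

record ('x, 'g) lgroupoid =
  lobj :: "'x mfd"
  larr :: "'g mfd"
  lsrc :: "'g \<Rightarrow> 'x"
  ltgt :: "'g \<Rightarrow> 'x"
  lmul :: "'g \<Rightarrow> 'g \<Rightarrow> 'g"
  lunit :: "'x \<Rightarrow> 'g"
  linv :: "'g \<Rightarrow> 'g"

definition composable :: "('x, 'g) lgroupoid \<Rightarrow> ('g \<times> 'g) set" where
  "composable X = {(g, h). g \<in> mcarrier (larr X) \<and> h \<in> mcarrier (larr X) \<and> lsrc X g = ltgt X h}"

definition lie_groupoid :: "('x, 'g) lgroupoid \<Rightarrow> bool" where
  "lie_groupoid X \<longleftrightarrow>
     smooth_manifold (lobj X) \<and> smooth_manifold (larr X) \<and>
     submersion (larr X) (lobj X) (lsrc X) \<and> submersion (larr X) (lobj X) (ltgt X) \<and>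
     smooth_map (lobj X) (larr X) (lunit X) \<and> smooth_map (larr X) (larr X) (linv X) \<and>
     smooth_on_subset (prod_mfd (larr X) (larr X)) (composable X) (larr X) (\<lambda>(g, h). lmul X g h) \<and>
     (\<forall>(g, h)\<in>composable X. lsrc X (lmul X g h) = lsrc X h \<and> ltgt X (lmul X g h) = ltgt X g) \<and>
     (\<forall>g h k. (g, h) \<in> composable X \<and> (h, k) \<in> composable X \<longrightarrow>
        lmul X (lmul X g h) k = lmul X g (lmul X h k)) \<and>
     (\<forall>x\<in>mcarrier (lobj X). lsrc X (lunit X x) = x \<and> ltgt X (lunit X x) = x) \<and>
     (\<forall>g\<in>mcarrier (larr X).
        lmul X g (lunit X (lsrc X g)) = g \<and> lmul X (lunit X (ltgt X g)) g = g \<and>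
        lsrc X (linv X g) = ltgt X g \<and> ltgt X (linv X g) = lsrc X g \<and>
        lmul X g (linv X g) = lunit X (ltgt X g) \<and> lmul X (linv X g) g = lunit X (lsrc X g))"

record ('x, 'g, 'p, 'm) pbundle =
  ptotal :: "'p mfd"
  pbase :: "'m mfd"
  pproj :: "'p \<Rightarrow> 'm"
  panchor :: "'p \<Rightarrow> 'x"
  pact :: "'p \<Rightarrow> 'g \<Rightarrow> 'p"

definition action_domain :: "('x, 'g) lgroupoid \<Rightarrow> ('x, 'g, 'p, 'm) pbundle \<Rightarrow> ('p \<times> 'g) set" where
  "action_domain X B =
     {(p, g). p \<in> mcarrier (ptotal B) \<and> g \<in> mcarrier (larr X) \<and> panchor B p = ltgt X g}"

definition right_action :: "('x, 'g) lgroupoid \<Rightarrow> ('x, 'g, 'p, 'm) pbundle \<Rightarrow> bool" where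
  "right_action X B \<longleftrightarrow>
     smooth_map (ptotal B) (lobj X) (panchor B) \<and>
     smooth_on_subset (prod_mfd (ptotal B) (larr X)) (action_domain X B) (ptotal B)
       (\<lambda>(p, g). pact B p g) \<and>
     (\<forall>(p, g)\<in>action_domain X B. panchor B (pact B p g) = lsrc X g) \<and>
     (\<forall>p g h. (p, g) \<in> action_domain X B \<and> (g, h) \<in> composable X \<longrightarrow>
        pact B (pact B p g) h = pact B p (lmul X g h)) \<and>
     (\<forall>p\<in>mcarrier (ptotal B). pact B p (lunit X (panchor B p)) = p)"

definition principal_bundle :: "('x, 'g) lgroupoid \<Rightarrow> ('x, 'g, 'p, 'm) pbundle \<Rightarrow> bool" where
  "principal_bundle X B \<longleftrightarrow>
     smooth_manifold (ptotal B) \<and> smooth_manifold (pbase B) \<and>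
     submersion (ptotal B) (pbase B) (pproj B) \<and>
     pproj B ` mcarrier (ptotal B) = mcarrier (pbase B) \<and>
     right_action X B \<and>
     (\<forall>(p, g)\<in>action_domain X B. pproj B (pact B p g) = pproj B p) \<and>
     diffeo_subsets (prod_mfd (ptotal B) (larr X)) (action_domain X B)
       (prod_mfd (ptotal B) (ptotal B))
       {(p, q). p \<in> mcarrier (ptotal B) \<and> q \<in> mcarrier (ptotal B) \<and> pproj B p = pproj B q}
       (\<lambda>(p, g). (p, pact B p g))"

text \<open>
  Distributions \<open>H\<close> which are linear in each fibre, and which have a smooth frame around every point.
\<close>

definition smooth_subbundle :: "'a mfd \<Rightarrow> ('a \<Rightarrow> 'a tvec set) \<Rightarrow> bool" where
  "smooth_subbundle N H \<longleftrightarrow>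
     (\<forall>x\<in>mcarrier N. H x \<subseteq> tangent_space N x \<and> 0 \<in> H x \<and>
        (\<forall>\<xi>\<in>H x. \<forall>\<eta>\<in>H x. \<xi> + \<eta> \<in> H x) \<and> (\<forall>r. \<forall>\<xi>\<in>H x. tscale r \<xi> \<in> H x)) \<and>
     (\<forall>x\<in>mcarrier N. \<exists>W (r::nat) e. x \<in> W \<and>
        (\<forall>i<r. smooth_map_on N W (tangent_bundle N) (\<lambda>y. (y, e i y))) \<and>
        (\<forall>y\<in>W. (\<forall>i<r. e i y \<in> H y) \<and>
           (\<forall>\<xi>\<in>H y. \<exists>!b. b \<in> topspace (Euclidean_space r) \<and>
              \<xi> = (\<Sum>i<r. tscale (b i) (e i y)))))"

definition ehresmann_connection :: "('x, 'g) lgroupoid \<Rightarrow> ('g \<Rightarrow> 'g tvec set) \<Rightarrow> bool" where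
  "ehresmann_connection X H \<longleftrightarrow> smooth_subbundle (larr X) H \<and>
     (\<forall>g\<in>mcarrier (larr X). \<forall>\<xi>\<in>tangent_space (larr X) g.
        \<exists>!(\<eta>, \<kappa>). \<eta> \<in> H g \<and> \<kappa> \<in> tangent_space (larr X) g \<and>
          differential (larr X) (lobj X) (lsrc X) g \<kappa> = 0 \<and> \<xi> = \<eta> + \<kappa>) \<and>
     (\<forall>x\<in>mcarrier (lobj X).
        H (lunit X x) = differential (lobj X) (larr X) (lunit X) x ` tangent_space (lobj X) x)"

definition hor_lift :: "('x, 'g) lgroupoid \<Rightarrow> ('g \<Rightarrow> 'g tvec set) \<Rightarrow> 'g \<Rightarrow> 'x tvec \<Rightarrow> 'g tvec" where
  "hor_lift X H g = the_inv_into (H g) (differential (larr X) (lobj X) (lsrc X) g)"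

definition lambda1 :: "('x, 'g) lgroupoid \<Rightarrow> ('g \<Rightarrow> 'g tvec set) \<Rightarrow> 'g \<Rightarrow> 'x tvec \<Rightarrow> 'x tvec" where
  "lambda1 X H g v = differential (larr X) (lobj X) (ltgt X) g (hor_lift X H g v)"

text \<open>The vector \<open>u.\<beta>\<close>, for \<open>(u, \<beta>)\<close> tangent to the action domain at \<open>(p, g)\<close>.\<close>

definition tangent_act ::
  "('x, 'g) lgroupoid \<Rightarrow> ('x, 'g, 'p, 'm) pbundle \<Rightarrow> 'p \<Rightarrow> 'g \<Rightarrow> 'p tvec \<Rightarrow> 'g tvec \<Rightarrow> 'p tvec" where
  "tangent_act X B p g u \<beta> =
     differential_subset (prod_mfd (ptotal B) (larr X)) (action_domain X B) (ptotal B)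
       (\<lambda>(p, g). pact B p g) (p, g) (tangent_pair (ptotal B) (larr X) p g u \<beta>)"

definition tau0 ::
  "('x, 'g) lgroupoid \<Rightarrow> ('g \<Rightarrow> 'g tvec set) \<Rightarrow> ('x, 'g, 'p, 'm) pbundle \<Rightarrow>
     'p \<Rightarrow> 'g \<Rightarrow> 'p tvec \<Rightarrow> 'p tvec" where
  "tau0 X H B p g u =
     tangent_act X B p g u
       (differential (larr X) (larr X) (linv X) (linv X g)
         (hor_lift X H (linv X g) (differential (ptotal B) (lobj X) (panchor B) p u)))"

definition tau1 :: "('x, 'g) lgroupoid \<Rightarrow> ('g \<Rightarrow> 'g tvec set) \<Rightarrow> 'g \<Rightarrow> 'x tvec \<Rightarrow> 'x tvec" where
  "tau1 X H g = lambda1 X H (linv X g)"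


section \<open>Diffeological spaces and groupoids\<close>

text \<open>
  Parametrizations are total functions of which only the values on the open set \<open>U\<close> matter; the last
  axiom of \<open>diffeological_space\<close>, with \<open>h\<close> the identity, makes this explicit.
\<close>

record 'a diffeology =
  dcarrier :: "'a set"
  plot :: "nat \<Rightarrow> (nat \<Rightarrow> real) set \<Rightarrow> ((nat \<Rightarrow> real) \<Rightarrow> 'a) \<Rightarrow> bool"

definition diffeological_space :: "'a diffeology \<Rightarrow> bool" where
  "diffeological_space D \<longleftrightarrow>
     (\<forall>n U f. plot D n U f \<longrightarrow> openin (Euclidean_space n) U \<and> f ` U \<subseteq> dcarrier D) \<and>
     (\<forall>n U x. openin (Euclidean_space n) U \<and> x \<in> dcarrier D \<longrightarrow> plot D n U (\<lambda>_. x)) \<and>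
     (\<forall>n U f. openin (Euclidean_space n) U \<and>
        (\<forall>x\<in>U. \<exists>V. x \<in> V \<and> V \<subseteq> U \<and> plot D n V f) \<longrightarrow> plot D n U f) \<and>
     (\<forall>n m U V f f' h. plot D m V f \<and> smooth_euc n m U h \<and> h ` U \<subseteq> V \<and>
        (\<forall>x\<in>U. f' x = f (h x)) \<longrightarrow> plot D n U f')"

definition dsmooth :: "'a diffeology \<Rightarrow> 'b diffeology \<Rightarrow> ('a \<Rightarrow> 'b) \<Rightarrow> bool" where
  "dsmooth D D' f \<longleftrightarrow> f ` dcarrier D \<subseteq> dcarrier D' \<and>
     (\<forall>n U q. plot D n U q \<longrightarrow> plot D' n U (f \<circ> q))"

definition mfd_diffeology :: "'a mfd \<Rightarrow> 'a diffeology" where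
  "mfd_diffeology N = \<lparr>dcarrier = mcarrier N,
     plot = \<lambda>n U f. smooth_map_on (euclidean_mfd n) U N f\<rparr>"

definition prod_diffeology :: "'a diffeology \<Rightarrow> 'b diffeology \<Rightarrow> ('a \<times> 'b) diffeology" where
  "prod_diffeology D D' = \<lparr>dcarrier = dcarrier D \<times> dcarrier D',
     plot = \<lambda>n U f. plot D n U (fst \<circ> f) \<and> plot D' n U (snd \<circ> f)\<rparr>"

definition induced_diffeology :: "'a set \<Rightarrow> ('a \<Rightarrow> 'b) \<Rightarrow> 'b diffeology \<Rightarrow> 'a diffeology" where
  "induced_diffeology A j D = \<lparr>dcarrier = A, plot = \<lambda>n U f. f ` U \<subseteq> A \<and> plot D n U (j \<circ> f)\<rparr>"

definition sub_diffeology :: "'a set \<Rightarrow> 'a diffeology \<Rightarrow> 'a diffeology" where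
  "sub_diffeology A D = induced_diffeology A (\<lambda>x. x) D"

definition quotient_diffeology :: "'a diffeology \<Rightarrow> ('a \<times> 'a) set \<Rightarrow> 'a set diffeology" where
  "quotient_diffeology D r = \<lparr>dcarrier = dcarrier D // r,
     plot = \<lambda>n U f. openin (Euclidean_space n) U \<and>
       (\<forall>x\<in>U. \<exists>V q. x \<in> V \<and> V \<subseteq> U \<and> plot D n V q \<and> (\<forall>y\<in>V. f y = r `` {q y}))\<rparr>"

text \<open>
  In contrast to \<^const>\<open>lmul\<close>, \<open>gcomp G \<gamma> \<delta>\<close> is the composite of \<open>\<gamma>\<close> followed by \<open>\<delta>\<close>.
\<close>

record ('o, 'a) dgroupoid =
  gobj :: "'o diffeology"
  garr :: "'a diffeology"
  gsrc :: "'a \<Rightarrow> 'o"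
  gtgt :: "'a \<Rightarrow> 'o"
  gunit :: "'o \<Rightarrow> 'a"
  gcomp :: "'a \<Rightarrow> 'a \<Rightarrow> 'a"

definition gcomposable :: "('o, 'a) dgroupoid \<Rightarrow> ('a \<times> 'a) set" where
  "gcomposable G =
     {(\<gamma>, \<delta>). \<gamma> \<in> dcarrier (garr G) \<and> \<delta> \<in> dcarrier (garr G) \<and> gtgt G \<gamma> = gsrc G \<delta>}"

definition diffeological_groupoid :: "('o, 'a) dgroupoid \<Rightarrow> bool" where
  "diffeological_groupoid G \<longleftrightarrow>
     diffeological_space (gobj G) \<and> diffeological_space (garr G) \<and>
     dsmooth (garr G) (gobj G) (gsrc G) \<and> dsmooth (garr G) (gobj G) (gtgt G) \<and>
     dsmooth (gobj G) (garr G) (gunit G) \<and>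
     dsmooth (sub_diffeology (gcomposable G) (prod_diffeology (garr G) (garr G))) (garr G)
       (\<lambda>(\<gamma>, \<delta>). gcomp G \<gamma> \<delta>) \<and>
     (\<forall>(\<gamma>, \<delta>)\<in>gcomposable G.
        gsrc G (gcomp G \<gamma> \<delta>) = gsrc G \<gamma> \<and> gtgt G (gcomp G \<gamma> \<delta>) = gtgt G \<delta>) \<and>
     (\<forall>\<gamma> \<delta> \<epsilon>. (\<gamma>, \<delta>) \<in> gcomposable G \<and> (\<delta>, \<epsilon>) \<in> gcomposable G \<longrightarrow>
        gcomp G (gcomp G \<gamma> \<delta>) \<epsilon> = gcomp G \<gamma> (gcomp G \<delta> \<epsilon>)) \<and>
     (\<forall>x\<in>dcarrier (gobj G). gsrc G (gunit G x) = x \<and> gtgt G (gunit G x) = x) \<and>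
     (\<forall>\<gamma>\<in>dcarrier (garr G).
        gcomp G (gunit G (gsrc G \<gamma>)) \<gamma> = \<gamma> \<and> gcomp G \<gamma> (gunit G (gtgt G \<gamma>)) = \<gamma>) \<and>
     (\<exists>j. dsmooth (garr G) (garr G) j \<and>
        (\<forall>\<gamma>\<in>dcarrier (garr G).
           gsrc G (j \<gamma>) = gtgt G \<gamma> \<and> gtgt G (j \<gamma>) = gsrc G \<gamma> \<and>
           gcomp G \<gamma> (j \<gamma>) = gunit G (gsrc G \<gamma>) \<and> gcomp G (j \<gamma>) \<gamma> = gunit G (gtgt G \<gamma>)))"

definition smooth_functor ::
  "('o, 'a) dgroupoid \<Rightarrow> ('o', 'a') dgroupoid \<Rightarrow> ('o \<Rightarrow> 'o') \<Rightarrow> ('a \<Rightarrow> 'a') \<Rightarrow> bool" where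
  "smooth_functor G G' F0 F1 \<longleftrightarrow>
     diffeological_groupoid G \<and> diffeological_groupoid G' \<and>
     dsmooth (gobj G) (gobj G') F0 \<and> dsmooth (garr G) (garr G') F1 \<and>
     (\<forall>\<gamma>\<in>dcarrier (garr G). gsrc G' (F1 \<gamma>) = F0 (gsrc G \<gamma>) \<and> gtgt G' (F1 \<gamma>) = F0 (gtgt G \<gamma>)) \<and>
     (\<forall>x\<in>dcarrier (gobj G). F1 (gunit G x) = gunit G' (F0 x)) \<and>
     (\<forall>(\<gamma>, \<delta>)\<in>gcomposable G. F1 (gcomp G \<gamma> \<delta>) = gcomp G' (F1 \<gamma>) (F1 \<delta>))"

text \<open>The discrete category on a space has only identity arrows, which are identified with its points.\<close>

definition discrete_dgroupoid :: "'a diffeology \<Rightarrow> ('a, 'a) dgroupoid" where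
  "discrete_dgroupoid D = \<lparr>gobj = D, garr = D, gsrc = (\<lambda>x. x), gtgt = (\<lambda>x. x),
     gunit = (\<lambda>x. x), gcomp = (\<lambda>x y. x)\<rparr>"

text \<open>Isomorphism of objects in the fibre subgroupoid over \<open>m\<close>.\<close>

definition fibre_iso ::
  "('o, 'a) dgroupoid \<Rightarrow> ('o \<Rightarrow> 'm) \<Rightarrow> ('a \<Rightarrow> 'm) \<Rightarrow> 'm \<Rightarrow> ('o \<times> 'o) set" where
  "fibre_iso G F0 F1 m =
     {(x, y). x \<in> dcarrier (gobj G) \<and> F0 x = m \<and> y \<in> dcarrier (gobj G) \<and> F0 y = m \<and>
        (\<exists>\<gamma>\<in>dcarrier (garr G). F1 \<gamma> = m \<and> gsrc G \<gamma> = x \<and> gtgt G \<gamma> = y)}"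

definition fibre_components ::
  "('o, 'a) dgroupoid \<Rightarrow> ('o \<Rightarrow> 'm) \<Rightarrow> ('a \<Rightarrow> 'm) \<Rightarrow> 'm \<Rightarrow> 'o set set" where
  "fibre_components G F0 F1 m = {x \<in> dcarrier (gobj G). F0 x = m} // fibre_iso G F0 F1 m"


section \<open>Graded vector spaces\<close>

definition real_scalars :: "real ring" where
  "real_scalars = \<lparr>carrier = UNIV, mult = (*), one = 1, zero = 0, add = (+)\<rparr>"

text \<open>
  A vector space (a module over the field of real numbers) which is the direct sum of subspaces
  indexed by the integers.
\<close>

definition graded_vector_space :: "(real, 'v) module \<Rightarrow> (int \<Rightarrow> 'v set) \<Rightarrow> bool" where
  "graded_vector_space V V' \<longleftrightarrow>
     Module.module real_scalars V \<and> (\<forall>k. submodule (V' k) real_scalars V) \<and>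
     (\<forall>x\<in>carrier V. \<exists>!w. (\<forall>k. w k \<in> V' k) \<and> finite {k. w k \<noteq> \<zero>\<^bsub>V\<^esub>} \<and>
        x = finsum V w {k. w k \<noteq> \<zero>\<^bsub>V\<^esub>})"


section \<open>The groupoid \<open>At(P)\<close>\<close>

type_synonym ('x, 'p) at_point = "'p \<times> 'p tvec \<times> 'x tvec"

definition At_total :: "('x, 'g) lgroupoid \<Rightarrow> ('x, 'g, 'p, 'm) pbundle \<Rightarrow> ('x, 'p) at_point set" where
  "At_total X B = {(p, u, v). p \<in> mcarrier (ptotal B) \<and> u \<in> tangent_space (ptotal B) p \<and>
     v \<in> tangent_space (lobj X) (panchor B p)}"

text \<open>
  The manifold \<open>TP \<oplus> a\<^sup>*TX\<^sub>0\<close> is the fibre product of \<open>TP\<close> and \<open>TX\<^sub>0\<close> over \<open>X\<^sub>0\<close>, an embedded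
  submanifold of \<open>TP \<times> TX\<^sub>0\<close>; hence its plots are those of the product with values in it.
\<close>

definition At_total_diffeology ::
  "('x, 'g) lgroupoid \<Rightarrow> ('x, 'g, 'p, 'm) pbundle \<Rightarrow> ('x, 'p) at_point diffeology" where
  "At_total_diffeology X B =
     induced_diffeology (At_total X B) (\<lambda>(p, u, v). ((p, u), (panchor B p, v)))
       (prod_diffeology (mfd_diffeology (tangent_bundle (ptotal B)))
          (mfd_diffeology (tangent_bundle (lobj X))))"

definition At_rel ::
  "('x, 'g) lgroupoid \<Rightarrow> ('g \<Rightarrow> 'g tvec set) \<Rightarrow> ('x, 'g, 'p, 'm) pbundle \<Rightarrow>
     (('x, 'p) at_point \<times> ('x, 'p) at_point) set" where
  "At_rel X H B = {((p, u, v), (p', u', v')).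
     (p, u, v) \<in> At_total X B \<and> (p', u', v') \<in> At_total X B \<and> p = p' \<and>
     (\<exists>(n::nat) ps gs hs us vs.
        (\<forall>i<n. (ps i, gs i) \<in> action_domain X B \<and> (gs i, hs i) \<in> composable X \<and>
           us i \<in> tangent_space (ptotal B) (ps i) \<and>
           vs i \<in> tangent_space (lobj X) (panchor B (ps i)) \<and>
           p = pact B (pact B (ps i) (gs i)) (hs i)) \<and>
        u - u' = (\<Sum>i<n. tau0 X H B (ps i) (lmul X (gs i) (hs i)) (us i)
          - tau0 X H B (pact B (ps i) (gs i)) (hs i) (tau0 X H B (ps i) (gs i) (us i))) \<and>
        v - v' = (\<Sum>i<n. tau1 X H (lmul X (gs i) (hs i)) (vs i)
          - tau1 X H (hs i) (tau1 X H (gs i) (vs i))))}"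

definition At_class ::
  "('x, 'g) lgroupoid \<Rightarrow> ('g \<Rightarrow> 'g tvec set) \<Rightarrow> ('x, 'g, 'p, 'm) pbundle \<Rightarrow>
     ('x, 'p) at_point \<Rightarrow> ('x, 'p) at_point set" where
  "At_class X H B z = At_rel X H B `` {z}"

text \<open>The base point \<open>p\<close> of the class \<open>[p, u, v]\<close>.\<close>

definition At_point :: "('x, 'p) at_point set \<Rightarrow> 'p" where
  "At_point z = (THE p. \<exists>u v. (p, u, v) \<in> z)"

definition At_obj ::
  "('x, 'g) lgroupoid \<Rightarrow> ('g \<Rightarrow> 'g tvec set) \<Rightarrow> ('x, 'g, 'p, 'm) pbundle \<Rightarrow>
     ('x, 'p) at_point set diffeology" where
  "At_obj X H B = quotient_diffeology (At_total_diffeology X B) (At_rel X H B)"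

definition At_arr ::
  "('x, 'g) lgroupoid \<Rightarrow> ('g \<Rightarrow> 'g tvec set) \<Rightarrow> ('x, 'g, 'p, 'm) pbundle \<Rightarrow>
     (('x, 'p) at_point set \<times> 'g) diffeology" where
  "At_arr X H B =
     sub_diffeology {(z, g). z \<in> dcarrier (At_obj X H B) \<and> g \<in> mcarrier (larr X) \<and>
         panchor B (At_point z) = ltgt X g}
       (prod_diffeology (At_obj X H B) (mfd_diffeology (larr X)))"

definition At_groupoid ::
  "('x, 'g) lgroupoid \<Rightarrow> ('g \<Rightarrow> 'g tvec set) \<Rightarrow> ('x, 'g, 'p, 'm) pbundle \<Rightarrow>
     (('x, 'p) at_point set, ('x, 'p) at_point set \<times> 'g) dgroupoid" where
  "At_groupoid X H B = \<lparr>
     gobj = At_obj X H B,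
     garr = At_arr X H B,
     gsrc = fst,
     gtgt = (\<lambda>(z, g). THE z'. \<exists>p u v. (p, u, v) \<in> z \<and>
               z' = At_class X H B (pact B p g, tau0 X H B p g u, tau1 X H g v)),
     gunit = (\<lambda>z. (z, lunit X (panchor B (At_point z)))),
     gcomp = (\<lambda>(z, g) (z', h). (z, lmul X g h))\<rparr>"

definition At_proj_obj :: "('x, 'g, 'p, 'm) pbundle \<Rightarrow> ('x, 'p) at_point set \<Rightarrow> 'm" where
  "At_proj_obj B z = pproj B (At_point z)"

definition At_proj_arr :: "('x, 'g, 'p, 'm) pbundle \<Rightarrow> ('x, 'p) at_point set \<times> 'g \<Rightarrow> 'm" where
  "At_proj_arr B = (\<lambda>(z, g). pproj B (At_point z))"

text \<open>The component of the object \<open>[p, u, v]\<close> in the fibre over \<open>\<pi>(p)\<close>.\<close>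

definition At_component ::
  "('x, 'g) lgroupoid \<Rightarrow> ('g \<Rightarrow> 'g tvec set) \<Rightarrow> ('x, 'g, 'p, 'm) pbundle \<Rightarrow>
     ('x, 'p) at_point \<Rightarrow> ('x, 'p) at_point set set" where
  "At_component X H B z =
     fibre_iso (At_groupoid X H B) (At_proj_obj B) (At_proj_arr B) (pproj B (fst z))
       `` {At_class X H B z}"

definition At_fibre ::
  "('x, 'g) lgroupoid \<Rightarrow> ('g \<Rightarrow> 'g tvec set) \<Rightarrow> ('x, 'g, 'p, 'm) pbundle \<Rightarrow> 'm \<Rightarrow>
     (real, ('x, 'p) at_point set set) module" where
  "At_fibre X H B m = \<lparr>
     carrier = fibre_components (At_groupoid X H B) (At_proj_obj B) (At_proj_arr B) m,
     mult = undefined,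
     one = undefined,
     zero = (THE C. \<exists>p\<in>mcarrier (ptotal B). pproj B p = m \<and> C = At_component X H B (p, 0, 0)),
     add = (\<lambda>C C'. THE D. \<exists>p u v g u' v'.
        (p, g) \<in> action_domain X B \<and> pproj B p = m \<and>
        (p, u, v) \<in> At_total X B \<and> (pact B p g, u', v') \<in> At_total X B \<and>
        C = At_component X H B (p, u, v) \<and> C' = At_component X H B (pact B p g, u', v') \<and>
        D = At_component X H B (pact B p g, tau0 X H B p g u + u', tau1 X H g v + v')),
     smult = (\<lambda>r C. THE D. \<exists>p u v. (p, u, v) \<in> At_total X B \<and> pproj B p = m \<and>
        C = At_component X H B (p, u, v) \<and>
        D = At_component X H B (p, tscale r u, tscale r v))\<rparr>"

definition At_grading ::
  "('x, 'g) lgroupoid \<Rightarrow> ('g \<Rightarrow> 'g tvec set) \<Rightarrow> ('x, 'g, 'p, 'm) pbundle \<Rightarrow> 'm \<Rightarrow>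
     int \<Rightarrow> ('x, 'p) at_point set set set" where
  "At_grading X H B m k =
     (if k = 0 then {At_component X H B (p, u, 0) | p u.
                       (p, u, 0) \<in> At_total X B \<and> pproj B p = m}
      else if k = 1 then {At_component X H B (p, 0, v) | p v.
                       (p, 0, v) \<in> At_total X B \<and> pproj B p = m}
      else {\<zero>\<^bsub>At_fibre X H B m\<^esub>})"

end

theory Submission
  imports Defs
begin

text \<open>
  The maps \<open>\<tau>\<^sup>0\<^sub>g\<close> and \<open>\<tau>\<^sup>1\<^sub>g\<close> are linear and equal to the identity for unit arrows, but \<open>\<tau>\<^sub>h\<tau>\<^sub>g\<close> need not
  be \<open>\<tau>\<^sub>g\<^sub>h\<close>; the relation \<open>\<sim>\<close> divides out these defects and nothing more. Since the arrows and vectors in its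
  two sums may be chosen separately for the two components (\<open>At_rel_iff\<close>), the classes over \<open>p\<close> form
  the direct sum of \<open>T\<^sub>pP\<close> and \<open>T\<^sub>a\<^sub>(\<^sub>p\<^sub>)X\<^sub>0\<close>, each modulo the span of the defects which end at \<open>p\<close>. By
  associativity, \<open>\<tau>\<^sub>k\<close> of a defect is a combination of three defects (\<open>tau_defect_generator\<close>), so \<open>\<tau>\<close>
  descends to the quotients and is functorial there. Thus arrows of \<open>X\<close> act on the classes, and \<open>At(P)\<close> is
  the groupoid of this action.

  Plots of the quotient lift locally to plots of \<open>TP \<oplus> a\<^sup>*TX\<^sub>0\<close>, so its structure maps are smooth once
  \<open>\<tau>\<^sup>0\<close> and \<open>\<tau>\<^sup>1\<close> send plots to plots (\<open>mplot_tau0\<close>, \<open>mplot_tau1\<close>). Two facts carry this. The horizontal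
  lift depends smoothly on its arguments, because its coefficients in a frame solve a linear system with
  smooth coefficients (\<open>mplot_hor_lift\<close>). And the differential of the action, a map on a fibre product only,
  can be computed from any smooth extension (\<open>differential_subset_eq\<close>), because vectors tangent to the
  zero set of a submersion are limits of difference quotients inside that set
  (\<open>zeros_tangent_to_kernel\<close>). Identities between differentials are reduced to identities between maps by
  writing tangent vectors as velocities of plots.

  The action on \<open>P\<close> is free, and transitive on the fibres of \<open>\<pi>\<close>. Hence, for a fixed point \<open>p\<^sub>0\<close> over \<open>m\<close>,
  every component over \<open>m\<close> has representatives at \<open>p\<^sub>0\<close>, and two of these are isomorphic iff their differences
  are defects (\<open>comp_eq_at_point\<close>). The components over \<open>m\<close> are therefore parametrized by the sum
  of \<open>T\<^sub>p\<^sub>0P\<close> and \<open>T\<^sub>a\<^sub>(\<^sub>p\<^sub>0\<^sub>)X\<^sub>0\<close> modulo defects, whose vector space operations and two summands are the stated operations and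
  the parts of degree \<open>0\<close> and \<open>1\<close>.
\<close>

section \<open>Calculus on open subsets of \<open>\<real>\<^sup>n\<close>\<close>

lemma in_topspace_Euclidean: "x \<in> topspace (Euclidean_space n) \<longleftrightarrow> (\<forall>i\<ge>n. x i = 0)"
  by (simp add: topspace_Euclidean_space)

lemma fun_upd_in_topspace_Euclidean:
  assumes "x \<in> topspace (Euclidean_space n)" "i < n"
  shows "x(i := t) \<in> topspace (Euclidean_space n)"
  using assms by (auto simp: in_topspace_Euclidean)

lemma Euclidean_space_conv_top_of_set:
  "Euclidean_space n = top_of_set (topspace (Euclidean_space n))"
  by (simp add: Euclidean_space_def euclidean_product_topology)

lemma openin_Euclidean_space_iff:
  "openin (Euclidean_space n) U \<longleftrightarrow> U \<subseteq> topspace (Euclidean_space n) \<and>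
     (\<forall>x\<in>U. \<exists>e>0. \<forall>y\<in>topspace (Euclidean_space n). (\<forall>i<n. \<bar>y i - x i\<bar> < e) \<longrightarrow> y \<in> U)"
  (is "?L \<longleftrightarrow> ?R")
proof
  assume L: ?L
  show ?R
  proof (intro conjI ballI)
    show "U \<subseteq> topspace (Euclidean_space n)" using L by (rule openin_subset)
    fix x assume x: "x \<in> U"
    obtain T where T: "open T" "U = topspace (Euclidean_space n) \<inter> T"
      using L by (metis Euclidean_space_conv_top_of_set openin_open)
    have "openin (product_topology (\<lambda>i. euclideanreal) UNIV) T"
      using T by (simp add: euclidean_product_topology)
    then obtain X where X: "\<And>i. open (X i)" "x \<in> Pi\<^sub>E UNIV X" "Pi\<^sub>E UNIV X \<subseteq> T"
      using x T unfolding openin_product_topology_alt by (auto, meson)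
    have "\<exists>e>0. \<forall>t. \<bar>t - x i\<bar> < e \<longrightarrow> t \<in> X i" for i
      using X(1)[of i] X(2) by (auto simp: open_dist dist_real_def PiE_iff)
    then obtain e where e: "\<And>i. e i > 0" "\<And>i t. \<bar>t - x i\<bar> < e i \<Longrightarrow> t \<in> X i" by metis
    define d where "d = Min (insert 1 (e ` {..<n}))"
    have d: "d > 0" "\<And>i. i < n \<Longrightarrow> d \<le> e i" using e(1) by (auto simp: d_def)
    have "y \<in> U" if y: "y \<in> topspace (Euclidean_space n)" "\<forall>i<n. \<bar>y i - x i\<bar> < d" for y
    proof -
      have "y i \<in> X i" for i
      proof (cases "i < n")
        case True then show ?thesis using y(2) d(2) e(2) by (meson less_le_trans)
      next
        case False
        then have "y i = x i" using y(1) x T by (auto simp: in_topspace_Euclidean)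
        then show ?thesis using X(2) by (auto simp: PiE_iff)
      qed
      then show ?thesis using X(3) T y(1) by auto
    qed
    then show "\<exists>e>0. \<forall>y\<in>topspace (Euclidean_space n). (\<forall>i<n. \<bar>y i - x i\<bar> < e) \<longrightarrow> y \<in> U"
      using d(1) by blast
  qed
next
  assume R: ?R
  then obtain e where e: "\<And>x. x \<in> U \<Longrightarrow> e x > 0"
    "\<And>x y. x \<in> U \<Longrightarrow> y \<in> topspace (Euclidean_space n) \<Longrightarrow> (\<forall>i<n. \<bar>y i - x i\<bar> < e x) \<Longrightarrow> y \<in> U"
    by metis
  define T where "T x = (\<Inter>i<n. {y. \<bar>y i - x i\<bar> < e x})" for x
  have "open {y::nat\<Rightarrow>real. \<bar>y i - x i\<bar> < e x}" for x i
    by (intro open_Collect_less continuous_intros) auto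
  then have "open (T x)" for x
    unfolding T_def by (intro open_INT) auto
  then have "open (\<Union>x\<in>U. T x)" by auto
  moreover have "U = topspace (Euclidean_space n) \<inter> (\<Union>x\<in>U. T x)"
    using R e by (auto simp: T_def)
  ultimately show ?L by (subst Euclidean_space_conv_top_of_set) (auto simp: openin_open)
qed

lemma continuous_map_Euclidean_iff:
  assumes "openin (Euclidean_space n) U"
  shows "continuous_map (subtopology (Euclidean_space n) U) euclideanreal f \<longleftrightarrow> continuous_on U f"
proof -
  have "subtopology (Euclidean_space n) U = top_of_set U"
    using openin_subset[OF assms]
    by (subst Euclidean_space_conv_top_of_set) (simp add: subtopology_subtopology Int_absorb1)
  then show ?thesis by simp
qed

lemma openin_Euclidean_preimage:
  assumes U: "openin (Euclidean_space n) U" and f: "continuous_on U f" and V: "open V"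
  shows "openin (Euclidean_space n) {x \<in> U. f x \<in> V}"
proof -
  have "openin (top_of_set U) {x \<in> U. f x \<in> V}"
    using continuous_openin_preimage_gen[OF f V] by (simp add: vimage_def Int_def conj_commute)
  then obtain T where T: "open T" "{x \<in> U. f x \<in> V} = U \<inter> T" by (auto simp: openin_open)
  have "openin (Euclidean_space n) (topspace (Euclidean_space n) \<inter> T)"
    using T(1) by (subst Euclidean_space_conv_top_of_set) (auto simp: openin_open)
  then have "openin (Euclidean_space n) (U \<inter> (topspace (Euclidean_space n) \<inter> T))"
    using U by blast
  then show ?thesis using T(2) openin_subset[OF U] by (simp add: Int_absorb1 Int_absorb2 Int_assoc[symmetric])
qed

lemma continuous_on_locally:
  assumes "\<And>x. x \<in> U \<Longrightarrow> \<exists>V. openin (Euclidean_space n) V \<and> x \<in> V \<and> continuous_on V f"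
    and U: "openin (Euclidean_space n) U"
  shows "continuous_on U f"
  unfolding continuous_on_eq_continuous_within
proof
  fix x assume x: "x \<in> U"
  obtain V where V: "openin (Euclidean_space n) V" "x \<in> V" "continuous_on V f"
    using assms x by blast
  obtain T where T: "open T" "V = topspace (Euclidean_space n) \<inter> T"
    using V(1) by (metis Euclidean_space_conv_top_of_set openin_open)
  have "continuous (at x within (U \<inter> V)) f"
    using V x by (meson continuous_on_eq_continuous_within continuous_on_subset Int_iff inf_le2)
  moreover have "at x within (U \<inter> V) = at x within U"
    using V(2) T openin_subset[OF U] by (intro at_within_nhd[of _ T]) auto
  ultimately show "continuous (at x within U) f" by simp
qed

lemma eventually_fun_upd_in:
  assumes U: "openin (Euclidean_space n) U" and x: "x \<in> U" and i: "i < n"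
  shows "\<forall>\<^sub>F t in nhds (x i). x(i := t) \<in> U"
proof -
  obtain e where e: "e > 0"
    "\<And>y. y \<in> topspace (Euclidean_space n) \<Longrightarrow> (\<forall>j<n. \<bar>y j - x j\<bar> < e) \<Longrightarrow> y \<in> U"
    using U x unfolding openin_Euclidean_space_iff by meson
  have "x(i := t) \<in> U" if "dist t (x i) < e" for t
    using that e(1) openin_subset[OF U] x i
    by (intro e(2) fun_upd_in_topspace_Euclidean) (auto simp: dist_real_def)
  then show ?thesis using e(1) by (auto simp: eventually_nhds_metric)
qed

lemma Ck_on_imp_continuous_on:
  assumes "openin (Euclidean_space n) U" "Ck_on n k U f"
  shows "continuous_on U f"
  using assms by (cases k) (simp_all add: continuous_map_Euclidean_iff)

lemma Ck_on_has_partial: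
  assumes "Ck_on n (Suc k) U f" "x \<in> U" "i < n"
  shows "((\<lambda>t. f (x(i := t))) has_field_derivative partial i f x) (at (x i))"
  using assms unfolding partial_def by (simp add: DERIV_deriv_iff_field_differentiable)

lemma Ck_on_partial: "Ck_on n (Suc k) U f \<Longrightarrow> i < n \<Longrightarrow> Ck_on n k U (partial i f)"
  by simp

lemma partial_cong:
  assumes U: "openin (Euclidean_space n) U" and eq: "\<And>x. x \<in> U \<Longrightarrow> f x = g x"
    and x: "x \<in> U" and i: "i < n"
  shows "partial i f x = partial i g x"
  unfolding partial_def
  by (rule deriv_cong_ev[OF eventually_mono[OF eventually_fun_upd_in[OF U x i] eq] refl])

lemma Ck_on_cong:
  assumes "openin (Euclidean_space n) U" "\<And>x. x \<in> U \<Longrightarrow> f x = g x" "Ck_on n k U f"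
  shows "Ck_on n k U g"
  using assms(2,3)
proof (induction k arbitrary: f g)
  case 0
  then show ?case
    using assms(1) by (simp add: continuous_map_Euclidean_iff cong: continuous_on_cong_simp)
next
  case (Suc k)
  have "continuous_on U g"
    using Suc.prems assms(1)
    by (metis Ck_on_imp_continuous_on continuous_on_cong)
  moreover have "(\<lambda>t. g (x(i := t))) field_differentiable at (x i)" if "i < n" "x \<in> U" for i x
  proof -
    have "((\<lambda>t. f (x(i := t))) has_field_derivative partial i f x) (at (x i))"
      using Ck_on_has_partial Suc.prems that by blast
    moreover have ev: "\<forall>\<^sub>F t in nhds (x i). f (x(i := t)) = g (x(i := t))"
      by (rule eventually_mono[OF eventually_fun_upd_in[OF assms(1) that(2,1)]]) (rule Suc.prems(1))
    ultimately have "((\<lambda>t. g (x(i := t))) has_field_derivative partial i f x) (at (x i))"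
      by (simp add: DERIV_cong_ev[OF refl ev refl])
    then show ?thesis by (auto simp: field_differentiable_def)
  qed
  moreover have "Ck_on n k U (partial i g)" if "i < n" for i
    using Suc.IH[of "partial i f" "partial i g"] Suc.prems that partial_cong[OF assms(1)]
    by (metis Ck_on_partial)
  ultimately show ?case using assms(1) by (simp add: continuous_map_Euclidean_iff)
qed

lemma Ck_on_SucI:
  assumes U: "openin (Euclidean_space n) U" and "continuous_on U f"
    and d: "\<And>i x. i < n \<Longrightarrow> x \<in> U \<Longrightarrow> ((\<lambda>t. f (x(i := t))) has_field_derivative D i x) (at (x i))"
    and D: "\<And>i. i < n \<Longrightarrow> Ck_on n k U (D i)"
  shows "Ck_on n (Suc k) U f"
proof -
  have "partial i f x = D i x" if "i < n" "x \<in> U" for i x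
    unfolding partial_def by (rule DERIV_imp_deriv[OF d[OF that]])
  then have "Ck_on n k U (partial i f)" if "i < n" for i
    using Ck_on_cong[OF U _ D[OF that]] that by auto
  then show ?thesis
    using assms by (auto simp: continuous_map_Euclidean_iff field_differentiable_def)
qed

lemma Ck_on_mono: "Ck_on n (Suc k) U f \<Longrightarrow> Ck_on n k U f"
  by (induction k arbitrary: f) auto

lemma Ck_on_mono_le: "Ck_on n k U f \<Longrightarrow> l \<le> k \<Longrightarrow> Ck_on n l U f"
  by (induction k) (use Ck_on_mono le_Suc_eq in blast)+

lemma Ck_on_subset:
  assumes "openin (Euclidean_space n) U" "openin (Euclidean_space n) V" "V \<subseteq> U" "Ck_on n k U f"
  shows "Ck_on n k V f"
  using assms(4)
proof (induction k arbitrary: f)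
  case (Suc k)
  then have "continuous_on V f" using assms Ck_on_imp_continuous_on continuous_on_subset by blast
  then show ?case using Suc assms(1-3) by (auto simp: continuous_map_Euclidean_iff)
qed (use assms in \<open>auto simp: continuous_map_Euclidean_iff intro: continuous_on_subset\<close>)

lemma Ck_on_locally:
  assumes U: "openin (Euclidean_space n) U"
    and loc: "\<And>x. x \<in> U \<Longrightarrow> \<exists>V. openin (Euclidean_space n) V \<and> x \<in> V \<and> Ck_on n k V f"
  shows "Ck_on n k U f"
proof -
  have c: "continuous_on U f"
    using continuous_on_locally[OF _ U, of f] loc Ck_on_imp_continuous_on by meson
  show ?thesis using loc c
  proof (induction k arbitrary: f)
    case 0
    then show ?case using U by (simp add: continuous_map_Euclidean_iff)
  next
    case (Suc k)
    have loc': "\<exists>V. openin (Euclidean_space n) V \<and> x \<in> V \<and> Ck_on n k V (partial i f)"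
      if x: "x \<in> U" and i: "i < n" for x i
    proof -
      obtain V where V: "openin (Euclidean_space n) V" "x \<in> V" "Ck_on n (Suc k) V f"
        using Suc.prems(1)[OF x] by blast
      show ?thesis using V(1,2) Ck_on_partial[OF V(3) i] by blast
    qed
    have "Ck_on n k U (partial i f)" if i: "i < n" for i
    proof (rule Suc.IH[OF loc'[OF _ i]])
      show "continuous_on U (partial i f)"
      proof (rule continuous_on_locally[OF _ U])
        fix x assume "x \<in> U"
        from loc'[OF this i] show "\<exists>V. openin (Euclidean_space n) V \<and> x \<in> V \<and> continuous_on V (partial i f)"
          using Ck_on_imp_continuous_on by blast
      qed
    qed
    moreover have "(\<lambda>t. f (x(i := t))) field_differentiable at (x i)" if i: "i < n" and x: "x \<in> U" for i x
    proof -
      obtain V where V: "x \<in> V" "Ck_on n (Suc k) V f" using Suc.prems(1)[OF x] by blast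
      show ?thesis using Ck_on_has_partial[OF V(2,1) i] by (auto simp: field_differentiable_def)
    qed
    ultimately show ?case using U Suc.prems by (auto simp: continuous_map_Euclidean_iff)
  qed
qed

text \<open>
  Strict differentiability: replacing the coordinates of \<open>y\<close> by those of \<open>x\<close> one after the other
  stays in a box around \<open>x0\<close>, on which the partial derivatives are almost constant; so the mean
  value theorem applies to each step.
\<close>

lemma Ck_on_strict_differentiable:
  assumes U: "openin (Euclidean_space n) U" and f: "Ck_on n (Suc 0) U f" and x0: "x0 \<in> U" and e: "e > 0"
  obtains d where "d > 0"
    "\<And>x. x \<in> topspace (Euclidean_space n) \<Longrightarrow> \<forall>i<n. \<bar>x i - x0 i\<bar> < d \<Longrightarrow> x \<in> U"
    "\<And>x y. x \<in> topspace (Euclidean_space n) \<Longrightarrow> y \<in> topspace (Euclidean_space n) \<Longrightarrow>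
       \<forall>i<n. \<bar>x i - x0 i\<bar> < d \<Longrightarrow> \<forall>i<n. \<bar>y i - x0 i\<bar> < d \<Longrightarrow>
       \<bar>f x - f y - (\<Sum>i<n. partial i f x0 * (x i - y i))\<bar> \<le> e * (\<Sum>i<n. \<bar>x i - y i\<bar>)"
proof -
  define U' where "U' i = {x \<in> U. partial i f x \<in> {partial i f x0 - e <..< partial i f x0 + e}}" for i
  have oU': "openin (Euclidean_space n) (U' i)" if "i < n" for i
    unfolding U'_def using that f U
    by (intro openin_Euclidean_preimage) (auto simp: continuous_map_Euclidean_iff)
  have "openin (Euclidean_space n) (U \<inter> (\<Inter>i\<in>{..<n}. U' i))"
    using U oU' by (intro openin_Int_Inter) auto
  moreover have "x0 \<in> U \<inter> (\<Inter>i\<in>{..<n}. U' i)" using x0 e by (auto simp: U'_def)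
  ultimately obtain d where d: "d > 0" "\<And>y. y \<in> topspace (Euclidean_space n) \<Longrightarrow>
      (\<forall>j<n. \<bar>y j - x0 j\<bar> < d) \<Longrightarrow> y \<in> U \<inter> (\<Inter>i\<in>{..<n}. U' i)"
    unfolding openin_Euclidean_space_iff by meson
  have "\<bar>f x - f y - (\<Sum>i<n. partial i f x0 * (x i - y i))\<bar> \<le> e * (\<Sum>i<n. \<bar>x i - y i\<bar>)"
    if x: "x \<in> topspace (Euclidean_space n)" "\<forall>i<n. \<bar>x i - x0 i\<bar> < d"
      and y: "y \<in> topspace (Euclidean_space n)" "\<forall>i<n. \<bar>y i - x0 i\<bar> < d" for x y
  proof -
    define z where "z k = (\<lambda>i. if i < k then x i else y i)" for k
    have z0: "z 0 = y" by (simp add: z_def)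
    have zn: "z n = x" using x y by (auto simp: z_def in_topspace_Euclidean fun_eq_iff)
    have step: "\<bar>f (z (Suc k)) - f (z k) - partial k f x0 * (x k - y k)\<bar> \<le> e * \<bar>x k - y k\<bar>"
      if k: "k < n" for k
    proof -
      let ?g = "\<lambda>t. f ((z k)(k := t)) - partial k f x0 * t"
      let ?S = "closed_segment (y k) (x k)"
      have zE: "(z k)(k := t) \<in> topspace (Euclidean_space n)" for t
        using x y k by (auto simp: z_def in_topspace_Euclidean)
      have near: "(z k)(k := t) \<in> U \<inter> (\<Inter>i\<in>{..<n}. U' i)" if "t \<in> ?S" for t
      proof (rule d(2)[OF zE], intro allI impI)
        fix j assume j: "j < n"
        have "\<bar>t - x0 k\<bar> < d"
          using that x(2) y(2) k by (auto simp: closed_segment_eq_real_ivl abs_less_iff split: if_splits)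
        then show "\<bar>((z k)(k := t)) j - x0 j\<bar> < d" using j x y by (auto simp: z_def)
      qed
      have der: "(?g has_field_derivative partial k f ((z k)(k := t)) - partial k f x0) (at t within ?S)"
        if "t \<in> ?S" for t
      proof -
        have "((\<lambda>s. f (((z k)(k := t))(k := s))) has_field_derivative partial k f ((z k)(k := t)))
           (at (((z k)(k := t)) k))"
          using near[OF that] k by (intro Ck_on_has_partial[OF f]) auto
        then have "((\<lambda>s. f ((z k)(k := s))) has_field_derivative partial k f ((z k)(k := t))) (at t within ?S)"
          by (simp add: has_field_derivative_at_within)
        then show ?thesis by (rule DERIV_diff[OF _ DERIV_cmult_Id])
      qed
      have "norm (?g (x k) - ?g (y k)) \<le> e * norm (x k - y k)"
      proof (rule field_differentiable_bound[OF _ der])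
        show "norm (partial k f ((z k)(k := t)) - partial k f x0) \<le> e" if "t \<in> ?S" for t
          using near[OF that] k by (auto simp: U'_def abs_le_iff) (smt (verit) lessThan_iff)+
      qed auto
      moreover have "(z k)(k := x k) = z (Suc k)" "(z k)(k := y k) = z k"
        by (auto simp: z_def fun_eq_iff)
      ultimately show ?thesis by (simp add: algebra_simps)
    qed
    have "f x - f y = (\<Sum>k<n. f (z (Suc k)) - f (z k))"
      using sum_lessThan_telescope[of "\<lambda>k. f (z k)" n] by (simp add: z0 zn)
    then have "\<bar>f x - f y - (\<Sum>i<n. partial i f x0 * (x i - y i))\<bar>
        = \<bar>\<Sum>k<n. f (z (Suc k)) - f (z k) - partial k f x0 * (x k - y k)\<bar>"
      by (simp only: sum_subtractf)
    also have "\<dots> \<le> (\<Sum>k<n. \<bar>f (z (Suc k)) - f (z k) - partial k f x0 * (x k - y k)\<bar>)"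
      by (rule sum_abs)
    also have "\<dots> \<le> (\<Sum>k<n. e * \<bar>x k - y k\<bar>)" using step by (intro sum_mono) auto
    finally show ?thesis by (simp add: sum_distrib_left)
  qed
  then show thesis using that d by blast
qed

text \<open>
  The chain rule along a curve which is merely differentiable at \<open>t0\<close>; partial derivatives of a
  composite are derivatives along such curves.
\<close>

lemma Ck_on_chain_rule_curve:
  assumes U: "openin (Euclidean_space n) U" and f: "Ck_on n (Suc 0) U f" and x0: "\<gamma> t0 \<in> U"
    and \<gamma>: "\<forall>\<^sub>F t in at t0. \<gamma> t \<in> U"
    and D: "\<And>i. i < n \<Longrightarrow> ((\<lambda>t. \<gamma> t i) has_field_derivative D i) (at t0)"
  shows "((\<lambda>t. f (\<gamma> t)) has_field_derivative (\<Sum>i<n. partial i f (\<gamma> t0) * D i)) (at t0)"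
proof -
  define q where "q i t = (\<gamma> t i - \<gamma> t0 i) / (t - t0)" for i t
  define R where "R t = f (\<gamma> t) - f (\<gamma> t0) - (\<Sum>i<n. partial i f (\<gamma> t0) * (\<gamma> t i - \<gamma> t0 i))" for t
  have q: "(q i \<longlongrightarrow> D i) (at t0)" if "i < n" for i
    using D[OF that] by (simp add: has_field_derivative_iff q_def[abs_def])
  define M where "M = (\<Sum>i<n. \<bar>D i\<bar>)"
  have "((\<lambda>t. \<Sum>i<n. \<bar>q i t\<bar>) \<longlongrightarrow> M) (at t0)"
    unfolding M_def using q by (intro tendsto_sum tendsto_rabs) auto
  then have evM: "\<forall>\<^sub>F t in at t0. (\<Sum>i<n. \<bar>q i t\<bar>) < M + 1"
    by (rule order_tendstoD) simp
  have M: "M \<ge> 0" by (auto simp: M_def intro: sum_nonneg)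
  have R: "((\<lambda>t. R t / (t - t0)) \<longlongrightarrow> 0) (at t0)"
  proof (rule tendstoI)
    fix e :: real assume e: "e > 0"
    then have e': "e / (M + 1) > 0" using M by simp
    obtain d where d: "d > 0"
      "\<And>x y. x \<in> topspace (Euclidean_space n) \<Longrightarrow> y \<in> topspace (Euclidean_space n) \<Longrightarrow>
       \<forall>i<n. \<bar>x i - \<gamma> t0 i\<bar> < d \<Longrightarrow> \<forall>i<n. \<bar>y i - \<gamma> t0 i\<bar> < d \<Longrightarrow>
       \<bar>f x - f y - (\<Sum>i<n. partial i f (\<gamma> t0) * (x i - y i))\<bar> \<le> e / (M + 1) * (\<Sum>i<n. \<bar>x i - y i\<bar>)"
      by (rule Ck_on_strict_differentiable[OF U f x0 e']) blast
    have "\<forall>\<^sub>F t in at t0. \<bar>\<gamma> t i - \<gamma> t0 i\<bar> < d" if "i < n" for i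
    proof -
      have "((\<lambda>t. \<gamma> t i) \<longlongrightarrow> \<gamma> t0 i) (at t0)"
        using DERIV_isCont[OF D[OF that]] by (simp add: isCont_def)
      from tendstoD[OF this d(1)] show ?thesis by (simp add: dist_real_def)
    qed
    then have "\<forall>\<^sub>F t in at t0. \<forall>i\<in>{..<n}. \<bar>\<gamma> t i - \<gamma> t0 i\<bar> < d"
      by (intro eventually_ball_finite ballI) (simp_all only: lessThan_iff finite_lessThan)
    then show "\<forall>\<^sub>F t in at t0. dist (R t / (t - t0)) 0 < e"
      using evM \<gamma> eventually_neq_at_within[of t0]
    proof eventually_elim
      case (elim t)
      have "\<bar>R t\<bar> \<le> e / (M + 1) * (\<Sum>i<n. \<bar>\<gamma> t i - \<gamma> t0 i\<bar>)"
        unfolding R_def using elim(1,3) x0 d(1) openin_subset[OF U] by (intro d(2)) auto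
      then have "\<bar>R t\<bar> / \<bar>t - t0\<bar> \<le> e / (M + 1) * (\<Sum>i<n. \<bar>\<gamma> t i - \<gamma> t0 i\<bar>) / \<bar>t - t0\<bar>"
        by (intro divide_right_mono) auto
      also have "\<dots> = e / (M + 1) * (\<Sum>i<n. \<bar>q i t\<bar>)"
        by (simp add: q_def sum_divide_distrib sum_distrib_left abs_divide)
      also have "\<dots> < e / (M + 1) * (M + 1)"
        using e' elim(2) by (intro mult_strict_left_mono) auto
      finally show ?case using M by (simp add: abs_divide)
    qed
  qed
  have "((\<lambda>t. (\<Sum>i<n. partial i f (\<gamma> t0) * q i t) + R t / (t - t0)) \<longlongrightarrow>
      (\<Sum>i<n. partial i f (\<gamma> t0) * D i) + 0) (at t0)"
    using q R by (intro tendsto_add tendsto_sum tendsto_mult) auto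
  moreover have "(\<Sum>i<n. partial i f (\<gamma> t0) * q i t) + R t / (t - t0) = (f (\<gamma> t) - f (\<gamma> t0)) / (t - t0)" for t
    by (simp add: R_def q_def diff_divide_distrib sum_divide_distrib right_diff_distrib)
  ultimately show ?thesis by (simp add: has_field_derivative_iff)
qed

subsection \<open>Smooth real functions\<close>

definition smooth_fun :: "nat \<Rightarrow> (nat \<Rightarrow> real) set \<Rightarrow> ((nat \<Rightarrow> real) \<Rightarrow> real) \<Rightarrow> bool" where
  "smooth_fun n U f \<longleftrightarrow> openin (Euclidean_space n) U \<and> (\<forall>k. Ck_on n k U f)"

lemma smooth_fun_open: "smooth_fun n U f \<Longrightarrow> openin (Euclidean_space n) U"
  by (simp add: smooth_fun_def)

lemma smooth_fun_continuous: "smooth_fun n U f \<Longrightarrow> continuous_on U f"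
  by (meson Ck_on_imp_continuous_on smooth_fun_def)

lemma smooth_fun_Ck: "smooth_fun n U f \<Longrightarrow> Ck_on n k U f"
  unfolding smooth_fun_def by blast

lemma smooth_fun_has_partial:
  "smooth_fun n U f \<Longrightarrow> x \<in> U \<Longrightarrow> i < n \<Longrightarrow>
     ((\<lambda>t. f (x(i := t))) has_field_derivative partial i f x) (at (x i))"
  by (rule Ck_on_has_partial[OF smooth_fun_Ck])

lemma smooth_fun_partial:
  assumes "smooth_fun n U f" "i < n"
  shows "smooth_fun n U (partial i f)"
  unfolding smooth_fun_def
  by (intro conjI allI Ck_on_partial[OF smooth_fun_Ck[OF assms(1)] assms(2)] smooth_fun_open[OF assms(1)])

lemma smooth_fun_cong:
  assumes "smooth_fun n U f" "\<And>x. x \<in> U \<Longrightarrow> f x = g x"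
  shows "smooth_fun n U g"
  unfolding smooth_fun_def
  by (intro conjI allI smooth_fun_open[OF assms(1)]
      Ck_on_cong[OF smooth_fun_open[OF assms(1)] assms(2) smooth_fun_Ck[OF assms(1)]])

lemma smooth_fun_subset:
  assumes "smooth_fun n U f" "openin (Euclidean_space n) V" "V \<subseteq> U"
  shows "smooth_fun n V f"
  unfolding smooth_fun_def
  by (intro conjI allI assms(2) Ck_on_subset[OF smooth_fun_open[OF assms(1)] assms(2,3) smooth_fun_Ck[OF assms(1)]])

lemma smooth_fun_locally:
  assumes "openin (Euclidean_space n) U" "\<And>x. x \<in> U \<Longrightarrow> \<exists>V. x \<in> V \<and> smooth_fun n V f"
  shows "smooth_fun n U f"
  unfolding smooth_fun_def
proof (intro conjI allI assms(1) Ck_on_locally[OF assms(1)])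
  fix k x assume "x \<in> U"
  then obtain V where "x \<in> V" "smooth_fun n V f" using assms(2) by blast
  then show "\<exists>V. openin (Euclidean_space n) V \<and> x \<in> V \<and> Ck_on n k V f"
    using smooth_fun_open[of n V f] smooth_fun_Ck[of n V f k] by auto
qed

lemma partial_eqI:
  "((\<lambda>t. f (x(i := t))) has_field_derivative D) (at (x i)) \<Longrightarrow> partial i f x = D"
  unfolding partial_def by (rule DERIV_imp_deriv)

lemma smooth_fun_const:
  assumes "openin (Euclidean_space n) U"
  shows "smooth_fun n U (\<lambda>x. c)"
proof -
  have "Ck_on n k U (\<lambda>x. c)" for k
  proof (induction k arbitrary: c)
    case 0 then show ?case using assms by (simp add: continuous_map_Euclidean_iff)
  next
    case (Suc k)
    show ?case by (rule Ck_on_SucI[OF assms, where D = "\<lambda>_ _. 0"]) (auto intro: Suc)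
  qed
  then show ?thesis using assms by (simp add: smooth_fun_def)
qed

lemma smooth_fun_coord:
  assumes "openin (Euclidean_space n) U"
  shows "smooth_fun n U (\<lambda>x. x j)"
proof -
  have c: "continuous_on U (\<lambda>x. x j)" 
    by (rule continuous_on_subset[OF continuous_on_product_coordinates]) simp
  have "Ck_on n k U (\<lambda>x. x j)" for k
  proof (cases k)
    case (Suc l)
    show ?thesis unfolding Suc
    proof (rule Ck_on_SucI[where D = "\<lambda>i x. if i = j then 1 else 0"])
      show "Ck_on n l U (\<lambda>x. if i = j then 1 else 0)" for i
        using smooth_fun_const[OF assms] by (simp add: smooth_fun_def)
      show "((\<lambda>t. (x(i := t)) j) has_field_derivative (if i = j then 1 else 0)) (at (x i))" for x :: "nat \<Rightarrow> real" and i
        by (cases "i = j") auto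
    qed (use c assms in auto)
  qed (use c assms in \<open>simp add: continuous_map_Euclidean_iff\<close>)
  then show ?thesis using assms by (simp add: smooth_fun_def)
qed

lemma Ck_on_add:
  assumes U: "openin (Euclidean_space n) U" and "Ck_on n k U f" "Ck_on n k U g"
  shows "Ck_on n k U (\<lambda>x. f x + g x)"
  using assms(2,3)
proof (induction k arbitrary: f g)
  case 0 then show ?case by (auto simp: continuous_map_Euclidean_iff[OF U] intro!: continuous_intros)
next
  case (Suc k)
  show ?case
  proof (rule Ck_on_SucI[OF U, where D = "\<lambda>i x. partial i f x + partial i g x"])
    show "continuous_on U (\<lambda>x. f x + g x)"
      by (intro continuous_on_add Ck_on_imp_continuous_on[OF U Suc.prems(1)] Ck_on_imp_continuous_on[OF U Suc.prems(2)])
    show "((\<lambda>t. f (x(i := t)) + g (x(i := t))) has_field_derivative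
        partial i f x + partial i g x) (at (x i))" if "i < n" "x \<in> U" for i x
      by (rule DERIV_add[OF Ck_on_has_partial[OF Suc.prems(1) that(2,1)]
            Ck_on_has_partial[OF Suc.prems(2) that(2,1)]])
    show "Ck_on n k U (\<lambda>x. partial i f x + partial i g x)" if "i < n" for i
      by (intro Suc.IH Ck_on_partial[OF Suc.prems(1) that] Ck_on_partial[OF Suc.prems(2) that])
  qed
qed

lemma Ck_on_mult:
  assumes U: "openin (Euclidean_space n) U" and "Ck_on n k U f" "Ck_on n k U g"
  shows "Ck_on n k U (\<lambda>x. f x * g x)"
  using assms(2,3)
proof (induction k arbitrary: f g)
  case 0 then show ?case by (auto simp: continuous_map_Euclidean_iff[OF U] intro!: continuous_intros)
next
  case (Suc k)
  show ?case
  proof (rule Ck_on_SucI[OF U, where D = "\<lambda>i x. partial i f x * g x + partial i g x * f x"])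
    show "((\<lambda>t. f (x(i := t)) * g (x(i := t))) has_field_derivative
        partial i f x * g x + partial i g x * f x) (at (x i))" if "i < n" "x \<in> U" for i x
      using DERIV_mult[OF Ck_on_has_partial[OF Suc.prems(1) that(2,1)]
          Ck_on_has_partial[OF Suc.prems(2) that(2,1)]] by (simp only: fun_upd_triv)
    show "Ck_on n k U (\<lambda>x. partial i f x * g x + partial i g x * f x)" if "i < n" for i
      by (intro Ck_on_add[OF U] Suc.IH Ck_on_partial[OF Suc.prems(1) that]
          Ck_on_partial[OF Suc.prems(2) that] Ck_on_mono[OF Suc.prems(1)] Ck_on_mono[OF Suc.prems(2)])
  qed (intro continuous_on_mult Ck_on_imp_continuous_on[OF U Suc.prems(1)] Ck_on_imp_continuous_on[OF U Suc.prems(2)])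
qed

lemma smooth_fun_add:
  "smooth_fun n U f \<Longrightarrow> smooth_fun n U g \<Longrightarrow> smooth_fun n U (\<lambda>x. f x + g x)"
  by (simp add: smooth_fun_def Ck_on_add)

lemma smooth_fun_mult:
  "smooth_fun n U f \<Longrightarrow> smooth_fun n U g \<Longrightarrow> smooth_fun n U (\<lambda>x. f x * g x)"
  by (simp add: smooth_fun_def Ck_on_mult)

lemma smooth_fun_sum:
  assumes "openin (Euclidean_space n) U" "\<And>i. i \<in> I \<Longrightarrow> smooth_fun n U (f i)"
  shows "smooth_fun n U (\<lambda>x. \<Sum>i\<in>I. f i x)"
proof (cases "finite I")
  case True
  then show ?thesis using assms
    by (induction I rule: finite_induct) (auto intro: smooth_fun_add smooth_fun_const)
qed (use assms in \<open>simp add: smooth_fun_const\<close>)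

lemma smooth_fun_uminus: "smooth_fun n U f \<Longrightarrow> smooth_fun n U (\<lambda>x. - f x)"
  using smooth_fun_mult[of n U "\<lambda>x. -1" f] smooth_fun_const[of n U "-1"] smooth_fun_open[of n U f] by simp

lemma smooth_fun_diff:
  "smooth_fun n U f \<Longrightarrow> smooth_fun n U g \<Longrightarrow> smooth_fun n U (\<lambda>x. f x - g x)"
  using smooth_fun_add[of n U f "\<lambda>x. - g x"] smooth_fun_uminus[of n U g] by simp

text \<open>
  The derivative of \<open>1/f\<close> is a product of \<open>- f'\<close> and copies of \<open>1/f\<close>; so the order of
  differentiability of \<open>1/f\<close> increases by induction.
\<close>

lemma smooth_fun_inverse:
  assumes f: "smooth_fun n U f" and nz: "\<And>x. x \<in> U \<Longrightarrow> f x \<noteq> 0"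
  shows "smooth_fun n U (\<lambda>x. inverse (f x))"
proof -
  have U: "openin (Euclidean_space n) U" using f by (simp add: smooth_fun_def)
  have c: "continuous_on U (\<lambda>x. inverse (f x))"
    using f nz by (intro continuous_on_inverse smooth_fun_continuous) auto
  have "Ck_on n k U (\<lambda>x. inverse (f x))" for k
  proof (induction k)
    case 0 then show ?case using c by (simp add: continuous_map_Euclidean_iff[OF U])
  next
    case (Suc k)
    show ?case
    proof (rule Ck_on_SucI[OF U c, where D = "\<lambda>i x. (- 1 * partial i f x) * (inverse (f x) * inverse (f x))"])
      show "((\<lambda>t. inverse (f (x(i := t)))) has_field_derivative
          - 1 * partial i f x * (inverse (f x) * inverse (f x))) (at (x i))" if "i < n" "x \<in> U" for i x
        using DERIV_inverse'[OF smooth_fun_has_partial[OF f that(2,1)]] nz[OF that(2)]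
        by (simp only: fun_upd_triv) (simp add: mult.commute mult.left_commute)
      show "Ck_on n k U (\<lambda>x. - 1 * partial i f x * (inverse (f x) * inverse (f x)))" if "i < n" for i
        using smooth_fun_partial[OF f that] smooth_fun_const[OF U, of "-1"]
        by (intro Ck_on_mult[OF U] Suc.IH) (auto simp: smooth_fun_def)
    qed
  qed
  then show ?thesis using U by (simp add: smooth_fun_def)
qed

lemma Ck_on_sum:
  fixes m :: nat
  assumes "openin (Euclidean_space n) U" "\<And>i. i < m \<Longrightarrow> Ck_on n k U (f i)"
  shows "Ck_on n k U (\<lambda>x. \<Sum>i<m. f i x)"
  using assms(2)
proof (induction m)
  case 0
  show ?case using smooth_fun_const[OF assms(1), of 0] by (simp add: smooth_fun_def)
next
  case (Suc m)
  have "Ck_on n k U (\<lambda>x. (\<Sum>i<m. f i x) + f m x)"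
    by (rule Ck_on_add[OF assms(1) Suc.IH]) (use Suc.prems in auto)
  then show ?case by simp
qed

subsection \<open>Smooth maps between Euclidean spaces\<close>

lemma smooth_euc_iff:
  "smooth_euc n m U g \<longleftrightarrow> openin (Euclidean_space n) U \<and> g ` U \<subseteq> topspace (Euclidean_space m) \<and>
     (\<forall>j<m. smooth_fun n U (\<lambda>x. g x j))"
  by (auto simp: smooth_euc_def smooth_fun_def)

lemma smooth_euc_continuous:
  assumes "smooth_euc n m U g"
  shows "continuous_on U g"
proof (rule continuous_on_coordinatewise_then_product)
  fix j
  show "continuous_on U (\<lambda>x. g x j)"
  proof (cases "j < m")
    case False
    then have "\<And>x. x \<in> U \<Longrightarrow> 0 = g x j"
      using assms by (auto simp: smooth_euc_iff in_topspace_Euclidean image_subset_iff)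
    then show ?thesis using continuous_on_cong[of U U "\<lambda>x. 0" "\<lambda>x. g x j"] by simp
  next
    case True
    then have "smooth_fun n U (\<lambda>x. g x j)" using assms by (simp add: smooth_euc_iff)
    then show ?thesis by (rule smooth_fun_continuous)
  qed
qed

lemma smooth_euc_preimage_open:
  assumes g: "smooth_euc n m U g" and V: "openin (Euclidean_space m) V"
  shows "openin (Euclidean_space n) {x \<in> U. g x \<in> V}"
proof -
  obtain T where T: "open T" "V = topspace (Euclidean_space m) \<inter> T"
    using V by (metis Euclidean_space_conv_top_of_set openin_open)
  have "{x \<in> U. g x \<in> V} = {x \<in> U. g x \<in> T}" using g T by (auto simp: smooth_euc_iff)
  then show ?thesis
    using openin_Euclidean_preimage[OF _ smooth_euc_continuous[OF g] T(1)] g by (simp add: smooth_euc_iff)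
qed

lemma smooth_euc_subset:
  "smooth_euc n m U g \<Longrightarrow> openin (Euclidean_space n) V \<Longrightarrow> V \<subseteq> U \<Longrightarrow> smooth_euc n m V g"
  by (auto simp: smooth_euc_iff intro: smooth_fun_subset)

lemma smooth_euc_cong:
  assumes "smooth_euc n m U f" "\<And>x. x \<in> U \<Longrightarrow> f x = g x"
  shows "smooth_euc n m U g"
  using assms by (auto simp: smooth_euc_iff intro: smooth_fun_cong)

lemma smooth_euc_id: "openin (Euclidean_space n) U \<Longrightarrow> smooth_euc n n U (\<lambda>x. x)"
  by (auto simp: smooth_euc_iff smooth_fun_coord dest: openin_subset)

lemma Ck_on_compose_partial:
  assumes g: "smooth_euc n m U g" and gV: "g ` U \<subseteq> V" and V: "openin (Euclidean_space m) V"
    and f: "Ck_on m (Suc k) V f" and i: "i < n" and x: "x \<in> U"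
  shows "((\<lambda>t. f (g (x(i := t)))) has_field_derivative
     (\<Sum>j<m. partial j f (g x) * partial i (\<lambda>x. g x j) x)) (at (x i))"
proof -
  have U: "openin (Euclidean_space n) U" using g by (simp add: smooth_euc_iff)
  have "((\<lambda>t. f (g (x(i := t)))) has_field_derivative
     (\<Sum>j<m. partial j f (g (x(i := x i))) * partial i (\<lambda>x. g x j) x)) (at (x i))"
  proof (rule Ck_on_chain_rule_curve[OF V])
    show "Ck_on m (Suc 0) V f" by (rule Ck_on_mono_le[OF f]) simp
    have "\<forall>\<^sub>F t in nhds (x i). g (x(i := t)) \<in> V"
      by (rule eventually_mono[OF eventually_fun_upd_in[OF U x i]]) (use gV in auto)
    then show "\<forall>\<^sub>F t in at (x i). g (x(i := t)) \<in> V"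
      unfolding eventually_at_filter by (rule eventually_mono) simp
    show "((\<lambda>t. g (x(i := t)) j) has_field_derivative partial i (\<lambda>x. g x j) x) (at (x i))" if "j < m" for j
      using smooth_fun_has_partial[of n U "\<lambda>x. g x j"] that g x i by (simp add: smooth_euc_iff)
  qed (use x gV in auto)
  then show ?thesis by simp
qed

text \<open>
  By the chain rule the partial derivatives of a composite are sums of products of composites,
  which are continuously differentiable to one order less by induction.
\<close>

lemma smooth_fun_compose:
  assumes f: "smooth_fun m V f" and g: "smooth_euc n m U g" and gV: "g ` U \<subseteq> V"
  shows "smooth_fun n U (\<lambda>x. f (g x))"
proof -
  have U: "openin (Euclidean_space n) U" using g by (simp add: smooth_euc_iff)
  have V: "openin (Euclidean_space m) V" using f by (simp add: smooth_fun_def)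
  have "Ck_on n k U (\<lambda>x. f (g x))" if "Ck_on m k V f" for k f
    using that
  proof (induction k arbitrary: f)
    case 0
    then have "continuous_on U (\<lambda>x. f (g x))"
      using continuous_on_compose2[OF _ smooth_euc_continuous[OF g] gV, of f] V
      by (simp add: continuous_map_Euclidean_iff)
    then show ?case by (simp add: continuous_map_Euclidean_iff[OF U])
  next
    case (Suc k)
    show ?case
    proof (rule Ck_on_SucI[OF U, where D = "\<lambda>i x. \<Sum>j<m. partial j f (g x) * partial i (\<lambda>x. g x j) x"])
      show "continuous_on U (\<lambda>x. f (g x))"
        by (rule continuous_on_compose2[OF Ck_on_imp_continuous_on[OF V Suc.prems] smooth_euc_continuous[OF g] gV])
      show "Ck_on n k U (\<lambda>x. \<Sum>j<m. partial j f (g x) * partial i (\<lambda>x. g x j) x)" if "i < n" for i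
      proof (intro Ck_on_sum[OF U] Ck_on_mult[OF U] Suc.IH Ck_on_partial[OF Suc.prems])
        fix j assume "j < m"
        then have "smooth_fun n U (\<lambda>x. g x j)" using g by (simp add: smooth_euc_iff)
        from smooth_fun_partial[OF this that] show "Ck_on n k U (partial i (\<lambda>x. g x j))"
          by (simp add: smooth_fun_def)
      qed
    qed (rule Ck_on_compose_partial[OF g gV V Suc.prems])
  qed
  then show ?thesis using f U by (simp add: smooth_fun_def)
qed

lemma smooth_euc_compose:
  assumes f: "smooth_euc m l V f" and g: "smooth_euc n m U g" and gV: "g ` U \<subseteq> V"
  shows "smooth_euc n l U (\<lambda>x. f (g x))"
  unfolding smooth_euc_iff
proof (intro conjI allI impI)
  show "openin (Euclidean_space n) U" using g by (simp add: smooth_euc_iff)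
  show "(\<lambda>x. f (g x)) ` U \<subseteq> topspace (Euclidean_space l)" using f gV unfolding smooth_euc_iff by blast
  show "smooth_fun n U (\<lambda>x. f (g x) j)" if "j < l" for j
    using f that by (intro smooth_fun_compose[OF _ g gV]) (simp add: smooth_euc_iff)
qed

lemma smooth_euc_locally:
  assumes "openin (Euclidean_space n) U" "\<And>x. x \<in> U \<Longrightarrow> \<exists>V. x \<in> V \<and> smooth_euc n m V g"
  shows "smooth_euc n m U g"
  unfolding smooth_euc_iff
proof (intro conjI allI impI assms(1))
  show "g ` U \<subseteq> topspace (Euclidean_space m)"
    using assms(2) unfolding smooth_euc_iff by blast
  show "smooth_fun n U (\<lambda>x. g x j)" if j: "j < m" for j
  proof (rule smooth_fun_locally[OF assms(1)])
    fix x assume "x \<in> U"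
    from assms(2)[OF this] show "\<exists>V. x \<in> V \<and> smooth_fun n V (\<lambda>x. g x j)"
      using j unfolding smooth_euc_iff by blast
  qed
qed

lemma jacobian_apply_compose:
  assumes g: "smooth_euc n m U g" and f: "smooth_euc m l V f" and gV: "g ` U \<subseteq> V" and x: "x \<in> U"
  shows "jacobian_apply m l f (g x) (jacobian_apply n m g x v) = jacobian_apply n l (\<lambda>x. f (g x)) x v"
proof -
  have V: "openin (Euclidean_space m) V" using f by (simp add: smooth_euc_iff)
  have "(\<Sum>i<m. partial i (\<lambda>y. f y j) (g x) * (\<Sum>k<n. partial k (\<lambda>y. g y i) x * v k)) =
        (\<Sum>k<n. partial k (\<lambda>x. f (g x) j) x * v k)" if j: "j < l" for j
  proof -
    have "partial k (\<lambda>x. f (g x) j) x = (\<Sum>i<m. partial i (\<lambda>y. f y j) (g x) * partial k (\<lambda>y. g y i) x)"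
      if "k < n" for k
      using f j by (intro partial_eqI Ck_on_compose_partial[OF g gV V _ that x, where k = 0])
        (simp add: smooth_euc_iff smooth_fun_def del: Ck_on.simps)
    then have "(\<Sum>k<n. partial k (\<lambda>x. f (g x) j) x * v k) =
       (\<Sum>k<n. (\<Sum>i<m. partial i (\<lambda>y. f y j) (g x) * partial k (\<lambda>y. g y i) x) * v k)" by simp
    also have "\<dots> = (\<Sum>i<m. partial i (\<lambda>y. f y j) (g x) * (\<Sum>k<n. partial k (\<lambda>y. g y i) x * v k))"
      by (subst sum_distrib_right, subst sum.swap) (simp add: sum_distrib_left mult.assoc)
    finally show ?thesis by simp
  qed
  then show ?thesis by (auto simp: jacobian_apply_def fun_eq_iff)
qed

lemma jacobian_apply_cong:
  assumes "openin (Euclidean_space n) U" "x \<in> U" "\<And>y. y \<in> U \<Longrightarrow> f y = g y"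
  shows "jacobian_apply n m f x v = jacobian_apply n m g x v"
  using partial_cong[OF assms(1), of "\<lambda>y. f y j" "\<lambda>y. g y j" x for j] assms(2,3)
  by (auto simp: jacobian_apply_def fun_eq_iff intro!: sum.cong)

lemma jacobian_apply_in_topspace [simp]:
  "jacobian_apply n m f x v \<in> topspace (Euclidean_space m)"
  by (simp add: jacobian_apply_def in_topspace_Euclidean)

lemma jacobian_apply_id:
  assumes "v \<in> topspace (Euclidean_space n)"
  shows "jacobian_apply n n (\<lambda>x. x) x v = v"
proof -
  have "partial i (\<lambda>y. y j) x = (if i = j then 1 else 0)" for i j
    by (rule partial_eqI) (cases "i = j"; auto)
  then show ?thesis
    using assms by (auto simp: jacobian_apply_def fun_eq_iff in_topspace_Euclidean if_distrib[of "\<lambda>a. a * _"]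
      cong: if_cong)
qed

lemma jacobian_apply_add:
  "jacobian_apply n m f x (v + w) = jacobian_apply n m f x v + jacobian_apply n m f x w"
  by (auto simp: jacobian_apply_def fun_eq_iff distrib_left sum.distrib)

lemma jacobian_apply_scale:
  "jacobian_apply n m f x (\<lambda>i. r * v i) = (\<lambda>j. r * jacobian_apply n m f x v j)"
  by (auto simp: jacobian_apply_def fun_eq_iff sum_distrib_left mult.left_commute)

subsection \<open>Zero sets of submersions\<close>

text \<open>Finitely many functions share one radius.\<close>

lemma strict_differentiable_family:
  fixes G :: "nat \<Rightarrow> (nat \<Rightarrow> real) \<Rightarrow> real"
  assumes U: "openin (Euclidean_space m) U" and x0: "x0 \<in> U" and e: "e > 0"
    and G: "\<And>j. j < n \<Longrightarrow> smooth_fun m U (G j)"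
  obtains d where "d > 0"
    "\<And>x. x \<in> topspace (Euclidean_space m) \<Longrightarrow> \<forall>i<m. \<bar>x i - x0 i\<bar> < d \<Longrightarrow> x \<in> U"
    "\<And>x y j. j < n \<Longrightarrow> x \<in> topspace (Euclidean_space m) \<Longrightarrow> y \<in> topspace (Euclidean_space m) \<Longrightarrow>
       \<forall>i<m. \<bar>x i - x0 i\<bar> < d \<Longrightarrow> \<forall>i<m. \<bar>y i - x0 i\<bar> < d \<Longrightarrow>
       \<bar>G j x - G j y - (\<Sum>i<m. partial i (G j) x0 * (x i - y i))\<bar> \<le> e * (\<Sum>i<m. \<bar>x i - y i\<bar>)"
proof -
  obtain d0 where d0: "d0 > 0"
    "\<And>x. x \<in> topspace (Euclidean_space m) \<Longrightarrow> \<forall>i<m. \<bar>x i - x0 i\<bar> < d0 \<Longrightarrow> x \<in> U"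
    using U x0 unfolding openin_Euclidean_space_iff by meson
  have "\<forall>j. \<exists>d>0. j < n \<longrightarrow> (\<forall>x y. x \<in> topspace (Euclidean_space m) \<longrightarrow> y \<in> topspace (Euclidean_space m) \<longrightarrow>
       (\<forall>i<m. \<bar>x i - x0 i\<bar> < d) \<longrightarrow> (\<forall>i<m. \<bar>y i - x0 i\<bar> < d) \<longrightarrow>
       \<bar>G j x - G j y - (\<Sum>i<m. partial i (G j) x0 * (x i - y i))\<bar> \<le> e * (\<Sum>i<m. \<bar>x i - y i\<bar>))"
    (is "\<forall>j. \<exists>d>0. j < n \<longrightarrow> ?P j d")
  proof
    fix j
    show "\<exists>d>0. j < n \<longrightarrow> ?P j d"
    proof (cases "j < n")
      case True
      obtain d where d: "d > 0" "\<And>x y. x \<in> topspace (Euclidean_space m) \<Longrightarrow> y \<in> topspace (Euclidean_space m) \<Longrightarrow>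
         \<forall>i<m. \<bar>x i - x0 i\<bar> < d \<Longrightarrow> \<forall>i<m. \<bar>y i - x0 i\<bar> < d \<Longrightarrow>
         \<bar>G j x - G j y - (\<Sum>i<m. partial i (G j) x0 * (x i - y i))\<bar> \<le> e * (\<Sum>i<m. \<bar>x i - y i\<bar>)"
        by (rule Ck_on_strict_differentiable[OF U smooth_fun_Ck[OF G[OF True]] x0 e]) blast
      have "?P j d" by (intro allI impI) (rule d(2))
      then show ?thesis using d(1) by blast
    qed (auto intro: exI[of _ 1])
  qed
  from choice[OF this] obtain d where dP': "\<forall>j. d j > 0 \<and> (j < n \<longrightarrow> ?P j (d j))" by (rule exE)
  have d: "d j > 0" for j using dP'[THEN spec, of j] by (rule conjunct1)
  have dP: "?P j (d j)" if "j < n" for j using dP'[THEN spec, of j, THEN conjunct2] that by (rule mp)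
  define d' where "d' = Min (insert d0 (d ` {..<n}))"
  have d': "d' > 0" "d' \<le> d0" "\<And>j. j < n \<Longrightarrow> d' \<le> d j" using d d0 by (auto simp: d'_def)
  show thesis
  proof (rule that[OF d'(1)])
    show "x \<in> U" if "x \<in> topspace (Euclidean_space m)" "\<forall>i<m. \<bar>x i - x0 i\<bar> < d'" for x
      using that d'(2) by (intro d0(2)) (auto intro: less_le_trans)
    show "\<bar>G j x - G j y - (\<Sum>i<m. partial i (G j) x0 * (x i - y i))\<bar> \<le> e * (\<Sum>i<m. \<bar>x i - y i\<bar>)"
      if "j < n" "x \<in> topspace (Euclidean_space m)" "y \<in> topspace (Euclidean_space m)"
        "\<forall>i<m. \<bar>x i - x0 i\<bar> < d'" "\<forall>i<m. \<bar>y i - x0 i\<bar> < d'" for j x y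
      using that(2-) d'(3)[OF that(1)] by (intro dP[OF that(1), rule_format]) (auto intro: less_le_trans)
  qed
qed

lemma compact_Euclidean_box:
  "compact {x \<in> topspace (Euclidean_space m). \<forall>i<m. \<bar>x i - x0 i\<bar> \<le> r}"
proof -
  have "compactin (product_topology (\<lambda>i::nat. euclideanreal) UNIV)
      (PiE UNIV (\<lambda>i. if i < m then {x0 i - r .. x0 i + r} else {0}))"
    by (subst compactin_PiE) auto
  moreover have "PiE UNIV (\<lambda>i. if i < m then {x0 i - r .. x0 i + r} else {0}) =
      {x \<in> topspace (Euclidean_space m). \<forall>i<m. \<bar>x i - x0 i\<bar> \<le> r}"
    unfolding set_eq_iff PiE_UNIV_domain in_topspace_Euclidean mem_Collect_eq Pi_iff
  proof (intro allI iffI conjI impI ballI)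
    fix x i assume *: "\<forall>i\<in>UNIV. x i \<in> (if i < m then {x0 i - r..x0 i + r} else {0})"
    then have "x i \<in> (if i < m then {x0 i - r..x0 i + r} else {0})" by blast
    then show "m \<le> i \<Longrightarrow> x i = 0" "i < m \<Longrightarrow> \<bar>x i - x0 i\<bar> \<le> r" by auto
  next
    fix x and i :: nat
    assume *: "(\<forall>i\<ge>m. x i = 0) \<and> (\<forall>i<m. \<bar>x i - x0 i\<bar> \<le> r)"
    then have "\<bar>x i - x0 i\<bar> \<le> r" if "i < m" using that by blast
    then show "x i \<in> (if i < m then {x0 i - r..x0 i + r} else {0})" using * by auto
  qed
  ultimately show ?thesis by (simp add: euclidean_product_topology)
qed

text \<open>
  A vector in the kernel of a surjective derivative is a limit of difference quotients of points of
  the zero set (Lyusternik). The zero near \<open>z = x0 + \<epsilon>\<zeta>\<close> is the minimum of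
  \<open>\<bar>G x\<bar> + \<kappa> \<bar>x - z\<bar>\<close> on a compact box: if \<open>G\<close> did not vanish there, then one Newton step with the right
  inverse \<open>r\<close> of the derivative at \<open>x0\<close> would lower that function.
\<close>

lemma zeros_tangent_to_kernel:
  fixes G :: "nat \<Rightarrow> (nat \<Rightarrow> real) \<Rightarrow> real" and r :: "nat \<Rightarrow> nat \<Rightarrow> real"
  assumes U: "openin (Euclidean_space m) U" and x0: "x0 \<in> U"
    and G: "\<And>j. j < n \<Longrightarrow> smooth_fun m U (G j)" and G0: "\<And>j. j < n \<Longrightarrow> G j x0 = 0"
    and r: "\<And>j k. j < n \<Longrightarrow> k < n \<Longrightarrow> (\<Sum>i<m. partial i (G k) x0 * r j i) = (if k = j then 1 else 0)"
    and \<zeta>: "\<zeta> \<in> topspace (Euclidean_space m)"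
    and ker: "\<And>j. j < n \<Longrightarrow> (\<Sum>i<m. partial i (G j) x0 * \<zeta> i) = 0"
    and \<theta>: "\<theta> > 0" and b: "b > 0"
  obtains \<epsilon> x where "\<epsilon> > 0" "x \<in> U" "\<And>j. j < n \<Longrightarrow> G j x = 0"
    "(\<Sum>i<m. \<bar>x i - (x0 i + \<epsilon> * \<zeta> i)\<bar>) \<le> \<theta> * \<epsilon>" "\<forall>i<m. \<bar>x i - x0 i\<bar> < b"
proof -
  have x0E: "x0 \<in> topspace (Euclidean_space m)" using U x0 openin_subset by blast
  define C where "C = (\<Sum>j<n. \<Sum>i<m. \<bar>r j i\<bar>) + 1"
  define A where "A = (\<Sum>i<m. \<bar>\<zeta> i\<bar>) + 1"
  define g where "g x = (\<Sum>j<n. \<bar>G j x\<bar>)" for x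
  have A: "A \<ge> 1" by (auto simp: A_def intro: sum_nonneg)
  have C: "C \<ge> 1" by (auto simp: C_def intro!: sum_nonneg)
  have g: "g x \<ge> 0" for x by (auto simp: g_def intro: sum_nonneg)
  \<comment> \<open>With this accuracy one Newton step divides \<open>g\<close> by four.\<close>
  define e where "e = 1 / (4 * C * (real n + 1))"
  have e: "e > 0" using C by (simp add: e_def)
  have "real n * e = 1 / (4 * C) * (real n / (real n + 1))" by (simp add: e_def)
  also have "\<dots> \<le> 1 / (4 * C) * 1" using C by (intro mult_left_mono) auto
  finally have ne: "real n * e \<le> 1 / (4 * C)" by simp
  obtain d where d: "d > 0" and dU: "\<And>x. x \<in> topspace (Euclidean_space m) \<Longrightarrow> \<forall>i<m. \<bar>x i - x0 i\<bar> < d \<Longrightarrow> x \<in> U"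
    and dG: "\<And>x y j. j < n \<Longrightarrow> x \<in> topspace (Euclidean_space m) \<Longrightarrow> y \<in> topspace (Euclidean_space m) \<Longrightarrow>
       \<forall>i<m. \<bar>x i - x0 i\<bar> < d \<Longrightarrow> \<forall>i<m. \<bar>y i - x0 i\<bar> < d \<Longrightarrow>
       \<bar>G j x - G j y - (\<Sum>i<m. partial i (G j) x0 * (x i - y i))\<bar> \<le> e * (\<Sum>i<m. \<bar>x i - y i\<bar>)"
    by (rule strict_differentiable_family[OF U x0 e G]) blast+
  define \<rho> where "\<rho> = min (d / 2) (b / 2)"
  have \<rho>: "\<rho> > 0" "\<rho> < d" "\<rho> < b" using d b by (auto simp: \<rho>_def)
  \<comment> \<open>This accuracy makes \<open>4 * C * g z\<close>, which bounds the distance from \<open>z\<close> to the minimum, at most \<open>\<theta> * \<epsilon>\<close>.\<close>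
  define \<theta>' where "\<theta>' = min \<theta> 1 / (4 * C * A * (real n + 1))"
  have \<theta>': "\<theta>' > 0" using \<theta> C A by (simp add: \<theta>'_def)
  obtain d' where d': "d' > 0"
    and dG': "\<And>x y j. j < n \<Longrightarrow> x \<in> topspace (Euclidean_space m) \<Longrightarrow> y \<in> topspace (Euclidean_space m) \<Longrightarrow>
       \<forall>i<m. \<bar>x i - x0 i\<bar> < d' \<Longrightarrow> \<forall>i<m. \<bar>y i - x0 i\<bar> < d' \<Longrightarrow>
       \<bar>G j x - G j y - (\<Sum>i<m. partial i (G j) x0 * (x i - y i))\<bar> \<le> \<theta>' * (\<Sum>i<m. \<bar>x i - y i\<bar>)"
    by (rule strict_differentiable_family[OF U x0 \<theta>' G]) blast+
  \<comment> \<open>The summand \<open>2\<close> leaves room in the box for the minimum and for the Newton step from it.\<close>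
  define \<epsilon> where "\<epsilon> = min (\<rho> / (A + 2)) (d' / (A + 2))"
  have \<epsilon>: "\<epsilon> > 0" using \<rho> d' A by (simp add: \<epsilon>_def)
  have "\<epsilon> \<le> \<rho> / (A + 2)" "\<epsilon> \<le> d' / (A + 2)" by (auto simp: \<epsilon>_def)
  then have \<epsilon>A: "\<epsilon> * (A + 2) \<le> \<rho>" "\<epsilon> * (A + 2) \<le> d'" using A by (auto simp: field_simps)
  define z where "z = (\<lambda>i. x0 i + \<epsilon> * \<zeta> i)"
  have zE: "z \<in> topspace (Euclidean_space m)" using x0E \<zeta> by (simp add: z_def in_topspace_Euclidean)
  have \<zeta>A: "\<bar>\<zeta> i\<bar> \<le> A - 1" if "i < m" for i
    using that by (auto simp: A_def intro: member_le_sum)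
  have zx0: "\<bar>z i - x0 i\<bar> \<le> \<epsilon> * A - \<epsilon>" if "i < m" for i
    using mult_left_mono[OF \<zeta>A[OF that], of \<epsilon>] \<epsilon> by (simp add: z_def abs_mult right_diff_distrib)
  have gz: "4 * C * g z \<le> min \<theta> 1 * \<epsilon>"
  proof -
    have z': "\<forall>i<m. \<bar>z i - x0 i\<bar> < d'" "\<forall>i<m. \<bar>x0 i - x0 i\<bar> < d'"
      using zx0 \<epsilon>A(2) \<epsilon> d' by (auto simp: distrib_left) (smt (verit))
    have "\<bar>G j z\<bar> \<le> \<theta>' * (\<epsilon> * A)" if j: "j < n" for j
    proof -
      have "(\<Sum>i<m. partial i (G j) x0 * (z i - x0 i)) = \<epsilon> * (\<Sum>i<m. partial i (G j) x0 * \<zeta> i)"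
        by (simp add: z_def sum_distrib_left mult.left_commute)
      then have "\<bar>G j z\<bar> \<le> \<theta>' * (\<Sum>i<m. \<bar>z i - x0 i\<bar>)"
        using dG'[OF j zE x0E z'] G0[OF j] ker[OF j] by simp
      also have "(\<Sum>i<m. \<bar>z i - x0 i\<bar>) = \<epsilon> * (A - 1)"
        using \<epsilon> by (simp add: z_def abs_mult sum_distrib_left A_def)
      also have "\<theta>' * (\<epsilon> * (A - 1)) \<le> \<theta>' * (\<epsilon> * A)" using \<theta>' \<epsilon> by simp
      finally show ?thesis .
    qed
    then have "g z \<le> (\<Sum>j<n. \<theta>' * (\<epsilon> * A))" unfolding g_def by (intro sum_mono) auto
    moreover have "0 \<le> \<theta>' * (\<epsilon> * A)" using \<theta>' \<epsilon> A by simp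
    ultimately have "g z \<le> (real n + 1) * (\<theta>' * (\<epsilon> * A))" by (simp add: distrib_right)
    then have "4 * C * g z \<le> 4 * C * ((real n + 1) * (\<theta>' * (\<epsilon> * A)))"
      using C by (intro mult_left_mono) auto
    also have "\<dots> = (4 * C * A * (real n + 1) * \<theta>') * \<epsilon>" by (simp add: algebra_simps)
    also have "4 * C * A * (real n + 1) * \<theta>' = min \<theta> 1" using C A by (simp add: \<theta>'_def)
    finally show ?thesis .
  qed
  define K where "K = {x \<in> topspace (Euclidean_space m). \<forall>i<m. \<bar>x i - x0 i\<bar> \<le> \<rho>}"
  have KU: "K \<subseteq> U" using dU \<rho> by (force simp: K_def)
  define h where "h x = g x + 1 / (4 * C) * (\<Sum>i<m. \<bar>x i - z i\<bar>)" for x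
  have "continuous_on K (\<lambda>x. x i :: real)" for i
    by (rule continuous_on_subset[OF continuous_on_product_coordinates]) simp
  moreover have "continuous_on K (G j)" if "j < n" for j
    using continuous_on_subset[OF smooth_fun_continuous[OF G[OF that]] KU] .
  ultimately have "continuous_on K h"
    unfolding h_def g_def by (intro continuous_intros) auto
  moreover have zK: "z \<in> K"
    using zE zx0 \<epsilon>A(1) \<epsilon> by (auto simp: K_def distrib_left) (smt (verit))
  ultimately obtain x where x: "x \<in> K" "\<And>y. y \<in> K \<Longrightarrow> h x \<le> h y"
    using continuous_attains_inf[of K h] compact_Euclidean_box unfolding K_def by blast
  have xE: "x \<in> topspace (Euclidean_space m)" using x by (simp add: K_def)
  have hz: "h z = g z" by (simp add: h_def)
  have hx: "g x + 1 / (4 * C) * (\<Sum>i<m. \<bar>x i - z i\<bar>) \<le> g z" using x(2)[OF zK] hz by (simp add: h_def)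
  have s0: "(\<Sum>i<m. \<bar>x i - z i\<bar>) \<ge> 0" by (intro sum_nonneg) auto
  then have gx: "g x \<le> g z" using hx C by (smt (verit) divide_nonneg_nonneg mult_nonneg_nonneg)
  have xz: "(\<Sum>i<m. \<bar>x i - z i\<bar>) \<le> 4 * C * g z"
  proof -
    have "1 / (4 * C) * (\<Sum>i<m. \<bar>x i - z i\<bar>) \<le> g z" using hx g[of x] by linarith
    then show ?thesis using C by (simp add: field_simps)
  qed
  \<comment> \<open>The Newton step from the minimum \<open>x\<close>.\<close>
  define y where "y = (\<lambda>i. if i < m then x i - (\<Sum>j<n. r j i * G j x) else 0)"
  have yE: "y \<in> topspace (Euclidean_space m)" by (simp add: y_def in_topspace_Euclidean)
  have yx: "(\<Sum>i<m. \<bar>y i - x i\<bar>) \<le> C * g x"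
  proof -
    have "(\<Sum>i<m. \<bar>y i - x i\<bar>) \<le> (\<Sum>i<m. \<Sum>j<n. \<bar>r j i\<bar> * \<bar>G j x\<bar>)"
      by (intro sum_mono) (auto simp: y_def abs_mult[symmetric] intro: sum_abs)
    also have "\<dots> = (\<Sum>j<n. (\<Sum>i<m. \<bar>r j i\<bar>) * \<bar>G j x\<bar>)"
      by (subst sum.swap) (simp add: sum_distrib_right)
    also have "\<dots> \<le> (\<Sum>j<n. C * \<bar>G j x\<bar>)"
    proof (intro sum_mono mult_right_mono)
      fix j assume "j \<in> {..<n}"
      then have "(\<Sum>i<m. \<bar>r j i\<bar>) \<le> (\<Sum>j<n. \<Sum>i<m. \<bar>r j i\<bar>)"
        by (intro member_le_sum[where f = "\<lambda>j. \<Sum>i<m. \<bar>r j i\<bar>"]) (auto intro: sum_nonneg)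
      then show "(\<Sum>i<m. \<bar>r j i\<bar>) \<le> C" by (simp add: C_def)
    qed auto
    finally show ?thesis by (simp add: g_def sum_distrib_left)
  qed
  have yK: "y \<in> K"
  proof -
    have "\<bar>y i - x0 i\<bar> \<le> \<rho>" if i: "i < m" for i
    proof -
      have "\<bar>y i - x i\<bar> \<le> C * g x"
        using yx member_le_sum[of i "{..<m}" "\<lambda>i. \<bar>y i - x i\<bar>"] i by simp
      moreover have "\<bar>x i - z i\<bar> \<le> 4 * C * g z"
        using xz member_le_sum[of i "{..<m}" "\<lambda>i. \<bar>x i - z i\<bar>"] i by simp
      moreover have "C * g x \<le> 4 * C * g z" using gx g[of x] C by (simp add: mult_mono)
      moreover have "4 * C * g z \<le> \<epsilon>" using gz \<epsilon> mult_right_mono[of "min \<theta> 1" 1 \<epsilon>] by linarith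
      ultimately show ?thesis using zx0[OF i] \<epsilon>A(1) \<epsilon> by (simp add: distrib_left)
    qed
    then show ?thesis using yE by (simp add: K_def)
  qed
  have gy: "g y \<le> 1 / 4 * g x"
  proof -
    have "\<bar>G j y\<bar> \<le> e * (\<Sum>i<m. \<bar>y i - x i\<bar>)" if j: "j < n" for j
    proof -
      have "(\<Sum>i<m. partial i (G j) x0 * (y i - x i)) = - (\<Sum>i<m. \<Sum>k<n. partial i (G j) x0 * r k i * G k x)"
        by (simp add: y_def sum_negf[symmetric] sum_distrib_left mult.assoc)
      also have "(\<Sum>i<m. \<Sum>k<n. partial i (G j) x0 * r k i * G k x) = (\<Sum>k<n. (\<Sum>i<m. partial i (G j) x0 * r k i) * G k x)"
        by (subst sum.swap) (simp add: sum_distrib_right)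
      also have "\<dots> = (\<Sum>k<n. if k = j then G k x else 0)"
        using r j by (intro sum.cong) auto
      also have "\<dots> = G j x" using j by simp
      finally have "(\<Sum>i<m. partial i (G j) x0 * (y i - x i)) = - G j x" .
      then show ?thesis using dG[OF j yE xE] yK x(1) \<rho> by (force simp: K_def)
    qed
    then have "g y \<le> (\<Sum>j<n. e * (\<Sum>i<m. \<bar>y i - x i\<bar>))" unfolding g_def by (intro sum_mono) auto
    also have "\<dots> = (real n * e) * (\<Sum>i<m. \<bar>y i - x i\<bar>)" by simp
    also have "\<dots> \<le> 1 / (4 * C) * (C * g x)"
      using ne yx C by (intro mult_mono) (auto intro: sum_nonneg)
    finally show ?thesis using C by simp
  qed
  have "h y \<le> g x / 4 + 1 / (4 * C) * ((\<Sum>i<m. \<bar>y i - x i\<bar>) + (\<Sum>i<m. \<bar>x i - z i\<bar>))"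
    unfolding h_def sum.distrib[symmetric] using gy C
    by (intro add_mono mult_left_mono sum_mono) auto
  also have "\<dots> \<le> g x / 4 + 1 / (4 * C) * (C * g x + (\<Sum>i<m. \<bar>x i - z i\<bar>))"
    using yx C by (intro add_mono mult_left_mono) auto
  also have "\<dots> = h x - g x / 2" using C by (simp add: h_def field_simps)
  finally have "g x = 0" using x(2)[OF yK] g[of x] by simp
  then have "G j x = 0" if "j < n" for j
    using that unfolding g_def by (subst (asm) sum_nonneg_eq_0_iff) auto
  moreover have "(\<Sum>i<m. \<bar>x i - (x0 i + \<epsilon> * \<zeta> i)\<bar>) \<le> \<theta> * \<epsilon>"
    using xz gz mult_right_mono[of "min \<theta> 1" \<theta> \<epsilon>] \<epsilon> unfolding z_def by linarith
  moreover have "\<forall>i<m. \<bar>x i - x0 i\<bar> < b" using x(1) \<rho>(3) by (force simp: K_def)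
  ultimately show thesis using that \<epsilon> x(1) KU by blast
qed

text \<open>
  Hence a function which vanishes on the zero set has zero derivative in those directions: the
  differential of a map on a submanifold does not depend on how the map is extended.
\<close>

lemma derivative_vanishes_on_kernel:
  fixes G :: "nat \<Rightarrow> (nat \<Rightarrow> real) \<Rightarrow> real" and r :: "nat \<Rightarrow> nat \<Rightarrow> real"
  assumes U: "openin (Euclidean_space m) U" and x0: "x0 \<in> U"
    and G: "\<And>j. j < n \<Longrightarrow> smooth_fun m U (G j)" and G0: "\<And>j. j < n \<Longrightarrow> G j x0 = 0"
    and r: "\<And>j k. j < n \<Longrightarrow> k < n \<Longrightarrow> (\<Sum>i<m. partial i (G k) x0 * r j i) = (if k = j then 1 else 0)"
    and \<zeta>: "\<zeta> \<in> topspace (Euclidean_space m)"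
    and ker: "\<And>j. j < n \<Longrightarrow> (\<Sum>i<m. partial i (G j) x0 * \<zeta> i) = 0"
    and D: "smooth_fun m U D" and D0: "\<And>x. x \<in> U \<Longrightarrow> (\<And>j. j < n \<Longrightarrow> G j x = 0) \<Longrightarrow> D x = 0"
  shows "(\<Sum>i<m. partial i D x0 * \<zeta> i) = 0"
proof (rule ccontr)
  define S where "S = (\<Sum>i<m. partial i D x0 * \<zeta> i)"
  assume "(\<Sum>i<m. partial i D x0 * \<zeta> i) \<noteq> 0"
  then have S: "\<bar>S\<bar> > 0" by (simp add: S_def)
  define M where "M = (\<Sum>i<m. \<bar>partial i D x0\<bar>)"
  define A where "A = (\<Sum>i<m. \<bar>\<zeta> i\<bar>)"
  have MA: "M \<ge> 0" "A \<ge> 0" by (auto simp: M_def A_def intro: sum_nonneg)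
  \<comment> \<open>The errors below, which bound \<open>\<epsilon> * \<bar>S\<bar>\<close>, add up to at most \<open>\<epsilon> * \<theta> * (M + A + 1)\<close>.\<close>
  define \<theta> where "\<theta> = min 1 (\<bar>S\<bar> / (2 * (M + A + 1)))"
  have \<theta>: "\<theta> > 0" "\<theta> \<le> 1" using S MA by (auto simp: \<theta>_def)
  have "\<theta> \<le> \<bar>S\<bar> / (2 * (M + A + 1))" by (simp add: \<theta>_def)
  then have \<theta>S: "\<theta> * (M + A + 1) < \<bar>S\<bar>" using MA S by (simp add: field_simps)
  obtain d where d: "d > 0"
    and dD: "\<And>x y. x \<in> topspace (Euclidean_space m) \<Longrightarrow> y \<in> topspace (Euclidean_space m) \<Longrightarrow>
       \<forall>i<m. \<bar>x i - x0 i\<bar> < d \<Longrightarrow> \<forall>i<m. \<bar>y i - x0 i\<bar> < d \<Longrightarrow>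
       \<bar>D x - D y - (\<Sum>i<m. partial i D x0 * (x i - y i))\<bar> \<le> \<theta> * (\<Sum>i<m. \<bar>x i - y i\<bar>)"
    by (rule Ck_on_strict_differentiable[OF U smooth_fun_Ck[OF D] x0 \<theta>(1)]) blast
  obtain \<epsilon> x where x: "\<epsilon> > 0" "x \<in> U" "\<And>j. j < n \<Longrightarrow> G j x = 0"
    "(\<Sum>i<m. \<bar>x i - (x0 i + \<epsilon> * \<zeta> i)\<bar>) \<le> \<theta> * \<epsilon>" "\<forall>i<m. \<bar>x i - x0 i\<bar> < d"
    by (rule zeros_tangent_to_kernel[where n = n, OF U x0 G G0 r \<zeta> ker \<theta>(1) d]) (assumption | rule that | simp)+
  have xE: "x \<in> topspace (Euclidean_space m)" "x0 \<in> topspace (Euclidean_space m)"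
    using x(2) x0 openin_subset[OF U] by auto
  have "D x = 0" "D x0 = 0" using D0 x(2,3) x0 G0 by auto
  then have *: "\<bar>\<Sum>i<m. partial i D x0 * (x i - x0 i)\<bar> \<le> \<theta> * (\<Sum>i<m. \<bar>x i - x0 i\<bar>)"
    using dD[OF xE x(5)] d by simp
  have "(\<Sum>i<m. \<bar>x i - x0 i\<bar>) \<le> (\<Sum>i<m. \<bar>x i - (x0 i + \<epsilon> * \<zeta> i)\<bar> + \<epsilon> * \<bar>\<zeta> i\<bar>)"
  proof (rule sum_mono)
    fix i
    show "\<bar>x i - x0 i\<bar> \<le> \<bar>x i - (x0 i + \<epsilon> * \<zeta> i)\<bar> + \<epsilon> * \<bar>\<zeta> i\<bar>"
      using abs_triangle_ineq[of "x i - (x0 i + \<epsilon> * \<zeta> i)" "\<epsilon> * \<zeta> i"] x(1) by (simp add: abs_mult)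
  qed
  also have "\<dots> \<le> \<theta> * \<epsilon> + \<epsilon> * A" using x(4) by (simp add: sum.distrib A_def sum_distrib_left)
  finally have **: "(\<Sum>i<m. \<bar>x i - x0 i\<bar>) \<le> \<theta> * \<epsilon> + \<epsilon> * A" .
  have "\<epsilon> * S = (\<Sum>i<m. partial i D x0 * (x i - x0 i)) - (\<Sum>i<m. partial i D x0 * (x i - (x0 i + \<epsilon> * \<zeta> i)))"
    by (simp add: S_def sum_distrib_left sum_subtractf[symmetric] algebra_simps)
  moreover have "\<bar>\<Sum>i<m. partial i D x0 * (x i - (x0 i + \<epsilon> * \<zeta> i))\<bar> \<le> M * (\<theta> * \<epsilon>)"
  proof -
    have "\<bar>\<Sum>i<m. partial i D x0 * (x i - (x0 i + \<epsilon> * \<zeta> i))\<bar> \<le> (\<Sum>i<m. M * \<bar>x i - (x0 i + \<epsilon> * \<zeta> i)\<bar>)"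
    proof (rule order_trans[OF sum_abs sum_mono])
      fix i assume "i \<in> {..<m}"
      then have "\<bar>partial i D x0\<bar> \<le> M" unfolding M_def by (intro member_le_sum) auto
      then show "\<bar>partial i D x0 * (x i - (x0 i + \<epsilon> * \<zeta> i))\<bar> \<le> M * \<bar>x i - (x0 i + \<epsilon> * \<zeta> i)\<bar>"
        by (simp add: abs_mult mult_right_mono)
    qed
    also have "\<dots> \<le> M * (\<theta> * \<epsilon>)" using x(4) MA by (simp add: sum_distrib_left[symmetric] mult_left_mono)
    finally show ?thesis .
  qed
  ultimately have "\<bar>\<epsilon> * S\<bar> \<le> \<theta> * (\<theta> * \<epsilon> + \<epsilon> * A) + M * (\<theta> * \<epsilon>)"
    using * mult_left_mono[OF **, of \<theta>] \<theta> by linarith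
  also have "\<dots> \<le> \<epsilon> * (\<theta> * (M + A + 1))"
    using \<theta> x(1) mult_right_mono[of \<theta> 1 "\<theta> * \<epsilon>"] by (simp add: algebra_simps)
  finally have "\<epsilon> * \<bar>S\<bar> \<le> \<epsilon> * (\<theta> * (M + A + 1))" using x(1) by (simp add: abs_mult)
  then show False using \<theta>S x(1) by simp
qed

subsection \<open>Smooth linear systems\<close>

text \<open>
  Gaussian elimination keeps the matrix equal to the identity at \<open>x0\<close>, so the pivots do not vanish
  near \<open>x0\<close>.
\<close>

lemma smooth_linear_system:
  fixes M :: "nat \<Rightarrow> nat \<Rightarrow> (nat \<Rightarrow> real) \<Rightarrow> real"
  assumes "openin (Euclidean_space k) U" "x0 \<in> U"
    and "\<And>i j. i < n \<Longrightarrow> j < n \<Longrightarrow> smooth_fun k U (M i j)"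
    and "\<And>i. i < n \<Longrightarrow> smooth_fun k U (v i)"
    and "\<And>i j. i < n \<Longrightarrow> j < n \<Longrightarrow> M i j x0 = (if i = j then 1 else 0)"
  shows "\<exists>V w. openin (Euclidean_space k) V \<and> x0 \<in> V \<and> V \<subseteq> U \<and> (\<forall>j<n. smooth_fun k V (w j)) \<and>
    (\<forall>x\<in>V. \<forall>i<n. (\<Sum>j<n. M i j x * w j x) = v i x)"
  using assms
proof (induction n arbitrary: U M v)
  case 0
  then show ?case by auto
next
  case (Suc n)
  note U = Suc.prems(1) and M = Suc.prems(3) and v = Suc.prems(4)
  define U' where "U' = {x \<in> U. M n n x \<in> - {0}}"
  have U': "openin (Euclidean_space k) U'"
    unfolding U'_def by (intro openin_Euclidean_preimage[OF U] smooth_fun_continuous[OF M[of n n]]) auto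
  have x0: "x0 \<in> U'" using Suc.prems by (simp add: U'_def)
  have M': "smooth_fun k U' (M i j)" if "i \<le> n" "j \<le> n" for i j
    using M[of i j] that by (intro smooth_fun_subset[OF _ U']) (auto simp: U'_def)
  have v': "smooth_fun k U' (v i)" if "i \<le> n" for i
    using v[of i] that by (intro smooth_fun_subset[OF _ U']) (auto simp: U'_def)
  have inv: "smooth_fun k U' (\<lambda>x. inverse (M n n x))"
    by (rule smooth_fun_inverse[OF M']) (auto simp: U'_def)
  let ?M = "\<lambda>i j x. M i j x - M i n x * (inverse (M n n x) * M n j x)"
  let ?v = "\<lambda>i x. v i x - M i n x * (inverse (M n n x) * v n x)"
  have "\<exists>V w. openin (Euclidean_space k) V \<and> x0 \<in> V \<and> V \<subseteq> U' \<and> (\<forall>j<n. smooth_fun k V (w j)) \<and>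
    (\<forall>x\<in>V. \<forall>i<n. (\<Sum>j<n. ?M i j x * w j x) = ?v i x)"
  proof (rule Suc.IH[OF U' x0])
    show "smooth_fun k U' (?M i j)" if "i < n" "j < n" for i j
      using that by (intro smooth_fun_diff smooth_fun_mult M' inv) auto
    show "smooth_fun k U' (?v i)" if "i < n" for i
      using that by (intro smooth_fun_diff smooth_fun_mult M' v' inv) auto
    show "?M i j x0 = (if i = j then 1 else 0)" if "i < n" "j < n" for i j
      using that Suc.prems(5)[of i j] Suc.prems(5)[of i n] by simp
  qed
  then obtain V w where V: "openin (Euclidean_space k) V" "x0 \<in> V" "V \<subseteq> U'"
    and w: "\<And>j. j < n \<Longrightarrow> smooth_fun k V (w j)"
    and eq: "\<And>x i. x \<in> V \<Longrightarrow> i < n \<Longrightarrow> (\<Sum>j<n. ?M i j x * w j x) = ?v i x" by blast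
  define w' where "w' j = (if j < n then w j else (\<lambda>x. inverse (M n n x) * (v n x - (\<Sum>j<n. M n j x * w j x))))" for j
  have MV: "smooth_fun k V (M n j)" if "j \<le> n" for j
    using smooth_fun_subset[OF M' V(1,3)] that by simp
  have "smooth_fun k V (\<lambda>x. inverse (M n n x) * (v n x - (\<Sum>j<n. M n j x * w j x)))"
    by (intro smooth_fun_mult smooth_fun_diff smooth_fun_sum V(1) MV w
        smooth_fun_subset[OF inv V(1,3)] smooth_fun_subset[OF v' V(1,3)]) auto
  then have "smooth_fun k V (w' j)" if "j < Suc n" for j using w by (auto simp: w'_def)
  moreover have "(\<Sum>j<Suc n. M i j x * w' j x) = v i x" if x: "x \<in> V" and i: "i < Suc n" for x i
  proof -
    have nz: "M n n x \<noteq> 0" using V(3) x by (auto simp: U'_def)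
    let ?s = "\<Sum>j<n. M n j x * w j x"
    have *: "(\<Sum>j<Suc n. M i j x * w' j x) =
        (\<Sum>j<n. M i j x * w j x) + M i n x * (inverse (M n n x) * (v n x - ?s))"
      by (simp add: w'_def)
    show ?thesis
    proof (cases "i = n")
      case True
      then show ?thesis using nz unfolding * by (simp add: mult.assoc[symmetric])
    next
      case False
      then have "(\<Sum>j<n. ?M i j x * w j x) = ?v i x" using eq[OF x] i by simp
      moreover have "(\<Sum>j<n. ?M i j x * w j x) = (\<Sum>j<n. M i j x * w j x) - M i n x * (inverse (M n n x) * ?s)"
        by (simp add: left_diff_distrib sum_subtractf sum_distrib_left mult.assoc)
      ultimately show ?thesis using * by (simp add: right_diff_distrib)
    qed
  qed
  ultimately show ?case using V by (intro exI[of _ V] exI[of _ w']) (auto simp: U'_def)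
qed

section \<open>Plots of manifolds and their velocities\<close>

lemma smooth_euc_open: "smooth_euc n m U g \<Longrightarrow> openin (Euclidean_space n) U"
  by (simp add: smooth_euc_iff)

lemma smooth_euc_in_topspace: "smooth_euc n m U g \<Longrightarrow> x \<in> U \<Longrightarrow> g x \<in> topspace (Euclidean_space m)"
  by (auto simp: smooth_euc_iff)

lemma smooth_euc_coord: "smooth_euc n m U g \<Longrightarrow> j < m \<Longrightarrow> smooth_fun n U (\<lambda>x. g x j)"
  by (simp add: smooth_euc_iff)

lemma smooth_eucI:
  assumes "openin (Euclidean_space n) U" "\<And>x. x \<in> U \<Longrightarrow> g x \<in> topspace (Euclidean_space m)"
    "\<And>j. j < m \<Longrightarrow> smooth_fun n U (\<lambda>x. g x j)"
  shows "smooth_euc n m U g"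
  using assms by (auto simp: smooth_euc_iff)

lemma smooth_euc_union:
  assumes "\<And>x. x \<in> U \<Longrightarrow> \<exists>V. x \<in> V \<and> V \<subseteq> U \<and> smooth_euc n m V g"
  shows "smooth_euc n m U g"
proof (rule smooth_euc_locally)
  show "openin (Euclidean_space n) U"
  proof (subst openin_subopen, rule ballI)
    fix x assume "x \<in> U"
    from assms[OF this] obtain V where V: "x \<in> V" "V \<subseteq> U" "smooth_euc n m V g" by (elim exE conjE)
    then show "\<exists>T. openin (Euclidean_space n) T \<and> x \<in> T \<and> T \<subseteq> U"
      using smooth_euc_open[OF V(3)] by (intro exI[of _ V]) simp
  qed
  fix x assume "x \<in> U"
  from assms[OF this] show "\<exists>V. x \<in> V \<and> smooth_euc n m V g" by (elim exE conjE) (rule exI, simp)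
qed

lemma smooth_euc_const:
  assumes "openin (Euclidean_space n) U" "c \<in> topspace (Euclidean_space m)"
  shows "smooth_euc n m U (\<lambda>x. c)"
  using assms by (intro smooth_eucI) (auto intro: smooth_fun_const)

lemma smooth_euc_jacobian:
  assumes f: "smooth_euc n m V f" and g: "smooth_euc k n U g" and gV: "g ` U \<subseteq> V" and w: "smooth_euc k n U w"
  shows "smooth_euc k m U (\<lambda>y. jacobian_apply n m f (g y) (w y))"
proof (rule smooth_eucI[OF smooth_euc_open[OF g] jacobian_apply_in_topspace])
  fix j assume j: "j < m"
  have "smooth_fun k U (\<lambda>y. \<Sum>i<n. partial i (\<lambda>z. f z j) (g y) * w y i)"
  proof (rule smooth_fun_sum[OF smooth_euc_open[OF g]], rule smooth_fun_mult)
    fix i assume i: "i \<in> {..<n}"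
    then show "smooth_fun k U (\<lambda>y. partial i (\<lambda>z. f z j) (g y))"
      by (intro smooth_fun_compose[OF smooth_fun_partial[OF smooth_euc_coord[OF f j]] g gV]) simp
    show "smooth_fun k U (\<lambda>y. w y i)" using smooth_euc_coord[OF w] i by simp
  qed
  then show "smooth_fun k U (\<lambda>y. jacobian_apply n m f (g y) (w y) j)"
    using j by (simp add: jacobian_apply_def)
qed

subsection \<open>Charts\<close>

lemma
  assumes N: "smooth_atlas N" and c: "c \<in> atlas N"
  shows chart_subset: "fst c \<subseteq> mcarrier N"
    and chart_inj: "inj_on (snd c) (fst c)"
    and chart_open: "openin (Euclidean_space (mdim N)) (snd c ` fst c)"
proof -
  show "fst c \<subseteq> mcarrier N"
    using N c unfolding smooth_atlas_def by blast
  show "inj_on (snd c) (fst c)" "openin (Euclidean_space (mdim N)) (snd c ` fst c)"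
    using N c unfolding smooth_atlas_def by simp_all
qed

lemma chart_ex:
  assumes "smooth_atlas N" "x \<in> mcarrier N"
  obtains c where "c \<in> atlas N" "x \<in> fst c"
proof -
  have "x \<in> \<Union>(fst ` atlas N)" using assms by (simp add: smooth_atlas_def)
  then show thesis using that by blast
qed

lemma chart_in_topspace:
  assumes N: "smooth_atlas N" and c: "c \<in> atlas N" and x: "x \<in> fst c"
  shows "snd c x \<in> topspace (Euclidean_space (mdim N))"
  using openin_subset[OF chart_open[OF N c]] x by auto

lemma chart_inv_chart [simp]:
  assumes "smooth_atlas N" "c \<in> atlas N" "x \<in> fst c"
  shows "chart_inv c (snd c x) = x"
  unfolding chart_inv_def by (rule the_inv_into_f_f[OF chart_inj[OF assms(1,2)] assms(3)])

lemma chart_chart_inv: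
  assumes "smooth_atlas N" "c \<in> atlas N" "y \<in> snd c ` fst c"
  shows "snd c (chart_inv c y) = y"
  using assms by auto

text \<open>
  The plots of the manifold diffeology (\<open>plot_mfd_diffeology\<close>), without the identity chart on the
  domain.
\<close>

definition mplot :: "nat \<Rightarrow> (nat \<Rightarrow> real) set \<Rightarrow> 'a mfd \<Rightarrow> ((nat \<Rightarrow> real) \<Rightarrow> 'a) \<Rightarrow> bool" where
  "mplot k U N q \<longleftrightarrow> openin (Euclidean_space k) U \<and> q ` U \<subseteq> mcarrier N \<and>
     (\<forall>c\<in>atlas N. smooth_euc k (mdim N) {x \<in> U. q x \<in> fst c} (\<lambda>x. snd c (q x)))"

lemma smooth_map_on_euclidean:
  "smooth_map_on (euclidean_mfd k) U N q \<longleftrightarrow> mplot k U N q"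
proof -
  let ?E = "topspace (Euclidean_space k)"
  have inv: "chart_inv (?E, \<lambda>x. x) x = x" if "x \<in> ?E" for x
    using the_inv_into_f_f[of "\<lambda>x. x" ?E x] that by (simp add: chart_inv_def)
  have "smooth_euc k k ?E (coord_rep (?E, \<lambda>x. x) (?E, \<lambda>x. x) (\<lambda>x. x))"
    by (rule smooth_euc_cong[OF smooth_euc_id]) (auto simp: coord_rep_def inv)
  then have "smooth_atlas (euclidean_mfd k)"
    by (simp add: smooth_atlas_def euclidean_mfd_def)
  then have o: "openin (mtop (euclidean_mfd k)) U \<longleftrightarrow> openin (Euclidean_space k) U"
    using openin_subset[of "Euclidean_space k" U]
    by (auto simp: openin_mtop mopen_def euclidean_mfd_def Int_absorb2)
  have "smooth_euc k (mdim N) {x \<in> U \<inter> ?E. q x \<in> fst c} (coord_rep (?E, \<lambda>x. x) c q) \<longleftrightarrow>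
      smooth_euc k (mdim N) {x \<in> U. q x \<in> fst c} (\<lambda>x. snd c (q x))"
    if "openin (Euclidean_space k) U" for c
  proof -
    have U: "U \<subseteq> ?E" using that by (rule openin_subset)
    then have eq: "{x \<in> U \<inter> ?E. q x \<in> fst c} = {x \<in> U. q x \<in> fst c}" by auto
    have "coord_rep (?E, \<lambda>x. x) c q x = snd c (q x)" if "x \<in> U" for x
      using inv[of x] that U by (auto simp: coord_rep_def)
    then show ?thesis
      unfolding eq
      using smooth_euc_cong[of k "mdim N" "{x \<in> U. q x \<in> fst c}" "coord_rep (?E, \<lambda>x. x) c q" "\<lambda>x. snd c (q x)"]
        smooth_euc_cong[of k "mdim N" "{x \<in> U. q x \<in> fst c}" "\<lambda>x. snd c (q x)" "coord_rep (?E, \<lambda>x. x) c q"]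
      by auto
  qed
  then show ?thesis
    unfolding smooth_map_on_def mplot_def o by (auto simp: euclidean_mfd_def)
qed

lemma mplot_open: "mplot k U N q \<Longrightarrow> openin (Euclidean_space k) U"
  by (simp add: mplot_def)

lemma mplot_in: "mplot k U N q \<Longrightarrow> x \<in> U \<Longrightarrow> q x \<in> mcarrier N"
  by (auto simp: mplot_def)

lemma mplot_chart:
  "mplot k U N q \<Longrightarrow> c \<in> atlas N \<Longrightarrow> smooth_euc k (mdim N) {x \<in> U. q x \<in> fst c} (\<lambda>x. snd c (q x))"
  by (simp add: mplot_def)

lemma mplot_chart_inv:
  assumes N: "smooth_atlas N" and c: "c \<in> atlas N"
  shows "mplot (mdim N) (snd c ` fst c) N (chart_inv c)"
  unfolding mplot_def
proof (intro conjI ballI chart_open[OF N c])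
  show "chart_inv c ` snd c ` fst c \<subseteq> mcarrier N"
    using chart_subset[OF N c] N c by auto
  fix c' assume c': "c' \<in> atlas N"
  have "{x \<in> snd c ` fst c. chart_inv c x \<in> fst c'} = snd c ` (fst c \<inter> fst c')"
    using N c by auto
  moreover have "smooth_euc (mdim N) (mdim N) (snd c ` (fst c \<inter> fst c')) (coord_rep c c' (\<lambda>x. x))"
    using N c c' unfolding smooth_atlas_def by simp
  ultimately show "smooth_euc (mdim N) (mdim N) {x \<in> snd c ` fst c. chart_inv c x \<in> fst c'}
      (\<lambda>x. snd c' (chart_inv c x))"
    by (simp add: coord_rep_def comp_def)
qed

lemma mplot_compose_euc:
  assumes q: "mplot k U N q" and h: "smooth_euc l k V h" and hV: "h ` V \<subseteq> U"
  shows "mplot l V N (\<lambda>x. q (h x))"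
  unfolding mplot_def
proof (intro conjI ballI smooth_euc_open[OF h])
  show "(\<lambda>x. q (h x)) ` V \<subseteq> mcarrier N" using q hV by (auto simp: mplot_def)
  fix c assume "c \<in> atlas N"
  note qc = mplot_chart[OF q this]
  have eq: "{x \<in> V. q (h x) \<in> fst c} = {x \<in> V. h x \<in> {x \<in> U. q x \<in> fst c}}" using hV by auto
  have "openin (Euclidean_space l) {x \<in> V. q (h x) \<in> fst c}"
    unfolding eq by (rule smooth_euc_preimage_open[OF h smooth_euc_open[OF qc]])
  then have "smooth_euc l k {x \<in> V. q (h x) \<in> fst c} h" by (intro smooth_euc_subset[OF h]) auto
  then show "smooth_euc l (mdim N) {x \<in> V. q (h x) \<in> fst c} (\<lambda>x. snd c (q (h x)))"
    using hV by (intro smooth_euc_compose[OF qc]) auto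
qed

lemma mplot_subset:
  assumes "mplot k U N q" "openin (Euclidean_space k) V" "V \<subseteq> U"
  shows "mplot k V N q"
  using mplot_compose_euc[OF assms(1) smooth_euc_id[OF assms(2)]] assms(3) by simp

lemma mplot_cong:
  assumes q: "mplot k U N q" and eq: "\<And>x. x \<in> U \<Longrightarrow> q x = q' x"
  shows "mplot k U N q'"
  unfolding mplot_def
proof (intro conjI ballI mplot_open[OF q])
  show "q' ` U \<subseteq> mcarrier N" using mplot_in[OF q] eq by force
  fix c assume "c \<in> atlas N"
  moreover have "{x \<in> U. q' x \<in> fst c} = {x \<in> U. q x \<in> fst c}" using eq by auto
  ultimately show "smooth_euc k (mdim N) {x \<in> U. q' x \<in> fst c} (\<lambda>x. snd c (q' x))"
    using smooth_euc_cong[OF mplot_chart[OF q], of c "\<lambda>x. snd c (q' x)"] eq by simp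
qed

lemma mplot_locally:
  assumes "openin (Euclidean_space k) U" "\<And>x. x \<in> U \<Longrightarrow> \<exists>V. x \<in> V \<and> V \<subseteq> U \<and> mplot k V N q"
  shows "mplot k U N q"
  unfolding mplot_def
proof (intro conjI ballI assms(1))
  show "q ` U \<subseteq> mcarrier N"
  proof
    fix y assume "y \<in> q ` U"
    then obtain x where x: "y = q x" "x \<in> U" by auto
    from assms(2)[OF x(2)] obtain V where "x \<in> V" "mplot k V N q" by (elim exE conjE)
    then show "y \<in> mcarrier N" using mplot_in x(1) by simp
  qed
  fix c assume c: "c \<in> atlas N"
  show "smooth_euc k (mdim N) {x \<in> U. q x \<in> fst c} (\<lambda>x. snd c (q x))"
  proof (rule smooth_euc_union)
    fix x assume "x \<in> {x \<in> U. q x \<in> fst c}"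
    then have x: "x \<in> U" "q x \<in> fst c" by auto
    from assms(2)[OF x(1)] obtain V where V: "x \<in> V" "V \<subseteq> U" "mplot k V N q" by (elim exE conjE)
    then show "\<exists>V. x \<in> V \<and> V \<subseteq> {x \<in> U. q x \<in> fst c} \<and> smooth_euc k (mdim N) V (\<lambda>x. snd c (q x))"
      using x mplot_chart[OF V(3) c] by (intro exI[of _ "{x \<in> V. q x \<in> fst c}"]) auto
  qed
qed

lemma mplot_chartI:
  assumes N: "smooth_atlas N" and c: "c \<in> atlas N" and g: "smooth_euc k (mdim N) U (\<lambda>x. snd c (q x))"
    and q: "\<And>x. x \<in> U \<Longrightarrow> q x \<in> fst c"
  shows "mplot k U N q"
proof (rule mplot_cong)
  show "mplot k U N (\<lambda>x. chart_inv c (snd c (q x)))"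
    using q by (intro mplot_compose_euc[OF mplot_chart_inv[OF N c] g]) auto
qed (use q N c in simp)

lemma mplot_const:
  assumes N: "smooth_atlas N" and U: "openin (Euclidean_space k) U" and x: "x \<in> mcarrier N"
  shows "mplot k U N (\<lambda>_. x)"
proof -
  obtain c where c: "c \<in> atlas N" "x \<in> fst c" using chart_ex[OF N x] .
  show ?thesis
    by (rule mplot_chartI[OF N c(1) smooth_euc_const[OF U chart_in_topspace[OF N c]] c(2)])
qed

lemma mplot_preimage_open:
  assumes N: "smooth_atlas N" and q: "mplot k U N q" and W: "openin (mtop N) W"
  shows "openin (Euclidean_space k) {x \<in> U. q x \<in> W}"
proof (subst openin_subopen, rule ballI)
  fix x assume "x \<in> {x \<in> U. q x \<in> W}"
  then have x: "x \<in> U" "q x \<in> W" by auto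
  obtain c where c: "c \<in> atlas N" "q x \<in> fst c" using chart_ex[OF N mplot_in[OF q x(1)]] .
  have "openin (Euclidean_space (mdim N)) (snd c ` (W \<inter> fst c))"
    using W c(1) unfolding openin_mtop[OF N] mopen_def by simp
  then have "openin (Euclidean_space k) {y \<in> {x \<in> U. q x \<in> fst c}. snd c (q y) \<in> snd c ` (W \<inter> fst c)}"
    by (rule smooth_euc_preimage_open[OF mplot_chart[OF q c(1)]])
  moreover have "q y \<in> W" if "q y \<in> fst c" "snd c (q y) \<in> snd c ` (W \<inter> fst c)" for y
    using inj_on_image_mem_iff[OF chart_inj[OF N c(1)], of "q y" "W \<inter> fst c"] that by auto
  ultimately show "\<exists>T. openin (Euclidean_space k) T \<and> x \<in> T \<and> T \<subseteq> {x \<in> U. q x \<in> W}"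
    using x c(2) by (intro exI[of _ "{y \<in> {x \<in> U. q x \<in> fst c}. snd c (q y) \<in> snd c ` (W \<inter> fst c)}"]) auto
qed

lemma openin_mtop_mcarrier:
  assumes N: "smooth_atlas N"
  shows "openin (mtop N) (mcarrier N)"
  unfolding openin_mtop[OF N] mopen_def
proof (intro conjI ballI order_refl)
  fix c assume c: "c \<in> atlas N"
  show "openin (Euclidean_space (mdim N)) (snd c ` (mcarrier N \<inter> fst c))"
    using chart_open[OF N c] chart_subset[OF N c] by (simp add: Int_absorb1)
qed

lemma openin_mtop_subset: "smooth_atlas N \<Longrightarrow> openin (mtop N) W \<Longrightarrow> W \<subseteq> mcarrier N"
  by (simp add: openin_mtop mopen_def)

lemma smooth_map_on_open: "smooth_map_on N W N' f \<Longrightarrow> openin (mtop N) W"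
  by (simp add: smooth_map_on_def)

lemma smooth_map_on_coord_rep:
  "smooth_map_on N W N' f \<Longrightarrow> c \<in> atlas N \<Longrightarrow> c' \<in> atlas N' \<Longrightarrow>
   smooth_euc (mdim N) (mdim N') (snd c ` {x \<in> W \<inter> fst c. f x \<in> fst c'}) (coord_rep c c' f)"
  by (simp add: smooth_map_on_def)

text \<open>In the chart \<open>c\<close>, a map composed with a plot is its coordinate expression after the plot.\<close>

lemma mplot_coord_rep:
  assumes N: "smooth_atlas N" and q: "mplot k U N q" and f: "smooth_map_on N W N' f"
    and c: "c \<in> atlas N" and c': "c' \<in> atlas N'"
  defines "V \<equiv> {y \<in> U. q y \<in> fst c \<and> q y \<in> W \<and> f (q y) \<in> fst c'}"
  shows "smooth_euc k (mdim N) V (\<lambda>y. snd c (q y))"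
    and "(\<lambda>y. snd c (q y)) ` V \<subseteq> snd c ` {x \<in> W \<inter> fst c. f x \<in> fst c'}"
    and "y \<in> V \<Longrightarrow> coord_rep c c' f (snd c (q y)) = snd c' (f (q y))"
proof -
  let ?A = "snd c ` {x \<in> W \<inter> fst c. f x \<in> fst c'}"
  have "V = {y \<in> {x \<in> U. q x \<in> fst c}. snd c (q y) \<in> ?A}"
    using inj_on_image_mem_iff[OF chart_inj[OF N c], of _ "{x \<in> W \<inter> fst c. f x \<in> fst c'}"]
    by (auto simp: V_def)
  then have "openin (Euclidean_space k) V"
    using smooth_euc_preimage_open[OF mplot_chart[OF q c]] smooth_euc_open[OF smooth_map_on_coord_rep[OF f c c']]
    by simp
  then show "smooth_euc k (mdim N) V (\<lambda>y. snd c (q y))"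
    by (intro smooth_euc_subset[OF mplot_chart[OF q c]]) (auto simp: V_def)
  show "(\<lambda>y. snd c (q y)) ` V \<subseteq> ?A" by (auto simp: V_def)
  show "y \<in> V \<Longrightarrow> coord_rep c c' f (snd c (q y)) = snd c' (f (q y))"
    using N c by (simp add: V_def coord_rep_def)
qed

lemma mplot_compose_smooth:
  assumes N: "smooth_atlas N" and q: "mplot k U N q" and f: "smooth_map_on N W N' f" and qW: "q ` U \<subseteq> W"
  shows "mplot k U N' (\<lambda>x. f (q x))"
  unfolding mplot_def
proof (intro conjI ballI mplot_open[OF q])
  show "(\<lambda>x. f (q x)) ` U \<subseteq> mcarrier N'" using f qW by (auto simp: smooth_map_on_def)
  fix c' assume c': "c' \<in> atlas N'"
  show "smooth_euc k (mdim N') {x \<in> U. f (q x) \<in> fst c'} (\<lambda>x. snd c' (f (q x)))"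
  proof (rule smooth_euc_union)
    fix x assume "x \<in> {x \<in> U. f (q x) \<in> fst c'}"
    then have x: "x \<in> U" "f (q x) \<in> fst c'" by auto
    obtain c where c: "c \<in> atlas N" "q x \<in> fst c" using chart_ex[OF N mplot_in[OF q x(1)]] .
    let ?V = "{y \<in> U. q y \<in> fst c \<and> q y \<in> W \<and> f (q y) \<in> fst c'}"
    note V = mplot_coord_rep[OF N q f c(1) c']
    have "smooth_euc k (mdim N') ?V (\<lambda>y. coord_rep c c' f (snd c (q y)))"
      by (rule smooth_euc_compose[OF smooth_map_on_coord_rep[OF f c(1) c'] V(1,2)])
    from smooth_euc_cong[OF this V(3)] have "smooth_euc k (mdim N') ?V (\<lambda>y. snd c' (f (q y)))" by simp
    then show "\<exists>V. x \<in> V \<and> V \<subseteq> {x \<in> U. f (q x) \<in> fst c'} \<and> smooth_euc k (mdim N') V (\<lambda>x. snd c' (f (q x)))"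
      using x c qW by (intro exI[of _ ?V]) auto
  qed
qed

text \<open>Smoothness of a map can be tested on the inverse charts of its domain, which are plots.\<close>

lemma smooth_map_onI:
  assumes N: "smooth_atlas N" and W: "openin (mtop N) W"
    and f: "\<And>c. c \<in> atlas N \<Longrightarrow> mplot (mdim N) (snd c ` (W \<inter> fst c)) N' (\<lambda>z. f (chart_inv c z))"
  shows "smooth_map_on N W N' f"
  unfolding smooth_map_on_def
proof (intro conjI ballI W)
  show "f ` W \<subseteq> mcarrier N'"
  proof
    fix y assume "y \<in> f ` W"
    then obtain x where x: "x \<in> W" "y = f x" by auto
    then obtain c where c: "c \<in> atlas N" "x \<in> fst c" using chart_ex[OF N] openin_mtop_subset[OF N W] by blast
    have "f (chart_inv c (snd c x)) \<in> mcarrier N'" using mplot_in[OF f[OF c(1)]] x c by simp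
    then show "y \<in> mcarrier N'" using N c x by simp
  qed
  fix c c' assume c: "c \<in> atlas N" and c': "c' \<in> atlas N'"
  have "{z \<in> snd c ` (W \<inter> fst c). f (chart_inv c z) \<in> fst c'} = snd c ` {x \<in> W \<inter> fst c. f x \<in> fst c'}"
    using N c by auto
  then show "smooth_euc (mdim N) (mdim N') (snd c ` {x \<in> W \<inter> fst c. f x \<in> fst c'}) (coord_rep c c' f)"
    using mplot_chart[OF f[OF c] c'] by (simp add: coord_rep_def comp_def)
qed

subsection \<open>Velocities\<close>

text \<open>
  The velocity of a plot at \<open>x\<close> in direction \<open>w\<close>. Every tangent vector is the velocity of an inverse
  chart, and differentials of maps act on velocities by composition; so identities between
  differentials follow from identities between maps.
\<close>

definition pvel ::
  "nat \<Rightarrow> 'a mfd \<Rightarrow> ((nat \<Rightarrow> real) \<Rightarrow> 'a) \<Rightarrow> (nat \<Rightarrow> real) \<Rightarrow> (nat \<Rightarrow> real) \<Rightarrow> 'a tvec" where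
  "pvel k N q x w =
     (\<lambda>c. if c \<in> charts_at N (q x) then jacobian_apply k (mdim N) (\<lambda>y. snd c (q y)) x w else 0)"

lemma charts_at_iff: "c \<in> charts_at N x \<longleftrightarrow> c \<in> atlas N \<and> x \<in> fst c"
  by (simp add: charts_at_def)

lemma pvel_cong:
  fixes N :: "'a mfd"
  assumes "openin (Euclidean_space k) V" "x \<in> V" "\<And>y. y \<in> V \<Longrightarrow> q y = q' y"
  shows "pvel k N q x w = pvel k N q' x w"
proof -
  have "jacobian_apply k (mdim N) (\<lambda>y. snd c (q y)) x w = jacobian_apply k (mdim N) (\<lambda>y. snd c (q' y)) x w" for c :: "'a chart"
    by (rule jacobian_apply_cong[OF assms(1,2)]) (simp add: assms(3))
  then have "pvel k N q x w c = pvel k N q' x w c" for c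
    using assms(3)[OF assms(2)] by (cases "c \<in> charts_at N (q' x)") (simp_all add: pvel_def)
  then show ?thesis by (rule ext)
qed

lemma mplot_pair_chart:
  assumes N: "smooth_atlas N" and q: "mplot k U N q" and c: "c \<in> atlas N" and c': "c' \<in> atlas N"
  shows "smooth_euc k (mdim N) {y \<in> U. q y \<in> fst c \<inter> fst c'} (\<lambda>y. snd c (q y))"
    and "(\<lambda>y. snd c (q y)) ` {y \<in> U. q y \<in> fst c \<inter> fst c'} \<subseteq> snd c ` (fst c \<inter> fst c')"
    and "smooth_euc (mdim N) (mdim N) (snd c ` (fst c \<inter> fst c')) (coord_rep c c' (\<lambda>x. x))"
    and "q y \<in> fst c \<Longrightarrow> coord_rep c c' (\<lambda>x. x) (snd c (q y)) = snd c' (q y)"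
proof -
  have "openin (Euclidean_space k) ({y \<in> U. q y \<in> fst c} \<inter> {y \<in> U. q y \<in> fst c'})"
    by (intro openin_Int smooth_euc_open[OF mplot_chart[OF q]] c c')
  moreover have "{y \<in> U. q y \<in> fst c} \<inter> {y \<in> U. q y \<in> fst c'} = {y \<in> U. q y \<in> fst c \<inter> fst c'}" by auto
  ultimately show "smooth_euc k (mdim N) {y \<in> U. q y \<in> fst c \<inter> fst c'} (\<lambda>y. snd c (q y))"
    by (intro smooth_euc_subset[OF mplot_chart[OF q c]]) auto
  show "smooth_euc (mdim N) (mdim N) (snd c ` (fst c \<inter> fst c')) (coord_rep c c' (\<lambda>x. x))"
    using N c c' unfolding smooth_atlas_def by simp
  show "q y \<in> fst c \<Longrightarrow> coord_rep c c' (\<lambda>x. x) (snd c (q y)) = snd c' (q y)"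
    using N c by (simp add: coord_rep_def)
qed auto

lemma pvel_in_tangent_space:
  assumes N: "smooth_atlas N" and q: "mplot k U N q" and x: "x \<in> U"
  shows "pvel k N q x w \<in> tangent_space N (q x)"
  unfolding tangent_space_def
proof (intro CollectI conjI allI impI ballI)
  fix c c' assume cc: "c \<in> charts_at N (q x)" "c' \<in> charts_at N (q x)"
  then have c: "c \<in> atlas N" "q x \<in> fst c" "c' \<in> atlas N" "q x \<in> fst c'" by (auto simp: charts_at_iff)
  note V = mplot_pair_chart[OF N q c(1,3)]
  let ?V = "{y \<in> U. q y \<in> fst c \<inter> fst c'}"
  have xV: "x \<in> ?V" using x c by simp
  have "jacobian_apply (mdim N) (mdim N) (coord_rep c c' (\<lambda>y. y)) (snd c (q x)) (jacobian_apply k (mdim N) (\<lambda>y. snd c (q y)) x w)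
     = jacobian_apply k (mdim N) (\<lambda>y. coord_rep c c' (\<lambda>y. y) (snd c (q y))) x w"
    by (rule jacobian_apply_compose[OF V(1,3,2) xV])
  also have "\<dots> = jacobian_apply k (mdim N) (\<lambda>y. snd c' (q y)) x w"
    by (rule jacobian_apply_cong[OF smooth_euc_open[OF V(1)] xV]) (simp add: V(4))
  finally show "pvel k N q x w c' =
      jacobian_apply (mdim N) (mdim N) (coord_rep c c' (\<lambda>y. y)) (snd c (q x)) (pvel k N q x w c)"
    using cc by (simp add: pvel_def)
qed (auto simp: pvel_def)

lemma tangent_in_topspace:
  assumes "\<xi> \<in> tangent_space N x"
  shows "\<xi> c \<in> topspace (Euclidean_space (mdim N))"
proof (cases "c \<in> charts_at N x")
  case True
  then show ?thesis using assms unfolding tangent_space_def by blast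
next
  case False
  then have "\<xi> c = 0" using assms unfolding tangent_space_def by blast
  then show ?thesis by (simp add: in_topspace_Euclidean)
qed

lemma tangent_spaceI:
  assumes "\<And>c. c \<notin> charts_at N x \<Longrightarrow> \<xi> c = 0"
    "\<And>c. c \<in> charts_at N x \<Longrightarrow> \<xi> c \<in> topspace (Euclidean_space (mdim N))"
    "\<And>c c'. c \<in> charts_at N x \<Longrightarrow> c' \<in> charts_at N x \<Longrightarrow>
       \<xi> c' = jacobian_apply (mdim N) (mdim N) (coord_rep c c' (\<lambda>y. y)) (snd c x) (\<xi> c)"
  shows "\<xi> \<in> tangent_space N x"
  unfolding tangent_space_def by (intro CollectI conjI allI impI ballI assms)

lemma tangent_outside: "\<xi> \<in> tangent_space N x \<Longrightarrow> c \<notin> charts_at N x \<Longrightarrow> \<xi> c = 0"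
  unfolding tangent_space_def by blast

lemma tangent_transition:
  "\<xi> \<in> tangent_space N x \<Longrightarrow> c \<in> charts_at N x \<Longrightarrow> c' \<in> charts_at N x \<Longrightarrow>
     \<xi> c' = jacobian_apply (mdim N) (mdim N) (coord_rep c c' (\<lambda>y. y)) (snd c x) (\<xi> c)"
  unfolding tangent_space_def by blast

lemma tangent_as_pvel:
  assumes N: "smooth_atlas N" and \<xi>: "\<xi> \<in> tangent_space N x" and c: "c \<in> atlas N" "x \<in> fst c"
  shows "pvel (mdim N) N (chart_inv c) (snd c x) (\<xi> c) = \<xi>"
proof
  fix c'
  have c0: "c \<in> charts_at N x" using c by (simp add: charts_at_iff)
  show "pvel (mdim N) N (chart_inv c) (snd c x) (\<xi> c) c' = \<xi> c'"
  proof (cases "c' \<in> charts_at N x")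
    case True
    then show ?thesis using True tangent_transition[OF \<xi> c0 True] N c by (simp add: pvel_def coord_rep_def comp_def)
  next
    case False
    then show ?thesis using tangent_outside[OF \<xi>] N c by (simp add: pvel_def)
  qed
qed

lemma tangent_eqI:
  assumes "smooth_atlas N" "\<xi> \<in> tangent_space N x" "\<eta> \<in> tangent_space N x"
    "c \<in> atlas N" "x \<in> fst c" "\<xi> c = \<eta> c"
  shows "\<xi> = \<eta>"
proof -
  have "\<xi> = pvel (mdim N) N (chart_inv c) (snd c x) (\<eta> c)"
    unfolding assms(6)[symmetric] by (rule tangent_as_pvel[OF assms(1,2,4,5), symmetric])
  also have "\<dots> = \<eta>" by (rule tangent_as_pvel[OF assms(1,3,4,5)])
  finally show ?thesis .
qed

lemma tangent_ex:
  assumes N: "smooth_atlas N" and c: "c \<in> atlas N" "x \<in> fst c" and w: "w \<in> topspace (Euclidean_space (mdim N))"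
  obtains \<xi> where "\<xi> \<in> tangent_space N x" "\<xi> c = w"
proof
  let ?\<xi> = "pvel (mdim N) N (chart_inv c) (snd c x) w"
  show "?\<xi> \<in> tangent_space N x"
    using pvel_in_tangent_space[OF N mplot_chart_inv[OF N c(1)], of "snd c x" w] N c by simp
  have "jacobian_apply (mdim N) (mdim N) (\<lambda>y. snd c (chart_inv c y)) (snd c x) w = jacobian_apply (mdim N) (mdim N) (\<lambda>y. y) (snd c x) w"
    by (rule jacobian_apply_cong[OF chart_open[OF N c(1)]]) (use N c in auto)
  then show "?\<xi> c = w" using N c jacobian_apply_id[OF w] by (simp add: pvel_def charts_at_iff)
qed

lemma charts_at_some:
  assumes "smooth_atlas N" "x \<in> mcarrier N"
  shows "(SOME c. c \<in> charts_at N x) \<in> atlas N" "x \<in> fst (SOME c. c \<in> charts_at N x)"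
proof -
  obtain c where "c \<in> atlas N" "x \<in> fst c" using chart_ex[OF assms] .
  then have "c \<in> charts_at N x" by (simp add: charts_at_iff)
  then have "(SOME c. c \<in> charts_at N x) \<in> charts_at N x" by (rule someI)
  then show "(SOME c. c \<in> charts_at N x) \<in> atlas N" "x \<in> fst (SOME c. c \<in> charts_at N x)"
    by (simp_all only: charts_at_iff)
qed

text \<open>
  The chain rule in coordinates. The right-hand side does not mention the chart which the definition
  of the differential chooses around \<open>q x\<close>.
\<close>

lemma differential_pvel:
  assumes N: "smooth_atlas N" and f: "smooth_map_on N W N' f" and q: "mplot k U N q"
    and x: "x \<in> U" and qx: "q x \<in> W"
  shows "differential N N' f (q x) (pvel k N q x w) = pvel k N' (\<lambda>y. f (q y)) x w"
proof
  fix c'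
  define c where "c = (SOME c. c \<in> charts_at N (q x))"
  have c: "c \<in> atlas N" "q x \<in> fst c"
    using charts_at_some[OF N mplot_in[OF q x]] by (simp_all add: c_def)
  have d: "differential N N' f (q x) (pvel k N q x w) c' = (if c' \<in> charts_at N' (f (q x))
     then jacobian_apply (mdim N) (mdim N') (coord_rep c c' f) (snd c (q x)) (pvel k N q x w c) else 0)"
    by (simp add: differential_def Let_def c_def)
  show "differential N N' f (q x) (pvel k N q x w) c' = pvel k N' (\<lambda>y. f (q y)) x w c'"
  proof (cases "c' \<in> charts_at N' (f (q x))")
    case True
    then have c': "c' \<in> atlas N'" "f (q x) \<in> fst c'" by (auto simp: charts_at_iff)
    note V = mplot_coord_rep[OF N q f c(1) c'(1)]
    let ?V = "{y \<in> U. q y \<in> fst c \<and> q y \<in> W \<and> f (q y) \<in> fst c'}"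
    have xV: "x \<in> ?V" using x qx c c' by simp
    have "jacobian_apply (mdim N) (mdim N') (coord_rep c c' f) (snd c (q x)) (jacobian_apply k (mdim N) (\<lambda>y. snd c (q y)) x w)
       = jacobian_apply k (mdim N') (\<lambda>y. coord_rep c c' f (snd c (q y))) x w"
      by (rule jacobian_apply_compose[OF V(1) smooth_map_on_coord_rep[OF f c(1) c'(1)] V(2) xV])
    also have "\<dots> = jacobian_apply k (mdim N') (\<lambda>y. snd c' (f (q y))) x w"
      by (rule jacobian_apply_cong[OF smooth_euc_open[OF V(1)] xV V(3)])
    finally show ?thesis using True c d by (simp add: pvel_def charts_at_iff)
  next
    case False
    then show ?thesis unfolding d by (simp add: pvel_def)
  qed
qed

lemma pvel_compose_euc:
  assumes q: "mplot k U N q" and h: "smooth_euc l k V h" and hV: "h ` V \<subseteq> U" and x: "x \<in> V"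
  shows "pvel k N q (h x) (jacobian_apply l k h x w) = pvel l N (\<lambda>y. q (h y)) x w"
proof
  fix c
  show "pvel k N q (h x) (jacobian_apply l k h x w) c = pvel l N (\<lambda>y. q (h y)) x w c"
  proof (cases "c \<in> charts_at N (q (h x))")
    case True
    then have c: "c \<in> atlas N" "q (h x) \<in> fst c" by (auto simp: charts_at_iff)
    note qc = mplot_chart[OF q c(1)]
    let ?V = "{y \<in> V. h y \<in> {x \<in> U. q x \<in> fst c}}"
    have "smooth_euc l k ?V h"
      by (rule smooth_euc_subset[OF h smooth_euc_preimage_open[OF h smooth_euc_open[OF qc]]]) auto
    from jacobian_apply_compose[OF this qc, of x w] show ?thesis
      using True x c hV by (auto simp: pvel_def)
  qed (simp add: pvel_def)
qed

lemma differential_add: "differential N N' f x (\<xi> + \<eta>) = differential N N' f x \<xi> + differential N N' f x \<eta>"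
  by (auto simp: differential_def Let_def fun_eq_iff jacobian_apply_add)

lemma differential_scale: "differential N N' f x (tscale r \<xi>) = tscale r (differential N N' f x \<xi>)"
  by (auto simp: differential_def Let_def fun_eq_iff jacobian_apply_scale tscale_def)

lemma tscale_add: "tscale r (\<xi> + \<eta>) = tscale r \<xi> + tscale r \<eta>"
  by (auto simp: tscale_def fun_eq_iff distrib_left)

lemma tscale_add_left: "tscale (r + s) \<xi> = tscale r \<xi> + tscale s \<xi>"
  by (auto simp: tscale_def fun_eq_iff distrib_right)

lemma tscale_tscale: "tscale r (tscale s \<xi>) = tscale (r * s) \<xi>"
  by (auto simp: tscale_def mult.assoc)

lemma tscale_simps [simp]: "tscale 1 \<xi> = \<xi>" "tscale 0 \<xi> = 0" "tscale r 0 = 0"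
  by (auto simp: tscale_def fun_eq_iff)

lemma tscale_minus_one: "tscale (-1) \<xi> = - \<xi>"
  by (auto simp: tscale_def fun_eq_iff)

lemma tangent_space_add:
  assumes "\<xi> \<in> tangent_space N x" "\<eta> \<in> tangent_space N x"
  shows "\<xi> + \<eta> \<in> tangent_space N x"
proof (rule tangent_spaceI)
  fix c c' assume c: "c \<in> charts_at N x" "c' \<in> charts_at N x"
  have "\<xi> c' + \<eta> c' = jacobian_apply (mdim N) (mdim N) (coord_rep c c' (\<lambda>y. y)) (snd c x) (\<xi> c + \<eta> c)"
    unfolding jacobian_apply_add
    by (simp only: tangent_transition[OF assms(1) c, symmetric] tangent_transition[OF assms(2) c, symmetric])
  then show "(\<xi> + \<eta>) c' = jacobian_apply (mdim N) (mdim N) (coord_rep c c' (\<lambda>y. y)) (snd c x) ((\<xi> + \<eta>) c)"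
    by (simp only: plus_fun_apply)
qed (use assms[THEN tangent_outside] assms[THEN tangent_in_topspace] in \<open>auto simp: in_topspace_Euclidean\<close>)

lemma tangent_space_scale:
  assumes "\<xi> \<in> tangent_space N x"
  shows "tscale r \<xi> \<in> tangent_space N x"
proof (rule tangent_spaceI)
  have s: "tscale r \<xi> c = (\<lambda>i. r * \<xi> c i)" for c by (simp add: tscale_def)
  fix c c' assume c: "c \<in> charts_at N x" "c' \<in> charts_at N x"
  show "tscale r \<xi> c' = jacobian_apply (mdim N) (mdim N) (coord_rep c c' (\<lambda>y. y)) (snd c x) (tscale r \<xi> c)"
    unfolding s jacobian_apply_scale by (simp only: tangent_transition[OF assms c, symmetric])
qed (use assms[THEN tangent_outside] assms[THEN tangent_in_topspace] in \<open>auto simp: in_topspace_Euclidean tscale_def fun_eq_iff\<close>)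

lemma tangent_space_zero [simp]: "0 \<in> tangent_space N x"
proof (rule tangent_spaceI)
  have "jacobian_apply n m f y 0 = (0 :: nat \<Rightarrow> real)" for n m f y
    by (auto simp: jacobian_apply_def fun_eq_iff)
  then show "(0 :: 'a tvec) c' = jacobian_apply (mdim N) (mdim N) (coord_rep c c' (\<lambda>y. y)) (snd c x) ((0 :: 'a tvec) c)" for c c'
    by simp
qed (auto simp: in_topspace_Euclidean)

lemma differential_in_tangent_space:
  assumes N: "smooth_atlas N" and N': "smooth_atlas N'" and f: "smooth_map_on N W N' f"
    and x: "x \<in> W" and \<xi>: "\<xi> \<in> tangent_space N x"
  shows "differential N N' f x \<xi> \<in> tangent_space N' (f x)"
proof -
  have "x \<in> mcarrier N" using openin_mtop_subset[OF N smooth_map_on_open[OF f]] x by auto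
  then obtain c where c: "c \<in> atlas N" "x \<in> fst c" using chart_ex[OF N] by metis
  let ?U = "{y \<in> snd c ` fst c. chart_inv c y \<in> W}"
  have q: "mplot (mdim N) ?U N (chart_inv c)"
    by (rule mplot_subset[OF mplot_chart_inv[OF N c(1)]])
      (auto intro: mplot_preimage_open[OF N mplot_chart_inv[OF N c(1)] smooth_map_on_open[OF f]])
  have "mplot (mdim N) ?U N' (\<lambda>y. f (chart_inv c y))"
    by (rule mplot_compose_smooth[OF N q f]) auto
  moreover have xU: "snd c x \<in> ?U" using N c x by simp
  ultimately have "pvel (mdim N) N' (\<lambda>y. f (chart_inv c y)) (snd c x) (\<xi> c) \<in> tangent_space N' (f (chart_inv c (snd c x)))"
    by (rule pvel_in_tangent_space[OF N'])
  also have "pvel (mdim N) N' (\<lambda>y. f (chart_inv c y)) (snd c x) (\<xi> c) = differential N N' f x \<xi>"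
    using differential_pvel[OF N f q xU, of "\<xi> c"] tangent_as_pvel[OF N \<xi> c] N c x by simp
  finally show ?thesis using N c by simp
qed

subsection \<open>Products of Euclidean spaces\<close>

definition fst_euc :: "nat \<Rightarrow> (nat \<Rightarrow> real) \<Rightarrow> nat \<Rightarrow> real" where
  "fst_euc n z = (\<lambda>i. if i < n then z i else 0)"

definition snd_euc :: "nat \<Rightarrow> (nat \<Rightarrow> real) \<Rightarrow> nat \<Rightarrow> real" where
  "snd_euc n z = (\<lambda>i. z (i + n))"

lemma fst_euc_concat: "x \<in> topspace (Euclidean_space n) \<Longrightarrow> fst_euc n (concat_euc n x y) = x"
  by (auto simp: fst_euc_def concat_euc_def in_topspace_Euclidean fun_eq_iff)

lemma snd_euc_concat: "snd_euc n (concat_euc n x y) = y"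
  by (auto simp: snd_euc_def concat_euc_def fun_eq_iff)

lemma concat_fst_snd: "concat_euc n (fst_euc n z) (snd_euc n z) = z"
  by (auto simp: fst_euc_def snd_euc_def concat_euc_def fun_eq_iff)

lemma concat_euc_in_topspace:
  "y \<in> topspace (Euclidean_space m) \<Longrightarrow> concat_euc n x y \<in> topspace (Euclidean_space (n + m))"
  by (auto simp: concat_euc_def in_topspace_Euclidean)

lemma partial_coord: "partial i (\<lambda>y. y j) x = (if i = j then 1 else 0)"
  by (rule partial_eqI) (cases "i = j"; auto)

lemma smooth_euc_fst_euc:
  assumes "openin (Euclidean_space k) U"
  shows "smooth_euc k n U (fst_euc n)"
  by (rule smooth_eucI[OF assms]) (auto simp: fst_euc_def in_topspace_Euclidean intro: smooth_fun_coord[OF assms])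

lemma smooth_euc_snd_euc:
  assumes "openin (Euclidean_space (n + m)) U"
  shows "smooth_euc (n + m) m U (snd_euc n)"
  by (rule smooth_eucI[OF assms])
    (use openin_subset[OF assms] in \<open>auto simp: snd_euc_def in_topspace_Euclidean intro: smooth_fun_coord[OF assms]\<close>)

lemma jacobian_fst_euc: "jacobian_apply (n + m) n (fst_euc n) z w = fst_euc n w"
proof
  fix j
  show "jacobian_apply (n + m) n (fst_euc n) z w j = fst_euc n w j"
    by (simp add: jacobian_apply_def fst_euc_def partial_coord if_distrib[of "\<lambda>a. a * _"] cong: if_cong)
qed

lemma jacobian_snd_euc:
  assumes "w \<in> topspace (Euclidean_space (n + m))"
  shows "jacobian_apply (n + m) m (snd_euc n) z w = snd_euc n w"
proof
  fix j
  show "jacobian_apply (n + m) m (snd_euc n) z w j = snd_euc n w j"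
    using assms by (simp add: jacobian_apply_def snd_euc_def partial_coord in_topspace_Euclidean
        if_distrib[of "\<lambda>a. a * _"] cong: if_cong)
qed

lemma smooth_euc_concat:
  assumes f: "smooth_euc k n U f" and g: "smooth_euc k m U g"
  shows "smooth_euc k (n + m) U (\<lambda>x. concat_euc n (f x) (g x))"
proof (rule smooth_eucI[OF smooth_euc_open[OF f]])
  show "concat_euc n (f x) (g x) \<in> topspace (Euclidean_space (n + m))" if "x \<in> U" for x
    by (rule concat_euc_in_topspace[OF smooth_euc_in_topspace[OF g that]])
  show "smooth_fun k U (\<lambda>x. concat_euc n (f x) (g x) j)" if "j < n + m" for j
  proof (cases "j < n")
    case True
    then show ?thesis using smooth_euc_coord[OF f True] by (simp add: concat_euc_def)
  next
    case False
    then have "j - n < m" using that by simp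
    then show ?thesis using False smooth_euc_coord[OF g] by (simp add: concat_euc_def)
  qed
qed

lemma smooth_euc_concatD:
  assumes s: "smooth_euc k (n + m) U (\<lambda>x. concat_euc n (f x) (g x))"
    and f: "\<And>x. x \<in> U \<Longrightarrow> f x \<in> topspace (Euclidean_space n)"
    and g: "\<And>x. x \<in> U \<Longrightarrow> g x \<in> topspace (Euclidean_space m)"
  shows "smooth_euc k n U f" "smooth_euc k m U g"
proof -
  show "smooth_euc k n U f"
  proof (rule smooth_eucI[OF smooth_euc_open[OF s] f])
    fix j assume "j < n"
    then show "smooth_fun k U (\<lambda>x. f x j)"
      using smooth_euc_coord[OF s, of j] by (simp add: concat_euc_def)
  qed
  show "smooth_euc k m U g"
  proof (rule smooth_eucI[OF smooth_euc_open[OF s] g])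
    fix j assume "j < m"
    then show "smooth_fun k U (\<lambda>x. g x j)"
      using smooth_euc_coord[OF s, of "j + n"] by (simp add: concat_euc_def)
  qed
qed

subsection \<open>Plots of the tangent bundle\<close>

text \<open>
  The chart of the tangent bundle over \<open>c\<close> records the base point in \<open>c\<close> and the coordinates of the
  vector in \<open>c\<close>.
\<close>

lemma mplot_tangent_bundle_iff:
  assumes N: "smooth_atlas N"
  shows "mplot k U (tangent_bundle N) (\<lambda>y. (p y, \<xi> y)) \<longleftrightarrow>
    mplot k U N p \<and> (\<forall>y\<in>U. \<xi> y \<in> tangent_space N (p y)) \<and>
    (\<forall>c\<in>atlas N. smooth_euc k (mdim N) {y \<in> U. p y \<in> fst c} (\<lambda>y. \<xi> y c))"
proof -
  have car: "(\<lambda>y. (p y, \<xi> y)) ` U \<subseteq> mcarrier (tangent_bundle N) \<longleftrightarrow>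
      p ` U \<subseteq> mcarrier N \<and> (\<forall>y\<in>U. \<xi> y \<in> tangent_space N (p y))"
    by (auto simp: tangent_bundle_def)
  have ch: "smooth_euc k (2 * mdim N) {y \<in> U. (p y, \<xi> y) \<in> (SIGMA x:fst c. tangent_space N x)}
        (\<lambda>y. concat_euc (mdim N) (snd c (p y)) (\<xi> y c)) \<longleftrightarrow>
      smooth_euc k (mdim N) {y \<in> U. p y \<in> fst c} (\<lambda>y. snd c (p y)) \<and>
      smooth_euc k (mdim N) {y \<in> U. p y \<in> fst c} (\<lambda>y. \<xi> y c)"
    if c: "c \<in> atlas N" and \<xi>: "\<forall>y\<in>U. \<xi> y \<in> tangent_space N (p y)" for c
  proof -
    have eq: "{y \<in> U. (p y, \<xi> y) \<in> (SIGMA x:fst c. tangent_space N x)} = {y \<in> U. p y \<in> fst c}"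
      using \<xi> by auto
    show ?thesis unfolding eq mult_2
    proof (intro iffI conjI)
      assume "smooth_euc k (mdim N + mdim N) {y \<in> U. p y \<in> fst c} (\<lambda>y. concat_euc (mdim N) (snd c (p y)) (\<xi> y c))"
      note * = smooth_euc_concatD[OF this]
      have 1: "snd c (p y) \<in> topspace (Euclidean_space (mdim N))" if "y \<in> {y \<in> U. p y \<in> fst c}" for y
        using chart_in_topspace[OF N c] that by simp
      have 2: "\<xi> y c \<in> topspace (Euclidean_space (mdim N))" if "y \<in> {y \<in> U. p y \<in> fst c}" for y
        using tangent_in_topspace[of "\<xi> y" N "p y" c] \<xi> that by simp
      show "smooth_euc k (mdim N) {y \<in> U. p y \<in> fst c} (\<lambda>y. snd c (p y))" by (rule *(1)[OF 1 2])
      show "smooth_euc k (mdim N) {y \<in> U. p y \<in> fst c} (\<lambda>y. \<xi> y c)" by (rule *(2)[OF 1 2])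
    qed (elim conjE, rule smooth_euc_concat)
  qed
  have "atlas (tangent_bundle N) =
      (\<lambda>c. (SIGMA x:fst c. tangent_space N x, \<lambda>(x, \<xi>). concat_euc (mdim N) (snd c x) (\<xi> c))) ` atlas N"
    unfolding tangent_bundle_def mfd.select_convs Setcompr_eq_image ..
  then have at: "(\<forall>C\<in>atlas (tangent_bundle N). P C) \<longleftrightarrow>
      (\<forall>c\<in>atlas N. P (SIGMA x:fst c. tangent_space N x, \<lambda>(x, \<xi>). concat_euc (mdim N) (snd c x) (\<xi> c)))" for P
    by (simp only: ball_simps)
  have d: "mdim (tangent_bundle N) = 2 * mdim N" by (simp add: tangent_bundle_def)
  show ?thesis
    unfolding mplot_def at car d fst_conv snd_conv split_conv
  proof (cases "\<forall>y\<in>U. \<xi> y \<in> tangent_space N (p y)")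
    case True
    let ?P = "\<lambda>c. smooth_euc k (mdim N) {y \<in> U. p y \<in> fst c} (\<lambda>y. snd c (p y))"
    let ?Q = "\<lambda>c. smooth_euc k (mdim N) {y \<in> U. p y \<in> fst c} (\<lambda>y. \<xi> y c)"
    let ?R = "\<lambda>c. smooth_euc k (2 * mdim N) {y \<in> U. (p y, \<xi> y) \<in> (SIGMA x:fst c. tangent_space N x)}
        (\<lambda>y. concat_euc (mdim N) (snd c (p y)) (\<xi> y c))"
    have "(\<forall>c\<in>atlas N. ?R c) \<longleftrightarrow> (\<forall>c\<in>atlas N. ?P c \<and> ?Q c)"
      by (rule ball_cong[OF refl ch[OF _ True]])
    then show "(openin (Euclidean_space k) U \<and> (p ` U \<subseteq> mcarrier N \<and> (\<forall>y\<in>U. \<xi> y \<in> tangent_space N (p y))) \<and>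
        (\<forall>c\<in>atlas N. ?R c)) \<longleftrightarrow> (openin (Euclidean_space k) U \<and> p ` U \<subseteq> mcarrier N \<and> (\<forall>c\<in>atlas N. ?P c)) \<and>
        (\<forall>y\<in>U. \<xi> y \<in> tangent_space N (p y)) \<and> (\<forall>c\<in>atlas N. ?Q c)"
      using True by blast
  qed blast
qed

lemma mplot_tangent_bundleD:
  assumes "smooth_atlas N" "mplot k U (tangent_bundle N) (\<lambda>y. (p y, \<xi> y))"
  shows "mplot k U N p" "y \<in> U \<Longrightarrow> \<xi> y \<in> tangent_space N (p y)"
    "c \<in> atlas N \<Longrightarrow> smooth_euc k (mdim N) {y \<in> U. p y \<in> fst c} (\<lambda>y. \<xi> y c)"
  using assms by (simp_all add: mplot_tangent_bundle_iff)

lemma mplot_pvel: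
  assumes N: "smooth_atlas N" and q: "mplot k V N q" and h: "smooth_euc l k U h" and hV: "h ` U \<subseteq> V"
    and w: "smooth_euc l k U w"
  shows "mplot l U (tangent_bundle N) (\<lambda>y. (q (h y), pvel k N q (h y) (w y)))"
  unfolding mplot_tangent_bundle_iff[OF N]
proof (intro conjI ballI)
  show qh: "mplot l U N (\<lambda>y. q (h y))" by (rule mplot_compose_euc[OF q h hV])
  show "pvel k N q (h y) (w y) \<in> tangent_space N (q (h y))" if "y \<in> U" for y
    using pvel_in_tangent_space[OF N q] hV that by auto
  fix c assume c: "c \<in> atlas N"
  let ?U = "{y \<in> U. q (h y) \<in> fst c}"
  have U: "openin (Euclidean_space l) ?U" by (rule smooth_euc_open[OF mplot_chart[OF qh c]])
  have "smooth_euc l (mdim N) ?U (\<lambda>y. jacobian_apply k (mdim N) (\<lambda>x. snd c (q x)) (h y) (w y))"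
  proof (rule smooth_euc_jacobian[OF mplot_chart[OF q c]])
    show "smooth_euc l k ?U h" by (rule smooth_euc_subset[OF h U]) auto
    show "smooth_euc l k ?U w" by (rule smooth_euc_subset[OF w U]) auto
  qed (use hV in auto)
  then show "smooth_euc l (mdim N) ?U (\<lambda>y. pvel k N q (h y) (w y) c)"
    by (rule smooth_euc_cong) (use c in \<open>auto simp: pvel_def charts_at_iff\<close>)
qed

text \<open>
  One chart around each point suffices: in it the vectors are velocities of the inverse chart, and
  velocities are smooth in all charts.
\<close>

lemma mplot_tangent_bundleI:
  assumes N: "smooth_atlas N" and p: "mplot k U N p"
    and \<xi>: "\<And>y. y \<in> U \<Longrightarrow> \<xi> y \<in> tangent_space N (p y)"
    and loc: "\<And>x. x \<in> U \<Longrightarrow> \<exists>c V. c \<in> atlas N \<and> x \<in> V \<and> V \<subseteq> U \<and> (\<forall>y\<in>V. p y \<in> fst c) \<and>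
       smooth_euc k (mdim N) V (\<lambda>y. \<xi> y c)"
  shows "mplot k U (tangent_bundle N) (\<lambda>y. (p y, \<xi> y))"
proof (rule mplot_locally[OF mplot_open[OF p]])
  fix x assume "x \<in> U"
  from loc[OF this] obtain c V where c: "c \<in> atlas N" and V: "x \<in> V" "V \<subseteq> U" "\<And>y. y \<in> V \<Longrightarrow> p y \<in> fst c"
    and s: "smooth_euc k (mdim N) V (\<lambda>y. \<xi> y c)" by (elim exE conjE) blast
  have h: "smooth_euc k (mdim N) V (\<lambda>y. snd c (p y))"
    using V by (intro smooth_euc_subset[OF mplot_chart[OF p c] smooth_euc_open[OF s]]) auto
  have "mplot k V (tangent_bundle N)
      (\<lambda>y. (chart_inv c (snd c (p y)), pvel (mdim N) N (chart_inv c) (snd c (p y)) (\<xi> y c)))"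
    using V(3) by (intro mplot_pvel[OF N mplot_chart_inv[OF N c] h _ s]) auto
  then have "mplot k V (tangent_bundle N) (\<lambda>y. (p y, \<xi> y))"
  proof (rule mplot_cong)
    fix y assume y: "y \<in> V"
    show "(chart_inv c (snd c (p y)), pvel (mdim N) N (chart_inv c) (snd c (p y)) (\<xi> y c)) = (p y, \<xi> y)"
      using tangent_as_pvel[OF N \<xi> c V(3)[OF y]] N c V y by auto
  qed
  then show "\<exists>V. x \<in> V \<and> V \<subseteq> U \<and> mplot k V (tangent_bundle N) (\<lambda>y. (p y, \<xi> y))"
    using V by (intro exI[of _ V]) simp
qed

text \<open>
  Locally the vectors are velocities of an inverse chart, and the differential sends these to the
  velocities of the composite with \<open>f\<close>.
\<close>

lemma mplot_differential:
  assumes N: "smooth_atlas N" and N': "smooth_atlas N'" and f: "smooth_map_on N W N' f"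
    and p: "mplot k U (tangent_bundle N) (\<lambda>y. (p y, \<xi> y))" and pW: "\<And>y. y \<in> U \<Longrightarrow> p y \<in> W"
  shows "mplot k U (tangent_bundle N') (\<lambda>y. (f (p y), differential N N' f (p y) (\<xi> y)))"
proof (rule mplot_locally[OF mplot_open[OF p]])
  note pD = mplot_tangent_bundleD[OF N p]
  fix x assume x: "x \<in> U"
  obtain c where c: "c \<in> atlas N" "p x \<in> fst c" using chart_ex[OF N mplot_in[OF pD(1) x]] .
  let ?V = "{y \<in> U. p y \<in> fst c}"
  let ?S = "{z \<in> snd c ` fst c. chart_inv c z \<in> W}"
  have q: "mplot (mdim N) ?S N (chart_inv c)"
    by (rule mplot_subset[OF mplot_chart_inv[OF N c(1)]])
      (auto intro: mplot_preimage_open[OF N mplot_chart_inv[OF N c(1)] smooth_map_on_open[OF f]])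
  have fq: "mplot (mdim N) ?S N' (\<lambda>z. f (chart_inv c z))"
    by (rule mplot_compose_smooth[OF N q f]) auto
  have "mplot k ?V (tangent_bundle N') (\<lambda>y. (f (chart_inv c (snd c (p y))),
      pvel (mdim N) N' (\<lambda>z. f (chart_inv c z)) (snd c (p y)) (\<xi> y c)))"
    by (rule mplot_pvel[OF N' fq mplot_chart[OF pD(1) c(1)] _ pD(3)[OF c(1)]])
      (use pW N c in auto)
  then have "mplot k ?V (tangent_bundle N') (\<lambda>y. (f (p y), differential N N' f (p y) (\<xi> y)))"
  proof (rule mplot_cong)
    fix y assume y: "y \<in> ?V"
    then have "snd c (p y) \<in> ?S" "chart_inv c (snd c (p y)) \<in> W" using pW N c by auto
    from differential_pvel[OF N f q this, of "\<xi> y c"]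
    show "(f (chart_inv c (snd c (p y))), pvel (mdim N) N' (\<lambda>z. f (chart_inv c z)) (snd c (p y)) (\<xi> y c)) =
        (f (p y), differential N N' f (p y) (\<xi> y))"
      using tangent_as_pvel[OF N pD(2) c(1)] N c y by simp
  qed
  then show "\<exists>V. x \<in> V \<and> V \<subseteq> U \<and> mplot k V (tangent_bundle N') (\<lambda>y. (f (p y), differential N N' f (p y) (\<xi> y)))"
    using x c by (intro exI[of _ ?V]) simp
qed

lemma smooth_euc_add:
  assumes f: "smooth_euc k n U f" and g: "smooth_euc k n U g"
  shows "smooth_euc k n U (\<lambda>x. f x + g x)"
  using smooth_euc_in_topspace[OF f] smooth_euc_in_topspace[OF g]
  by (intro smooth_eucI[OF smooth_euc_open[OF f]])
    (auto simp: in_topspace_Euclidean intro!: smooth_fun_add smooth_euc_coord[OF f] smooth_euc_coord[OF g])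

lemma mplot_tangent_add:
  assumes N: "smooth_atlas N" and \<xi>: "mplot k U (tangent_bundle N) (\<lambda>y. (p y, \<xi> y))"
    and \<eta>: "mplot k U (tangent_bundle N) (\<lambda>y. (p y, \<eta> y))"
  shows "mplot k U (tangent_bundle N) (\<lambda>y. (p y, \<xi> y + \<eta> y))"
  using \<xi> \<eta> unfolding mplot_tangent_bundle_iff[OF N]
  by (auto intro: tangent_space_add smooth_euc_add)

lemma mplot_tangent_zero:
  fixes N :: "'a mfd"
  assumes N: "smooth_atlas N" and p: "mplot k U N p"
  shows "mplot k U (tangent_bundle N) (\<lambda>y. (p y, 0))"
  unfolding mplot_tangent_bundle_iff[OF N]
proof (intro conjI ballI p tangent_space_zero)
  fix c assume "c \<in> atlas N"
  then show "smooth_euc k (mdim N) {y \<in> U. p y \<in> fst c} (\<lambda>y. (0 :: 'a tvec) c)"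
    unfolding zero_fun_apply by (intro smooth_euc_const smooth_euc_open[OF mplot_chart[OF p]]) (simp_all add: in_topspace_Euclidean)
qed

lemma mplot_tangent_scale:
  assumes N: "smooth_atlas N" and \<xi>: "mplot k U (tangent_bundle N) (\<lambda>y. (p y, \<xi> y))"
    and r: "smooth_fun k U r"
  shows "mplot k U (tangent_bundle N) (\<lambda>y. (p y, tscale (r y) (\<xi> y)))"
  unfolding mplot_tangent_bundle_iff[OF N]
proof (intro conjI ballI)
  note D = mplot_tangent_bundleD[OF N \<xi>]
  show "mplot k U N p" by (rule D(1))
  show "tscale (r y) (\<xi> y) \<in> tangent_space N (p y)" if "y \<in> U" for y
    by (rule tangent_space_scale[OF D(2)[OF that]])
  fix c assume c: "c \<in> atlas N"
  note s = D(3)[OF c]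
  show "smooth_euc k (mdim N) {y \<in> U. p y \<in> fst c} (\<lambda>y. tscale (r y) (\<xi> y) c)"
  proof (rule smooth_eucI[OF smooth_euc_open[OF s]])
    show "tscale (r y) (\<xi> y) c \<in> topspace (Euclidean_space (mdim N))" if "y \<in> {y \<in> U. p y \<in> fst c}" for y
      using smooth_euc_in_topspace[OF s that] by (simp add: tscale_def in_topspace_Euclidean)
    show "smooth_fun k {y \<in> U. p y \<in> fst c} (\<lambda>y. tscale (r y) (\<xi> y) c j)" if "j < mdim N" for j
      unfolding tscale_def
      by (intro smooth_fun_mult smooth_euc_coord[OF s that] smooth_fun_subset[OF r smooth_euc_open[OF s]]) auto
  qed
qed

lemma mplot_tangent_sum:
  fixes r :: nat
  assumes N: "smooth_atlas N" and p: "mplot k U N p"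
    and \<xi>: "\<And>i. i < r \<Longrightarrow> mplot k U (tangent_bundle N) (\<lambda>y. (p y, \<xi> i y))"
  shows "mplot k U (tangent_bundle N) (\<lambda>y. (p y, \<Sum>i<r. \<xi> i y))"
  using \<xi>
proof (induction r)
  case 0
  show ?case unfolding lessThan_0 sum.empty by (rule mplot_tangent_zero[OF N p])
next
  case (Suc r)
  show ?case unfolding sum.lessThan_Suc
    by (rule mplot_tangent_add[OF N Suc.IH Suc.prems]) (use Suc.prems in auto)
qed

subsection \<open>Products of manifolds\<close>

definition prod_chart :: "nat \<Rightarrow> 'a chart \<Rightarrow> 'b chart \<Rightarrow> ('a \<times> 'b) chart" where
  "prod_chart n c c' = (fst c \<times> fst c', \<lambda>(x, y). concat_euc n (snd c x) (snd c' y))"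

lemma atlas_prod_mfd:
  "C \<in> atlas (prod_mfd N N') \<longleftrightarrow> (\<exists>c c'. C = prod_chart (mdim N) c c' \<and> c \<in> atlas N \<and> c' \<in> atlas N')"
  by (auto simp: prod_mfd_def prod_chart_def)

lemma prod_chart_in_atlas:
  "c \<in> atlas N \<Longrightarrow> c' \<in> atlas N' \<Longrightarrow> prod_chart (mdim N) c c' \<in> atlas (prod_mfd N N')"
  unfolding atlas_prod_mfd by (rule exI[of _ c], rule exI[of _ c']) simp

lemma mdim_prod [simp]: "mdim (prod_mfd N N') = mdim N + mdim N'"
  and mcarrier_prod [simp]: "mcarrier (prod_mfd N N') = mcarrier N \<times> mcarrier N'"
  by (simp_all add: prod_mfd_def)

lemma fst_prod_chart [simp]: "fst (prod_chart n c c') = fst c \<times> fst c'"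
  and snd_prod_chart [simp]: "snd (prod_chart n c c') (x, y) = concat_euc n (snd c x) (snd c' y)"
  by (simp_all add: prod_chart_def)

lemma mplot_Pair:
  assumes p: "mplot k U N p" and q: "mplot k U N' q"
  shows "mplot k U (prod_mfd N N') (\<lambda>x. (p x, q x))"
  unfolding mplot_def
proof (intro conjI ballI mplot_open[OF p])
  show "(\<lambda>x. (p x, q x)) ` U \<subseteq> mcarrier (prod_mfd N N')"
    using mplot_in[OF p] mplot_in[OF q] by auto
  fix C assume "C \<in> atlas (prod_mfd N N')"
  then obtain c c' where C: "C = prod_chart (mdim N) c c'" and c: "c \<in> atlas N" and c': "c' \<in> atlas N'"
    unfolding atlas_prod_mfd by (elim exE conjE)
  let ?V = "{x \<in> U. (p x, q x) \<in> fst C}"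
  have "?V = {x \<in> U. p x \<in> fst c} \<inter> {x \<in> U. q x \<in> fst c'}" by (auto simp: C)
  then have V: "openin (Euclidean_space k) ?V"
    using openin_Int[OF smooth_euc_open[OF mplot_chart[OF p c]] smooth_euc_open[OF mplot_chart[OF q c']]] by simp
  have "smooth_euc k (mdim N) ?V (\<lambda>x. snd c (p x))"
    by (rule smooth_euc_subset[OF mplot_chart[OF p c] V]) (auto simp: C)
  moreover have "smooth_euc k (mdim N') ?V (\<lambda>x. snd c' (q x))"
    by (rule smooth_euc_subset[OF mplot_chart[OF q c'] V]) (auto simp: C)
  ultimately show "smooth_euc k (mdim (prod_mfd N N')) ?V (\<lambda>x. snd C (p x, q x))"
    by (simp add: C smooth_euc_concat)
qed

lemma prod_chart_image:
  assumes N: "smooth_atlas N" and N': "smooth_atlas N'" and c: "c \<in> atlas N" and c': "c' \<in> atlas N'"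
  defines "I \<equiv> snd (prod_chart (mdim N) c c') ` (fst c \<times> fst c')"
  shows "I = {z \<in> topspace (Euclidean_space (mdim N + mdim N')).
      fst_euc (mdim N) z \<in> snd c ` fst c \<and> snd_euc (mdim N) z \<in> snd c' ` fst c'}"
    and "inj_on (snd (prod_chart (mdim N) c c')) (fst c \<times> fst c')"
    and "openin (Euclidean_space (mdim N + mdim N')) I"
    and "z \<in> I \<Longrightarrow> chart_inv (prod_chart (mdim N) c c') z =
      (chart_inv c (fst_euc (mdim N) z), chart_inv c' (snd_euc (mdim N) z))"
proof -
  let ?n = "mdim N" let ?m = "mdim N'" let ?C = "prod_chart (mdim N) c c'"
  have E: "snd c x \<in> topspace (Euclidean_space ?n)" if "x \<in> fst c" for x
    by (rule chart_in_topspace[OF N c that])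
  have E': "snd c' x \<in> topspace (Euclidean_space ?m)" if "x \<in> fst c'" for x
    by (rule chart_in_topspace[OF N' c' that])
  show I: "I = {z \<in> topspace (Euclidean_space (?n + ?m)). fst_euc ?n z \<in> snd c ` fst c \<and> snd_euc ?n z \<in> snd c' ` fst c'}"
  proof (intro Set.set_eqI iffI)
    fix z assume "z \<in> I"
    then obtain x y where "x \<in> fst c" "y \<in> fst c'" "z = concat_euc ?n (snd c x) (snd c' y)"
      by (auto simp: I_def)
    then show "z \<in> {z \<in> topspace (Euclidean_space (?n + ?m)). fst_euc ?n z \<in> snd c ` fst c \<and> snd_euc ?n z \<in> snd c' ` fst c'}"
      using E E' by (auto simp: fst_euc_concat snd_euc_concat concat_euc_in_topspace)
  next
    fix z assume "z \<in> {z \<in> topspace (Euclidean_space (?n + ?m)). fst_euc ?n z \<in> snd c ` fst c \<and> snd_euc ?n z \<in> snd c' ` fst c'}"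
    then obtain x y where "x \<in> fst c" "y \<in> fst c'" "fst_euc ?n z = snd c x" "snd_euc ?n z = snd c' y" by auto
    then have "z = snd ?C (x, y)" "(x, y) \<in> fst c \<times> fst c'"
      using concat_fst_snd[of ?n z] by auto
    then show "z \<in> I" unfolding I_def by blast
  qed
  show inj: "inj_on (snd ?C) (fst c \<times> fst c')"
  proof (rule inj_onI)
    fix a b assume ab: "a \<in> fst c \<times> fst c'" "b \<in> fst c \<times> fst c'" "snd ?C a = snd ?C b"
    obtain x y x' y' where xy: "a = (x, y)" "b = (x', y')" by (cases a, cases b)
    have eq: "concat_euc ?n (snd c x) (snd c' y) = concat_euc ?n (snd c x') (snd c' y')" using ab xy by simp
    have "snd c x = snd c x'"
      using arg_cong[OF eq, of "fst_euc ?n"] ab(1,2) xy E by (simp add: fst_euc_concat)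
    moreover have "snd c' y = snd c' y'"
      using arg_cong[OF eq, of "snd_euc ?n"] by (simp add: snd_euc_concat)
    ultimately show "a = b"
      using ab xy chart_inj[OF N c] chart_inj[OF N' c'] by (auto dest: inj_onD)
  qed
  have o: "openin (Euclidean_space (?n + ?m)) (topspace (Euclidean_space (?n + ?m)))" by simp
  have "I = {z \<in> topspace (Euclidean_space (?n + ?m)). fst_euc ?n z \<in> snd c ` fst c} \<inter>
      {z \<in> topspace (Euclidean_space (?n + ?m)). snd_euc ?n z \<in> snd c' ` fst c'}"
    unfolding I by auto
  then show "openin (Euclidean_space (?n + ?m)) I"
    using openin_Int[OF smooth_euc_preimage_open[OF smooth_euc_fst_euc[OF o] chart_open[OF N c]]
        smooth_euc_preimage_open[OF smooth_euc_snd_euc[OF o] chart_open[OF N' c']]] by simp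
  assume "z \<in> I"
  then obtain x y where xy: "x \<in> fst c" "y \<in> fst c'" "z = snd ?C (x, y)" by (auto simp: I_def)
  have "chart_inv ?C z = (x, y)"
    unfolding chart_inv_def xy(3) using xy inj by (intro the_inv_into_f_f) auto
  then show "chart_inv ?C z = (chart_inv c (fst_euc ?n z), chart_inv c' (snd_euc ?n z))"
    using xy N N' c c' E by (simp add: fst_euc_concat snd_euc_concat)
qed

lemma mplot_prod_chart_components:
  assumes N: "smooth_atlas N" and N': "smooth_atlas N'" and c: "c \<in> atlas N" and c': "c' \<in> atlas N'"
  defines "I \<equiv> snd (prod_chart (mdim N) c c') ` (fst c \<times> fst c')"
  shows "mplot (mdim N + mdim N') I N (\<lambda>z. chart_inv c (fst_euc (mdim N) z))"
    and "mplot (mdim N + mdim N') I N' (\<lambda>z. chart_inv c' (snd_euc (mdim N) z))"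
proof -
  note I = prod_chart_image[OF N N' c c', folded I_def]
  show "mplot (mdim N + mdim N') I N (\<lambda>z. chart_inv c (fst_euc (mdim N) z))"
    by (rule mplot_compose_euc[OF mplot_chart_inv[OF N c] smooth_euc_fst_euc[OF I(3)]]) (auto simp: I(1))
  show "mplot (mdim N + mdim N') I N' (\<lambda>z. chart_inv c' (snd_euc (mdim N) z))"
    by (rule mplot_compose_euc[OF mplot_chart_inv[OF N' c'] smooth_euc_snd_euc[OF I(3)]]) (auto simp: I(1))
qed

lemma mplot_prod_chart_inv:
  assumes N: "smooth_atlas N" and N': "smooth_atlas N'" and c: "c \<in> atlas N" and c': "c' \<in> atlas N'"
  shows "mplot (mdim N + mdim N') (snd (prod_chart (mdim N) c c') ` (fst c \<times> fst c')) (prod_mfd N N')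
     (chart_inv (prod_chart (mdim N) c c'))"
  by (rule mplot_cong[OF mplot_Pair[OF mplot_prod_chart_components[OF N N' c c']]])
    (simp add: prod_chart_image(4)[OF N N' c c'])

lemma smooth_atlas_prod:
  assumes N: "smooth_atlas N" and N': "smooth_atlas N'"
  shows "smooth_atlas (prod_mfd N N')"
  unfolding smooth_atlas_def
proof (intro conjI ballI)
  show "\<Union>(fst ` atlas (prod_mfd N N')) = mcarrier (prod_mfd N N')"
  proof (intro equalityI subsetI)
    fix z assume "z \<in> \<Union>(fst ` atlas (prod_mfd N N'))"
    then obtain C where C: "C \<in> atlas (prod_mfd N N')" "z \<in> fst C" by blast
    then obtain c c' where "C = prod_chart (mdim N) c c'" "c \<in> atlas N" "c' \<in> atlas N'"
      unfolding atlas_prod_mfd by (elim exE conjE)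
    then show "z \<in> mcarrier (prod_mfd N N')"
      using C(2) chart_subset[OF N, of c] chart_subset[OF N', of c'] by auto
  next
    fix z assume "z \<in> mcarrier (prod_mfd N N')"
    then have z: "fst z \<in> mcarrier N" "snd z \<in> mcarrier N'" by auto
    obtain c where c: "c \<in> atlas N" "fst z \<in> fst c" using chart_ex[OF N z(1)] .
    obtain c' where c': "c' \<in> atlas N'" "snd z \<in> fst c'" using chart_ex[OF N' z(2)] .
    show "z \<in> \<Union>(fst ` atlas (prod_mfd N N'))"
      by (rule UN_I[OF prod_chart_in_atlas[OF c(1) c'(1)]]) (use c c' in \<open>simp add: mem_Times_iff\<close>)
  qed
next
  fix C assume "C \<in> atlas (prod_mfd N N')"
  then obtain c c' where C: "C = prod_chart (mdim N) c c'" and c: "c \<in> atlas N" and c': "c' \<in> atlas N'"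
    unfolding atlas_prod_mfd by (elim exE conjE)
  show "inj_on (snd C) (fst C)" unfolding C fst_prod_chart by (rule prod_chart_image(2)[OF N N' c c'])
  show "openin (Euclidean_space (mdim (prod_mfd N N'))) (snd C ` fst C)"
    unfolding C fst_prod_chart mdim_prod by (rule prod_chart_image(3)[OF N N' c c'])
  fix C' assume C': "C' \<in> atlas (prod_mfd N N')"
  have inv: "chart_inv C (snd C x) = x" if "x \<in> fst C" for x
    unfolding chart_inv_def C
    by (rule the_inv_into_f_f) (use that prod_chart_image(2)[OF N N' c c'] in \<open>simp_all add: C\<close>)
  have eq: "snd C ` (fst C \<inter> fst C') = {z \<in> snd C ` fst C. chart_inv C z \<in> fst C'}"
    using inv by force
  show "smooth_euc (mdim (prod_mfd N N')) (mdim (prod_mfd N N')) (snd C ` (fst C \<inter> fst C')) (coord_rep C C' (\<lambda>x. x))"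
    using mplot_chart[OF mplot_prod_chart_inv[OF N N' c c'] C'] unfolding eq
    by (simp add: C coord_rep_def comp_def)
qed

lemma
  assumes N: "smooth_atlas N" and N': "smooth_atlas N'"
  shows smooth_map_fst: "smooth_map (prod_mfd N N') N fst"
    and smooth_map_snd: "smooth_map (prod_mfd N N') N' snd"
proof -
  note P = smooth_atlas_prod[OF N N']
  have *: "mplot (mdim (prod_mfd N N')) (snd C ` (mcarrier (prod_mfd N N') \<inter> fst C)) N (\<lambda>z. fst (chart_inv C z)) \<and>
     mplot (mdim (prod_mfd N N')) (snd C ` (mcarrier (prod_mfd N N') \<inter> fst C)) N' (\<lambda>z. snd (chart_inv C z))"
    if C: "C \<in> atlas (prod_mfd N N')" for C
  proof -
    obtain c c' where C': "C = prod_chart (mdim N) c c'" and c: "c \<in> atlas N" and c': "c' \<in> atlas N'"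
      using C unfolding atlas_prod_mfd by (elim exE conjE)
    have "mcarrier (prod_mfd N N') \<inter> fst C = fst c \<times> fst c'"
      using chart_subset[OF P C] by (auto simp: C')
    then show ?thesis
      using mplot_cong[OF mplot_prod_chart_components(1)[OF N N' c c'], of "\<lambda>z. fst (chart_inv C z)"]
        mplot_cong[OF mplot_prod_chart_components(2)[OF N N' c c'], of "\<lambda>z. snd (chart_inv C z)"]
        prod_chart_image(4)[OF N N' c c'] by (simp add: C')
  qed
  show "smooth_map (prod_mfd N N') N fst"
    by (rule smooth_map_onI[OF P openin_mtop_mcarrier[OF P] *[THEN conjunct1]])
  show "smooth_map (prod_mfd N N') N' snd"
    by (rule smooth_map_onI[OF P openin_mtop_mcarrier[OF P] *[THEN conjunct2]])
qed

subsection \<open>Tangent vectors of products\<close>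

lemma pvel_chart_inv_chart:
  assumes N: "smooth_atlas N" and c: "c \<in> atlas N" "x \<in> fst c" and w: "w \<in> topspace (Euclidean_space (mdim N))"
  shows "pvel (mdim N) N (chart_inv c) (snd c x) w c = w"
proof -
  have "jacobian_apply (mdim N) (mdim N) (\<lambda>y. snd c (chart_inv c y)) (snd c x) w = jacobian_apply (mdim N) (mdim N) (\<lambda>y. y) (snd c x) w"
    by (rule jacobian_apply_cong[OF chart_open[OF N c(1)]]) (use N c in auto)
  then show ?thesis using N c jacobian_apply_id[OF w] by (simp add: pvel_def charts_at_iff)
qed

text \<open>The projections of the inverse product chart are the inverse charts of the factors.\<close>

lemma differential_fst_snd_pvel:
  assumes N: "smooth_atlas N" and N': "smooth_atlas N'" and c: "c \<in> atlas N" "x \<in> fst c"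
    and c': "c' \<in> atlas N'" "y \<in> fst c'" and w: "w \<in> topspace (Euclidean_space (mdim N + mdim N'))"
  defines "\<zeta> \<equiv> pvel (mdim N + mdim N') (prod_mfd N N') (chart_inv (prod_chart (mdim N) c c'))
      (concat_euc (mdim N) (snd c x) (snd c' y)) w"
  shows "differential (prod_mfd N N') N fst (x, y) \<zeta> = pvel (mdim N) N (chart_inv c) (snd c x) (fst_euc (mdim N) w)"
    and "differential (prod_mfd N N') N' snd (x, y) \<zeta> = pvel (mdim N') N' (chart_inv c') (snd c' y) (snd_euc (mdim N) w)"
    and "\<zeta> \<in> tangent_space (prod_mfd N N') (x, y)"
proof -
  let ?C = "prod_chart (mdim N) c c'" let ?z = "concat_euc (mdim N) (snd c x) (snd c' y)"
  let ?P = "prod_mfd N N'" let ?k = "mdim N + mdim N'"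
  define I where "I = snd ?C ` (fst c \<times> fst c')"
  note P = smooth_atlas_prod[OF N N']
  note Q = mplot_prod_chart_inv[OF N N' c(1) c'(1), folded I_def]
  note I = prod_chart_image[OF N N' c(1) c'(1), folded I_def]
  have E: "snd c x \<in> topspace (Euclidean_space (mdim N))" by (rule chart_in_topspace[OF N c])
  have z: "?z \<in> I" unfolding I_def using c c' by (intro image_eqI[of _ _ "(x, y)"]) auto
  have inv: "chart_inv ?C ?z = (x, y)"
    using I(4)[OF z] E N N' c c' by (simp add: fst_euc_concat snd_euc_concat)
  show "\<zeta> \<in> tangent_space ?P (x, y)"
    using pvel_in_tangent_space[OF P Q z] by (simp add: inv \<zeta>_def)
  have f: "fst_euc (mdim N) ` I \<subseteq> snd c ` fst c" "snd_euc (mdim N) ` I \<subseteq> snd c' ` fst c'"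
    using I(1) by auto
  have "differential ?P N fst (chart_inv ?C ?z) \<zeta> = pvel ?k N (\<lambda>z. fst (chart_inv ?C z)) ?z w"
    unfolding \<zeta>_def by (rule differential_pvel[OF P smooth_map_fst[OF N N'] Q z mplot_in[OF Q z]])
  also have "\<dots> = pvel ?k N (\<lambda>z. chart_inv c (fst_euc (mdim N) z)) ?z w"
    by (rule pvel_cong[OF I(3) z]) (simp add: I(4))
  also have "\<dots> = pvel (mdim N) N (chart_inv c) (fst_euc (mdim N) ?z) (jacobian_apply ?k (mdim N) (fst_euc (mdim N)) ?z w)"
    by (rule pvel_compose_euc[OF mplot_chart_inv[OF N c(1)] smooth_euc_fst_euc[OF I(3)] f(1) z, symmetric])
  finally show "differential ?P N fst (x, y) \<zeta> = pvel (mdim N) N (chart_inv c) (snd c x) (fst_euc (mdim N) w)"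
    using E by (simp add: inv jacobian_fst_euc fst_euc_concat)
  have "differential ?P N' snd (chart_inv ?C ?z) \<zeta> = pvel ?k N' (\<lambda>z. snd (chart_inv ?C z)) ?z w"
    unfolding \<zeta>_def by (rule differential_pvel[OF P smooth_map_snd[OF N N'] Q z mplot_in[OF Q z]])
  also have "\<dots> = pvel ?k N' (\<lambda>z. chart_inv c' (snd_euc (mdim N) z)) ?z w"
    by (rule pvel_cong[OF I(3) z]) (simp add: I(4))
  also have "\<dots> = pvel (mdim N') N' (chart_inv c') (snd_euc (mdim N) ?z) (jacobian_apply ?k (mdim N') (snd_euc (mdim N)) ?z w)"
    by (rule pvel_compose_euc[OF mplot_chart_inv[OF N' c'(1)] smooth_euc_snd_euc[OF I(3)] f(2) z, symmetric])
  finally show "differential ?P N' snd (x, y) \<zeta> = pvel (mdim N') N' (chart_inv c') (snd c' y) (snd_euc (mdim N) w)"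
    by (simp add: inv jacobian_snd_euc[OF w] snd_euc_concat)
qed

text \<open>
  A tangent vector of a product is thus determined by its two projections, which is the uniqueness
  behind the definite description in \<open>tangent_pair\<close>.
\<close>

lemma tangent_prod_components:
  assumes N: "smooth_atlas N" and N': "smooth_atlas N'" and c: "c \<in> atlas N" "x \<in> fst c"
    and c': "c' \<in> atlas N'" "y \<in> fst c'" and \<zeta>: "\<zeta> \<in> tangent_space (prod_mfd N N') (x, y)"
  shows "\<zeta> (prod_chart (mdim N) c c') =
    concat_euc (mdim N) (differential (prod_mfd N N') N fst (x, y) \<zeta> c) (differential (prod_mfd N N') N' snd (x, y) \<zeta> c')"
proof -
  let ?C = "prod_chart (mdim N) c c'"
  define w where "w = \<zeta> ?C"
  have w: "w \<in> topspace (Euclidean_space (mdim N + mdim N'))"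
    using tangent_in_topspace[OF \<zeta>, of ?C] by (simp add: w_def)
  have C: "?C \<in> atlas (prod_mfd N N')" "(x, y) \<in> fst ?C"
    using c c' by (auto intro: prod_chart_in_atlas)
  have "\<zeta> = pvel (mdim N + mdim N') (prod_mfd N N') (chart_inv ?C) (concat_euc (mdim N) (snd c x) (snd c' y)) w"
    using tangent_as_pvel[OF smooth_atlas_prod[OF N N'] \<zeta> C] by (simp add: w_def)
  note d = differential_fst_snd_pvel(1,2)[OF N N' c c' w, folded this]
  have "differential (prod_mfd N N') N fst (x, y) \<zeta> c = fst_euc (mdim N) w"
    unfolding d(1) by (rule pvel_chart_inv_chart[OF N c]) (simp add: fst_euc_def in_topspace_Euclidean)
  moreover have "differential (prod_mfd N N') N' snd (x, y) \<zeta> c' = snd_euc (mdim N) w"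
    unfolding d(2) by (rule pvel_chart_inv_chart[OF N' c']) (use w in \<open>simp add: snd_euc_def in_topspace_Euclidean\<close>)
  ultimately show ?thesis by (simp add: concat_fst_snd w_def)
qed

lemma tangent_pair_unique:
  assumes N: "smooth_atlas N" and N': "smooth_atlas N'" and x: "x \<in> mcarrier N" and y: "y \<in> mcarrier N'"
    and \<zeta>: "\<zeta> \<in> tangent_space (prod_mfd N N') (x, y)"
    and u: "differential (prod_mfd N N') N fst (x, y) \<zeta> = u"
    and \<beta>: "differential (prod_mfd N N') N' snd (x, y) \<zeta> = \<beta>"
  shows "tangent_pair N N' x y u \<beta> = \<zeta>"
  unfolding tangent_pair_def
proof (rule the_equality)
  fix \<zeta>' assume a: "\<zeta>' \<in> tangent_space (prod_mfd N N') (x, y) \<and>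
      differential (prod_mfd N N') N fst (x, y) \<zeta>' = u \<and> differential (prod_mfd N N') N' snd (x, y) \<zeta>' = \<beta>"
  obtain c where c: "c \<in> atlas N" "x \<in> fst c" using chart_ex[OF N x] .
  obtain c' where c': "c' \<in> atlas N'" "y \<in> fst c'" using chart_ex[OF N' y] .
  show "\<zeta>' = \<zeta>"
  proof (rule tangent_eqI[OF smooth_atlas_prod[OF N N'] _ \<zeta> prod_chart_in_atlas[OF c(1) c'(1)]])
    show "\<zeta>' (prod_chart (mdim N) c c') = \<zeta> (prod_chart (mdim N) c c')"
      using tangent_prod_components[OF N N' c c' \<zeta>] tangent_prod_components[OF N N' c c', of \<zeta>'] a u \<beta> by simp
  qed (use a c c' in auto)
qed (use \<zeta> u \<beta> in simp)

lemma
  assumes N: "smooth_atlas N" and N': "smooth_atlas N'" and x: "x \<in> mcarrier N" and y: "y \<in> mcarrier N'"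
    and u: "u \<in> tangent_space N x" and \<beta>: "\<beta> \<in> tangent_space N' y"
  shows tangent_pair_in: "tangent_pair N N' x y u \<beta> \<in> tangent_space (prod_mfd N N') (x, y)"
    and differential_fst_tangent_pair: "differential (prod_mfd N N') N fst (x, y) (tangent_pair N N' x y u \<beta>) = u"
    and differential_snd_tangent_pair: "differential (prod_mfd N N') N' snd (x, y) (tangent_pair N N' x y u \<beta>) = \<beta>"
proof -
  obtain c where c: "c \<in> atlas N" "x \<in> fst c" using chart_ex[OF N x] .
  obtain c' where c': "c' \<in> atlas N'" "y \<in> fst c'" using chart_ex[OF N' y] .
  let ?w = "concat_euc (mdim N) (u c) (\<beta> c')"
  let ?\<zeta> = "pvel (mdim N + mdim N') (prod_mfd N N') (chart_inv (prod_chart (mdim N) c c'))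
      (concat_euc (mdim N) (snd c x) (snd c' y)) ?w"
  have w: "?w \<in> topspace (Euclidean_space (mdim N + mdim N'))"
    by (rule concat_euc_in_topspace[OF tangent_in_topspace[OF \<beta>]])
  note d = differential_fst_snd_pvel[OF N N' c c' w]
  have 1: "differential (prod_mfd N N') N fst (x, y) ?\<zeta> = u"
    unfolding d(1) fst_euc_concat[OF tangent_in_topspace[OF u]] by (rule tangent_as_pvel[OF N u c])
  have 2: "differential (prod_mfd N N') N' snd (x, y) ?\<zeta> = \<beta>"
    unfolding d(2) snd_euc_concat by (rule tangent_as_pvel[OF N' \<beta> c'])
  have eq: "tangent_pair N N' x y u \<beta> = ?\<zeta>"
    by (rule tangent_pair_unique[OF N N' x y d(3) 1 2])
  show "tangent_pair N N' x y u \<beta> \<in> tangent_space (prod_mfd N N') (x, y)"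
    "differential (prod_mfd N N') N fst (x, y) (tangent_pair N N' x y u \<beta>) = u"
    "differential (prod_mfd N N') N' snd (x, y) (tangent_pair N N' x y u \<beta>) = \<beta>"
    unfolding eq by (rule d(3), rule 1, rule 2)
qed

lemma tangent_pair_add:
  assumes N: "smooth_atlas N" and N': "smooth_atlas N'" and x: "x \<in> mcarrier N" and y: "y \<in> mcarrier N'"
    and u: "u \<in> tangent_space N x" "u' \<in> tangent_space N x"
    and \<beta>: "\<beta> \<in> tangent_space N' y" "\<beta>' \<in> tangent_space N' y"
  shows "tangent_pair N N' x y (u + u') (\<beta> + \<beta>') = tangent_pair N N' x y u \<beta> + tangent_pair N N' x y u' \<beta>'"
proof (rule tangent_pair_unique[OF N N' x y])
  show "tangent_pair N N' x y u \<beta> + tangent_pair N N' x y u' \<beta>' \<in> tangent_space (prod_mfd N N') (x, y)"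
    by (intro tangent_space_add tangent_pair_in[OF N N' x y] u \<beta>)
qed (simp_all only: differential_add differential_fst_tangent_pair[OF N N' x y u(1) \<beta>(1)]
    differential_fst_tangent_pair[OF N N' x y u(2) \<beta>(2)] differential_snd_tangent_pair[OF N N' x y u(1) \<beta>(1)]
    differential_snd_tangent_pair[OF N N' x y u(2) \<beta>(2)])

lemma tangent_pair_scale:
  assumes N: "smooth_atlas N" and N': "smooth_atlas N'" and x: "x \<in> mcarrier N" and y: "y \<in> mcarrier N'"
    and u: "u \<in> tangent_space N x" and \<beta>: "\<beta> \<in> tangent_space N' y"
  shows "tangent_pair N N' x y (tscale r u) (tscale r \<beta>) = tscale r (tangent_pair N N' x y u \<beta>)"
proof (rule tangent_pair_unique[OF N N' x y])
  show "tscale r (tangent_pair N N' x y u \<beta>) \<in> tangent_space (prod_mfd N N') (x, y)"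
    by (intro tangent_space_scale tangent_pair_in[OF N N' x y] u \<beta>)
qed (simp_all only: differential_scale differential_fst_tangent_pair[OF N N' x y u \<beta>]
    differential_snd_tangent_pair[OF N N' x y u \<beta>])

lemma tangent_pair_pvel:
  assumes N: "smooth_atlas N" and N': "smooth_atlas N'" and p: "mplot k U N p" and q: "mplot k U N' q" and z: "z \<in> U"
  shows "tangent_pair N N' (p z) (q z) (pvel k N p z w) (pvel k N' q z w) = pvel k (prod_mfd N N') (\<lambda>z. (p z, q z)) z w"
proof -
  note P = smooth_atlas_prod[OF N N'] and pq = mplot_Pair[OF p q]
  show ?thesis
  proof (rule tangent_pair_unique[OF N N' mplot_in[OF p z] mplot_in[OF q z] pvel_in_tangent_space[OF P pq z]])
    show "differential (prod_mfd N N') N fst (p z, q z) (pvel k (prod_mfd N N') (\<lambda>z. (p z, q z)) z w) = pvel k N p z w"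
      using differential_pvel[OF P smooth_map_fst[OF N N'] pq z mplot_in[OF pq z], of w] by simp
    show "differential (prod_mfd N N') N' snd (p z, q z) (pvel k (prod_mfd N N') (\<lambda>z. (p z, q z)) z w) = pvel k N' q z w"
      using differential_pvel[OF P smooth_map_snd[OF N N'] pq z mplot_in[OF pq z], of w] by simp
  qed
qed

lemma mplot_tangent_pair:
  assumes N: "smooth_atlas N" and N': "smooth_atlas N'"
    and p: "mplot k U (tangent_bundle N) (\<lambda>y. (p y, \<xi> y))" and q: "mplot k U (tangent_bundle N') (\<lambda>y. (q y, \<eta> y))"
  shows "mplot k U (tangent_bundle (prod_mfd N N'))
     (\<lambda>y. ((p y, q y), tangent_pair N N' (p y) (q y) (\<xi> y) (\<eta> y)))"
proof (rule mplot_tangent_bundleI[OF smooth_atlas_prod[OF N N']])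
  note pD = mplot_tangent_bundleD[OF N p] and qD = mplot_tangent_bundleD[OF N' q]
  note in' = mplot_in[OF pD(1)] mplot_in[OF qD(1)]
  show pq: "mplot k U (prod_mfd N N') (\<lambda>y. (p y, q y))" by (rule mplot_Pair[OF pD(1) qD(1)])
  show "tangent_pair N N' (p y) (q y) (\<xi> y) (\<eta> y) \<in> tangent_space (prod_mfd N N') (p y, q y)" if "y \<in> U" for y
    by (rule tangent_pair_in[OF N N' in'[OF that] pD(2)[OF that] qD(2)[OF that]])
  fix x assume x: "x \<in> U"
  obtain c where c: "c \<in> atlas N" "p x \<in> fst c" using chart_ex[OF N in'(1)[OF x]] .
  obtain c' where c': "c' \<in> atlas N'" "q x \<in> fst c'" using chart_ex[OF N' in'(2)[OF x]] .
  let ?C = "prod_chart (mdim N) c c'" let ?V = "{y \<in> U. p y \<in> fst c} \<inter> {y \<in> U. q y \<in> fst c'}"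
  note 1 = pD(3)[OF c(1)] and 2 = qD(3)[OF c'(1)]
  have V: "openin (Euclidean_space k) ?V" by (rule openin_Int[OF smooth_euc_open[OF 1] smooth_euc_open[OF 2]])
  have "smooth_euc k (mdim N + mdim N') ?V (\<lambda>y. concat_euc (mdim N) (\<xi> y c) (\<eta> y c'))"
    by (rule smooth_euc_concat[OF smooth_euc_subset[OF 1 V] smooth_euc_subset[OF 2 V]]) auto
  then have "smooth_euc k (mdim (prod_mfd N N')) ?V (\<lambda>y. tangent_pair N N' (p y) (q y) (\<xi> y) (\<eta> y) ?C)"
    unfolding mdim_prod
  proof (rule smooth_euc_cong)
    fix y assume y: "y \<in> ?V"
    then have yU: "y \<in> U" and yc: "p y \<in> fst c" "q y \<in> fst c'" by auto
    note h = in'[OF yU] pD(2)[OF yU] qD(2)[OF yU]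
    show "concat_euc (mdim N) (\<xi> y c) (\<eta> y c') = tangent_pair N N' (p y) (q y) (\<xi> y) (\<eta> y) ?C"
      unfolding tangent_prod_components[OF N N' c(1) yc(1) c'(1) yc(2) tangent_pair_in[OF N N' h]]
        differential_fst_tangent_pair[OF N N' h] differential_snd_tangent_pair[OF N N' h] ..
  qed
  then show "\<exists>C V. C \<in> atlas (prod_mfd N N') \<and> x \<in> V \<and> V \<subseteq> U \<and> (\<forall>y\<in>V. (p y, q y) \<in> fst C) \<and>
      smooth_euc k (mdim (prod_mfd N N')) V (\<lambda>y. tangent_pair N N' (p y) (q y) (\<xi> y) (\<eta> y) C)"
    using x c c' prod_chart_in_atlas[OF c(1) c'(1)] by (intro exI[of _ ?C] exI[of _ ?V]) auto
qed

subsection \<open>Differentials of maps on fibre products\<close>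

lemma partial_diff:
  assumes "smooth_fun n U f" "smooth_fun n U g" "x \<in> U" "i < n"
  shows "partial i (\<lambda>x. f x - g x) x = partial i f x - partial i g x"
  by (rule partial_eqI[OF DERIV_diff[OF smooth_fun_has_partial[OF assms(1,3,4)] smooth_fun_has_partial[OF assms(2,3,4)]]])

lemma differential_zero: "differential N N' f x 0 = 0"
  using differential_scale[of N N' f x 0 0] by simp

text \<open>
  In coordinates the fibre product is the zero set of \<open>a - t\<close>, whose derivative is surjective because
  that of \<open>t\<close> is; so the general fact on zero sets applies to the difference of two extensions.
\<close>

lemma differential_extension_unique:
  fixes N1 :: "'a mfd" and N2 :: "'b mfd" and N0 :: "'c mfd" and N' :: "'d mfd"
  assumes N1: "smooth_atlas N1" and N2: "smooth_atlas N2" and N0: "smooth_atlas N0" and N': "smooth_atlas N'"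
    and a: "smooth_map N1 N0 a" and t: "smooth_map N2 N0 t"
    and A: "A = {(x, y). x \<in> mcarrier N1 \<and> y \<in> mcarrier N2 \<and> a x = t y}" and xy: "(x, y) \<in> A"
    and surj: "tangent_space N0 (t y) \<subseteq> differential N2 N0 t y ` tangent_space N2 y"
    and \<zeta>: "\<zeta> \<in> tangent_space (prod_mfd N1 N2) (x, y)"
    and ker: "differential N1 N0 a x (differential (prod_mfd N1 N2) N1 fst (x, y) \<zeta>) =
       differential N2 N0 t y (differential (prod_mfd N1 N2) N2 snd (x, y) \<zeta>)"
    and F1: "smooth_ext (prod_mfd N1 N2) A N' f W1 F1" "(x, y) \<in> W1"
    and F2: "smooth_ext (prod_mfd N1 N2) A N' f W2 F2" "(x, y) \<in> W2"
  shows "differential (prod_mfd N1 N2) N' F1 (x, y) \<zeta> = differential (prod_mfd N1 N2) N' F2 (x, y) \<zeta>"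
proof -
  let ?P = "prod_mfd N1 N2" let ?m = "mdim N1 + mdim N2" let ?n = "mdim N0"
  note P = smooth_atlas_prod[OF N1 N2]
  have x: "x \<in> mcarrier N1" and y: "y \<in> mcarrier N2" and axty: "a x = t y" using xy A by auto
  obtain c1 where c1: "c1 \<in> atlas N1" "x \<in> fst c1" using chart_ex[OF N1 x] .
  obtain c2 where c2: "c2 \<in> atlas N2" "y \<in> fst c2" using chart_ex[OF N2 y] .
  have "a x \<in> mcarrier N0" using a x by (auto simp: smooth_map_on_def)
  then obtain c0 where c0: "c0 \<in> atlas N0" "a x \<in> fst c0" using chart_ex[OF N0] by metis
  have F1s: "smooth_map_on ?P W1 N' F1" and F1f: "\<And>z. z \<in> A \<Longrightarrow> z \<in> W1 \<Longrightarrow> F1 z = f z"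
    using F1 by (auto simp: smooth_ext_def)
  have F2s: "smooth_map_on ?P W2 N' F2" and F2f: "\<And>z. z \<in> A \<Longrightarrow> z \<in> W2 \<Longrightarrow> F2 z = f z"
    using F2 by (auto simp: smooth_ext_def)
  have F12: "F1 (x, y) = F2 (x, y)" using F1f[OF xy F1(2)] F2f[OF xy F2(2)] by simp
  define C where "C = prod_chart (mdim N1) c1 c2"
  have C: "C \<in> atlas ?P" "(x, y) \<in> fst C" using c1 c2 by (auto simp: C_def intro: prod_chart_in_atlas)
  define Q where "Q = chart_inv C"
  define I where "I = snd C ` fst C"
  have Q: "mplot ?m I ?P Q" using mplot_chart_inv[OF P C(1)] by (simp add: Q_def I_def)
  define z0 where "z0 = snd C (x, y)"
  have z0: "z0 \<in> I" "Q z0 = (x, y)" using C P by (auto simp: z0_def I_def Q_def)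
  have Q1: "mplot ?m I N1 (\<lambda>z. fst (Q z))"
    by (rule mplot_compose_smooth[OF P Q smooth_map_fst[OF N1 N2]]) (rule image_subsetI[OF mplot_in[OF Q]])
  have Q2: "mplot ?m I N2 (\<lambda>z. snd (Q z))"
    by (rule mplot_compose_smooth[OF P Q smooth_map_snd[OF N1 N2]]) (rule image_subsetI[OF mplot_in[OF Q]])
  have aQ: "mplot ?m I N0 (\<lambda>z. a (fst (Q z)))"
    by (rule mplot_compose_smooth[OF N1 Q1 a]) (use mplot_in[OF Q1] in auto)
  have tQ: "mplot ?m I N0 (\<lambda>z. t (snd (Q z)))"
    by (rule mplot_compose_smooth[OF N2 Q2 t]) (use mplot_in[OF Q2] in auto)
  note W1 = mplot_preimage_open[OF P Q smooth_map_on_open[OF F1s]]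
  note W2 = mplot_preimage_open[OF P Q smooth_map_on_open[OF F2s]]
  have FQ1: "mplot ?m {z \<in> I. Q z \<in> W1} N' (\<lambda>z. F1 (Q z))"
    by (rule mplot_compose_smooth[OF P mplot_subset[OF Q W1] F1s]) auto
  have FQ2: "mplot ?m {z \<in> I. Q z \<in> W2} N' (\<lambda>z. F2 (Q z))"
    by (rule mplot_compose_smooth[OF P mplot_subset[OF Q W2] F2s]) auto
  have \<zeta>Q: "\<tau> = pvel ?m ?P Q z0 (\<tau> C)" if "\<tau> \<in> tangent_space ?P (x, y)" for \<tau>
    using tangent_as_pvel[OF P that C] by (simp add: Q_def z0_def)
  have d1: "differential ?P N1 fst (x, y) \<tau> = pvel ?m N1 (\<lambda>z. fst (Q z)) z0 (\<tau> C)"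
    and d2: "differential ?P N2 snd (x, y) \<tau> = pvel ?m N2 (\<lambda>z. snd (Q z)) z0 (\<tau> C)"
    if "\<tau> \<in> tangent_space ?P (x, y)" for \<tau>
    using differential_pvel[OF P smooth_map_fst[OF N1 N2] Q z0(1) mplot_in[OF Q z0(1)], of "\<tau> C"]
      differential_pvel[OF P smooth_map_snd[OF N1 N2] Q z0(1) mplot_in[OF Q z0(1)], of "\<tau> C"]
      \<zeta>Q[OF that] z0(2) by simp_all
  have dF1: "differential ?P N' F1 (x, y) \<zeta> = pvel ?m N' (\<lambda>z. F1 (Q z)) z0 (\<zeta> C)"
    using differential_pvel[OF P F1s Q z0(1), of "\<zeta> C"] F1(2) \<zeta>Q[OF \<zeta>] z0(2) by simp
  have dF2: "differential ?P N' F2 (x, y) \<zeta> = pvel ?m N' (\<lambda>z. F2 (Q z)) z0 (\<zeta> C)"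
    using differential_pvel[OF P F2s Q z0(1), of "\<zeta> C"] F2(2) \<zeta>Q[OF \<zeta>] z0(2) by simp
  define G where "G = (\<lambda>j z. snd c0 (a (fst (Q z))) j - snd c0 (t (snd (Q z))) j)"
  have "pvel ?m N' (\<lambda>z. F1 (Q z)) z0 (\<zeta> C) c' j = pvel ?m N' (\<lambda>z. F2 (Q z)) z0 (\<zeta> C) c' j" for c' j
  proof (cases "c' \<in> charts_at N' (F1 (x, y)) \<and> j < mdim N'")
    case False
    then show ?thesis using F12 z0(2) by (auto simp: pvel_def jacobian_apply_def)
  next
    case True
    then have c': "c' \<in> atlas N'" "F1 (x, y) \<in> fst c'" and j: "j < mdim N'" by (auto simp: charts_at_iff)
    note s1 = mplot_chart[OF aQ c0(1)] and s2 = mplot_chart[OF tQ c0(1)]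
      and s3 = mplot_chart[OF FQ1 c'(1)] and s4 = mplot_chart[OF FQ2 c'(1)]
    define U where "U = ({z \<in> I. a (fst (Q z)) \<in> fst c0} \<inter> {z \<in> I. t (snd (Q z)) \<in> fst c0}) \<inter>
        ({z \<in> {z \<in> I. Q z \<in> W1}. F1 (Q z) \<in> fst c'} \<inter> {z \<in> {z \<in> I. Q z \<in> W2}. F2 (Q z) \<in> fst c'})"
    have U: "openin (Euclidean_space ?m) U"
      unfolding U_def by (intro openin_Int smooth_euc_open[OF s1] smooth_euc_open[OF s2]
          smooth_euc_open[OF s3] smooth_euc_open[OF s4])
    have z0U: "z0 \<in> U" using z0 c0 c' F1 F2 F12 axty by (simp add: U_def)
    have s1': "smooth_euc ?m ?n U (\<lambda>z. snd c0 (a (fst (Q z))))"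
      by (rule smooth_euc_subset[OF s1 U]) (auto simp: U_def)
    have s2': "smooth_euc ?m ?n U (\<lambda>z. snd c0 (t (snd (Q z))))"
      by (rule smooth_euc_subset[OF s2 U]) (auto simp: U_def)
    have s3': "smooth_euc ?m (mdim N') U (\<lambda>z. snd c' (F1 (Q z)))"
      by (rule smooth_euc_subset[OF s3 U]) (auto simp: U_def)
    have s4': "smooth_euc ?m (mdim N') U (\<lambda>z. snd c' (F2 (Q z)))"
      by (rule smooth_euc_subset[OF s4 U]) (auto simp: U_def)
    have G: "smooth_fun ?m U (G k)" if "k < ?n" for k
      unfolding G_def by (rule smooth_fun_diff[OF smooth_euc_coord[OF s1' that] smooth_euc_coord[OF s2' that]])
    have dG: "(\<Sum>i<?m. partial i (G k) z0 * \<tau> C i) =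
        differential N1 N0 a x (differential ?P N1 fst (x, y) \<tau>) c0 k -
        differential N2 N0 t y (differential ?P N2 snd (x, y) \<tau>) c0 k"
      if k: "k < ?n" and \<tau>: "\<tau> \<in> tangent_space ?P (x, y)" for k \<tau>
    proof -
      have "partial i (G k) z0 = partial i (\<lambda>z. snd c0 (a (fst (Q z))) k) z0 - partial i (\<lambda>z. snd c0 (t (snd (Q z))) k) z0"
        if "i < ?m" for i
        unfolding G_def by (rule partial_diff[OF smooth_euc_coord[OF s1' k] smooth_euc_coord[OF s2' k] z0U that])
      then have "(\<Sum>i<?m. partial i (G k) z0 * \<tau> C i) =
          jacobian_apply ?m ?n (\<lambda>z. snd c0 (a (fst (Q z)))) z0 (\<tau> C) k -
          jacobian_apply ?m ?n (\<lambda>z. snd c0 (t (snd (Q z)))) z0 (\<tau> C) k"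
        using k by (simp add: jacobian_apply_def left_diff_distrib sum_subtractf)
      also have "\<dots> = pvel ?m N0 (\<lambda>z. a (fst (Q z))) z0 (\<tau> C) c0 k - pvel ?m N0 (\<lambda>z. t (snd (Q z))) z0 (\<tau> C) c0 k"
        using c0 z0 axty by (simp add: pvel_def charts_at_iff)
      also have "pvel ?m N0 (\<lambda>z. a (fst (Q z))) z0 (\<tau> C) = differential N1 N0 a x (differential ?P N1 fst (x, y) \<tau>)"
        using differential_pvel[OF N1 a Q1 z0(1) mplot_in[OF Q1 z0(1)], of "\<tau> C"] d1[OF \<tau>] z0(2) by simp
      also have "pvel ?m N0 (\<lambda>z. t (snd (Q z))) z0 (\<tau> C) = differential N2 N0 t y (differential ?P N2 snd (x, y) \<tau>)"
        using differential_pvel[OF N2 t Q2 z0(1) mplot_in[OF Q2 z0(1)], of "\<tau> C"] d2[OF \<tau>] z0(2) by simp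
      finally show ?thesis .
    qed
    define right where "right l \<tau> \<longleftrightarrow> \<tau> \<in> tangent_space ?P (x, y) \<and>
        (\<forall>k<?n. (\<Sum>i<?m. partial i (G k) z0 * \<tau> C i) = (if k = l then 1 else 0))" for l \<tau>
    have right: "right l (SOME \<tau>. right l \<tau>)" if l: "l < ?n" for l
    proof -
      \<comment> \<open>The sign is negative since \<open>G\<close> contains \<open>- t\<close>.\<close>
      have "(\<lambda>i. if i = l then - 1 else 0) \<in> topspace (Euclidean_space ?n)"
        using l by (simp add: in_topspace_Euclidean)
      then obtain \<eta> where \<eta>: "\<eta> \<in> tangent_space N0 (t y)" "\<eta> c0 = (\<lambda>i. if i = l then - 1 else 0)"
        using tangent_ex[OF N0 c0(1)] c0(2) axty by metis
      obtain \<beta> where \<beta>: "\<beta> \<in> tangent_space N2 y" "differential N2 N0 t y \<beta> = \<eta>" using surj \<eta>(1) by blast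
      note tp = tangent_pair_in[OF N1 N2 x y tangent_space_zero \<beta>(1)]
        differential_fst_tangent_pair[OF N1 N2 x y tangent_space_zero \<beta>(1)]
        differential_snd_tangent_pair[OF N1 N2 x y tangent_space_zero \<beta>(1)]
      have "right l (tangent_pair N1 N2 x y 0 \<beta>)"
        unfolding right_def
        by (intro conjI tp(1)) (simp add: dG[OF _ tp(1)] tp(2,3) differential_zero \<beta>(2) \<eta>(2))
      then show ?thesis by (rule someI[where P = "right l"])
    qed
    define T where "T l = (SOME \<tau>. right l \<tau>)" for l
    have T: "(\<Sum>i<?m. partial i (G k) z0 * T l C i) = (if k = l then 1 else 0)" if "l < ?n" "k < ?n" for l k
    proof -
      have "right l (T l)" using right[OF that(1)] by (simp only: T_def)
      then show ?thesis using that(2) unfolding right_def by simp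
    qed
    have \<zeta>E: "\<zeta> C \<in> topspace (Euclidean_space ?m)" using tangent_in_topspace[OF \<zeta>, of C] by simp
    have D: "smooth_fun ?m U (\<lambda>z. snd c' (F1 (Q z)) j - snd c' (F2 (Q z)) j)"
      by (rule smooth_fun_diff[OF smooth_euc_coord[OF s3' j] smooth_euc_coord[OF s4' j]])
    have "(\<Sum>i<?m. partial i (\<lambda>z. snd c' (F1 (Q z)) j - snd c' (F2 (Q z)) j) z0 * \<zeta> C i) = 0"
    proof (rule derivative_vanishes_on_kernel[OF U z0U G _ T \<zeta>E _ D])
      show "G k z0 = 0" for k by (simp add: G_def z0(2) axty)
      show "(\<Sum>i<?m. partial i (G k) z0 * \<zeta> C i) = 0" if "k < ?n" for k
        using dG[OF that \<zeta>] ker by simp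
      fix z assume z: "z \<in> U" and Gz: "\<And>k. k < ?n \<Longrightarrow> G k z = 0"
      have zI: "z \<in> I" and zc: "a (fst (Q z)) \<in> fst c0" "t (snd (Q z)) \<in> fst c0" and zW: "Q z \<in> W1" "Q z \<in> W2"
        using z by (auto simp: U_def)
      have "snd c0 (a (fst (Q z))) = snd c0 (t (snd (Q z)))"
      proof
        fix k
        show "snd c0 (a (fst (Q z))) k = snd c0 (t (snd (Q z))) k"
          using Gz[of k] chart_in_topspace[OF N0 c0(1) zc(1)] chart_in_topspace[OF N0 c0(1) zc(2)]
          by (cases "k < ?n") (auto simp: G_def in_topspace_Euclidean)
      qed
      then have "a (fst (Q z)) = t (snd (Q z))" by (rule inj_onD[OF chart_inj[OF N0 c0(1)] _ zc])
      then have "Q z \<in> A" using mplot_in[OF Q1 zI] mplot_in[OF Q2 zI] unfolding A by (simp add: case_prod_beta)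
      then show "snd c' (F1 (Q z)) j - snd c' (F2 (Q z)) j = 0" using F1f F2f zW by simp
    qed auto
    moreover have "partial i (\<lambda>z. snd c' (F1 (Q z)) j - snd c' (F2 (Q z)) j) z0 =
        partial i (\<lambda>z. snd c' (F1 (Q z)) j) z0 - partial i (\<lambda>z. snd c' (F2 (Q z)) j) z0" if "i < ?m" for i
      by (rule partial_diff[OF smooth_euc_coord[OF s3' j] smooth_euc_coord[OF s4' j] z0U that])
    ultimately have "jacobian_apply ?m (mdim N') (\<lambda>z. snd c' (F1 (Q z))) z0 (\<zeta> C) j =
        jacobian_apply ?m (mdim N') (\<lambda>z. snd c' (F2 (Q z))) z0 (\<zeta> C) j"
      using j by (simp add: jacobian_apply_def left_diff_distrib sum_subtractf)
    then show ?thesis using True F12 z0(2) by (simp add: pvel_def)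
  qed
  then show ?thesis unfolding dF1 dF2 by (intro ext)
qed

text \<open>
  Therefore the definite description in \<open>differential_subset\<close> may be evaluated with any local
  extension.
\<close>

lemma differential_subset_eq:
  fixes N1 :: "'a mfd" and N2 :: "'b mfd" and N0 :: "'c mfd" and N' :: "'d mfd"
  assumes N1: "smooth_atlas N1" and N2: "smooth_atlas N2" and N0: "smooth_atlas N0" and N': "smooth_atlas N'"
    and a: "smooth_map N1 N0 a" and t: "smooth_map N2 N0 t"
    and A: "A = {(x, y). x \<in> mcarrier N1 \<and> y \<in> mcarrier N2 \<and> a x = t y}" and xy: "(x, y) \<in> A"
    and surj: "tangent_space N0 (t y) \<subseteq> differential N2 N0 t y ` tangent_space N2 y"
    and u: "u \<in> tangent_space N1 x" and \<beta>: "\<beta> \<in> tangent_space N2 y"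
    and ker: "differential N1 N0 a x u = differential N2 N0 t y \<beta>"
    and F: "smooth_ext (prod_mfd N1 N2) A N' f W F" "(x, y) \<in> W"
  shows "differential_subset (prod_mfd N1 N2) A N' f (x, y) (tangent_pair N1 N2 x y u \<beta>) =
    differential (prod_mfd N1 N2) N' F (x, y) (tangent_pair N1 N2 x y u \<beta>)"
proof -
  have x: "x \<in> mcarrier N1" "y \<in> mcarrier N2" using xy A by auto
  note tp = tangent_pair_in[OF N1 N2 x u \<beta>] differential_fst_tangent_pair[OF N1 N2 x u \<beta>]
    differential_snd_tangent_pair[OF N1 N2 x u \<beta>]
  have k: "differential N1 N0 a x (differential (prod_mfd N1 N2) N1 fst (x, y) (tangent_pair N1 N2 x y u \<beta>)) =
      differential N2 N0 t y (differential (prod_mfd N1 N2) N2 snd (x, y) (tangent_pair N1 N2 x y u \<beta>))"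
    unfolding tp by (rule ker)
  show ?thesis
    unfolding differential_subset_def
  proof (rule the_equality)
    show "\<exists>W F'. (x, y) \<in> W \<and> smooth_ext (prod_mfd N1 N2) A N' f W F' \<and>
        differential (prod_mfd N1 N2) N' F (x, y) (tangent_pair N1 N2 x y u \<beta>) =
        differential (prod_mfd N1 N2) N' F' (x, y) (tangent_pair N1 N2 x y u \<beta>)"
      using F by blast
    fix \<eta> assume "\<exists>W F. (x, y) \<in> W \<and> smooth_ext (prod_mfd N1 N2) A N' f W F \<and>
        \<eta> = differential (prod_mfd N1 N2) N' F (x, y) (tangent_pair N1 N2 x y u \<beta>)"
    then obtain W' F' where F': "(x, y) \<in> W'" "smooth_ext (prod_mfd N1 N2) A N' f W' F'"
      and \<eta>: "\<eta> = differential (prod_mfd N1 N2) N' F' (x, y) (tangent_pair N1 N2 x y u \<beta>)"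
      by (elim exE conjE)
    show "\<eta> = differential (prod_mfd N1 N2) N' F (x, y) (tangent_pair N1 N2 x y u \<beta>)"
      unfolding \<eta> by (rule differential_extension_unique[OF N1 N2 N0 N' a t A xy surj tp(1) k F'(2,1) F])
  qed
qed

subsection \<open>The chain rule for differentials\<close>

lemma chart_plot_in:
  assumes N: "smooth_atlas N" and c: "c \<in> atlas N" and W: "openin (mtop N) W"
  shows "mplot (mdim N) {z \<in> snd c ` fst c. chart_inv c z \<in> W} N (chart_inv c)"
  by (rule mplot_subset[OF mplot_chart_inv[OF N c] mplot_preimage_open[OF N mplot_chart_inv[OF N c] W]]) auto

text \<open>
  Both sides are velocities of composites of one inverse chart around \<open>x\<close>, and these composites agree
  near \<open>x\<close>.
\<close>

lemma differential_chain:
  assumes N: "smooth_atlas N" and N': "smooth_atlas N'"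
    and f: "smooth_map_on N W N' f" and g: "smooth_map_on N' W' N'' g" and h: "smooth_map_on N W'' N'' h"
    and x: "x \<in> W" "x \<in> W''" "f x \<in> W'"
    and eq: "\<And>y. y \<in> W \<Longrightarrow> y \<in> W'' \<Longrightarrow> f y \<in> W' \<Longrightarrow> g (f y) = h y"
    and \<xi>: "\<xi> \<in> tangent_space N x"
  shows "differential N' N'' g (f x) (differential N N' f x \<xi>) = differential N N'' h x \<xi>"
proof -
  have "x \<in> mcarrier N" using openin_mtop_subset[OF N smooth_map_on_open[OF f]] x(1) by blast
  then obtain c where c: "c \<in> atlas N" "x \<in> fst c" using chart_ex[OF N] by metis
  let ?n = "mdim N" and ?q = "chart_inv c" and ?z = "snd c x"
  have q: "?q ?z = x" using N c by simp
  define V where "V = {z \<in> snd c ` fst c. ?q z \<in> W}"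
  have V: "mplot ?n V N ?q" unfolding V_def by (rule chart_plot_in[OF N c(1) smooth_map_on_open[OF f]])
  have zV: "?z \<in> V" using c q x by (simp add: V_def)
  have fV: "mplot ?n V N' (\<lambda>z. f (?q z))"
    by (rule mplot_compose_smooth[OF N V f]) (auto simp: V_def)
  define V' where "V' = {z \<in> V. f (?q z) \<in> W'} \<inter> {z \<in> V. ?q z \<in> W''}"
  have oV': "openin (Euclidean_space ?n) V'"
    unfolding V'_def
    by (intro openin_Int mplot_preimage_open[OF N' fV smooth_map_on_open[OF g]]
        mplot_preimage_open[OF N V smooth_map_on_open[OF h]])
  have zV': "?z \<in> V'" using zV q x by (simp add: V'_def)
  have \<xi>': "\<xi> = pvel ?n N ?q ?z (\<xi> c)" by (rule tangent_as_pvel[OF N \<xi> c, symmetric])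
  have 1: "differential N N' f x \<xi> = pvel ?n N' (\<lambda>z. f (?q z)) ?z (\<xi> c)"
    using differential_pvel[OF N f V zV, of "\<xi> c"] x(1) \<xi>' q by simp
  have 2: "differential N N'' h x \<xi> = pvel ?n N'' (\<lambda>z. h (?q z)) ?z (\<xi> c)"
    using differential_pvel[OF N h V zV, of "\<xi> c"] x(2) \<xi>' q by simp
  have 3: "differential N' N'' g (f x) (pvel ?n N' (\<lambda>z. f (?q z)) ?z (\<xi> c)) = pvel ?n N'' (\<lambda>z. g (f (?q z))) ?z (\<xi> c)"
    using differential_pvel[OF N' g fV zV, of "\<xi> c"] x(3) q by simp
  show ?thesis
    unfolding 1 2 3
  proof (rule pvel_cong[OF oV' zV'])
    fix y assume "y \<in> V'"
    then show "g (f (?q y)) = h (?q y)" using eq[of "?q y"] by (simp add: V'_def V_def)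
  qed
qed

lemma smooth_map_id:
  assumes N: "smooth_atlas N"
  shows "smooth_map N N (\<lambda>x. x)"
proof (rule smooth_map_onI[OF N openin_mtop_mcarrier[OF N]])
  fix c assume c: "c \<in> atlas N"
  show "mplot (mdim N) (snd c ` (mcarrier N \<inter> fst c)) N (\<lambda>z. chart_inv c z)"
    using mplot_chart_inv[OF N c] chart_subset[OF N c] by (simp add: Int_absorb1)
qed

lemma differential_id:
  assumes N: "smooth_atlas N" and \<xi>: "\<xi> \<in> tangent_space N x" and x: "x \<in> mcarrier N"
  shows "differential N N (\<lambda>x. x) x \<xi> = \<xi>"
proof -
  obtain c where c: "c \<in> atlas N" "x \<in> fst c" using chart_ex[OF N x] .
  have z: "snd c x \<in> snd c ` fst c" using c by simp
  have "differential N N (\<lambda>x. x) (chart_inv c (snd c x)) (pvel (mdim N) N (chart_inv c) (snd c x) (\<xi> c)) =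
      pvel (mdim N) N (chart_inv c) (snd c x) (\<xi> c)"
    by (rule differential_pvel[OF N smooth_map_id[OF N] mplot_chart_inv[OF N c(1)] z])
      (use N c x in simp)
  then show ?thesis unfolding tangent_as_pvel[OF N \<xi> c] using N c by simp
qed

lemma differential_sum:
  "differential N N' f x (\<Sum>i<(r::nat). \<xi> i) = (\<Sum>i<r. differential N N' f x (\<xi> i))"
  by (induction r) (simp_all only: lessThan_0 sum.empty sum.lessThan_Suc differential_zero differential_add)

lemma sum_tvec_apply: "(\<Sum>i<(r::nat). \<xi> i) c j = (\<Sum>i<r. \<xi> i c j)" for \<xi> :: "nat \<Rightarrow> 'a tvec"
  by (induction r) simp_all

section \<open>Lie groupoids with a connection\<close>

lemma smooth_manifold_atlas: "smooth_manifold N \<Longrightarrow> smooth_atlas N"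
  by (simp add: smooth_manifold_def)

locale principal_bundle_with_connection =
  fixes X :: "('x, 'g) lgroupoid" and H :: "'g \<Rightarrow> 'g tvec set" and B :: "('x, 'g, 'p, 'm) pbundle"
  assumes groupoid: "lie_groupoid X" and connection: "ehresmann_connection X H" and principal: "principal_bundle X B"
begin

abbreviation "X0 \<equiv> lobj X"
abbreviation "X1 \<equiv> larr X"
abbreviation "P \<equiv> ptotal B"

lemma atlas_X0: "smooth_atlas X0" and atlas_X1: "smooth_atlas X1"
  using groupoid by (simp_all add: lie_groupoid_def smooth_manifold_atlas)

lemma atlas_P: "smooth_atlas P" and atlas_M: "smooth_atlas (pbase B)"
  using principal by (simp_all add: principal_bundle_def smooth_manifold_atlas)

lemma submersion_src: "submersion X1 X0 (lsrc X)" and submersion_tgt: "submersion X1 X0 (ltgt X)"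
  using groupoid by (simp_all add: lie_groupoid_def)

lemma smooth_src: "smooth_map X1 X0 (lsrc X)" and smooth_tgt: "smooth_map X1 X0 (ltgt X)"
  using submersion_src submersion_tgt by (simp_all add: submersion_def)

lemma smooth_unit: "smooth_map X0 X1 (lunit X)" and smooth_inv: "smooth_map X1 X1 (linv X)"
  using groupoid by (simp_all add: lie_groupoid_def)

lemma smooth_anchor: "smooth_map P X0 (panchor B)"
  using principal by (simp add: principal_bundle_def right_action_def)

lemma smooth_proj: "smooth_map P (pbase B) (pproj B)"
  using principal by (simp add: principal_bundle_def submersion_def)

lemma smooth_mapD: "smooth_map N N' f \<Longrightarrow> x \<in> mcarrier N \<Longrightarrow> f x \<in> mcarrier N'"
  by (auto simp: smooth_map_on_def)

lemmas src_in = smooth_mapD[OF smooth_src] and tgt_in = smooth_mapD[OF smooth_tgt]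
  and unit_in = smooth_mapD[OF smooth_unit] and inv_in = smooth_mapD[OF smooth_inv]
  and anchor_in = smooth_mapD[OF smooth_anchor] and proj_in = smooth_mapD[OF smooth_proj]

subsection \<open>Groupoid and action identities\<close>

lemma src_inv: "g \<in> mcarrier X1 \<Longrightarrow> lsrc X (linv X g) = ltgt X g"
  and tgt_inv: "g \<in> mcarrier X1 \<Longrightarrow> ltgt X (linv X g) = lsrc X g"
  and mul_inv: "g \<in> mcarrier X1 \<Longrightarrow> lmul X g (linv X g) = lunit X (ltgt X g)"
  and inv_mul: "g \<in> mcarrier X1 \<Longrightarrow> lmul X (linv X g) g = lunit X (lsrc X g)"
  and mul_unit: "g \<in> mcarrier X1 \<Longrightarrow> lmul X g (lunit X (lsrc X g)) = g"
  and unit_mul: "g \<in> mcarrier X1 \<Longrightarrow> lmul X (lunit X (ltgt X g)) g = g"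
  using groupoid unfolding lie_groupoid_def by simp_all

lemma src_unit: "x \<in> mcarrier X0 \<Longrightarrow> lsrc X (lunit X x) = x"
  and tgt_unit: "x \<in> mcarrier X0 \<Longrightarrow> ltgt X (lunit X x) = x"
  using groupoid unfolding lie_groupoid_def by simp_all

lemma composableI: "g \<in> mcarrier X1 \<Longrightarrow> h \<in> mcarrier X1 \<Longrightarrow> lsrc X g = ltgt X h \<Longrightarrow> (g, h) \<in> composable X"
  by (simp add: composable_def)

lemma composableD:
  assumes "(g, h) \<in> composable X"
  shows "g \<in> mcarrier X1" "h \<in> mcarrier X1" "lsrc X g = ltgt X h"
  using assms by (simp_all add: composable_def)

lemma smooth_mul: "smooth_on_subset (prod_mfd X1 X1) (composable X) X1 (\<lambda>(g, h). lmul X g h)"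
  using groupoid by (simp add: lie_groupoid_def)

lemma mul_in: "(g, h) \<in> composable X \<Longrightarrow> lmul X g h \<in> mcarrier X1"
  using smooth_mul by (auto simp: smooth_on_subset_def)

lemma tgt_mul: "(g, h) \<in> composable X \<Longrightarrow> ltgt X (lmul X g h) = ltgt X g"
  using groupoid unfolding lie_groupoid_def by auto

lemma mul_assoc:
  "(g, h) \<in> composable X \<Longrightarrow> (h, k) \<in> composable X \<Longrightarrow> lmul X (lmul X g h) k = lmul X g (lmul X h k)"
  using groupoid unfolding lie_groupoid_def by blast

lemma inv_unit:
  assumes x: "x \<in> mcarrier X0"
  shows "linv X (lunit X x) = lunit X x"
proof -
  have u: "lunit X x \<in> mcarrier X1" by (rule unit_in[OF x])
  have "linv X (lunit X x) = lmul X (lunit X (ltgt X (linv X (lunit X x)))) (linv X (lunit X x))"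
    by (rule unit_mul[OF inv_in[OF u], symmetric])
  also have "\<dots> = lmul X (lunit X x) (linv X (lunit X x))" by (simp add: tgt_inv[OF u] src_unit[OF x])
  also have "\<dots> = lunit X x" by (simp add: mul_inv[OF u] tgt_unit[OF x])
  finally show ?thesis .
qed

lemma inv_inv:
  assumes g: "g \<in> mcarrier X1"
  shows "linv X (linv X g) = g"
proof -
  let ?h = "linv X g" let ?k = "linv X ?h"
  have h: "?h \<in> mcarrier X1" and k: "?k \<in> mcarrier X1" using g by (auto intro: inv_in)
  have gh: "(g, ?h) \<in> composable X" "(?h, ?k) \<in> composable X"
    using g h k by (auto intro!: composableI simp: tgt_inv src_inv)
  have "?k = lmul X (lunit X (ltgt X ?k)) ?k" by (rule unit_mul[OF k, symmetric])
  also have "\<dots> = lmul X (lmul X g ?h) ?k" using g h by (simp add: mul_inv tgt_inv src_inv)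
  also have "\<dots> = lmul X g (lmul X ?h ?k)" by (rule mul_assoc[OF gh])
  also have "\<dots> = g" using g h by (simp add: mul_inv tgt_inv mul_unit)
  finally show ?thesis .
qed

lemma action_domain_iff:
  "(p, g) \<in> action_domain X B \<longleftrightarrow> p \<in> mcarrier P \<and> g \<in> mcarrier X1 \<and> panchor B p = ltgt X g"
  by (simp add: action_domain_def)

lemma smooth_act: "smooth_on_subset (prod_mfd P X1) (action_domain X B) P (\<lambda>(p, g). pact B p g)"
  using principal by (simp add: principal_bundle_def right_action_def)

lemma act_in: "(p, g) \<in> action_domain X B \<Longrightarrow> pact B p g \<in> mcarrier P"
  using smooth_act by (auto simp: smooth_on_subset_def)

lemma anchor_act: "(p, g) \<in> action_domain X B \<Longrightarrow> panchor B (pact B p g) = lsrc X g"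
  using principal by (auto simp: principal_bundle_def right_action_def)

lemma proj_act: "(p, g) \<in> action_domain X B \<Longrightarrow> pproj B (pact B p g) = pproj B p"
  using principal by (auto simp: principal_bundle_def)

lemma act_act: "(p, g) \<in> action_domain X B \<Longrightarrow> (g, h) \<in> composable X \<Longrightarrow> pact B (pact B p g) h = pact B p (lmul X g h)"
  using principal unfolding principal_bundle_def right_action_def by blast

lemma act_unit: "p \<in> mcarrier P \<Longrightarrow> pact B p (lunit X (panchor B p)) = p"
  using principal by (simp add: principal_bundle_def right_action_def)

lemma unit_in_domain: "p \<in> mcarrier P \<Longrightarrow> (p, lunit X (panchor B p)) \<in> action_domain X B"
  by (simp add: action_domain_iff unit_in anchor_in tgt_unit)

lemma act_in_domain: "(p, g) \<in> action_domain X B \<Longrightarrow> (g, h) \<in> composable X \<Longrightarrow> (pact B p g, h) \<in> action_domain X B"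
  by (simp add: action_domain_iff[of "pact B p g"] act_in anchor_act composableD)

lemma mul_in_domain: "(p, g) \<in> action_domain X B \<Longrightarrow> (g, h) \<in> composable X \<Longrightarrow> (p, lmul X g h) \<in> action_domain X B"
  by (simp add: action_domain_iff mul_in tgt_mul)

lemma composable_of_domain:
  "(p, g) \<in> action_domain X B \<Longrightarrow> (pact B p g, h) \<in> action_domain X B \<Longrightarrow> (g, h) \<in> composable X"
  using anchor_act[of p g] by (simp add: action_domain_iff composable_def)

lemma inv_in_domain: "(p, g) \<in> action_domain X B \<Longrightarrow> (pact B p g, linv X g) \<in> action_domain X B"
  using anchor_act[of p g] act_in[of p g] by (simp add: action_domain_iff inv_in tgt_inv)

lemma principal_bij:
  "bij_betw (\<lambda>(p, g). (p, pact B p g)) (action_domain X B)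
     {(p, q). p \<in> mcarrier P \<and> q \<in> mcarrier P \<and> pproj B p = pproj B q}"
  using principal by (simp add: principal_bundle_def diffeo_subsets_def)

lemma act_free:
  assumes "(p, g) \<in> action_domain X B" "(p, h) \<in> action_domain X B" "pact B p g = pact B p h"
  shows "g = h"
  using inj_onD[OF bij_betw_imp_inj_on[OF principal_bij], of "(p, g)" "(p, h)"] assms by simp

lemma act_transitive:
  assumes "p \<in> mcarrier P" "q \<in> mcarrier P" "pproj B p = pproj B q"
  obtains g where "(p, g) \<in> action_domain X B" "pact B p g = q"
proof -
  have "(p, q) \<in> (\<lambda>(p, g). (p, pact B p g)) ` action_domain X B"
    unfolding bij_betw_imp_surj_on[OF principal_bij] using assms by simp
  then show thesis using that by auto
qed

subsection \<open>The horizontal lift\<close>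

lemma horizontal_subspace:
  assumes "g \<in> mcarrier X1"
  shows "H g \<subseteq> tangent_space X1 g" "0 \<in> H g"
    "\<xi> \<in> H g \<Longrightarrow> \<eta> \<in> H g \<Longrightarrow> \<xi> + \<eta> \<in> H g" "\<xi> \<in> H g \<Longrightarrow> tscale r \<xi> \<in> H g"
proof -
  have "smooth_subbundle X1 H" using connection unfolding ehresmann_connection_def by (rule conjunct1)
  then have "\<forall>x\<in>mcarrier X1. H x \<subseteq> tangent_space X1 x \<and> 0 \<in> H x \<and>
        (\<forall>\<xi>\<in>H x. \<forall>\<eta>\<in>H x. \<xi> + \<eta> \<in> H x) \<and> (\<forall>r. \<forall>\<xi>\<in>H x. tscale r \<xi> \<in> H x)"
    unfolding smooth_subbundle_def by (rule conjunct1)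
  from bspec[OF this assms]
  show "H g \<subseteq> tangent_space X1 g" "0 \<in> H g"
    "\<xi> \<in> H g \<Longrightarrow> \<eta> \<in> H g \<Longrightarrow> \<xi> + \<eta> \<in> H g" "\<xi> \<in> H g \<Longrightarrow> tscale r \<xi> \<in> H g"
    by (elim conjE; blast)+
qed

lemma horizontal_decomposition:
  assumes "g \<in> mcarrier X1" "\<xi> \<in> tangent_space X1 g"
  shows "\<exists>!(\<eta>, \<kappa>). \<eta> \<in> H g \<and> \<kappa> \<in> tangent_space X1 g \<and>
    differential X1 X0 (lsrc X) g \<kappa> = 0 \<and> \<xi> = \<eta> + \<kappa>"
  using connection assms unfolding ehresmann_connection_def by (elim conjE) (drule (1) bspec, drule (1) bspec, assumption)

lemma horizontal_at_unit:
  assumes "x \<in> mcarrier X0"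
  shows "H (lunit X x) = differential X0 X1 (lunit X) x ` tangent_space X0 x"
  using connection assms unfolding ehresmann_connection_def by (elim conjE) (drule (1) bspec, assumption)

lemma horizontal_sum:
  assumes g: "g \<in> mcarrier X1" and \<xi>: "\<And>i. i < r \<Longrightarrow> \<xi> i \<in> H g"
  shows "(\<Sum>i<(r::nat). \<xi> i) \<in> H g"
  using \<xi> by (induction r) (simp_all only: lessThan_0 sum.empty sum.lessThan_Suc horizontal_subspace[OF g] less_SucI lessI)

lemma horizontal_frame:
  assumes "g \<in> mcarrier X1"
  obtains W r e where "g \<in> W" "\<forall>i<(r::nat). smooth_map_on X1 W (tangent_bundle X1) (\<lambda>y. (y, e i y))"
    "\<forall>y\<in>W. (\<forall>i<r. e i y \<in> H y) \<and> (\<forall>\<xi>\<in>H y. \<exists>!b. b \<in> topspace (Euclidean_space r) \<and>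
        \<xi> = (\<Sum>i<r. tscale (b i) (e i y)))"
proof -
  have "smooth_subbundle X1 H" using connection unfolding ehresmann_connection_def by (rule conjunct1)
  then have "\<forall>x\<in>mcarrier X1. \<exists>W (r::nat) e. x \<in> W \<and>
      (\<forall>i<r. smooth_map_on X1 W (tangent_bundle X1) (\<lambda>y. (y, e i y))) \<and>
      (\<forall>y\<in>W. (\<forall>i<r. e i y \<in> H y) \<and>
         (\<forall>\<xi>\<in>H y. \<exists>!b. b \<in> topspace (Euclidean_space r) \<and> \<xi> = (\<Sum>i<r. tscale (b i) (e i y))))"
    unfolding smooth_subbundle_def by (rule conjunct2)
  from bspec[OF this assms] show thesis by (elim exE conjE) (rule that)
qed

lemma ds_in: "g \<in> mcarrier X1 \<Longrightarrow> \<xi> \<in> tangent_space X1 g \<Longrightarrow> differential X1 X0 (lsrc X) g \<xi> \<in> tangent_space X0 (lsrc X g)"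
  by (rule differential_in_tangent_space[OF atlas_X1 atlas_X0 smooth_src])

lemma dt_in: "g \<in> mcarrier X1 \<Longrightarrow> \<xi> \<in> tangent_space X1 g \<Longrightarrow> differential X1 X0 (ltgt X) g \<xi> \<in> tangent_space X0 (ltgt X g)"
  by (rule differential_in_tangent_space[OF atlas_X1 atlas_X0 smooth_tgt])

lemma da_in: "p \<in> mcarrier P \<Longrightarrow> u \<in> tangent_space P p \<Longrightarrow> differential P X0 (panchor B) p u \<in> tangent_space X0 (panchor B p)"
  by (rule differential_in_tangent_space[OF atlas_P atlas_X0 smooth_anchor])

text \<open>
  Restricted to the horizontal space, \<open>ds\<close> is injective since the decomposition into horizontal and
  vertical parts is unique, and surjective since it kills the vertical part.
\<close>

lemma ds_inj_on_horizontal: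
  assumes g: "g \<in> mcarrier X1"
  shows "inj_on (differential X1 X0 (lsrc X) g) (H g)"
proof (rule inj_onI)
  fix \<xi> \<eta> assume \<xi>: "\<xi> \<in> H g" and \<eta>: "\<eta> \<in> H g"
    and eq: "differential X1 X0 (lsrc X) g \<xi> = differential X1 X0 (lsrc X) g \<eta>"
  note hs = horizontal_subspace[OF g]
  define \<kappa> where "\<kappa> = \<xi> + tscale (-1) \<eta>"
  have \<kappa>: "\<kappa> \<in> H g" unfolding \<kappa>_def by (intro hs \<xi> \<eta>)
  have \<kappa>T: "\<kappa> \<in> tangent_space X1 g" using hs(1) \<kappa> by blast
  have d0: "differential X1 X0 (lsrc X) g \<kappa> = 0"
    unfolding \<kappa>_def differential_add differential_scale eq
    by (simp only: tscale_minus_one add.right_inverse)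
  have ex: "\<exists>!z. case z of (a, b) \<Rightarrow> a \<in> H g \<and> b \<in> tangent_space X1 g \<and>
      differential X1 X0 (lsrc X) g b = 0 \<and> \<kappa> = a + b"
    by (rule horizontal_decomposition[OF g \<kappa>T])
  have "(\<kappa>, 0) = (0, \<kappa>)"
  proof (rule ex1E[OF ex])
    fix z assume z: "\<forall>y. (case y of (a, b) \<Rightarrow> a \<in> H g \<and> b \<in> tangent_space X1 g \<and>
        differential X1 X0 (lsrc X) g b = 0 \<and> \<kappa> = a + b) \<longrightarrow> y = z"
    have "(\<kappa>, 0) = z" using \<kappa> by (intro z[rule_format]) (simp add: differential_zero)
    moreover have "(0, \<kappa>) = z" using \<kappa>T d0 hs(2) by (intro z[rule_format]) simp
    ultimately show ?thesis by simp
  qed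
  then have "\<kappa> = 0" by simp
  then show "\<xi> = \<eta>" unfolding \<kappa>_def tscale_minus_one by (simp only: add_uminus_conv_diff right_minus_eq)
qed

lemma ds_horizontal_surj:
  assumes g: "g \<in> mcarrier X1" and v: "v \<in> tangent_space X0 (lsrc X g)"
  obtains \<xi> where "\<xi> \<in> H g" "differential X1 X0 (lsrc X) g \<xi> = v"
proof -
  have "v \<in> differential X1 X0 (lsrc X) g ` tangent_space X1 g"
    using submersion_src g v by (simp add: submersion_def)
  then obtain \<xi> where \<xi>: "\<xi> \<in> tangent_space X1 g" "v = differential X1 X0 (lsrc X) g \<xi>" by blast
  have "\<exists>!z. case z of (a, b) \<Rightarrow> a \<in> H g \<and> b \<in> tangent_space X1 g \<and>
      differential X1 X0 (lsrc X) g b = 0 \<and> \<xi> = a + b"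
    by (rule horizontal_decomposition[OF g \<xi>(1)])
  then obtain a b where ab: "a \<in> H g" "differential X1 X0 (lsrc X) g b = 0" "\<xi> = a + b" by auto
  have "differential X1 X0 (lsrc X) g a = v"
    unfolding \<xi>(2) ab(3) differential_add ab(2) by (rule add_0_right[symmetric])
  then show thesis using that ab(1) by blast
qed

lemma hor_lift_eqI:
  assumes g: "g \<in> mcarrier X1" and \<xi>: "\<xi> \<in> H g" "differential X1 X0 (lsrc X) g \<xi> = v"
  shows "hor_lift X H g v = \<xi>"
  unfolding hor_lift_def \<xi>(2)[symmetric] by (rule the_inv_into_f_f[OF ds_inj_on_horizontal[OF g] \<xi>(1)])

lemma
  assumes g: "g \<in> mcarrier X1" and v: "v \<in> tangent_space X0 (lsrc X g)"
  shows hor_lift_horizontal: "hor_lift X H g v \<in> H g"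
    and ds_hor_lift: "differential X1 X0 (lsrc X) g (hor_lift X H g v) = v"
    and hor_lift_in: "hor_lift X H g v \<in> tangent_space X1 g"
proof -
  obtain \<xi> where \<xi>: "\<xi> \<in> H g" "differential X1 X0 (lsrc X) g \<xi> = v" using ds_horizontal_surj[OF g v] .
  have eq: "hor_lift X H g v = \<xi>" by (rule hor_lift_eqI[OF g \<xi>])
  show "hor_lift X H g v \<in> H g" "differential X1 X0 (lsrc X) g (hor_lift X H g v) = v"
    "hor_lift X H g v \<in> tangent_space X1 g"
    unfolding eq using \<xi> horizontal_subspace(1)[OF g] by auto
qed

lemma hor_lift_add:
  assumes g: "g \<in> mcarrier X1" and v: "v \<in> tangent_space X0 (lsrc X g)" "w \<in> tangent_space X0 (lsrc X g)"
  shows "hor_lift X H g (v + w) = hor_lift X H g v + hor_lift X H g w"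
  by (rule hor_lift_eqI[OF g])
    (simp_all only: horizontal_subspace(3)[OF g] hor_lift_horizontal[OF g v(1)] hor_lift_horizontal[OF g v(2)]
      differential_add ds_hor_lift[OF g v(1)] ds_hor_lift[OF g v(2)])

lemma hor_lift_scale:
  assumes g: "g \<in> mcarrier X1" and v: "v \<in> tangent_space X0 (lsrc X g)"
  shows "hor_lift X H g (tscale r v) = tscale r (hor_lift X H g v)"
  by (rule hor_lift_eqI[OF g])
    (simp_all only: horizontal_subspace(4)[OF g] hor_lift_horizontal[OF g v] differential_scale ds_hor_lift[OF g v])

lemma hor_lift_unit:
  assumes x: "x \<in> mcarrier X0" and v: "v \<in> tangent_space X0 x"
  shows "hor_lift X H (lunit X x) v = differential X0 X1 (lunit X) x v"
proof (rule hor_lift_eqI[OF unit_in[OF x]])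
  show "differential X0 X1 (lunit X) x v \<in> H (lunit X x)"
    unfolding horizontal_at_unit[OF x] by (rule imageI[OF v])
  have "differential X1 X0 (lsrc X) (lunit X x) (differential X0 X1 (lunit X) x v) = differential X0 X0 (\<lambda>x. x) x v"
    by (rule differential_chain[OF atlas_X0 atlas_X1 smooth_unit smooth_src smooth_map_id[OF atlas_X0] x x unit_in[OF x] _ v])
      (simp add: src_unit)
  also have "\<dots> = v" by (rule differential_id[OF atlas_X0 v x])
  finally show "differential X1 X0 (lsrc X) (lunit X x) (differential X0 X1 (lunit X) x v) = v" .
qed

text \<open>
  The matrix of \<open>ds\<close> in a frame of \<open>H\<close> and a chart of \<open>X0\<close> depends smoothly on the arrow. At one arrow it
  has a right inverse \<open>S\<close>; the product with \<open>S\<close> is then the identity at this arrow, and solving that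
  linear system gives coefficients of the lift.
\<close>

lemma mplot_hor_lift:
  assumes g: "mplot k U X1 g" and v: "mplot k U (tangent_bundle X0) (\<lambda>y. (lsrc X (g y), v y))"
  shows "mplot k U (tangent_bundle X1) (\<lambda>y. (g y, hor_lift X H (g y) (v y)))"
proof (rule mplot_locally[OF mplot_open[OF g]])
  fix y0 assume y0: "y0 \<in> U"
  let ?n = "mdim X0" let ?ds = "differential X1 X0 (lsrc X)"
  note vD = mplot_tangent_bundleD[OF atlas_X0 v]
  have g0: "g y0 \<in> mcarrier X1" by (rule mplot_in[OF g y0])
  obtain c where c: "c \<in> atlas X0" "lsrc X (g y0) \<in> fst c" using chart_ex[OF atlas_X0 src_in[OF g0]] .
  obtain W r e where W: "g y0 \<in> W"
    and eW: "\<forall>i<(r::nat). smooth_map_on X1 W (tangent_bundle X1) (\<lambda>y. (y, e i y))"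
    and frame: "\<forall>y\<in>W. (\<forall>i<r. e i y \<in> H y) \<and> (\<forall>\<xi>\<in>H y. \<exists>!b. b \<in> topspace (Euclidean_space r) \<and>
        \<xi> = (\<Sum>i<r. tscale (b i) (e i y)))"
    by (rule horizontal_frame[OF g0])
  have e: "smooth_map_on X1 W (tangent_bundle X1) (\<lambda>y. (y, e i y))" if "i < r" for i
    using eW that by simp
  have eH: "e i y \<in> H y" if "y \<in> W" "i < r" for i y
    using frame that by blast
  have eb: "\<exists>b. \<xi> = (\<Sum>i<r. tscale (b i) (e i y))" if "y \<in> W" "\<xi> \<in> H y" for y \<xi>
  proof -
    have "\<exists>!b. b \<in> topspace (Euclidean_space r) \<and> \<xi> = (\<Sum>i<r. tscale (b i) (e i y))"
      using frame that by blast
    then show ?thesis by (elim ex1E conjE) (rule exI)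
  qed
  show "\<exists>V. y0 \<in> V \<and> V \<subseteq> U \<and> mplot k V (tangent_bundle X1) (\<lambda>y. (g y, hor_lift X H (g y) (v y)))"
  proof (cases "r = 0")
    case True
    \<comment> \<open>An empty frame does not make \<open>W\<close> open; but then \<open>H\<close> vanishes at this arrow, so \<open>X0\<close> has
      dimension zero and all lifts are zero.\<close>
    have "?n = 0"
    proof (rule ccontr)
      assume n: "?n \<noteq> 0"
      have "(\<lambda>i. if i = 0 then 1 else 0) \<in> topspace (Euclidean_space ?n)"
        using n by (simp add: in_topspace_Euclidean)
      then obtain \<eta> where \<eta>: "\<eta> \<in> tangent_space X0 (lsrc X (g y0))" "\<eta> c = (\<lambda>i. if i = 0 then 1 else 0)"
        using tangent_ex[OF atlas_X0 c] by metis
      obtain b where b: "hor_lift X H (g y0) \<eta> = (\<Sum>i<r. tscale (b i) (e i (g y0)))"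
        using eb[OF W hor_lift_horizontal[OF g0 \<eta>(1)]] by (elim exE)
      have "hor_lift X H (g y0) \<eta> = 0" unfolding b True lessThan_0 sum.empty ..
      then have "\<eta> = 0" using ds_hor_lift[OF g0 \<eta>(1)] by (simp only: differential_zero)
      then have "\<eta> c 0 = 0" by simp
      then show False using \<eta>(2) by simp
    qed
    have "hor_lift X H (g y) (v y) = 0" if y: "y \<in> U" for y
    proof (rule hor_lift_eqI[OF mplot_in[OF g y] horizontal_subspace(2)[OF mplot_in[OF g y]]])
      have "v y c' = 0 c'" for c'
        using tangent_in_topspace[OF vD(2)[OF y], of c'] \<open>?n = 0\<close> by (simp add: in_topspace_Euclidean fun_eq_iff)
      then have "v y = 0" by (intro ext) simp
      then show "?ds (g y) 0 = v y" by (simp only: differential_zero)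
    qed
    then have "mplot k U (tangent_bundle X1) (\<lambda>y. (g y, hor_lift X H (g y) (v y)))"
      by (intro mplot_cong[OF mplot_tangent_zero[OF atlas_X1 g]]) simp
    then show ?thesis using y0 by (intro exI[of _ U]) simp
  next
    case False
    then have oW: "openin (mtop X1) W" using smooth_map_on_open[OF e[of 0]] by simp
    define U1 where "U1 = {y \<in> U. g y \<in> W}"
    have oU1: "openin (Euclidean_space k) U1"
      unfolding U1_def by (rule mplot_preimage_open[OF atlas_X1 g oW])
    have g1: "mplot k U1 X1 g" by (rule mplot_subset[OF g oU1]) (auto simp: U1_def)
    have sg1: "mplot k U1 X0 (\<lambda>y. lsrc X (g y))" by (rule mplot_subset[OF vD(1) oU1]) (auto simp: U1_def)
    have e1: "mplot k U1 (tangent_bundle X1) (\<lambda>y. (g y, e i (g y)))" if "i < r" for i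
      by (rule mplot_compose_smooth[OF atlas_X1 g1 e[OF that]]) (auto simp: U1_def)
    have de1: "mplot k U1 (tangent_bundle X0) (\<lambda>y. (lsrc X (g y), ?ds (g y) (e i (g y))))" if "i < r" for i
      by (rule mplot_differential[OF atlas_X1 atlas_X0 smooth_src e1[OF that] mplot_in[OF g1]])
    define U2 where "U2 = {y \<in> U1. lsrc X (g y) \<in> fst c}"
    have oU2: "openin (Euclidean_space k) U2" unfolding U2_def by (rule smooth_euc_open[OF mplot_chart[OF sg1 c(1)]])
    have y02: "y0 \<in> U2" using y0 W c by (simp add: U2_def U1_def)
    define A where "A j i y = ?ds (g y) (e i (g y)) c j" for j i y
    have A: "smooth_fun k U2 (A j i)" if "j < ?n" "i < r" for j i
      using smooth_euc_coord[OF mplot_tangent_bundleD(3)[OF atlas_X0 de1[OF that(2)] c(1)] that(1)]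
      by (simp add: A_def[abs_def] U2_def)
    have v2: "smooth_fun k U2 (\<lambda>y. v y c j)" if "j < ?n" for j
      by (rule smooth_fun_subset[OF smooth_euc_coord[OF vD(3)[OF c(1)] that] oU2]) (auto simp: U2_def U1_def)
    have comb: "?ds (g y) (\<Sum>i<r. tscale (b i) (e i (g y))) c j = (\<Sum>i<r. b i * A j i y)" for b y j
      unfolding differential_sum differential_scale sum_tvec_apply by (simp add: tscale_def A_def)
    have "\<exists>b. \<forall>j<?n. (\<Sum>i<r. b i * A j i y0) = (if j = l then 1 else 0)" if l: "l < ?n" for l
    proof -
      have "(\<lambda>i. if i = l then 1 else 0) \<in> topspace (Euclidean_space ?n)"
        using l by (simp add: in_topspace_Euclidean)
      then obtain \<eta> where \<eta>: "\<eta> \<in> tangent_space X0 (lsrc X (g y0))" "\<eta> c = (\<lambda>i. if i = l then 1 else 0)"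
        using tangent_ex[OF atlas_X0 c] by metis
      obtain b where b: "hor_lift X H (g y0) \<eta> = (\<Sum>i<r. tscale (b i) (e i (g y0)))"
        using eb[OF W hor_lift_horizontal[OF g0 \<eta>(1)]] by (elim exE)
      have "(\<Sum>i<r. b i * A j i y0) = \<eta> c j" for j
        unfolding comb[symmetric] b[symmetric] ds_hor_lift[OF g0 \<eta>(1)] ..
      then show ?thesis using \<eta>(2) by (intro exI[of _ b]) simp
    qed
    then have "\<forall>l. \<exists>b. l < ?n \<longrightarrow> (\<forall>j<?n. (\<Sum>i<r. b i * A j i y0) = (if j = l then 1 else 0))" by blast
    from choice[OF this] obtain S where S: "\<And>l j. l < ?n \<Longrightarrow> j < ?n \<Longrightarrow> (\<Sum>i<r. S l i * A j i y0) = (if j = l then 1 else 0)"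
      by blast
    define M where "M j l y = (\<Sum>i<r. S l i * A j i y)" for j l y
    have M: "smooth_fun k U2 (M j l)" if "j < ?n" for j l
      unfolding M_def by (intro smooth_fun_sum[OF oU2] smooth_fun_mult smooth_fun_const[OF oU2] A that) simp
    have M0: "M j l y0 = (if j = l then 1 else 0)" if "j < ?n" "l < ?n" for j l
      using S[OF that(2,1)] by (simp add: M_def)
    have "\<exists>V w. openin (Euclidean_space k) V \<and> y0 \<in> V \<and> V \<subseteq> U2 \<and> (\<forall>l<?n. smooth_fun k V (w l)) \<and>
        (\<forall>y\<in>V. \<forall>j<?n. (\<Sum>l<?n. M j l y * w l y) = v y c j)"
      by (rule smooth_linear_system[OF oU2 y02 M v2 M0])
    then obtain V w where V: "openin (Euclidean_space k) V" "y0 \<in> V" "V \<subseteq> U2"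
      and w': "\<forall>l<?n. smooth_fun k V (w l)"
      and eq': "\<forall>y\<in>V. \<forall>j<?n. (\<Sum>l<?n. M j l y * w l y) = v y c j"
      by (elim exE conjE)
    have w: "smooth_fun k V (w l)" if "l < ?n" for l using w' that by simp
    have eq: "(\<Sum>l<?n. M j l y * w l y) = v y c j" if "y \<in> V" "j < ?n" for y j using eq' that by simp
    have VU: "V \<subseteq> U1" "V \<subseteq> U" using V(3) by (auto simp: U2_def U1_def)
    define b where "b i y = (\<Sum>l<?n. S l i * w l y)" for i y
    have b: "smooth_fun k V (b i)" for i
      unfolding b_def by (intro smooth_fun_sum[OF V(1)] smooth_fun_mult smooth_fun_const[OF V(1)] w) simp
    have gV: "mplot k V X1 g" by (rule mplot_subset[OF g V(1) VU(2)])
    have "mplot k V (tangent_bundle X1) (\<lambda>y. (g y, \<Sum>i<r. tscale (b i y) (e i (g y))))"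
      by (intro mplot_tangent_sum[OF atlas_X1 gV] mplot_tangent_scale[OF atlas_X1 _ b] mplot_subset[OF e1 V(1) VU(1)])
    then have "mplot k V (tangent_bundle X1) (\<lambda>y. (g y, hor_lift X H (g y) (v y)))"
    proof (rule mplot_cong)
      fix y assume y: "y \<in> V"
      have yU: "y \<in> U" and gy: "g y \<in> mcarrier X1" and yW: "g y \<in> W" and yc: "lsrc X (g y) \<in> fst c"
        using y V(3) mplot_in[OF gV y] by (auto simp: U2_def U1_def)
      let ?\<xi> = "\<Sum>i<r. tscale (b i y) (e i (g y))"
      have \<xi>H: "?\<xi> \<in> H (g y)"
        by (intro horizontal_sum[OF gy] horizontal_subspace(4)[OF gy] eH[OF yW])
      have \<xi>T: "?ds (g y) ?\<xi> \<in> tangent_space X0 (lsrc X (g y))"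
        using ds_in[OF gy] horizontal_subspace(1)[OF gy] \<xi>H by blast
      have "?ds (g y) ?\<xi> = v y"
      proof (rule tangent_eqI[OF atlas_X0 \<xi>T vD(2)[OF yU] c(1) yc])
        show "?ds (g y) ?\<xi> c = v y c"
        proof
          fix j
          show "?ds (g y) ?\<xi> c j = v y c j"
          proof (cases "j < ?n")
            case True
            have "?ds (g y) ?\<xi> c j = (\<Sum>i<r. \<Sum>l<?n. S l i * w l y * A j i y)"
              unfolding comb b_def by (simp add: sum_distrib_right)
            also have "\<dots> = (\<Sum>l<?n. M j l y * w l y)"
              by (subst sum.swap) (simp add: M_def sum_distrib_right mult.assoc mult.commute[of "w _ y"])
            finally show ?thesis using eq[OF y True] by simp
          next
            case False
            then show ?thesis
              using tangent_in_topspace[OF \<xi>T, of c] tangent_in_topspace[OF vD(2)[OF yU], of c]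
              by (simp add: in_topspace_Euclidean)
          qed
        qed
      qed
      from hor_lift_eqI[OF gy \<xi>H this]
      show "(g y, ?\<xi>) = (g y, hor_lift X H (g y) (v y))" by simp
    qed
    then show ?thesis using V(2) VU(2) by (intro exI[of _ V]) simp
  qed
qed

subsection \<open>The quasi-actions \<open>\<tau>\<^sup>0\<close> and \<open>\<tau>\<^sup>1\<close>\<close>

lemma tau1_eq: "tau1 X H g v = differential X1 X0 (ltgt X) (linv X g) (hor_lift X H (linv X g) v)"
  by (simp add: tau1_def lambda1_def)

lemma inv_lift_base:
  assumes g: "g \<in> mcarrier X1" and v: "v \<in> tangent_space X0 (ltgt X g)"
  shows "linv X g \<in> mcarrier X1" "v \<in> tangent_space X0 (lsrc X (linv X g))"
  using assms by (simp_all add: inv_in src_inv)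

lemma tau1_in:
  assumes g: "g \<in> mcarrier X1" and v: "v \<in> tangent_space X0 (ltgt X g)"
  shows "tau1 X H g v \<in> tangent_space X0 (lsrc X g)"
  using dt_in[OF inv_lift_base(1)[OF g v] hor_lift_in[OF inv_lift_base[OF g v]]]
  by (simp add: tau1_eq tgt_inv[OF g])

lemma tau1_add:
  assumes g: "g \<in> mcarrier X1" and v: "v \<in> tangent_space X0 (ltgt X g)" "w \<in> tangent_space X0 (ltgt X g)"
  shows "tau1 X H g (v + w) = tau1 X H g v + tau1 X H g w"
  unfolding tau1_eq hor_lift_add[OF inv_lift_base(1)[OF g v(1)] inv_lift_base(2)[OF g v(1)] inv_lift_base(2)[OF g v(2)]]
  by (rule differential_add)

lemma tau1_scale:
  assumes g: "g \<in> mcarrier X1" and v: "v \<in> tangent_space X0 (ltgt X g)"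
  shows "tau1 X H g (tscale r v) = tscale r (tau1 X H g v)"
  unfolding tau1_eq hor_lift_scale[OF inv_lift_base[OF g v]] by (rule differential_scale)

lemma tau1_unit:
  assumes x: "x \<in> mcarrier X0" and v: "v \<in> tangent_space X0 x"
  shows "tau1 X H (lunit X x) v = v"
proof -
  have "tau1 X H (lunit X x) v = differential X1 X0 (ltgt X) (lunit X x) (differential X0 X1 (lunit X) x v)"
    unfolding tau1_eq inv_unit[OF x] hor_lift_unit[OF x v] ..
  also have "\<dots> = differential X0 X0 (\<lambda>x. x) x v"
    by (rule differential_chain[OF atlas_X0 atlas_X1 smooth_unit smooth_tgt smooth_map_id[OF atlas_X0] x x unit_in[OF x] _ v])
      (simp add: tgt_unit)
  also have "\<dots> = v" by (rule differential_id[OF atlas_X0 v x])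
  finally show ?thesis .
qed

text \<open>The vector acting on \<open>u\<close> in the definition of \<open>\<tau>\<^sup>0\<close>; \<open>(u, lift)\<close> is tangent to the action domain.\<close>

definition inv_lift :: "'p \<Rightarrow> 'g \<Rightarrow> 'p tvec \<Rightarrow> 'g tvec" where
  "inv_lift p g u = differential X1 X1 (linv X) (linv X g)
     (hor_lift X H (linv X g) (differential P X0 (panchor B) p u))"

lemma domain_lift:
  assumes pg: "(p, g) \<in> action_domain X B" and u: "u \<in> tangent_space P p"
  shows "p \<in> mcarrier P" "g \<in> mcarrier X1" "differential P X0 (panchor B) p u \<in> tangent_space X0 (ltgt X g)"
  using pg da_in[of p u] u by (simp_all add: action_domain_iff)

lemma inv_lift_in:
  assumes pg: "(p, g) \<in> action_domain X B" and u: "u \<in> tangent_space P p"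
  shows "inv_lift p g u \<in> tangent_space X1 g"
proof -
  note d = domain_lift[OF pg u]
  note b = inv_lift_base[OF d(2,3)]
  show ?thesis
    using differential_in_tangent_space[OF atlas_X1 atlas_X1 smooth_inv b(1) hor_lift_in[OF b]]
    by (simp add: inv_lift_def inv_inv[OF d(2)])
qed

text \<open>
  This is tangency to the action domain: \<open>t \<circ> i = s\<close>, and \<open>ds\<close> maps a horizontal lift back to the
  vector which was lifted.
\<close>

lemma dt_inv_lift:
  assumes pg: "(p, g) \<in> action_domain X B" and u: "u \<in> tangent_space P p"
  shows "differential X1 X0 (ltgt X) g (inv_lift p g u) = differential P X0 (panchor B) p u"
proof -
  note d = domain_lift[OF pg u]
  note b = inv_lift_base[OF d(2,3)]
  have "differential X1 X0 (ltgt X) (linv X (linv X g)) (inv_lift p g u) =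
      differential X1 X0 (lsrc X) (linv X g) (hor_lift X H (linv X g) (differential P X0 (panchor B) p u))"
    unfolding inv_lift_def
    by (rule differential_chain[OF atlas_X1 atlas_X1 smooth_inv smooth_tgt smooth_src b(1) b(1) inv_in[OF b(1)] _ hor_lift_in[OF b]])
      (rule tgt_inv)
  then show ?thesis unfolding ds_hor_lift[OF b] inv_inv[OF d(2)] .
qed

lemma action_extension:
  assumes pg: "(p, g) \<in> action_domain X B"
  obtains W F where "(p, g) \<in> W" "smooth_ext (prod_mfd P X1) (action_domain X B) P (\<lambda>(p, g). pact B p g) W F"
  using smooth_act pg unfolding smooth_on_subset_def by blast

lemma tau0_eq:
  assumes pg: "(p, g) \<in> action_domain X B" and u: "u \<in> tangent_space P p"
    and F: "smooth_ext (prod_mfd P X1) (action_domain X B) P (\<lambda>(p, g). pact B p g) W F" "(p, g) \<in> W"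
  shows "tau0 X H B p g u = differential (prod_mfd P X1) P F (p, g) (tangent_pair P X1 p g u (inv_lift p g u))"
proof -
  have surj: "tangent_space X0 (ltgt X g) \<subseteq> differential X1 X0 (ltgt X) g ` tangent_space X1 g"
    using submersion_tgt domain_lift(2)[OF pg u] by (simp add: submersion_def)
  show ?thesis
    unfolding tau0_def tangent_act_def inv_lift_def[symmetric]
    by (rule differential_subset_eq[OF atlas_P atlas_X1 atlas_X0 atlas_P smooth_anchor smooth_tgt
          action_domain_def pg surj u inv_lift_in[OF pg u] dt_inv_lift[OF pg u, symmetric] F])
qed

lemma smooth_extD:
  assumes "smooth_ext (prod_mfd P X1) (action_domain X B) P (\<lambda>(p, g). pact B p g) W F"
  shows "smooth_map_on (prod_mfd P X1) W P F"
    "(p, g) \<in> action_domain X B \<Longrightarrow> (p, g) \<in> W \<Longrightarrow> F (p, g) = pact B p g"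
  using assms by (auto simp: smooth_ext_def)

lemma tau0_in:
  assumes pg: "(p, g) \<in> action_domain X B" and u: "u \<in> tangent_space P p"
  shows "tau0 X H B p g u \<in> tangent_space P (pact B p g)"
proof -
  obtain W F where F: "(p, g) \<in> W" "smooth_ext (prod_mfd P X1) (action_domain X B) P (\<lambda>(p, g). pact B p g) W F"
    using action_extension[OF pg] .
  note d = domain_lift[OF pg u]
  show ?thesis
    unfolding tau0_eq[OF pg u F(2,1)] smooth_extD(2)[OF F(2) pg F(1), symmetric]
    by (rule differential_in_tangent_space[OF smooth_atlas_prod[OF atlas_P atlas_X1] atlas_P smooth_extD(1)[OF F(2)] F(1)
          tangent_pair_in[OF atlas_P atlas_X1 d(1,2) u inv_lift_in[OF pg u]]])
qed

lemma tau0_add: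
  assumes pg: "(p, g) \<in> action_domain X B" and u: "u \<in> tangent_space P p" "u' \<in> tangent_space P p"
  shows "tau0 X H B p g (u + u') = tau0 X H B p g u + tau0 X H B p g u'"
proof -
  obtain W F where F: "(p, g) \<in> W" "smooth_ext (prod_mfd P X1) (action_domain X B) P (\<lambda>(p, g). pact B p g) W F"
    using action_extension[OF pg] .
  note d = domain_lift[OF pg u(1)] domain_lift[OF pg u(2)]
  note b = inv_lift_base[OF d(2,3)] inv_lift_base[OF d(5,6)]
  have "inv_lift p g (u + u') = inv_lift p g u + inv_lift p g u'"
    unfolding inv_lift_def differential_add hor_lift_add[OF b(1,2,4)] ..
  then show ?thesis
    unfolding tau0_eq[OF pg u(1) F(2,1)] tau0_eq[OF pg u(2) F(2,1)] tau0_eq[OF pg tangent_space_add[OF u] F(2,1)]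
    by (simp only: tangent_pair_add[OF atlas_P atlas_X1 d(1,2) u inv_lift_in[OF pg u(1)] inv_lift_in[OF pg u(2)]] differential_add)
qed

lemma tau0_scale:
  assumes pg: "(p, g) \<in> action_domain X B" and u: "u \<in> tangent_space P p"
  shows "tau0 X H B p g (tscale r u) = tscale r (tau0 X H B p g u)"
proof -
  obtain W F where F: "(p, g) \<in> W" "smooth_ext (prod_mfd P X1) (action_domain X B) P (\<lambda>(p, g). pact B p g) W F"
    using action_extension[OF pg] .
  note d = domain_lift[OF pg u]
  note b = inv_lift_base[OF d(2,3)]
  have "inv_lift p g (tscale r u) = tscale r (inv_lift p g u)"
    unfolding inv_lift_def differential_scale hor_lift_scale[OF b] ..
  then show ?thesis
    unfolding tau0_eq[OF pg u F(2,1)] tau0_eq[OF pg tangent_space_scale[OF u] F(2,1)]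
    by (simp only: tangent_pair_scale[OF atlas_P atlas_X1 d(1,2) u inv_lift_in[OF pg u]] differential_scale)
qed

text \<open>
  At a unit the horizontal space is the image of \<open>d1\<close>, so \<open>\<tau>\<^sup>0\<close> is the differential of
  \<open>p \<mapsto> p 1\<close>, the identity.
\<close>

lemma tau0_unit:
  assumes p: "p \<in> mcarrier P" and u: "u \<in> tangent_space P p"
  shows "tau0 X H B p (lunit X (panchor B p)) u = u"
proof -
  let ?a = "panchor B" let ?e = "\<lambda>p. lunit X (panchor B p)" let ?PX = "prod_mfd P X1"
  have pg: "(p, ?e p) \<in> action_domain X B" by (rule unit_in_domain[OF p])
  obtain W F where F: "(p, ?e p) \<in> W" "smooth_ext ?PX (action_domain X B) P (\<lambda>(p, g). pact B p g) W F"
    using action_extension[OF pg] .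
  note Fs = smooth_extD[OF F(2)]
  have a: "?a p \<in> mcarrier X0" by (rule anchor_in[OF p])
  note da = da_in[OF p u]
  note PX = smooth_atlas_prod[OF atlas_P atlas_X1]
  have lift: "inv_lift p (?e p) u = differential X0 X1 (lunit X) (?a p) (differential P X0 ?a p u)"
  proof -
    have "inv_lift p (?e p) u = differential X1 X1 (linv X) (?e p) (differential X0 X1 (lunit X) (?a p) (differential P X0 ?a p u))"
      unfolding inv_lift_def inv_unit[OF a] hor_lift_unit[OF a da] ..
    also have "\<dots> = differential X0 X1 (lunit X) (?a p) (differential P X0 ?a p u)"
      by (rule differential_chain[OF atlas_X0 atlas_X1 smooth_unit smooth_inv smooth_unit a a unit_in[OF a] _ da])
        (rule inv_unit)
    finally show ?thesis .
  qed
  obtain c where c: "c \<in> atlas P" "p \<in> fst c" using chart_ex[OF atlas_P p] .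
  let ?n = "mdim P" let ?q = "chart_inv c" let ?z = "snd c p" let ?V = "snd c ` fst c"
  have q: "mplot ?n ?V P ?q" by (rule mplot_chart_inv[OF atlas_P c(1)])
  have z: "?z \<in> ?V" and qz: "?q ?z = p" using c atlas_P by auto
  have aq: "mplot ?n ?V X0 (\<lambda>z. ?a (?q z))"
    by (rule mplot_compose_smooth[OF atlas_P q smooth_anchor image_subsetI[OF mplot_in[OF q]]])
  have uq: "mplot ?n ?V X1 (\<lambda>z. ?e (?q z))"
    by (rule mplot_compose_smooth[OF atlas_X0 aq smooth_unit image_subsetI[OF mplot_in[OF aq]]])
  have u': "pvel ?n P ?q ?z (u c) = u" by (rule tangent_as_pvel[OF atlas_P u c])
  have "differential P X0 ?a p u = pvel ?n X0 (\<lambda>z. ?a (?q z)) ?z (u c)"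
    using differential_pvel[OF atlas_P smooth_anchor q z, of "u c"] qz p u' by simp
  then have lift': "inv_lift p (?e p) u = pvel ?n X1 (\<lambda>z. ?e (?q z)) ?z (u c)"
    unfolding lift
    using differential_pvel[OF atlas_X0 smooth_unit aq z mplot_in[OF aq z], of "u c"] qz by simp
  note pr = mplot_Pair[OF q uq]
  define V' where "V' = {z \<in> ?V. (?q z, ?e (?q z)) \<in> W}"
  have V': "openin (Euclidean_space ?n) V'"
    unfolding V'_def by (rule mplot_preimage_open[OF PX pr smooth_map_on_open[OF Fs(1)]])
  have zV': "?z \<in> V'" using z F(1) qz by (simp add: V'_def)
  have "tau0 X H B p (?e p) u = differential ?PX P F (p, ?e p) (pvel ?n ?PX (\<lambda>z. (?q z, ?e (?q z))) ?z (u c))"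
    unfolding tau0_eq[OF pg u F(2,1)] lift'
    using tangent_pair_pvel[OF atlas_P atlas_X1 q uq z, of "u c"] qz u' by simp
  also have "\<dots> = pvel ?n P (\<lambda>z. F (?q z, ?e (?q z))) ?z (u c)"
    using differential_pvel[OF PX Fs(1) pr z, of "u c"] F(1) qz by simp
  also have "\<dots> = pvel ?n P ?q ?z (u c)"
  proof (rule pvel_cong[OF V' zV'])
    fix y assume y: "y \<in> V'"
    then have qy: "?q y \<in> mcarrier P" using mplot_in[OF q] by (simp add: V'_def)
    show "F (?q y, ?e (?q y)) = ?q y"
      using Fs(2)[OF unit_in_domain[OF qy]] act_unit[OF qy] y by (simp add: V'_def)
  qed
  finally show ?thesis unfolding u' .
qed

subsection \<open>Smoothness along plots\<close>

lemma mplot_inv: "mplot k U X1 g \<Longrightarrow> mplot k U X1 (\<lambda>y. linv X (g y))"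
  by (rule mplot_compose_smooth[OF atlas_X1 _ smooth_inv]) (auto simp: mplot_def)

lemma mplot_tau1:
  assumes g: "mplot k U X1 g" and v: "mplot k U (tangent_bundle X0) (\<lambda>y. (ltgt X (g y), v y))"
  shows "mplot k U (tangent_bundle X0) (\<lambda>y. (lsrc X (g y), tau1 X H (g y) (v y)))"
proof -
  note ig = mplot_inv[OF g]
  have v': "mplot k U (tangent_bundle X0) (\<lambda>y. (lsrc X (linv X (g y)), v y))"
    by (rule mplot_cong[OF v]) (simp add: src_inv mplot_in[OF g])
  have "mplot k U (tangent_bundle X0) (\<lambda>y. (ltgt X (linv X (g y)), tau1 X H (g y) (v y)))"
    unfolding tau1_eq
    by (rule mplot_differential[OF atlas_X1 atlas_X0 smooth_tgt mplot_hor_lift[OF ig v'] mplot_in[OF ig]])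
  then show ?thesis by (rule mplot_cong) (simp add: tgt_inv mplot_in[OF g])
qed

text \<open>
  The vector inserted into the differential of the action depends smoothly on the parameters, since
  the horizontal lift does; and the differential is locally that of a smooth extension.
\<close>

lemma mplot_tau0:
  assumes u: "mplot k U (tangent_bundle P) (\<lambda>y. (p y, u y))" and g: "mplot k U X1 g"
    and pg: "\<And>y. y \<in> U \<Longrightarrow> (p y, g y) \<in> action_domain X B"
  shows "mplot k U (tangent_bundle P) (\<lambda>y. (pact B (p y) (g y), tau0 X H B (p y) (g y) (u y)))"
proof -
  let ?PX = "prod_mfd P X1"
  note PX = smooth_atlas_prod[OF atlas_P atlas_X1]
  note uD = mplot_tangent_bundleD[OF atlas_P u]
  note ig = mplot_inv[OF g]
  have "mplot k U (tangent_bundle X0) (\<lambda>y. (panchor B (p y), differential P X0 (panchor B) (p y) (u y)))"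
    by (rule mplot_differential[OF atlas_P atlas_X0 smooth_anchor u mplot_in[OF uD(1)]])
  then have "mplot k U (tangent_bundle X0) (\<lambda>y. (lsrc X (linv X (g y)), differential P X0 (panchor B) (p y) (u y)))"
  proof (rule mplot_cong)
    fix y assume "y \<in> U"
    then have "panchor B (p y) = ltgt X (g y)" "g y \<in> mcarrier X1" using pg[of y] by (simp_all add: action_domain_iff)
    then show "(panchor B (p y), differential P X0 (panchor B) (p y) (u y)) =
        (lsrc X (linv X (g y)), differential P X0 (panchor B) (p y) (u y))" by (simp add: src_inv)
  qed
  from mplot_differential[OF atlas_X1 atlas_X1 smooth_inv mplot_hor_lift[OF ig this] mplot_in[OF ig]]
  have "mplot k U (tangent_bundle X1) (\<lambda>y. (linv X (linv X (g y)), inv_lift (p y) (g y) (u y)))"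
    by (simp only: inv_lift_def)
  then have "mplot k U (tangent_bundle X1) (\<lambda>y. (g y, inv_lift (p y) (g y) (u y)))"
    by (rule mplot_cong) (simp add: inv_inv mplot_in[OF g])
  note pair = mplot_tangent_pair[OF atlas_P atlas_X1 u this]
  note pgp = mplot_tangent_bundleD(1)[OF PX pair]
  show ?thesis
  proof (rule mplot_locally[OF mplot_open[OF g]])
    fix x assume x: "x \<in> U"
    obtain W F where F: "(p x, g x) \<in> W" "smooth_ext ?PX (action_domain X B) P (\<lambda>(p, g). pact B p g) W F"
      using action_extension[OF pg[OF x]] .
    note Fs = smooth_extD[OF F(2)]
    define V where "V = {y \<in> U. (p y, g y) \<in> W}"
    have V: "openin (Euclidean_space k) V"
      unfolding V_def by (rule mplot_preimage_open[OF PX pgp smooth_map_on_open[OF Fs(1)]])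
    have "mplot k V (tangent_bundle P) (\<lambda>y. (F (p y, g y),
        differential ?PX P F (p y, g y) (tangent_pair P X1 (p y) (g y) (u y) (inv_lift (p y) (g y) (u y)))))"
      by (rule mplot_differential[OF PX atlas_P Fs(1) mplot_subset[OF pair V]]) (auto simp: V_def)
    then have "mplot k V (tangent_bundle P) (\<lambda>y. (pact B (p y) (g y), tau0 X H B (p y) (g y) (u y)))"
    proof (rule mplot_cong)
      fix y assume "y \<in> V"
      then have y: "y \<in> U" "(p y, g y) \<in> W" by (auto simp: V_def)
      show "(F (p y, g y), differential ?PX P F (p y, g y)
            (tangent_pair P X1 (p y) (g y) (u y) (inv_lift (p y) (g y) (u y)))) =
          (pact B (p y) (g y), tau0 X H B (p y) (g y) (u y))"
        unfolding tau0_eq[OF pg[OF y(1)] uD(2)[OF y(1)] F(2) y(2)] Fs(2)[OF pg[OF y(1)] y(2)] ..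
    qed
    then show "\<exists>V. x \<in> V \<and> V \<subseteq> U \<and> mplot k V (tangent_bundle P) (\<lambda>y. (pact B (p y) (g y), tau0 X H B (p y) (g y) (u y)))"
      using x F(1) by (intro exI[of _ V]) (auto simp: V_def)
  qed
qed

text \<open>The multiplication extends smoothly around each composable pair.\<close>

lemma mplot_mul:
  assumes g: "mplot k U X1 g" and h: "mplot k U X1 h" and gh: "\<And>y. y \<in> U \<Longrightarrow> (g y, h y) \<in> composable X"
  shows "mplot k U X1 (\<lambda>y. lmul X (g y) (h y))"
proof (rule mplot_locally[OF mplot_open[OF g]])
  let ?XX = "prod_mfd X1 X1"
  note XX = smooth_atlas_prod[OF atlas_X1 atlas_X1]
  note pr = mplot_Pair[OF g h]
  fix x assume x: "x \<in> U"
  obtain W F where F: "(g x, h x) \<in> W" "smooth_map_on ?XX W X1 F"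
    "\<forall>z\<in>composable X \<inter> W. F z = (case z of (g, h) \<Rightarrow> lmul X g h)"
    using smooth_mul gh[OF x] unfolding smooth_on_subset_def smooth_ext_def by blast
  define V where "V = {y \<in> U. (g y, h y) \<in> W}"
  have V: "openin (Euclidean_space k) V"
    unfolding V_def by (rule mplot_preimage_open[OF XX pr smooth_map_on_open[OF F(2)]])
  have "mplot k V X1 (\<lambda>y. F (g y, h y))"
    by (rule mplot_compose_smooth[OF XX mplot_subset[OF pr V] F(2)]) (auto simp: V_def)
  then have "mplot k V X1 (\<lambda>y. lmul X (g y) (h y))"
    by (rule mplot_cong) (use F(3) gh in \<open>auto simp: V_def\<close>)
  then show "\<exists>V. x \<in> V \<and> V \<subseteq> U \<and> mplot k V X1 (\<lambda>y. lmul X (g y) (h y))"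
    using x F(1) by (intro exI[of _ V]) (auto simp: V_def)
qed

end

section \<open>Diffeological spaces\<close>

lemma diffeological_spaceI:
  assumes "\<And>n U f. plot D n U f \<Longrightarrow> openin (Euclidean_space n) U"
    "\<And>n U f x. plot D n U f \<Longrightarrow> x \<in> U \<Longrightarrow> f x \<in> dcarrier D"
    "\<And>n U x. openin (Euclidean_space n) U \<Longrightarrow> x \<in> dcarrier D \<Longrightarrow> plot D n U (\<lambda>_. x)"
    "\<And>n U f. openin (Euclidean_space n) U \<Longrightarrow> (\<And>x. x \<in> U \<Longrightarrow> \<exists>V. x \<in> V \<and> V \<subseteq> U \<and> plot D n V f) \<Longrightarrow> plot D n U f"
    "\<And>n m U V f f' h. plot D m V f \<Longrightarrow> smooth_euc n m U h \<Longrightarrow> h ` U \<subseteq> V \<Longrightarrow>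
        (\<And>x. x \<in> U \<Longrightarrow> f' x = f (h x)) \<Longrightarrow> plot D n U f'"
  shows "diffeological_space D"
  unfolding diffeological_space_def
proof (intro conjI allI impI)
  fix n U f assume "plot D n U f"
  then show "openin (Euclidean_space n) U" "f ` U \<subseteq> dcarrier D" using assms(1,2) by auto
next
  fix n U x assume "openin (Euclidean_space n) U \<and> x \<in> dcarrier D"
  then show "plot D n U (\<lambda>_. x)" using assms(3) by simp
next
  fix n U f assume a: "openin (Euclidean_space n) U \<and> (\<forall>x\<in>U. \<exists>V. x \<in> V \<and> V \<subseteq> U \<and> plot D n V f)"
  show "plot D n U f" by (rule assms(4)) (use a in simp_all)
next
  fix n m U V f f' h
  assume a: "plot D m V f \<and> smooth_euc n m U h \<and> h ` U \<subseteq> V \<and> (\<forall>x\<in>U. f' x = f (h x))"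
  show "plot D n U f'" by (rule assms(5)[of m V f n U h]) (use a in simp_all)
qed

lemma
  assumes "diffeological_space D"
  shows plot_open: "plot D n U f \<Longrightarrow> openin (Euclidean_space n) U"
    and plot_in: "plot D n U f \<Longrightarrow> x \<in> U \<Longrightarrow> f x \<in> dcarrier D"
    and plot_const: "openin (Euclidean_space n) U \<Longrightarrow> y \<in> dcarrier D \<Longrightarrow> plot D n U (\<lambda>_. y)"
proof -
  note D = assms[unfolded diffeological_space_def]
  note 1 = D[THEN conjunct1] and 2 = D[THEN conjunct2, THEN conjunct1]
  show "plot D n U f \<Longrightarrow> openin (Euclidean_space n) U" using 1 by simp
  show "f x \<in> dcarrier D" if "plot D n U f" "x \<in> U"
    using 1[rule_format, OF that(1)] that(2) by auto
  show "openin (Euclidean_space n) U \<Longrightarrow> y \<in> dcarrier D \<Longrightarrow> plot D n U (\<lambda>_. y)" using 2 by simp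
qed

lemma plot_local:
  assumes "diffeological_space D" "openin (Euclidean_space n) U"
    "\<And>x. x \<in> U \<Longrightarrow> \<exists>V. x \<in> V \<and> V \<subseteq> U \<and> plot D n V f"
  shows "plot D n U f"
proof -
  have "\<forall>n U f. openin (Euclidean_space n) U \<and> (\<forall>x\<in>U. \<exists>V. x \<in> V \<and> V \<subseteq> U \<and> plot D n V f) \<longrightarrow> plot D n U f"
    using assms(1) unfolding diffeological_space_def by (elim conjE)
  then show ?thesis using assms(2,3) by simp
qed

lemma plot_compose:
  assumes "diffeological_space D" "plot D m V f" "smooth_euc n m U h" "h ` U \<subseteq> V"
    "\<And>x. x \<in> U \<Longrightarrow> f' x = f (h x)"
  shows "plot D n U f'"
proof -
  have "\<forall>n m U V f f' h. plot D m V f \<and> smooth_euc n m U h \<and> h ` U \<subseteq> V \<and> (\<forall>x\<in>U. f' x = f (h x)) \<longrightarrow> plot D n U f'"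
    using assms(1) unfolding diffeological_space_def by (elim conjE)
  from this[rule_format, of m V f n U h f'] show ?thesis using assms(2-5) by simp
qed

lemma plot_mfd_diffeology: "plot (mfd_diffeology N) n U f \<longleftrightarrow> mplot n U N f"
  and dcarrier_mfd_diffeology: "dcarrier (mfd_diffeology N) = mcarrier N"
  by (simp_all add: mfd_diffeology_def smooth_map_on_euclidean)

lemma diffeological_space_mfd:
  assumes "\<And>k U x. openin (Euclidean_space k) U \<Longrightarrow> x \<in> mcarrier N \<Longrightarrow> mplot k U N (\<lambda>_. x)"
  shows "diffeological_space (mfd_diffeology N)"
proof (rule diffeological_spaceI, unfold plot_mfd_diffeology dcarrier_mfd_diffeology)
  fix n m U V f f' h
  assume *: "mplot m V N f" "smooth_euc n m U h" "h ` U \<subseteq> V" "\<And>x. x \<in> U \<Longrightarrow> f' x = f (h x)"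
  show "mplot n U N f'" by (rule mplot_cong[OF mplot_compose_euc[OF *(1-3)]]) (simp add: *(4))
qed (rule mplot_open mplot_in assms mplot_locally; assumption)+

lemma diffeological_space_atlas: "smooth_atlas N \<Longrightarrow> diffeological_space (mfd_diffeology N)"
  by (rule diffeological_space_mfd) (rule mplot_const)

lemma diffeological_space_tangent_bundle:
  fixes N :: "'a mfd"
  assumes N: "smooth_atlas N"
  shows "diffeological_space (mfd_diffeology (tangent_bundle N))"
proof (rule diffeological_space_mfd)
  fix k U and z :: "'a \<times> 'a tvec" assume U: "openin (Euclidean_space k) U" and z: "z \<in> mcarrier (tangent_bundle N)"
  then have z': "fst z \<in> mcarrier N" "snd z \<in> tangent_space N (fst z)" by (auto simp: tangent_bundle_def)
  note p = mplot_const[OF N U z'(1)]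
  have "mplot k U (tangent_bundle N) (\<lambda>_. (fst z, snd z))"
    unfolding mplot_tangent_bundle_iff[OF N]
    by (intro conjI ballI p z'(2) smooth_euc_const smooth_euc_open[OF mplot_chart[OF p]] tangent_in_topspace[OF z'(2)])
  then show "mplot k U (tangent_bundle N) (\<lambda>_. z)" by simp
qed

lemma plot_prod_diffeology:
  "plot (prod_diffeology D D') n U f \<longleftrightarrow> plot D n U (\<lambda>x. fst (f x)) \<and> plot D' n U (\<lambda>x. snd (f x))"
  and dcarrier_prod_diffeology: "dcarrier (prod_diffeology D D') = dcarrier D \<times> dcarrier D'"
  by (simp_all add: prod_diffeology_def comp_def)

lemma diffeological_space_prod:
  assumes D: "diffeological_space D" and D': "diffeological_space D'"
  shows "diffeological_space (prod_diffeology D D')"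
proof (rule diffeological_spaceI, unfold plot_prod_diffeology dcarrier_prod_diffeology)
  fix n U f assume f: "plot D n U (\<lambda>x. fst (f x)) \<and> plot D' n U (\<lambda>x. snd (f x))"
  then show "openin (Euclidean_space n) U" using plot_open[OF D] by blast
  fix x assume "x \<in> U"
  then show "f x \<in> dcarrier D \<times> dcarrier D'"
    using f plot_in[OF D, of n U "\<lambda>x. fst (f x)" x] plot_in[OF D', of n U "\<lambda>x. snd (f x)" x]
    by (simp add: mem_Times_iff)
next
  fix n U x assume "openin (Euclidean_space n) U" "x \<in> dcarrier D \<times> dcarrier D'"
  then show "plot D n U (\<lambda>_. fst x) \<and> plot D' n U (\<lambda>_. snd x)"
    using plot_const[OF D] plot_const[OF D'] by auto
next
  fix n U f assume U: "openin (Euclidean_space n) U"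
    and loc: "\<And>x. x \<in> U \<Longrightarrow> \<exists>V. x \<in> V \<and> V \<subseteq> U \<and> plot D n V (\<lambda>x. fst (f x)) \<and> plot D' n V (\<lambda>x. snd (f x))"
  show "plot D n U (\<lambda>x. fst (f x)) \<and> plot D' n U (\<lambda>x. snd (f x))"
  proof
    show "plot D n U (\<lambda>x. fst (f x))"
    proof (rule plot_local[OF D U])
      fix x assume "x \<in> U"
      from loc[OF this] show "\<exists>V. x \<in> V \<and> V \<subseteq> U \<and> plot D n V (\<lambda>x. fst (f x))" by (elim exE conjE) (intro exI conjI)
    qed
    show "plot D' n U (\<lambda>x. snd (f x))"
    proof (rule plot_local[OF D' U])
      fix x assume "x \<in> U"
      from loc[OF this] show "\<exists>V. x \<in> V \<and> V \<subseteq> U \<and> plot D' n V (\<lambda>x. snd (f x))" by (elim exE conjE) (intro exI conjI)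
    qed
  qed
next
  fix n m U V f f' h
  assume f: "plot D m V (\<lambda>x. fst (f x)) \<and> plot D' m V (\<lambda>x. snd (f x))" and h: "smooth_euc n m U h" "h ` U \<subseteq> V"
    and eq: "\<And>x. x \<in> U \<Longrightarrow> f' x = f (h x)"
  show "plot D n U (\<lambda>x. fst (f' x)) \<and> plot D' n U (\<lambda>x. snd (f' x))"
    by (rule conjI, rule plot_compose[OF D conjunct1[OF f] h], simp add: eq,
        rule plot_compose[OF D' conjunct2[OF f] h], simp add: eq)
qed

lemma plot_induced_diffeology:
  "plot (induced_diffeology A j D) n U f \<longleftrightarrow> f ` U \<subseteq> A \<and> plot D n U (\<lambda>x. j (f x))"
  and dcarrier_induced_diffeology: "dcarrier (induced_diffeology A j D) = A"
  by (simp_all add: induced_diffeology_def comp_def)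

lemma diffeological_space_induced:
  assumes D: "diffeological_space D" and j: "j ` A \<subseteq> dcarrier D"
  shows "diffeological_space (induced_diffeology A j D)"
proof (rule diffeological_spaceI, unfold plot_induced_diffeology dcarrier_induced_diffeology)
  fix n U f assume f: "f ` U \<subseteq> A \<and> plot D n U (\<lambda>x. j (f x))"
  then show "openin (Euclidean_space n) U" using plot_open[OF D] by blast
  fix x assume "x \<in> U"
  then show "f x \<in> A" using f by blast
next
  fix n U x assume "openin (Euclidean_space n) U" "x \<in> A"
  then show "(\<lambda>_. x) ` U \<subseteq> A \<and> plot D n U (\<lambda>_. j x)" using plot_const[OF D] j by auto
next
  fix n U f assume U: "openin (Euclidean_space n) U"
    and loc: "\<And>x. x \<in> U \<Longrightarrow> \<exists>V. x \<in> V \<and> V \<subseteq> U \<and> f ` V \<subseteq> A \<and> plot D n V (\<lambda>x. j (f x))"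
  show "f ` U \<subseteq> A \<and> plot D n U (\<lambda>x. j (f x))"
  proof
    show "f ` U \<subseteq> A"
    proof
      fix y assume "y \<in> f ` U"
      then obtain x where x: "x \<in> U" "y = f x" by auto
      from loc[OF x(1)] obtain V where "x \<in> V" "f ` V \<subseteq> A" by (elim exE conjE)
      then show "y \<in> A" using x(2) by auto
    qed
    show "plot D n U (\<lambda>x. j (f x))"
    proof (rule plot_local[OF D U])
      fix x assume "x \<in> U"
      from loc[OF this] show "\<exists>V. x \<in> V \<and> V \<subseteq> U \<and> plot D n V (\<lambda>x. j (f x))" by (elim exE conjE) (intro exI conjI)
    qed
  qed
next
  fix n m U V f f' h
  assume f: "f ` V \<subseteq> A \<and> plot D m V (\<lambda>x. j (f x))" and h: "smooth_euc n m U h" "h ` U \<subseteq> V"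
    and eq: "\<And>x. x \<in> U \<Longrightarrow> f' x = f (h x)"
  have "plot D n U (\<lambda>x. j (f' x))" by (rule plot_compose[OF D conjunct2[OF f] h]) (simp add: eq)
  moreover have "f' ` U \<subseteq> A" using f h(2) eq by auto
  ultimately show "f' ` U \<subseteq> A \<and> plot D n U (\<lambda>x. j (f' x))" by blast
qed

lemma plot_sub_diffeology:
  "plot (sub_diffeology A D) n U f \<longleftrightarrow> f ` U \<subseteq> A \<and> plot D n U f"
  and dcarrier_sub_diffeology: "dcarrier (sub_diffeology A D) = A"
  by (simp_all add: sub_diffeology_def plot_induced_diffeology dcarrier_induced_diffeology)

lemma diffeological_space_sub:
  "diffeological_space D \<Longrightarrow> A \<subseteq> dcarrier D \<Longrightarrow> diffeological_space (sub_diffeology A D)"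
  unfolding sub_diffeology_def by (rule diffeological_space_induced) auto

lemma plot_quotient_diffeology:
  "plot (quotient_diffeology D r) n U f \<longleftrightarrow> openin (Euclidean_space n) U \<and>
     (\<forall>x\<in>U. \<exists>V q. x \<in> V \<and> V \<subseteq> U \<and> plot D n V q \<and> (\<forall>y\<in>V. f y = r `` {q y}))"
  and dcarrier_quotient_diffeology: "dcarrier (quotient_diffeology D r) = dcarrier D // r"
  by (simp_all add: quotient_diffeology_def)

lemma plot_quotientI:
  assumes "openin (Euclidean_space n) U" "\<And>x. x \<in> U \<Longrightarrow> \<exists>V q. x \<in> V \<and> V \<subseteq> U \<and> plot D n V q \<and> (\<forall>y\<in>V. f y = r `` {q y})"
  shows "plot (quotient_diffeology D r) n U f"
  unfolding plot_quotient_diffeology using assms by simp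

lemma plot_quotientE:
  assumes "plot (quotient_diffeology D r) n U f" "x \<in> U"
  obtains V q where "x \<in> V" "V \<subseteq> U" "plot D n V q" "\<forall>y\<in>V. f y = r `` {q y}"
proof -
  have "\<exists>V q. x \<in> V \<and> V \<subseteq> U \<and> plot D n V q \<and> (\<forall>y\<in>V. f y = r `` {q y})"
    using assms unfolding plot_quotient_diffeology by simp
  then show thesis by (elim exE conjE) (rule that)
qed

lemma diffeological_space_quotient:
  assumes D: "diffeological_space D"
  shows "diffeological_space (quotient_diffeology D r)"
proof (rule diffeological_spaceI)
  fix n U f assume f: "plot (quotient_diffeology D r) n U f"
  show "openin (Euclidean_space n) U" using f by (simp add: plot_quotient_diffeology)
  fix x assume x: "x \<in> U"
  obtain V q where "x \<in> V" "V \<subseteq> U" "plot D n V q" "\<forall>y\<in>V. f y = r `` {q y}" by (rule plot_quotientE[OF f x])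
  then show "f x \<in> dcarrier (quotient_diffeology D r)"
    using plot_in[OF D, of n V q x] by (simp add: dcarrier_quotient_diffeology quotientI)
next
  fix n U z assume U: "openin (Euclidean_space n) U" and "z \<in> dcarrier (quotient_diffeology D r)"
  then obtain x where x: "x \<in> dcarrier D" "z = r `` {x}"
    unfolding dcarrier_quotient_diffeology by (auto elim: quotientE)
  show "plot (quotient_diffeology D r) n U (\<lambda>_. z)"
    by (rule plot_quotientI[OF U], rule exI[of _ U], rule exI[of _ "\<lambda>_. x"])
      (simp add: x(2) plot_const[OF D U x(1)])
next
  fix n U f assume U: "openin (Euclidean_space n) U"
    and loc: "\<And>x. x \<in> U \<Longrightarrow> \<exists>V. x \<in> V \<and> V \<subseteq> U \<and> plot (quotient_diffeology D r) n V f"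
  show "plot (quotient_diffeology D r) n U f"
  proof (rule plot_quotientI[OF U])
    fix x assume x: "x \<in> U"
    from loc[OF x] obtain V where V: "x \<in> V" "V \<subseteq> U" "plot (quotient_diffeology D r) n V f" by (elim exE conjE)
    obtain V' q where V': "x \<in> V'" "V' \<subseteq> V" "plot D n V' q" "\<forall>y\<in>V'. f y = r `` {q y}" by (rule plot_quotientE[OF V(3,1)])
    show "\<exists>V q. x \<in> V \<and> V \<subseteq> U \<and> plot D n V q \<and> (\<forall>y\<in>V. f y = r `` {q y})"
      by (rule exI[of _ V'], rule exI[of _ q]) (use V V' in simp)
  qed
next
  fix n m U V f f' h
  assume f: "plot (quotient_diffeology D r) m V f" and h: "smooth_euc n m U h" "h ` U \<subseteq> V"
    and eq: "\<And>x. x \<in> U \<Longrightarrow> f' x = f (h x)"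
  show "plot (quotient_diffeology D r) n U f'"
  proof (rule plot_quotientI[OF smooth_euc_open[OF h(1)]])
    fix x assume x: "x \<in> U"
    then have "h x \<in> V" using h(2) by auto
    then obtain V' q where V': "h x \<in> V'" "V' \<subseteq> V" "plot D m V' q" "\<forall>y\<in>V'. f y = r `` {q y}" by (rule plot_quotientE[OF f])
    let ?U = "{y \<in> U. h y \<in> V'}"
    have U': "openin (Euclidean_space n) ?U"
      by (rule smooth_euc_preimage_open[OF h(1) plot_open[OF D V'(3)]])
    have "plot D n ?U (\<lambda>y. q (h y))"
      by (rule plot_compose[OF D V'(3) smooth_euc_subset[OF h(1) U']]) auto
    then show "\<exists>V q. x \<in> V \<and> V \<subseteq> U \<and> plot D n V q \<and> (\<forall>y\<in>V. f' y = r `` {q y})"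
      using x V' eq by (intro exI[of _ ?U] exI[of _ "\<lambda>y. q (h y)"]) simp
  qed
qed

lemma dsmoothI:
  assumes "\<And>x. x \<in> dcarrier D \<Longrightarrow> f x \<in> dcarrier D'"
    "\<And>n U q. plot D n U q \<Longrightarrow> plot D' n U (\<lambda>x. f (q x))"
  shows "dsmooth D D' f"
  using assms by (auto simp: dsmooth_def comp_def)

lemma diffeological_groupoid_discrete:
  assumes D: "diffeological_space D"
  shows "diffeological_groupoid (discrete_dgroupoid D)"
proof -
  have id: "dsmooth D D (\<lambda>x. x)" by (rule dsmoothI)
  moreover have "dsmooth (sub_diffeology (gcomposable (discrete_dgroupoid D)) (prod_diffeology D D)) D (\<lambda>(\<gamma>, \<delta>). \<gamma>)"
  proof (rule dsmoothI)
    fix z assume "z \<in> dcarrier (sub_diffeology (gcomposable (discrete_dgroupoid D)) (prod_diffeology D D))"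
    then show "(case z of (\<gamma>, \<delta>) \<Rightarrow> \<gamma>) \<in> dcarrier D"
      by (auto simp: dcarrier_sub_diffeology gcomposable_def discrete_dgroupoid_def)
  next
    fix n U q assume "plot (sub_diffeology (gcomposable (discrete_dgroupoid D)) (prod_diffeology D D)) n U q"
    then show "plot D n U (\<lambda>x. case q x of (\<gamma>, \<delta>) \<Rightarrow> \<gamma>)"
      by (simp add: plot_sub_diffeology plot_prod_diffeology case_prod_beta)
  qed
  ultimately show ?thesis
    using D unfolding diffeological_groupoid_def
    by (auto simp: discrete_dgroupoid_def gcomposable_def intro!: exI[of _ "\<lambda>x. x"])
qed

section \<open>Quasi-actions up to defects\<close>

definition finite_sums :: "'a::comm_monoid_add set \<Rightarrow> 'a set" where
  "finite_sums K = {x. \<exists>(n::nat) k. (\<forall>i<n. k i \<in> K) \<and> x = (\<Sum>i<n. k i)}"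

lemma finite_sums_zero: "0 \<in> finite_sums K"
  unfolding finite_sums_def by (rule CollectI, rule exI[of _ 0]) simp

lemma finite_sums_base: "x \<in> K \<Longrightarrow> x \<in> finite_sums K"
  unfolding finite_sums_def by (rule CollectI, rule exI[of _ 1], rule exI[of _ "\<lambda>_. x"]) simp

lemma sum_lessThan_append:
  fixes f :: "nat \<Rightarrow> 'a::comm_monoid_add"
  shows "(\<Sum>i<n + m. if i < n then f i else h (i - n)) = (\<Sum>i<n. f i) + (\<Sum>i<m. h i)"
proof -
  have "(\<Sum>i<n + m. if i < n then f i else h (i - n)) = (\<Sum>i<n. f i) + (\<Sum>i\<in>{n..<n + m}. h (i - n))"
    using sum.union_disjoint[of "{..<n}" "{n..<n + m}" "\<lambda>i. if i < n then f i else h (i - n)"]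
    by (simp add: ivl_disj_un ivl_disj_int)
  also have "(\<Sum>i\<in>{n..<n + m}. h (i - n)) = (\<Sum>i<m. h i)"
    by (rule sum.reindex_bij_witness[of _ "\<lambda>i. i + n" "\<lambda>i. i - n"]) auto
  finally show ?thesis .
qed

lemma finite_sums_add:
  assumes "x \<in> finite_sums K" "y \<in> finite_sums K"
  shows "x + y \<in> finite_sums K"
proof -
  obtain n :: nat and k where k: "\<forall>i<n. k i \<in> K" "x = (\<Sum>i<n. k i)" using assms(1) unfolding finite_sums_def by blast
  obtain m :: nat and l where l: "\<forall>i<m. l i \<in> K" "y = (\<Sum>i<m. l i)" using assms(2) unfolding finite_sums_def by blast
  have "x + y = (\<Sum>i<n + m. if i < n then k i else l (i - n))" unfolding k l by (rule sum_lessThan_append[symmetric])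
  moreover have "\<forall>i<n + m. (if i < n then k i else l (i - n)) \<in> K" using k(1) l(1) by auto
  ultimately show ?thesis unfolding finite_sums_def mem_Collect_eq
    by (intro exI[of _ "n + m"] exI[of _ "\<lambda>i. if i < n then k i else l (i - n)"] conjI)
qed

lemma finite_sums_induct [consumes 1, case_names zero add]:
  assumes "x \<in> finite_sums K" "Q 0" "\<And>x k. x \<in> finite_sums K \<Longrightarrow> Q x \<Longrightarrow> k \<in> K \<Longrightarrow> Q (x + k)"
  shows "Q x"
proof -
  obtain n :: nat and k where k: "\<forall>i<n. k i \<in> K" "x = (\<Sum>i<n. k i)" using assms(1) unfolding finite_sums_def by blast
  have "(\<Sum>i<l. k i) \<in> finite_sums K \<and> Q (\<Sum>i<l. k i)" if "l \<le> n" for l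
    using that
  proof (induction l)
    case 0
    show ?case unfolding lessThan_0 sum.empty by (intro conjI finite_sums_zero assms(2))
  next
    case (Suc l)
    then have kl: "k l \<in> K" and IH: "(\<Sum>i<l. k i) \<in> finite_sums K" "Q (\<Sum>i<l. k i)" using k(1) by simp_all
    show ?case unfolding sum.lessThan_Suc
      by (rule conjI[OF finite_sums_add[OF IH(1) finite_sums_base[OF kl]] assms(3)[OF IH kl]])
  qed
  then show ?thesis using k(2) by blast
qed

text \<open>
  Linear maps \<open>\<tau>\<close> along the arrows of the action groupoid which need not preserve
  composition, such as \<open>\<tau>\<^sup>0\<close> and \<open>\<tau>\<^sup>1\<close>. Their defects of functoriality span subspaces which \<open>\<tau>\<close> maps
  into each other, so that \<open>\<tau>\<close> becomes functorial on the quotients.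
\<close>

locale quasi_action = principal_bundle_with_connection X H B
  for X :: "('x, 'g) lgroupoid" and H :: "'g \<Rightarrow> 'g tvec set" and B :: "('x, 'g, 'p, 'm) pbundle" +
  fixes T :: "'p \<Rightarrow> 'c tvec set" and \<tau> :: "'p \<Rightarrow> 'g \<Rightarrow> 'c tvec \<Rightarrow> 'c tvec"
  assumes T_zero: "0 \<in> T p"
    and T_add: "u \<in> T p \<Longrightarrow> u' \<in> T p \<Longrightarrow> u + u' \<in> T p"
    and T_scale: "u \<in> T p \<Longrightarrow> tscale r u \<in> T p"
    and tau_in: "(p, g) \<in> action_domain X B \<Longrightarrow> u \<in> T p \<Longrightarrow> \<tau> p g u \<in> T (pact B p g)"
    and tau_add: "(p, g) \<in> action_domain X B \<Longrightarrow> u \<in> T p \<Longrightarrow> u' \<in> T p \<Longrightarrow> \<tau> p g (u + u') = \<tau> p g u + \<tau> p g u'"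
    and tau_scale: "(p, g) \<in> action_domain X B \<Longrightarrow> u \<in> T p \<Longrightarrow> \<tau> p g (tscale r u) = tscale r (\<tau> p g u)"
begin

definition defect_generators :: "'p \<Rightarrow> 'c tvec set" where
  "defect_generators q = {\<tau> p (lmul X g h) u - \<tau> (pact B p g) h (\<tau> p g u) | p g h u.
     (p, g) \<in> action_domain X B \<and> (g, h) \<in> composable X \<and> u \<in> T p \<and> q = pact B (pact B p g) h}"

text \<open>The generators are closed under scalar multiplication, so their finite sums form a subspace.\<close>

definition defects :: "'p \<Rightarrow> 'c tvec set" where
  "defects q = finite_sums (defect_generators q)"

lemma defect_generatorsI:
  assumes "(p, g) \<in> action_domain X B" "(g, h) \<in> composable X" "u \<in> T p" "q = pact B (pact B p g) h"
  shows "\<tau> p (lmul X g h) u - \<tau> (pact B p g) h (\<tau> p g u) \<in> defect_generators q"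
  unfolding defect_generators_def using assms by blast

lemma defect_generatorsE:
  assumes "x \<in> defect_generators q"
  obtains p g h u where "(p, g) \<in> action_domain X B" "(g, h) \<in> composable X" "u \<in> T p"
    "q = pact B (pact B p g) h" "x = \<tau> p (lmul X g h) u - \<tau> (pact B p g) h (\<tau> p g u)"
  using assms unfolding defect_generators_def by blast

lemma T_uminus: "u \<in> T p \<Longrightarrow> - u \<in> T p"
  using T_scale[of u p "-1"] by (simp only: tscale_minus_one)

lemma T_diff: "u \<in> T p \<Longrightarrow> u' \<in> T p \<Longrightarrow> u - u' \<in> T p"
  using T_add[OF _ T_uminus, of u p u'] by (simp only: add_uminus_conv_diff)

lemma tau_uminus: "(p, g) \<in> action_domain X B \<Longrightarrow> u \<in> T p \<Longrightarrow> \<tau> p g (- u) = - \<tau> p g u"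
  using tau_scale[of p g u "-1"] by (simp only: tscale_minus_one)

lemma tau_diff:
  "(p, g) \<in> action_domain X B \<Longrightarrow> u \<in> T p \<Longrightarrow> u' \<in> T p \<Longrightarrow> \<tau> p g (u - u') = \<tau> p g u - \<tau> p g u'"
  using tau_add[OF _ _ T_uminus, of p g u u'] tau_uminus[of p g u'] by (simp only: add_uminus_conv_diff)

lemma tau_zero: "(p, g) \<in> action_domain X B \<Longrightarrow> \<tau> p g 0 = 0"
  using tau_scale[OF _ T_zero, of p g 0] by (simp only: tscale_simps)

lemma defects_zero: "0 \<in> defects q"
  unfolding defects_def by (rule finite_sums_zero)

lemma defects_add: "x \<in> defects q \<Longrightarrow> y \<in> defects q \<Longrightarrow> x + y \<in> defects q"
  unfolding defects_def by (rule finite_sums_add)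

lemma tscale_diff: "tscale r (\<xi> - \<eta>) = tscale r \<xi> - tscale r \<eta>"
  by (auto simp: tscale_def fun_eq_iff right_diff_distrib)

lemma defect_generators_scale:
  assumes "x \<in> defect_generators q"
  shows "tscale r x \<in> defect_generators q"
proof -
  obtain p g h u where a: "(p, g) \<in> action_domain X B" "(g, h) \<in> composable X" "u \<in> T p"
    and q: "q = pact B (pact B p g) h" and x: "x = \<tau> p (lmul X g h) u - \<tau> (pact B p g) h (\<tau> p g u)"
    using defect_generatorsE[OF assms] .
  have "tscale r x = \<tau> p (lmul X g h) (tscale r u) - \<tau> (pact B p g) h (\<tau> p g (tscale r u))"
    unfolding x tscale_diff tau_scale[OF a(1,3)] tau_scale[OF mul_in_domain[OF a(1,2)] a(3)]
      tau_scale[OF act_in_domain[OF a(1,2)] tau_in[OF a(1,3)]] ..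
  then show ?thesis using defect_generatorsI[OF a(1,2) T_scale[OF a(3)] q] by simp
qed

lemma defects_scale:
  assumes "x \<in> defects q"
  shows "tscale r x \<in> defects q"
  using assms unfolding defects_def
proof (induction rule: finite_sums_induct)
  case zero
  show ?case unfolding tscale_simps by (rule finite_sums_zero)
next
  case (add x k)
  show ?case unfolding tscale_add
    by (rule finite_sums_add[OF add(3) finite_sums_base[OF defect_generators_scale[OF add(2)]]])
qed

lemma defects_uminus: "x \<in> defects q \<Longrightarrow> - x \<in> defects q"
  using defects_scale[of x q "-1"] by (simp only: tscale_minus_one)

lemma defects_diff: "x \<in> defects q \<Longrightarrow> y \<in> defects q \<Longrightarrow> x - y \<in> defects q"
  using defects_add[OF _ defects_uminus, of x q y] by (simp only: add_uminus_conv_diff)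

lemma defects_diff_commute: "x - y \<in> defects q \<Longrightarrow> y - x \<in> defects q"
  using defects_uminus[of "x - y" q] by (simp only: minus_diff_eq)

lemma defects_diff_trans: "x - y \<in> defects q \<Longrightarrow> y - z \<in> defects q \<Longrightarrow> x - z \<in> defects q"
  using defects_add[of "x - y" q "y - z"] by (simp only: diff_add_cancel add_diff_eq)

lemma defect_generators_in:
  assumes "x \<in> defect_generators q"
  shows "x \<in> T q"
proof -
  obtain p g h u where a: "(p, g) \<in> action_domain X B" "(g, h) \<in> composable X" "u \<in> T p"
    and q: "q = pact B (pact B p g) h" and x: "x = \<tau> p (lmul X g h) u - \<tau> (pact B p g) h (\<tau> p g u)"
    using defect_generatorsE[OF assms] .
  have "\<tau> p (lmul X g h) u \<in> T q"
    using tau_in[OF mul_in_domain[OF a(1,2)] a(3)] unfolding q act_act[OF a(1,2)] .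
  moreover have "\<tau> (pact B p g) h (\<tau> p g u) \<in> T q"
    unfolding q by (rule tau_in[OF act_in_domain[OF a(1,2)] tau_in[OF a(1,3)]])
  ultimately show ?thesis unfolding x by (rule T_diff)
qed

lemma defects_in:
  assumes "x \<in> defects q"
  shows "x \<in> T q"
  using assms unfolding defects_def
proof (induction rule: finite_sums_induct)
  case zero show ?case by (rule T_zero)
next
  case (add x k)
  show ?case by (rule T_add[OF add(3) defect_generators_in[OF add(2)]])
qed

text \<open>
  For \<open>w = \<tau>\<^sub>g u\<close>, the image of a defect is a combination of three defects:
  \<open>\<tau>\<^sub>k(\<tau>\<^sub>g\<^sub>hu - \<tau>\<^sub>hw) = (\<tau>\<^sub>h\<^sub>kw - \<tau>\<^sub>k\<tau>\<^sub>hw) + (\<tau>\<^sub>g\<^sub>h\<^sub>ku - \<tau>\<^sub>h\<^sub>kw) - (\<tau>\<^sub>g\<^sub>h\<^sub>ku - \<tau>\<^sub>k\<tau>\<^sub>g\<^sub>hu)\<close>.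
\<close>

lemma tau_defect_generator:
  assumes qk: "(q, k) \<in> action_domain X B" and x: "x \<in> defect_generators q"
  shows "\<tau> q k x \<in> defects (pact B q k)"
proof -
  obtain p g h u where pg: "(p, g) \<in> action_domain X B" and gh: "(g, h) \<in> composable X" and u: "u \<in> T p"
    and q: "q = pact B (pact B p g) h" and x: "x = \<tau> p (lmul X g h) u - \<tau> (pact B p g) h (\<tau> p g u)"
    using defect_generatorsE[OF x] .
  let ?w = "\<tau> p g u" let ?pg = "pact B p g"
  have w: "?w \<in> T ?pg" by (rule tau_in[OF pg u])
  have pgh: "(?pg, h) \<in> action_domain X B" by (rule act_in_domain[OF pg gh])
  have pm: "(p, lmul X g h) \<in> action_domain X B" by (rule mul_in_domain[OF pg gh])
  have q': "q = pact B p (lmul X g h)" unfolding q by (rule act_act[OF pg gh])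
  have hk: "(h, k) \<in> composable X" using composable_of_domain[OF pgh] qk q by simp
  have mk: "(lmul X g h, k) \<in> composable X" using composable_of_domain[OF pm] qk q' by simp
  have ghk: "(g, lmul X h k) \<in> composable X"
    by (rule composable_of_domain[OF pg mul_in_domain[OF pgh hk]])
  have assoc: "lmul X (lmul X g h) k = lmul X g (lmul X h k)" by (rule mul_assoc[OF gh hk])
  have 1: "\<tau> ?pg (lmul X h k) ?w - \<tau> q k (\<tau> ?pg h ?w) \<in> defect_generators (pact B q k)"
    using defect_generatorsI[OF pgh hk w refl] unfolding q .
  have 2: "\<tau> p (lmul X g (lmul X h k)) u - \<tau> ?pg (lmul X h k) ?w \<in> defect_generators (pact B q k)"
    by (rule defect_generatorsI[OF pg ghk u]) (simp add: q act_act[OF pgh hk])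
  have 3: "\<tau> p (lmul X g (lmul X h k)) u - \<tau> q k (\<tau> p (lmul X g h) u) \<in> defect_generators (pact B q k)"
    using defect_generatorsI[OF pm mk u refl] unfolding assoc q'[symmetric] .
  have mT: "\<tau> p (lmul X g h) u \<in> T q" unfolding q' by (rule tau_in[OF pm u])
  have hT: "\<tau> ?pg h ?w \<in> T q" unfolding q by (rule tau_in[OF pgh w])
  have "\<tau> q k x = ((\<tau> ?pg (lmul X h k) ?w - \<tau> q k (\<tau> ?pg h ?w)) +
      (\<tau> p (lmul X g (lmul X h k)) u - \<tau> ?pg (lmul X h k) ?w)) -
      (\<tau> p (lmul X g (lmul X h k)) u - \<tau> q k (\<tau> p (lmul X g h) u))"
    unfolding x tau_diff[OF qk mT hT] by (simp only: algebra_simps)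
  also have "\<dots> \<in> defects (pact B q k)"
    using finite_sums_base[OF 1] finite_sums_base[OF 2] finite_sums_base[OF 3] unfolding defects_def[symmetric]
    by (intro defects_diff[OF defects_add])
  finally show ?thesis .
qed

lemma tau_defects:
  assumes qk: "(q, k) \<in> action_domain X B" and x: "x \<in> defects q"
  shows "\<tau> q k x \<in> defects (pact B q k)"
proof -
  have "x \<in> finite_sums (defect_generators q)" using x by (simp only: defects_def)
  then show ?thesis
  proof (induction rule: finite_sums_induct)
    case zero
    show ?case unfolding tau_zero[OF qk] by (rule defects_zero)
  next
    case (add x k')
    have "x \<in> T q" by (rule defects_in) (simp only: defects_def add(1))
    then show ?case
      unfolding tau_add[OF qk \<open>x \<in> T q\<close> defect_generators_in[OF add(2)]]
      by (intro defects_add[OF add(3) tau_defect_generator[OF qk add(2)]])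
  qed
qed

lemma tau_cong:
  assumes pg: "(p, g) \<in> action_domain X B" and u: "u \<in> T p" "u' \<in> T p" and d: "u - u' \<in> defects p"
  shows "\<tau> p g u - \<tau> p g u' \<in> defects (pact B p g)"
  using tau_defects[OF pg d] unfolding tau_diff[OF pg u] .

lemma tau_mul:
  assumes "(p, g) \<in> action_domain X B" "(g, h) \<in> composable X" "u \<in> T p"
  shows "\<tau> p (lmul X g h) u - \<tau> (pact B p g) h (\<tau> p g u) \<in> defects (pact B (pact B p g) h)"
  unfolding defects_def by (rule finite_sums_base[OF defect_generatorsI[OF assms refl]])

lemma defectsE:
  assumes "x \<in> defects q"
  obtains n :: nat and ps gs hs us where
    "\<forall>i<n. (ps i, gs i) \<in> action_domain X B \<and> (gs i, hs i) \<in> composable X \<and> us i \<in> T (ps i) \<and>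
       q = pact B (pact B (ps i) (gs i)) (hs i)"
    "x = (\<Sum>i<n. \<tau> (ps i) (lmul X (gs i) (hs i)) (us i) - \<tau> (pact B (ps i) (gs i)) (hs i) (\<tau> (ps i) (gs i) (us i)))"
proof -
  obtain n :: nat and k where k: "\<forall>i<n. k i \<in> defect_generators q" "x = (\<Sum>i<n. k i)"
    using assms unfolding defects_def finite_sums_def by blast
  let ?R = "\<lambda>i (p, g, h, u). (p, g) \<in> action_domain X B \<and> (g, h) \<in> composable X \<and> u \<in> T p \<and>
      q = pact B (pact B p g) h \<and> k i = \<tau> p (lmul X g h) u - \<tau> (pact B p g) h (\<tau> p g u)"
  have "\<forall>i\<in>{..<n}. \<exists>z. ?R i z"
  proof
    fix i assume "i \<in> {..<n}"
    then have "k i \<in> defect_generators q" using k(1) by simp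
    then obtain p g h u where "(p, g) \<in> action_domain X B" "(g, h) \<in> composable X" "u \<in> T p"
      "q = pact B (pact B p g) h" "k i = \<tau> p (lmul X g h) u - \<tau> (pact B p g) h (\<tau> p g u)"
      by (rule defect_generatorsE)
    then show "\<exists>z. ?R i z" by (intro exI[of _ "(p, g, h, u)"]) simp
  qed
  from bchoice[OF this] obtain f where f: "\<forall>i\<in>{..<n}. ?R i (f i)" by (rule exE)
  let ?p = "\<lambda>i. fst (f i)" let ?g = "\<lambda>i. fst (snd (f i))" let ?h = "\<lambda>i. fst (snd (snd (f i)))"
    let ?u = "\<lambda>i. snd (snd (snd (f i)))"
  have f': "(?p i, ?g i) \<in> action_domain X B \<and> (?g i, ?h i) \<in> composable X \<and> ?u i \<in> T (?p i) \<and>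
      q = pact B (pact B (?p i) (?g i)) (?h i) \<and>
      k i = \<tau> (?p i) (lmul X (?g i) (?h i)) (?u i) - \<tau> (pact B (?p i) (?g i)) (?h i) (\<tau> (?p i) (?g i) (?u i))"
    if "i < n" for i
    using f that by (simp add: case_prod_beta)
  show thesis
  proof (rule that[of n ?p ?g ?h ?u])
    show "\<forall>i<n. (?p i, ?g i) \<in> action_domain X B \<and> (?g i, ?h i) \<in> composable X \<and> ?u i \<in> T (?p i) \<and>
        q = pact B (pact B (?p i) (?g i)) (?h i)"
      using f' by blast
    show "x = (\<Sum>i<n. \<tau> (?p i) (lmul X (?g i) (?h i)) (?u i) -
        \<tau> (pact B (?p i) (?g i)) (?h i) (\<tau> (?p i) (?g i) (?u i)))"
      unfolding k(2) using f' by (intro sum.cong refl) simp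
  qed
qed

lemma defectsI:
  assumes "\<forall>i<(n::nat). (ps i, gs i) \<in> action_domain X B \<and> (gs i, hs i) \<in> composable X \<and> us i \<in> T (ps i) \<and>
       q = pact B (pact B (ps i) (gs i)) (hs i)"
    and "x = (\<Sum>i<n. \<tau> (ps i) (lmul X (gs i) (hs i)) (us i) - \<tau> (pact B (ps i) (gs i)) (hs i) (\<tau> (ps i) (gs i) (us i)))"
  shows "x \<in> defects q"
  unfolding defects_def finite_sums_def mem_Collect_eq
proof (intro exI conjI allI impI)
  show "x = (\<Sum>i<n. \<tau> (ps i) (lmul X (gs i) (hs i)) (us i) - \<tau> (pact B (ps i) (gs i)) (hs i) (\<tau> (ps i) (gs i) (us i)))"
    by (rule assms(2))
  fix i assume "i < n"
  then show "\<tau> (ps i) (lmul X (gs i) (hs i)) (us i) - \<tau> (pact B (ps i) (gs i)) (hs i) (\<tau> (ps i) (gs i) (us i))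
      \<in> defect_generators q"
    using assms(1) by (intro defect_generatorsI) simp_all
qed

end

context principal_bundle_with_connection
begin

abbreviation "TX p \<equiv> tangent_space X0 (panchor B p)"
abbreviation "\<tau>0 \<equiv> tau0 X H B"
abbreviation "\<tau>1 p \<equiv> tau1 X H"

lemma quasi_action_tau0: "quasi_action X H B (tangent_space P) \<tau>0"
  by (intro quasi_action.intro quasi_action_axioms.intro principal_bundle_with_connection_axioms
      tangent_space_zero tangent_space_add tangent_space_scale tau0_in tau0_add tau0_scale)

lemma quasi_action_tau1: "quasi_action X H B TX \<tau>1"
proof (intro quasi_action.intro quasi_action_axioms.intro principal_bundle_with_connection_axioms
      tangent_space_zero tangent_space_add tangent_space_scale)
  fix p g and u u' :: "'x tvec" and r
  assume pg: "(p, g) \<in> action_domain X B" and u: "u \<in> TX p"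
  then have g: "g \<in> mcarrier X1" and u1: "u \<in> tangent_space X0 (ltgt X g)" by (simp_all add: action_domain_iff)
  show "\<tau>1 p g u \<in> TX (pact B p g)" unfolding anchor_act[OF pg] by (rule tau1_in[OF g u1])
  show "\<tau>1 p g (tscale r u) = tscale r (\<tau>1 p g u)" by (rule tau1_scale[OF g u1])
  assume "u' \<in> TX p"
  then have "u' \<in> tangent_space X0 (ltgt X g)" using pg by (simp add: action_domain_iff)
  then show "\<tau>1 p g (u + u') = \<tau>1 p g u + \<tau>1 p g u'" by (rule tau1_add[OF g u1])
qed

section \<open>The groupoid \<open>At(P)\<close>\<close>

interpretation q0: quasi_action X H B "tangent_space P" \<tau>0 by (rule quasi_action_tau0)
interpretation q1: quasi_action X H B TX \<tau>1 by (rule quasi_action_tau1)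

abbreviation "Tot \<equiv> At_total X B"
abbreviation "Rel \<equiv> At_rel X H B"
abbreviation "cls \<equiv> At_class X H B"
abbreviation "At \<equiv> At_groupoid X H B"

lemma At_total_iff: "(p, u, v) \<in> Tot \<longleftrightarrow> p \<in> mcarrier P \<and> u \<in> tangent_space P p \<and> v \<in> TX p"
  by (simp add: At_total_def)

text \<open>
  The two sums in the definition of the relation use the same arrows, but one may take \<open>u\<^sub>i = 0\<close> or
  \<open>v\<^sub>i = 0\<close>; so the \<open>u\<close>- and the \<open>v\<close>-component are identified independently.
\<close>

lemma At_rel_iff:
  "((p, u, v), (p', u', v')) \<in> Rel \<longleftrightarrow> (p, u, v) \<in> Tot \<and> (p', u', v') \<in> Tot \<and> p = p' \<and>
     u - u' \<in> q0.defects p \<and> v - v' \<in> q1.defects p"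
proof
  assume "((p, u, v), (p', u', v')) \<in> Rel"
  note r = this[unfolded At_rel_def mem_Collect_eq split_conv]
  note t = r[THEN conjunct1] r[THEN conjunct2, THEN conjunct1] r[THEN conjunct2, THEN conjunct2, THEN conjunct1]
  from r[THEN conjunct2, THEN conjunct2, THEN conjunct2]
  obtain n :: nat and ps gs hs us vs where
    a: "\<forall>i<n. (ps i, gs i) \<in> action_domain X B \<and> (gs i, hs i) \<in> composable X \<and>
           us i \<in> tangent_space P (ps i) \<and> vs i \<in> TX (ps i) \<and> p = pact B (pact B (ps i) (gs i)) (hs i)"
    and u: "u - u' = (\<Sum>i<n. \<tau>0 (ps i) (lmul X (gs i) (hs i)) (us i)
          - \<tau>0 (pact B (ps i) (gs i)) (hs i) (\<tau>0 (ps i) (gs i) (us i)))"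
    and v: "v - v' = (\<Sum>i<n. tau1 X H (lmul X (gs i) (hs i)) (vs i)
          - tau1 X H (hs i) (tau1 X H (gs i) (vs i)))"
    by (elim exE conjE)
  have "u - u' \<in> q0.defects p" by (rule q0.defectsI[where ps = ps, OF _ u]) (use a in simp)
  moreover have "v - v' \<in> q1.defects p" by (rule q1.defectsI[where ps = ps, OF _ v]) (use a in simp)
  ultimately show "(p, u, v) \<in> Tot \<and> (p', u', v') \<in> Tot \<and> p = p' \<and>
     u - u' \<in> q0.defects p \<and> v - v' \<in> q1.defects p" using t by simp
next
  assume "(p, u, v) \<in> Tot \<and> (p', u', v') \<in> Tot \<and> p = p' \<and> u - u' \<in> q0.defects p \<and> v - v' \<in> q1.defects p"
  then have t: "(p, u, v) \<in> Tot" "(p', u', v') \<in> Tot" "p = p'"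
    and u: "u - u' \<in> q0.defects p" and v: "v - v' \<in> q1.defects p" by blast+
  obtain n :: nat and ps gs hs us where
    a: "\<forall>i<n. (ps i, gs i) \<in> action_domain X B \<and> (gs i, hs i) \<in> composable X \<and> us i \<in> tangent_space P (ps i) \<and>
       p = pact B (pact B (ps i) (gs i)) (hs i)"
    and u: "u - u' = (\<Sum>i<n. \<tau>0 (ps i) (lmul X (gs i) (hs i)) (us i)
          - \<tau>0 (pact B (ps i) (gs i)) (hs i) (\<tau>0 (ps i) (gs i) (us i)))"
    by (rule q0.defectsE[OF u])
  obtain m :: nat and ps' gs' hs' vs where
    b: "\<forall>i<m. (ps' i, gs' i) \<in> action_domain X B \<and> (gs' i, hs' i) \<in> composable X \<and> vs i \<in> TX (ps' i) \<and>
       p = pact B (pact B (ps' i) (gs' i)) (hs' i)"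
    and v: "v - v' = (\<Sum>i<m. tau1 X H (lmul X (gs' i) (hs' i)) (vs i)
          - tau1 X H (hs' i) (tau1 X H (gs' i) (vs i)))"
    by (rule q1.defectsE[OF v])
  \<comment> \<open>The two families of arrows are concatenated, with zero vectors on the part that belongs to the other
    component.\<close>
  let ?p = "\<lambda>i. if i < n then ps i else ps' (i - n)" let ?g = "\<lambda>i. if i < n then gs i else gs' (i - n)"
  let ?h = "\<lambda>i. if i < n then hs i else hs' (i - n)"
  let ?u = "\<lambda>i. if i < n then us i else 0" let ?v = "\<lambda>i. if i < n then 0 else vs (i - n)"
  have ab: "(?p i, ?g i) \<in> action_domain X B \<and> (?g i, ?h i) \<in> composable X \<and>
      ?u i \<in> tangent_space P (?p i) \<and> ?v i \<in> TX (?p i) \<and> p = pact B (pact B (?p i) (?g i)) (?h i)"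
    if "i < n + m" for i
    using a[rule_format, of i] b[rule_format, of "i - n"] that by (cases "i < n") (auto simp del: zero_fun_apply)
  have z0: "\<tau>0 q (lmul X g h) 0 - \<tau>0 (pact B q g) h (\<tau>0 q g 0) = 0"
    and z1: "tau1 X H (lmul X g h) 0 - tau1 X H h (tau1 X H g 0) = 0"
    if "(q, g) \<in> action_domain X B" "(g, h) \<in> composable X" for q g h
    using q0.tau_zero[OF that(1)] q0.tau_zero[OF mul_in_domain[OF that]] q0.tau_zero[OF act_in_domain[OF that]]
      q1.tau_zero[OF that(1)] q1.tau_zero[OF mul_in_domain[OF that]] q1.tau_zero[OF act_in_domain[OF that]]
    by (simp_all only: diff_self)
  have su: "u - u' = (\<Sum>i<n + m. \<tau>0 (?p i) (lmul X (?g i) (?h i)) (?u i)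
          - \<tau>0 (pact B (?p i) (?g i)) (?h i) (\<tau>0 (?p i) (?g i) (?u i)))"
  proof -
    have "u - u' = (\<Sum>i<n. \<tau>0 (ps i) (lmul X (gs i) (hs i)) (us i)
          - \<tau>0 (pact B (ps i) (gs i)) (hs i) (\<tau>0 (ps i) (gs i) (us i))) + (\<Sum>i<m. 0)"
      unfolding u by (simp only: sum.neutral_const add_0_right)
    also have "\<dots> = (\<Sum>i<n + m. if i < n then \<tau>0 (ps i) (lmul X (gs i) (hs i)) (us i)
          - \<tau>0 (pact B (ps i) (gs i)) (hs i) (\<tau>0 (ps i) (gs i) (us i)) else 0)"
      by (rule sum_lessThan_append[symmetric])
    also have "\<dots> = (\<Sum>i<n + m. \<tau>0 (?p i) (lmul X (?g i) (?h i)) (?u i)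
          - \<tau>0 (pact B (?p i) (?g i)) (?h i) (\<tau>0 (?p i) (?g i) (?u i)))"
    proof (rule sum.cong[OF refl])
      fix i assume "i \<in> {..<n + m}"
      then have "i < n + m" by simp
      from ab[OF this] show "(if i < n then \<tau>0 (ps i) (lmul X (gs i) (hs i)) (us i)
          - \<tau>0 (pact B (ps i) (gs i)) (hs i) (\<tau>0 (ps i) (gs i) (us i)) else 0) = \<tau>0 (?p i) (lmul X (?g i) (?h i)) (?u i)
          - \<tau>0 (pact B (?p i) (?g i)) (?h i) (\<tau>0 (?p i) (?g i) (?u i))"
        using z0[of "?p i" "?g i" "?h i"] by (cases "i < n") (simp_all only: if_True if_False)
    qed
    finally show ?thesis .
  qed
  have sv: "v - v' = (\<Sum>i<n + m. tau1 X H (lmul X (?g i) (?h i)) (?v i)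
          - tau1 X H (?h i) (tau1 X H (?g i) (?v i)))"
  proof -
    have "v - v' = (\<Sum>i<n. 0) + (\<Sum>i<m. tau1 X H (lmul X (gs' i) (hs' i)) (vs i)
          - tau1 X H (hs' i) (tau1 X H (gs' i) (vs i)))"
      unfolding v by (simp only: sum.neutral_const add_0_left)
    also have "\<dots> = (\<Sum>i<n + m. if i < n then 0 else tau1 X H (lmul X (gs' (i - n)) (hs' (i - n))) (vs (i - n))
          - tau1 X H (hs' (i - n)) (tau1 X H (gs' (i - n)) (vs (i - n))))"
      by (rule sum_lessThan_append[symmetric])
    also have "\<dots> = (\<Sum>i<n + m. tau1 X H (lmul X (?g i) (?h i)) (?v i)
          - tau1 X H (?h i) (tau1 X H (?g i) (?v i)))"
    proof (rule sum.cong[OF refl])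
      fix i assume "i \<in> {..<n + m}"
      then have "i < n + m" by simp
      from ab[OF this] show "(if i < n then 0 else tau1 X H (lmul X (gs' (i - n)) (hs' (i - n))) (vs (i - n))
          - tau1 X H (hs' (i - n)) (tau1 X H (gs' (i - n)) (vs (i - n)))) = tau1 X H (lmul X (?g i) (?h i)) (?v i)
          - tau1 X H (?h i) (tau1 X H (?g i) (?v i))"
        using z1[of "?p i" "?g i" "?h i"] by (cases "i < n") (simp_all only: if_True if_False)
    qed
    finally show ?thesis .
  qed
  show "((p, u, v), (p', u', v')) \<in> Rel"
    unfolding At_rel_def mem_Collect_eq split_conv
    by (rule conjI[OF t(1) conjI[OF t(2) conjI[OF t(3)]]], rule exI[of _ "n + m"], rule exI[of _ ?p],
        rule exI[of _ ?g], rule exI[of _ ?h], rule exI[of _ ?u], rule exI[of _ ?v],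
        rule conjI[OF _ conjI[OF su sv]], intro allI impI, rule ab)
qed

lemma At_relD:
  assumes "(z, z') \<in> Rel"
  shows "z \<in> Tot" "z' \<in> Tot" "fst z' = fst z"
  using assms At_rel_iff[of "fst z" "fst (snd z)" "snd (snd z)" "fst z'" "fst (snd z')" "snd (snd z')"] by simp_all

lemma equiv_At_rel: "equiv Tot Rel"
proof (rule equivI)
  show "Rel \<subseteq> Tot \<times> Tot" using At_relD by auto
  show "refl_on Tot Rel"
  proof (rule refl_onI)
    fix z assume z: "z \<in> Tot"
    obtain p u v where "z = (p, u, v)" by (cases z)
    then show "(z, z) \<in> Rel" using z by (simp only: At_rel_iff diff_self q0.defects_zero q1.defects_zero)
  qed
  show "sym Rel"
  proof (rule symI)
    fix z z' assume a: "(z, z') \<in> Rel"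
    obtain p u v p' u' v' where z: "z = (p, u, v)" "z' = (p', u', v')" by (cases z, cases z')
    show "(z', z) \<in> Rel" using a unfolding z At_rel_iff
      by (elim conjE) (simp only: q0.defects_diff_commute q1.defects_diff_commute)
  qed
  show "trans Rel"
  proof (rule transI)
    fix z z' z'' assume a: "(z, z') \<in> Rel" "(z', z'') \<in> Rel"
    obtain p u v p' u' v' p'' u'' v'' where z: "z = (p, u, v)" "z' = (p', u', v')" "z'' = (p'', u'', v'')"
      by (cases z, cases z', cases z'')
    have b: "(p, u, v) \<in> Tot" "(p'', u'', v'') \<in> Tot" "p = p'" "p' = p''"
      "u - u' \<in> q0.defects p" "u' - u'' \<in> q0.defects p" "v - v' \<in> q1.defects p" "v' - v'' \<in> q1.defects p"
      using a unfolding z At_rel_iff by blast+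
    show "(z, z'') \<in> Rel" unfolding z At_rel_iff
      by (intro conjI b(1,2) q0.defects_diff_trans[OF b(5,6)] q1.defects_diff_trans[OF b(7,8)]) (simp add: b)
  qed
qed

lemma rel_refl: "z \<in> Tot \<Longrightarrow> (z, z) \<in> Rel"
  by (rule equivE[OF equiv_At_rel]) (rule refl_onD)

lemma rel_sym: "(z, z') \<in> Rel \<Longrightarrow> (z', z) \<in> Rel"
  by (rule equivE[OF equiv_At_rel]) (rule symD)

lemma rel_trans: "(z, z') \<in> Rel \<Longrightarrow> (z', z'') \<in> Rel \<Longrightarrow> (z, z'') \<in> Rel"
  by (rule equivE[OF equiv_At_rel]) (rule transD)

subsection \<open>Moving points along arrows\<close>

text \<open>
  The arrows act on representatives, though only up to the relation (\<open>shift_rel\<close>, \<open>shift_shift\<close>).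
\<close>

definition shift :: "('x, 'p) at_point \<Rightarrow> 'g \<Rightarrow> ('x, 'p) at_point" where
  "shift z g = (pact B (fst z) g, \<tau>0 (fst z) g (fst (snd z)), tau1 X H g (snd (snd z)))"

lemma fst_shift: "fst (shift z g) = pact B (fst z) g"
  by (simp add: shift_def)

lemma totalD:
  assumes "z \<in> Tot"
  shows "fst z \<in> mcarrier P" "fst (snd z) \<in> tangent_space P (fst z)" "snd (snd z) \<in> TX (fst z)"
  using assms by (auto simp: At_total_def)

lemma shift_in:
  assumes z: "z \<in> Tot" and g: "(fst z, g) \<in> action_domain X B"
  shows "shift z g \<in> Tot"
  unfolding shift_def At_total_iff
  by (intro conjI act_in[OF g] q0.tau_in[OF g] q1.tau_in[OF g] totalD[OF z])

lemma shift_rel: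
  assumes r: "(z, z') \<in> Rel" and g: "(fst z, g) \<in> action_domain X B"
  shows "(shift z g, shift z' g) \<in> Rel"
proof -
  note t = At_relD[OF r]
  obtain p u v u' v' where z: "z = (p, u, v)" "z' = (p, u', v')" using t(3) by (cases z, cases z') simp
  have g': "(p, g) \<in> action_domain X B" using g z by simp
  have d: "u - u' \<in> q0.defects p" "v - v' \<in> q1.defects p" using r unfolding z At_rel_iff by simp_all
  have "u \<in> tangent_space P p" "u' \<in> tangent_space P p" "v \<in> TX p" "v' \<in> TX p"
    using t(1,2) unfolding z At_total_iff by simp_all
  then have "\<tau>0 p g u - \<tau>0 p g u' \<in> q0.defects (pact B p g)" "tau1 X H g v - tau1 X H g v' \<in> q1.defects (pact B p g)"
    using q0.tau_cong[OF g' _ _ d(1)] q1.tau_cong[OF g' _ _ d(2)] by simp_all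
  moreover have "shift z g \<in> Tot" by (rule shift_in[OF t(1) g])
  moreover have "shift z' g \<in> Tot" by (rule shift_in[OF t(2)]) (simp only: t(3) g)
  ultimately show ?thesis unfolding z shift_def fst_conv snd_conv At_rel_iff by simp
qed

lemma shift_shift:
  assumes z: "z \<in> Tot" and g: "(fst z, g) \<in> action_domain X B" and gh: "(g, h) \<in> composable X"
  shows "(shift (shift z g) h, shift z (lmul X g h)) \<in> Rel"
proof -
  obtain p u v where z': "z = (p, u, v)" by (cases z)
  have g': "(p, g) \<in> action_domain X B" using g z' by simp
  have uv: "u \<in> tangent_space P p" "v \<in> TX p" using z unfolding z' At_total_iff by simp_all
  have 1: "shift (shift z g) h \<in> Tot"
    by (rule shift_in[OF shift_in[OF z g]]) (simp only: fst_shift act_in_domain[OF g gh])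
  have 2: "shift z (lmul X g h) \<in> Tot" by (rule shift_in[OF z mul_in_domain[OF g gh]])
  show ?thesis
    using 1 2 q0.defects_diff_commute[OF q0.tau_mul[OF g' gh uv(1)]] q1.defects_diff_commute[OF q1.tau_mul[OF g' gh uv(2)]]
    unfolding z' shift_def fst_conv snd_conv At_rel_iff act_act[OF g' gh] by simp
qed

lemma shift_unit:
  assumes z: "z \<in> Tot"
  shows "shift z (lunit X (panchor B (fst z))) = z"
proof -
  note d = totalD[OF z]
  show ?thesis unfolding shift_def act_unit[OF d(1)] tau0_unit[OF d(1,2)] tau1_unit[OF anchor_in[OF d(1)] d(3)] by simp
qed

subsection \<open>Objects and arrows\<close>

lemma cls_eq_iff: "z \<in> Tot \<Longrightarrow> z' \<in> Tot \<Longrightarrow> cls z = cls z' \<longleftrightarrow> (z, z') \<in> Rel"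
  unfolding At_class_def by (rule eq_equiv_class_iff[OF equiv_At_rel])

lemma cls_eqI: "(z, z') \<in> Rel \<Longrightarrow> cls z = cls z'"
  unfolding At_class_def by (rule equiv_class_eq[OF equiv_At_rel])

lemma mem_cls: "z' \<in> cls z \<longleftrightarrow> (z, z') \<in> Rel"
  by (simp add: At_class_def)

lemma At_point_cls:
  assumes z: "z \<in> Tot"
  shows "At_point (cls z) = fst z"
  unfolding At_point_def
proof (rule the_equality)
  show "\<exists>u v. (fst z, u, v) \<in> cls z"
    by (rule exI[of _ "fst (snd z)"], rule exI[of _ "snd (snd z)"]) (simp add: mem_cls rel_refl z)
  fix p assume "\<exists>u v. (p, u, v) \<in> cls z"
  then obtain u v where "(z, (p, u, v)) \<in> Rel" unfolding mem_cls by (elim exE)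
  from At_relD(3)[OF this] show "p = fst z" by simp
qed

lemma dcarrier_At_total: "dcarrier (At_total_diffeology X B) = Tot"
  by (simp add: At_total_diffeology_def dcarrier_induced_diffeology)

lemma obj_iff: "w \<in> dcarrier (At_obj X H B) \<longleftrightarrow> (\<exists>z\<in>Tot. w = cls z)"
  by (auto simp: At_obj_def dcarrier_quotient_diffeology dcarrier_At_total quotient_def At_class_def)

lemma cls_obj: "z \<in> Tot \<Longrightarrow> cls z \<in> dcarrier (At_obj X H B)"
  by (auto simp: obj_iff)

lemma dcarrier_At_arr: "(w, g) \<in> dcarrier (At_arr X H B) \<longleftrightarrow>
    w \<in> dcarrier (At_obj X H B) \<and> g \<in> mcarrier X1 \<and> panchor B (At_point w) = ltgt X g"
  by (simp add: At_arr_def dcarrier_sub_diffeology)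

lemma cls_arr: "z \<in> Tot \<Longrightarrow> (fst z, g) \<in> action_domain X B \<Longrightarrow> (cls z, g) \<in> dcarrier (At_arr X H B)"
  by (simp add: dcarrier_At_arr cls_obj At_point_cls action_domain_iff)

lemma arrE:
  assumes "\<gamma> \<in> dcarrier (At_arr X H B)"
  obtains z g where "\<gamma> = (cls z, g)" "z \<in> Tot" "(fst z, g) \<in> action_domain X B"
proof -
  obtain w g where \<gamma>: "\<gamma> = (w, g)" by (cases \<gamma>)
  then have *: "w \<in> dcarrier (At_obj X H B)" "g \<in> mcarrier X1" "panchor B (At_point w) = ltgt X g"
    using assms by (simp_all add: dcarrier_At_arr)
  then obtain z where z: "z \<in> Tot" "w = cls z" unfolding obj_iff by blast
  show thesis by (rule that[OF _ z(1)]) (use \<gamma> z * totalD(1)[OF z(1)] in \<open>simp_all add: action_domain_iff At_point_cls\<close>)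
qed

lemma At_simps:
  "gobj At = At_obj X H B" "garr At = At_arr X H B" "gsrc At = fst"
  "gunit At w = (w, lunit X (panchor B (At_point w)))" "gcomp At (w, g) (w', h) = (w, lmul X g h)"
  by (simp_all add: At_groupoid_def)

lemma gtgt_cls:
  assumes z: "z \<in> Tot" and g: "(fst z, g) \<in> action_domain X B"
  shows "gtgt At (cls z, g) = cls (shift z g)"
proof -
  have "(THE z'. \<exists>p u v. (p, u, v) \<in> cls z \<and> z' = cls (pact B p g, \<tau>0 p g u, tau1 X H g v)) = cls (shift z g)"
  proof (rule the_equality)
    show "\<exists>p u v. (p, u, v) \<in> cls z \<and> cls (shift z g) = cls (pact B p g, \<tau>0 p g u, tau1 X H g v)"
      by (rule exI[of _ "fst z"], rule exI[of _ "fst (snd z)"], rule exI[of _ "snd (snd z)"])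
        (simp add: mem_cls rel_refl z shift_def)
    fix w assume "\<exists>p u v. (p, u, v) \<in> cls z \<and> w = cls (pact B p g, \<tau>0 p g u, tau1 X H g v)"
    then obtain p u v where r: "(z, (p, u, v)) \<in> Rel" and w: "w = cls (shift (p, u, v) g)"
      unfolding mem_cls shift_def fst_conv snd_conv by (elim exE conjE)
    show "w = cls (shift z g)" unfolding w by (rule cls_eqI[OF shift_rel[OF r g], symmetric])
  qed
  then show ?thesis by (simp add: At_groupoid_def)
qed

lemma gtgt_arr:
  assumes z: "z \<in> Tot" and g: "(fst z, g) \<in> action_domain X B" and gh: "(g, h) \<in> composable X"
  shows "gtgt At (cls (shift z g), h) = gtgt At (cls z, lmul X g h)"
proof -
  have h: "(fst (shift z g), h) \<in> action_domain X B" unfolding fst_shift by (rule act_in_domain[OF g gh])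
  show ?thesis
    unfolding gtgt_cls[OF shift_in[OF z g] h] gtgt_cls[OF z mul_in_domain[OF g gh]]
    by (rule cls_eqI[OF shift_shift[OF z g gh]])
qed

lemma gcomposableE:
  assumes "(\<gamma>, \<delta>) \<in> gcomposable At"
  obtains z g h where "\<gamma> = (cls z, g)" "\<delta> = (cls (shift z g), h)" "z \<in> Tot" "(fst z, g) \<in> action_domain X B"
    "(g, h) \<in> composable X"
proof -
  have a: "\<gamma> \<in> dcarrier (At_arr X H B)" "\<delta> \<in> dcarrier (At_arr X H B)" "gtgt At \<gamma> = fst \<delta>"
    using assms by (simp_all add: gcomposable_def At_simps)
  obtain z g where \<gamma>: "\<gamma> = (cls z, g)" and z: "z \<in> Tot" "(fst z, g) \<in> action_domain X B" using arrE[OF a(1)] .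
  obtain z' h where \<delta>: "\<delta> = (cls z', h)" and z': "z' \<in> Tot" "(fst z', h) \<in> action_domain X B" using arrE[OF a(2)] .
  have eq: "cls z' = cls (shift z g)" using a(3) gtgt_cls[OF z] by (simp add: \<gamma> \<delta>)
  have "fst z' = pact B (fst z) g"
    using At_point_cls[OF z'(1)] At_point_cls[OF shift_in[OF z]] eq fst_shift by simp
  then have "(g, h) \<in> composable X" using composable_of_domain[OF z(2)] z'(2) by simp
  then show thesis using that \<gamma> \<delta> z eq by simp
qed

subsection \<open>Smoothness of the structure maps\<close>

lemma plot_At_total:
  "plot (At_total_diffeology X B) k U q \<longleftrightarrow> (\<forall>y\<in>U. q y \<in> Tot) \<and>
     mplot k U (tangent_bundle P) (\<lambda>y. (fst (q y), fst (snd (q y)))) \<and>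
     mplot k U (tangent_bundle X0) (\<lambda>y. (panchor B (fst (q y)), snd (snd (q y))))"
  by (simp add: At_total_diffeology_def plot_induced_diffeology plot_prod_diffeology plot_mfd_diffeology
      case_prod_beta image_subset_iff)

lemma diffeological_space_At_total: "diffeological_space (At_total_diffeology X B)"
  unfolding At_total_diffeology_def
proof (rule diffeological_space_induced[OF diffeological_space_prod[OF
        diffeological_space_tangent_bundle[OF atlas_P] diffeological_space_tangent_bundle[OF atlas_X0]]])
  show "(\<lambda>(p, u, v). ((p, u), panchor B p, v)) ` Tot \<subseteq>
      dcarrier (prod_diffeology (mfd_diffeology (tangent_bundle P)) (mfd_diffeology (tangent_bundle X0)))"
    unfolding dcarrier_prod_diffeology dcarrier_mfd_diffeology
    by (auto simp: At_total_def tangent_bundle_def anchor_in)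
qed

lemma diffeological_space_At_obj: "diffeological_space (At_obj X H B)"
  unfolding At_obj_def by (rule diffeological_space_quotient[OF diffeological_space_At_total])

lemma diffeological_space_At_arr: "diffeological_space (At_arr X H B)"
  unfolding At_arr_def
  by (rule diffeological_space_sub[OF diffeological_space_prod[OF diffeological_space_At_obj diffeological_space_atlas[OF atlas_X1]]])
    (auto simp: dcarrier_prod_diffeology dcarrier_mfd_diffeology)

lemma plot_At_objI:
  assumes "openin (Euclidean_space k) U"
    "\<And>x. x \<in> U \<Longrightarrow> \<exists>V q. x \<in> V \<and> V \<subseteq> U \<and> plot (At_total_diffeology X B) k V q \<and> (\<forall>y\<in>V. f y = cls (q y))"
  shows "plot (At_obj X H B) k U f"
  unfolding At_obj_def by (rule plot_quotientI[OF assms[unfolded At_class_def]])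

lemma plot_At_objE:
  assumes "plot (At_obj X H B) k U f" "x \<in> U"
  obtains V q where "x \<in> V" "V \<subseteq> U" "plot (At_total_diffeology X B) k V q" "\<forall>y\<in>V. f y = cls (q y)"
  using plot_quotientE[OF assms[unfolded At_obj_def], folded At_class_def] .

lemma plot_At_arr:
  "plot (At_arr X H B) k U f \<longleftrightarrow> (\<forall>y\<in>U. f y \<in> dcarrier (At_arr X H B)) \<and>
     plot (At_obj X H B) k U (\<lambda>y. fst (f y)) \<and> mplot k U X1 (\<lambda>y. snd (f y))"
  by (simp add: At_arr_def plot_sub_diffeology plot_prod_diffeology plot_mfd_diffeology
      dcarrier_sub_diffeology image_subset_iff)

lemma plot_At_total_base: "plot (At_total_diffeology X B) k U q \<Longrightarrow> mplot k U P (\<lambda>y. fst (q y))"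
  unfolding plot_At_total by (elim conjE) (rule mplot_tangent_bundleD(1)[OF atlas_P])

lemma plot_shift:
  assumes q: "plot (At_total_diffeology X B) k U q" and g: "mplot k U X1 g"
    and d: "\<And>y. y \<in> U \<Longrightarrow> (fst (q y), g y) \<in> action_domain X B"
  shows "plot (At_total_diffeology X B) k U (\<lambda>y. shift (q y) (g y))"
proof -
  have q': "\<forall>y\<in>U. q y \<in> Tot" "mplot k U (tangent_bundle P) (\<lambda>y. (fst (q y), fst (snd (q y))))"
     "mplot k U (tangent_bundle X0) (\<lambda>y. (panchor B (fst (q y)), snd (snd (q y))))"
    using q unfolding plot_At_total by simp_all
  have "mplot k U (tangent_bundle X0) (\<lambda>y. (ltgt X (g y), snd (snd (q y))))"
    by (rule mplot_cong[OF q'(3)]) (use d in \<open>simp add: action_domain_iff\<close>)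
  from mplot_tau1[OF g this]
  have "mplot k U (tangent_bundle X0) (\<lambda>y. (panchor B (fst (shift (q y) (g y))), snd (snd (shift (q y) (g y)))))"
    by (rule mplot_cong) (simp add: shift_def anchor_act[OF d])
  moreover have "mplot k U (tangent_bundle P) (\<lambda>y. (fst (shift (q y) (g y)), fst (snd (shift (q y) (g y)))))"
    using mplot_tau0[OF q'(2) g d] by (simp add: shift_def)
  moreover have "\<forall>y\<in>U. shift (q y) (g y) \<in> Tot" using q'(1) d by (simp add: shift_in)
  ultimately show ?thesis unfolding plot_At_total by simp
qed

text \<open>
  A plot of objects locally has a smooth family of representatives, which can be moved along a smooth
  family of arrows.
\<close>

lemma plot_gtgt:
  assumes f: "plot (At_arr X H B) k U f"
  shows "plot (At_obj X H B) k U (\<lambda>y. gtgt At (f y))"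
proof (rule plot_At_objI)
  have f': "\<forall>y\<in>U. f y \<in> dcarrier (At_arr X H B)" "plot (At_obj X H B) k U (\<lambda>y. fst (f y))" "mplot k U X1 (\<lambda>y. snd (f y))"
    using f unfolding plot_At_arr by simp_all
  show "openin (Euclidean_space k) U" by (rule mplot_open[OF f'(3)])
  fix x assume x: "x \<in> U"
  obtain V q where V: "x \<in> V" "V \<subseteq> U" and q: "plot (At_total_diffeology X B) k V q" "\<forall>y\<in>V. fst (f y) = cls (q y)"
    by (rule plot_At_objE[OF f'(2) x])
  have qt: "q y \<in> Tot" if "y \<in> V" for y using q(1) that unfolding plot_At_total by simp
  have d: "(fst (q y), snd (f y)) \<in> action_domain X B" if y: "y \<in> V" for y
  proof -
    have "(cls (q y), snd (f y)) \<in> dcarrier (At_arr X H B)"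
      using f'(1) V(2) y q(2)[rule_format, OF y, symmetric] by auto
    then show ?thesis using totalD(1)[OF qt[OF y]] At_point_cls[OF qt[OF y]]
      by (simp add: dcarrier_At_arr action_domain_iff)
  qed
  have "plot (At_total_diffeology X B) k V (\<lambda>y. shift (q y) (snd (f y)))"
    by (rule plot_shift[OF q(1) mplot_subset[OF f'(3) plot_open[OF diffeological_space_At_total q(1)] V(2)] d])
  moreover have "gtgt At (f y) = cls (shift (q y) (snd (f y)))" if y: "y \<in> V" for y
    using gtgt_cls[OF qt[OF y] d[OF y]] q(2)[rule_format, OF y, symmetric] by simp
  ultimately show "\<exists>V q. x \<in> V \<and> V \<subseteq> U \<and> plot (At_total_diffeology X B) k V q \<and> (\<forall>y\<in>V. gtgt At (f y) = cls (q y))"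
    using V by (intro exI[of _ V] exI[of _ "\<lambda>y. shift (q y) (snd (f y))"]) simp
qed

lemma mplot_At_point:
  assumes f: "plot (At_obj X H B) k U f"
  shows "mplot k U P (\<lambda>y. At_point (f y))"
proof (rule mplot_locally)
  show "openin (Euclidean_space k) U" by (rule plot_open[OF diffeological_space_At_obj f])
  fix x assume x: "x \<in> U"
  obtain V q where V: "x \<in> V" "V \<subseteq> U" and q: "plot (At_total_diffeology X B) k V q" "\<forall>y\<in>V. f y = cls (q y)"
    by (rule plot_At_objE[OF f x])
  have "mplot k V P (\<lambda>y. At_point (f y))"
    by (rule mplot_cong[OF plot_At_total_base[OF q(1)]])
      (use q in \<open>simp add: plot_At_total At_point_cls\<close>)
  then show "\<exists>V. x \<in> V \<and> V \<subseteq> U \<and> mplot k V P (\<lambda>y. At_point (f y))" using V by (intro exI[of _ V]) simp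
qed

lemma gtgt_obj: "\<gamma> \<in> dcarrier (At_arr X H B) \<Longrightarrow> gtgt At \<gamma> \<in> dcarrier (At_obj X H B)"
  by (erule arrE) (simp add: gtgt_cls cls_obj shift_in)

lemma dsmooth_gsrc: "dsmooth (At_arr X H B) (At_obj X H B) fst"
  by (rule dsmoothI) (auto simp: dcarrier_At_arr plot_At_arr)

lemma dsmooth_gtgt: "dsmooth (At_arr X H B) (At_obj X H B) (gtgt At)"
  by (rule dsmoothI[OF gtgt_obj plot_gtgt])

lemma gunit_arr:
  assumes "w \<in> dcarrier (At_obj X H B)"
  shows "gunit At w \<in> dcarrier (At_arr X H B)"
proof -
  obtain z where z: "z \<in> Tot" "w = cls z" using assms unfolding obj_iff by blast
  show ?thesis unfolding At_simps z(2) At_point_cls[OF z(1)]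
    by (rule cls_arr[OF z(1) unit_in_domain[OF totalD(1)[OF z(1)]]])
qed

lemma dsmooth_gunit: "dsmooth (At_obj X H B) (At_arr X H B) (gunit At)"
proof (rule dsmoothI[OF gunit_arr])
  fix k U f assume f: "plot (At_obj X H B) k U f"
  note p = mplot_At_point[OF f]
  note a = mplot_compose_smooth[OF atlas_P p smooth_anchor image_subsetI[OF mplot_in[OF p]]]
  note e = mplot_compose_smooth[OF atlas_X0 a smooth_unit image_subsetI[OF mplot_in[OF a]]]
  show "plot (At_arr X H B) k U (\<lambda>y. gunit At (f y))"
    unfolding plot_At_arr
    using gunit_arr plot_in[OF diffeological_space_At_obj f] f e by (simp add: At_simps)
qed

lemma gcomp_arr: "(\<gamma>, \<delta>) \<in> gcomposable At \<Longrightarrow> gcomp At \<gamma> \<delta> \<in> dcarrier (At_arr X H B)"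
  by (erule gcomposableE) (simp add: At_simps cls_arr mul_in_domain)

lemma dsmooth_gcomp:
  "dsmooth (sub_diffeology (gcomposable At) (prod_diffeology (At_arr X H B) (At_arr X H B))) (At_arr X H B)
     (\<lambda>(\<gamma>, \<delta>). gcomp At \<gamma> \<delta>)"
proof (rule dsmoothI)
  fix z assume "z \<in> dcarrier (sub_diffeology (gcomposable At) (prod_diffeology (At_arr X H B) (At_arr X H B)))"
  then show "(case z of (\<gamma>, \<delta>) \<Rightarrow> gcomp At \<gamma> \<delta>) \<in> dcarrier (At_arr X H B)"
    by (cases z) (simp add: dcarrier_sub_diffeology gcomp_arr)
next
  fix k U f assume "plot (sub_diffeology (gcomposable At) (prod_diffeology (At_arr X H B) (At_arr X H B))) k U f"
  then have f: "f ` U \<subseteq> gcomposable At" "plot (At_arr X H B) k U (\<lambda>y. fst (f y))" "plot (At_arr X H B) k U (\<lambda>y. snd (f y))"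
    by (simp_all add: plot_sub_diffeology plot_prod_diffeology)
  have gc: "(fst (f y), snd (f y)) \<in> gcomposable At" if "y \<in> U" for y using f(1) that by auto
  have comp: "(snd (fst (f y)), snd (snd (f y))) \<in> composable X" if "y \<in> U" for y
    by (rule gcomposableE[OF gc[OF that]]) simp
  have eq: "gcomp At (fst (f y)) (snd (f y)) = (fst (fst (f y)), lmul X (snd (fst (f y))) (snd (snd (f y))))" for y
    by (cases "fst (f y)"; cases "snd (f y)") (simp add: At_simps)
  have "plot (At_arr X H B) k U (\<lambda>y. gcomp At (fst (f y)) (snd (f y)))"
    unfolding plot_At_arr
  proof (intro conjI ballI)
    show "gcomp At (fst (f y)) (snd (f y)) \<in> dcarrier (At_arr X H B)" if "y \<in> U" for y
      by (rule gcomp_arr[OF gc[OF that]])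
    show "plot (At_obj X H B) k U (\<lambda>y. fst (gcomp At (fst (f y)) (snd (f y))))"
      using f(2) by (simp add: eq plot_At_arr)
    show "mplot k U X1 (\<lambda>y. snd (gcomp At (fst (f y)) (snd (f y))))"
      using mplot_mul[OF _ _ comp, of k U] f(2,3) by (simp add: eq plot_At_arr)
  qed
  then show "plot (At_arr X H B) k U (\<lambda>y. case f y of (\<gamma>, \<delta>) \<Rightarrow> gcomp At \<gamma> \<delta>)"
    by (simp add: case_prod_beta)
qed

definition At_inv :: "('x, 'p) at_point set \<times> 'g \<Rightarrow> ('x, 'p) at_point set \<times> 'g" where
  "At_inv \<gamma> = (gtgt At \<gamma>, linv X (snd \<gamma>))"

lemma At_inv_cls:
  "z \<in> Tot \<Longrightarrow> (fst z, g) \<in> action_domain X B \<Longrightarrow> At_inv (cls z, g) = (cls (shift z g), linv X g)"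
  by (simp add: At_inv_def gtgt_cls)

lemma At_inv_arr: "\<gamma> \<in> dcarrier (At_arr X H B) \<Longrightarrow> At_inv \<gamma> \<in> dcarrier (At_arr X H B)"
  by (erule arrE) (simp add: At_inv_cls cls_arr shift_in fst_shift inv_in_domain)

lemma dsmooth_At_inv: "dsmooth (At_arr X H B) (At_arr X H B) At_inv"
proof (rule dsmoothI[OF At_inv_arr])
  fix k U f assume f: "plot (At_arr X H B) k U f"
  show "plot (At_arr X H B) k U (\<lambda>y. At_inv (f y))"
    unfolding plot_At_arr
    using At_inv_arr plot_in[OF diffeological_space_At_arr f] plot_gtgt[OF f] mplot_inv[of k U "\<lambda>y. snd (f y)"] f
    by (simp add: At_inv_def plot_At_arr)
qed

text \<open>
  The components in \<open>X\<close> inherit the groupoid laws from \<open>X\<close>; sources and targets fit together because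
  moving representatives is functorial up to the relation.
\<close>

lemma diffeological_groupoid_At: "diffeological_groupoid At"
  unfolding diffeological_groupoid_def At_simps(1-3)
proof (intro conjI diffeological_space_At_obj diffeological_space_At_arr dsmooth_gsrc dsmooth_gtgt dsmooth_gunit dsmooth_gcomp
    exI[of _ At_inv] dsmooth_At_inv ballI allI impI)
  show "case x of (\<gamma>, \<delta>) \<Rightarrow> fst (gcomp At \<gamma> \<delta>) = fst \<gamma> \<and> gtgt At (gcomp At \<gamma> \<delta>) = gtgt At \<delta>"
    if c: "x \<in> gcomposable At" for x
  proof -
    obtain \<gamma> \<delta> where x: "x = (\<gamma>, \<delta>)" by (cases x)
    obtain z g h where "\<gamma> = (cls z, g)" "\<delta> = (cls (shift z g), h)" "z \<in> Tot"
      "(fst z, g) \<in> action_domain X B" "(g, h) \<in> composable X" by (rule gcomposableE[OF c[unfolded x]])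
    then show ?thesis by (simp add: x At_simps gtgt_arr)
  qed
  show "gcomp At (gcomp At \<gamma> \<delta>) \<epsilon> = gcomp At \<gamma> (gcomp At \<delta> \<epsilon>)"
    if c: "(\<gamma>, \<delta>) \<in> gcomposable At \<and> (\<delta>, \<epsilon>) \<in> gcomposable At" for \<gamma> \<delta> \<epsilon>
  proof -
    obtain z g h where 1: "\<gamma> = (cls z, g)" "\<delta> = (cls (shift z g), h)" "(g, h) \<in> composable X"
      by (rule gcomposableE[OF conjunct1[OF c]])
    obtain z' g' h' where 2: "\<delta> = (cls z', g')" "\<epsilon> = (cls (shift z' g'), h')" "(g', h') \<in> composable X"
      by (rule gcomposableE[OF conjunct2[OF c]])
    have "h = g'" using 1(2) 2(1) by simp
    then show ?thesis using 1 2 mul_assoc[OF 1(3)] by (simp add: At_simps)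
  qed
  show "fst (gunit At w) = w" "gtgt At (gunit At w) = w" if w: "w \<in> dcarrier (At_obj X H B)" for w
  proof -
    obtain z where z: "z \<in> Tot" "w = cls z" using w unfolding obj_iff by blast
    show "fst (gunit At w) = w" by (simp add: At_simps)
    show "gtgt At (gunit At w) = w"
      using gtgt_cls[OF z(1) unit_in_domain[OF totalD(1)[OF z(1)]]]
      by (simp add: At_simps z(2) At_point_cls[OF z(1)] shift_unit[OF z(1)])
  qed
  fix \<gamma> assume "\<gamma> \<in> dcarrier (At_arr X H B)"
  then obtain z g where \<gamma>: "\<gamma> = (cls z, g)" and z: "z \<in> Tot" and zg: "(fst z, g) \<in> action_domain X B" by (rule arrE)
  have g: "g \<in> mcarrier X1" "panchor B (fst z) = ltgt X g" using zg by (simp_all add: action_domain_iff)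
  have pt: "At_point (cls z) = fst z" "At_point (cls (shift z g)) = pact B (fst z) g"
    using At_point_cls[OF z] At_point_cls[OF shift_in[OF z zg]] by (simp_all add: fst_shift)
  have an: "panchor B (pact B (fst z) g) = lsrc X g" by (rule anchor_act[OF zg])
  show "gcomp At (gunit At (fst \<gamma>)) \<gamma> = \<gamma>"
    by (simp add: \<gamma> At_simps pt g unit_mul)
  show "gcomp At \<gamma> (gunit At (gtgt At \<gamma>)) = \<gamma>"
    by (simp add: \<gamma> At_simps gtgt_cls[OF z zg] pt an mul_unit[OF g(1)])
  show "fst (At_inv \<gamma>) = gtgt At \<gamma>" by (simp add: At_inv_def)
  show "gtgt At (At_inv \<gamma>) = fst \<gamma>"
  proof -
    have gi: "(g, linv X g) \<in> composable X" by (rule composableI[OF g(1) inv_in[OF g(1)]]) (simp add: tgt_inv[OF g(1)])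
    have "gtgt At (At_inv \<gamma>) = gtgt At (cls z, lunit X (panchor B (fst z)))"
      unfolding \<gamma> At_inv_cls[OF z zg] gtgt_arr[OF z zg gi] mul_inv[OF g(1)] g(2) ..
    also have "\<dots> = cls z" unfolding gtgt_cls[OF z unit_in_domain[OF totalD(1)[OF z]]] shift_unit[OF z] ..
    finally show ?thesis by (simp add: \<gamma>)
  qed
  show "gcomp At \<gamma> (At_inv \<gamma>) = gunit At (fst \<gamma>)"
    unfolding \<gamma> At_inv_cls[OF z zg] by (simp add: At_simps pt g mul_inv)
  show "gcomp At (At_inv \<gamma>) \<gamma> = gunit At (gtgt At \<gamma>)"
    unfolding \<gamma> At_inv_cls[OF z zg] gtgt_cls[OF z zg] by (simp add: At_simps pt an inv_mul[OF g(1)])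
qed

subsection \<open>The projection to the base\<close>

lemma At_proj_obj_cls: "z \<in> Tot \<Longrightarrow> At_proj_obj B (cls z) = pproj B (fst z)"
  by (simp add: At_proj_obj_def At_point_cls)

lemma At_proj_obj_in:
  assumes "w \<in> dcarrier (At_obj X H B)"
  shows "At_proj_obj B w \<in> mcarrier (pbase B)"
proof -
  obtain z where z: "z \<in> Tot" "w = cls z" using assms unfolding obj_iff by blast
  show ?thesis unfolding z(2) At_proj_obj_cls[OF z(1)] by (rule proj_in[OF totalD(1)[OF z(1)]])
qed

lemma At_proj_arr_eq: "At_proj_arr B \<gamma> = At_proj_obj B (fst \<gamma>)"
  by (simp add: At_proj_arr_def At_proj_obj_def case_prod_beta)

lemma At_proj_shift:
  assumes "z \<in> Tot" "(fst z, g) \<in> action_domain X B"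
  shows "At_proj_obj B (cls (shift z g)) = At_proj_obj B (cls z)"
  using assms by (simp add: At_proj_obj_cls shift_in fst_shift proj_act)

lemma plot_At_proj_obj:
  assumes f: "plot (At_obj X H B) k U f"
  shows "mplot k U (pbase B) (\<lambda>y. At_proj_obj B (f y))"
  unfolding At_proj_obj_def
  by (rule mplot_compose_smooth[OF atlas_P mplot_At_point[OF f] smooth_proj image_subsetI[OF mplot_in[OF mplot_At_point[OF f]]]])

lemma smooth_functor_At:
  "smooth_functor At (discrete_dgroupoid (mfd_diffeology (pbase B))) (At_proj_obj B) (At_proj_arr B)"
proof -
  let ?D = "discrete_dgroupoid (mfd_diffeology (pbase B))"
  have D: "gobj ?D = mfd_diffeology (pbase B)" "garr ?D = mfd_diffeology (pbase B)" "gsrc ?D = (\<lambda>x. x)"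
    "gtgt ?D = (\<lambda>x. x)" "gunit ?D = (\<lambda>x. x)" "gcomp ?D = (\<lambda>x y. x)"
    by (simp_all add: discrete_dgroupoid_def)
  note in' = At_proj_obj_in
  show ?thesis
    unfolding smooth_functor_def D At_simps(1-3)
  proof (intro conjI diffeological_groupoid_At diffeological_groupoid_discrete[OF diffeological_space_atlas[OF atlas_M]] ballI)
    show "dsmooth (At_obj X H B) (mfd_diffeology (pbase B)) (At_proj_obj B)"
      by (rule dsmoothI) (simp_all add: dcarrier_mfd_diffeology plot_mfd_diffeology in' plot_At_proj_obj)
    show "dsmooth (At_arr X H B) (mfd_diffeology (pbase B)) (At_proj_arr B)"
      by (rule dsmoothI) (auto simp: dcarrier_mfd_diffeology plot_mfd_diffeology in' At_proj_arr_eq dcarrier_At_arr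
          plot_At_arr plot_At_proj_obj)
    show "At_proj_arr B \<gamma> = At_proj_obj B (fst \<gamma>)" for \<gamma> by (rule At_proj_arr_eq)
    show "At_proj_arr B \<gamma> = At_proj_obj B (gtgt At \<gamma>)" if "\<gamma> \<in> dcarrier (At_arr X H B)" for \<gamma>
      by (rule arrE[OF that]) (simp add: At_proj_arr_eq gtgt_cls At_proj_shift)
    show "At_proj_arr B (gunit At w) = At_proj_obj B w" for w by (simp add: At_proj_arr_eq At_simps)
    show "case x of (\<gamma>, \<delta>) \<Rightarrow> At_proj_arr B (gcomp At \<gamma> \<delta>) = At_proj_arr B \<gamma>" for x
      by (cases x; cases "fst x"; cases "snd x") (simp add: At_proj_arr_eq At_simps)
  qed
qed

lemma base_point:
  assumes "m \<in> mcarrier (pbase B)"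
  obtains p where "p \<in> mcarrier P" "pproj B p = m"
proof -
  have "pproj B ` mcarrier P = mcarrier (pbase B)" using principal by (simp add: principal_bundle_def)
  then have "m \<in> pproj B ` mcarrier P" using assms by simp
  then show thesis using that by auto
qed

lemma zero_in_total: "p \<in> mcarrier P \<Longrightarrow> (p, 0, 0) \<in> Tot"
  by (simp only: At_total_iff tangent_space_zero)

lemma At_proj_surj:
  "At_proj_obj B ` dcarrier (gobj At) = mcarrier (pbase B)" "At_proj_arr B ` dcarrier (garr At) = mcarrier (pbase B)"
proof -
  note 1 = At_proj_obj_in
  have 2: "\<exists>\<gamma>\<in>dcarrier (At_arr X H B). At_proj_arr B \<gamma> = m \<and> At_proj_obj B (fst \<gamma>) = m \<and> fst \<gamma> \<in> dcarrier (At_obj X H B)"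
    if m: "m \<in> mcarrier (pbase B)" for m
  proof -
    obtain p where p: "p \<in> mcarrier P" "pproj B p = m" using base_point[OF m] .
    note z = zero_in_total[OF p(1)]
    show ?thesis
      by (rule bexI[OF _ cls_arr[OF z, of "lunit X (panchor B p)"]])
        (use p z unit_in_domain[OF p(1)] in \<open>simp_all only: At_proj_arr_eq fst_conv At_proj_obj_cls cls_obj\<close>)
  qed
  show "At_proj_obj B ` dcarrier (gobj At) = mcarrier (pbase B)"
    unfolding At_simps
  proof (intro equalityI subsetI)
    fix m assume "m \<in> At_proj_obj B ` dcarrier (At_obj X H B)"
    then show "m \<in> mcarrier (pbase B)" using 1 by auto
  next
    fix m assume "m \<in> mcarrier (pbase B)"
    from 2[OF this] obtain w where "At_proj_obj B w = m" "w \<in> dcarrier (At_obj X H B)" by blast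
    then show "m \<in> At_proj_obj B ` dcarrier (At_obj X H B)" by (auto simp: image_iff)
  qed
  show "At_proj_arr B ` dcarrier (garr At) = mcarrier (pbase B)"
    unfolding At_simps
  proof (intro equalityI subsetI)
    fix m assume "m \<in> At_proj_arr B ` dcarrier (At_arr X H B)"
    then show "m \<in> mcarrier (pbase B)" using 1 by (auto simp: At_proj_arr_eq dcarrier_At_arr)
  next
    fix m assume "m \<in> mcarrier (pbase B)"
    from 2[OF this] show "m \<in> At_proj_arr B ` dcarrier (At_arr X H B)" by (auto simp: image_iff)
  qed
qed

end

section \<open>The graded vector space of components\<close>

lemma cring_real_scalars: "cring real_scalars"
proof (rule cringI)
  show "abelian_group real_scalars"
  proof (rule abelian_groupI)
    fix x :: real
    show "\<exists>y\<in>carrier real_scalars. y \<oplus>\<^bsub>real_scalars\<^esub> x = \<zero>\<^bsub>real_scalars\<^esub>"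
      by (rule bexI[of _ "- x"]) (simp_all add: real_scalars_def)
  qed (simp_all add: real_scalars_def)
  show "comm_monoid real_scalars"
    by (rule comm_monoidI) (simp_all add: real_scalars_def)
qed (simp add: real_scalars_def distrib_right)

text \<open>
  An operation-preserving parametrization \<open>\<Psi>\<close> of \<open>V\<close> by pairs transports the vector space structure of
  the pairs; identifications of the two components are independent of each other, so the
  decomposition of a pair into its components descends.
\<close>

lemma graded_vector_space_of_parametrization:
  fixes V :: "(real, 'v) module" and A0 :: "'a tvec set" and A1 :: "'b tvec set"
  assumes A0: "0 \<in> A0" "\<And>a a'. a \<in> A0 \<Longrightarrow> a' \<in> A0 \<Longrightarrow> a + a' \<in> A0" "\<And>a r. a \<in> A0 \<Longrightarrow> tscale r a \<in> A0"
    and A1: "0 \<in> A1" "\<And>b b'. b \<in> A1 \<Longrightarrow> b' \<in> A1 \<Longrightarrow> b + b' \<in> A1" "\<And>b r. b \<in> A1 \<Longrightarrow> tscale r b \<in> A1"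
    and carrier: "\<And>x. x \<in> carrier V \<longleftrightarrow> (\<exists>a\<in>A0. \<exists>b\<in>A1. x = \<Psi> a b)"
    and zero: "\<zero>\<^bsub>V\<^esub> = \<Psi> 0 0"
    and add: "\<And>a b a' b'. a \<in> A0 \<Longrightarrow> b \<in> A1 \<Longrightarrow> a' \<in> A0 \<Longrightarrow> b' \<in> A1 \<Longrightarrow>
        \<Psi> a b \<oplus>\<^bsub>V\<^esub> \<Psi> a' b' = \<Psi> (a + a') (b + b')"
    and smult: "\<And>r a b. a \<in> A0 \<Longrightarrow> b \<in> A1 \<Longrightarrow> r \<odot>\<^bsub>V\<^esub> \<Psi> a b = \<Psi> (tscale r a) (tscale r b)"
    and split: "\<And>a b a' b'. a \<in> A0 \<Longrightarrow> b \<in> A1 \<Longrightarrow> a' \<in> A0 \<Longrightarrow> b' \<in> A1 \<Longrightarrow> \<Psi> a b = \<Psi> a' b' \<Longrightarrow>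
        \<Psi> a 0 = \<Psi> a' 0 \<and> \<Psi> 0 b = \<Psi> 0 b'"
    and G0: "\<And>x. x \<in> G (0::int) \<longleftrightarrow> (\<exists>a\<in>A0. x = \<Psi> a 0)" and G1: "\<And>x. x \<in> G 1 \<longleftrightarrow> (\<exists>b\<in>A1. x = \<Psi> 0 b)"
    and Gk: "\<And>k. k \<noteq> 0 \<Longrightarrow> k \<noteq> 1 \<Longrightarrow> G k = {\<zero>\<^bsub>V\<^esub>}"
  shows "graded_vector_space V G"
proof -
  have elim: thesis if "x \<in> carrier V" "\<And>a b. a \<in> A0 \<Longrightarrow> b \<in> A1 \<Longrightarrow> x = \<Psi> a b \<Longrightarrow> thesis" for x thesis
    using that carrier by blast
  have in': "\<Psi> a b \<in> carrier V" if "a \<in> A0" "b \<in> A1" for a b using carrier that by blast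
  have neg: "- a \<in> A0" if "a \<in> A0" for a using A0(3)[OF that, of "-1"] by (simp only: tscale_minus_one)
  have neg': "- b \<in> A1" if "b \<in> A1" for b using A1(3)[OF that, of "-1"] by (simp only: tscale_minus_one)
  have ab: "abelian_group V"
  proof (rule abelian_groupI)
    fix x y assume x: "x \<in> carrier V" and y: "y \<in> carrier V"
    obtain a b where a: "a \<in> A0" "b \<in> A1" "x = \<Psi> a b" by (rule elim[OF x])
    obtain a' b' where a': "a' \<in> A0" "b' \<in> A1" "y = \<Psi> a' b'" by (rule elim[OF y])
    show "x \<oplus>\<^bsub>V\<^esub> y \<in> carrier V" unfolding a(3) a'(3) add[OF a(1,2) a'(1,2)] by (intro in' A0 A1 a a')
    show "x \<oplus>\<^bsub>V\<^esub> y = y \<oplus>\<^bsub>V\<^esub> x" unfolding a(3) a'(3) add[OF a(1,2) a'(1,2)] add[OF a'(1,2) a(1,2)]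
      by (simp only: add.commute)
    fix z assume z: "z \<in> carrier V"
    obtain a'' b'' where a'': "a'' \<in> A0" "b'' \<in> A1" "z = \<Psi> a'' b''" by (rule elim[OF z])
    show "x \<oplus>\<^bsub>V\<^esub> y \<oplus>\<^bsub>V\<^esub> z = x \<oplus>\<^bsub>V\<^esub> (y \<oplus>\<^bsub>V\<^esub> z)"
      unfolding a(3) a'(3) a''(3) add[OF a(1,2) a'(1,2)] add[OF a'(1,2) a''(1,2)]
        add[OF A0(2)[OF a(1) a'(1)] A1(2)[OF a(2) a'(2)] a''(1,2)]
        add[OF a(1,2) A0(2)[OF a'(1) a''(1)] A1(2)[OF a'(2) a''(2)]]
      by (simp only: add.assoc)
  next
    fix x assume x: "x \<in> carrier V"
    obtain a b where a: "a \<in> A0" "b \<in> A1" "x = \<Psi> a b" by (rule elim[OF x])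
    show "\<zero>\<^bsub>V\<^esub> \<oplus>\<^bsub>V\<^esub> x = x" unfolding zero a(3) add[OF A0(1) A1(1) a(1,2)] by (simp only: add_0_left)
    show "\<exists>y\<in>carrier V. y \<oplus>\<^bsub>V\<^esub> x = \<zero>\<^bsub>V\<^esub>"
      by (rule bexI[OF _ in'[OF neg[OF a(1)] neg'[OF a(2)]]])
        (simp only: zero a(3) add[OF neg[OF a(1)] neg'[OF a(2)] a(1,2)] add.left_inverse)
  qed (simp only: zero in' A0 A1)
  have mod: "Module.module real_scalars V"
  proof (rule moduleI[OF cring_real_scalars ab])
    fix r x assume x: "x \<in> carrier V"
    obtain a b where a: "a \<in> A0" "b \<in> A1" "x = \<Psi> a b" by (rule elim[OF x])
    show "r \<odot>\<^bsub>V\<^esub> x \<in> carrier V" unfolding a(3) smult[OF a(1,2)] by (intro in' A0 A1 a)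
    show "\<one>\<^bsub>real_scalars\<^esub> \<odot>\<^bsub>V\<^esub> x = x"
      unfolding a(3) smult[OF a(1,2)] by (simp add: real_scalars_def tscale_simps)
    fix s
    show "(r \<oplus>\<^bsub>real_scalars\<^esub> s) \<odot>\<^bsub>V\<^esub> x = r \<odot>\<^bsub>V\<^esub> x \<oplus>\<^bsub>V\<^esub> s \<odot>\<^bsub>V\<^esub> x"
      unfolding a(3) smult[OF a(1,2)] add[OF A0(3)[OF a(1)] A1(3)[OF a(2)] A0(3)[OF a(1)] A1(3)[OF a(2)]]
      by (simp add: real_scalars_def tscale_add_left)
    show "(r \<otimes>\<^bsub>real_scalars\<^esub> s) \<odot>\<^bsub>V\<^esub> x = r \<odot>\<^bsub>V\<^esub> (s \<odot>\<^bsub>V\<^esub> x)"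
      unfolding a(3) smult[OF a(1,2)] smult[OF A0(3)[OF a(1)] A1(3)[OF a(2)]]
      by (simp add: real_scalars_def tscale_tscale)
    fix y assume y: "y \<in> carrier V"
    obtain a' b' where a': "a' \<in> A0" "b' \<in> A1" "y = \<Psi> a' b'" by (rule elim[OF y])
    show "r \<odot>\<^bsub>V\<^esub> (x \<oplus>\<^bsub>V\<^esub> y) = r \<odot>\<^bsub>V\<^esub> x \<oplus>\<^bsub>V\<^esub> r \<odot>\<^bsub>V\<^esub> y"
      unfolding a(3) a'(3) add[OF a(1,2) a'(1,2)] smult[OF a(1,2)] smult[OF a'(1,2)]
        smult[OF A0(2)[OF a(1) a'(1)] A1(2)[OF a(2) a'(2)]]
        add[OF A0(3)[OF a(1)] A1(3)[OF a(2)] A0(3)[OF a'(1)] A1(3)[OF a'(2)]]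
      by (simp only: tscale_add)
  qed
  interpret V: Module.module real_scalars V by (rule mod)
  have Gsub: "x \<in> carrier V" if "x \<in> G k" for x k
    using that Gk[of k] G0 G1 in' A0(1) A1(1) by (cases "k = 0"; cases "k = 1") auto
  have sub: "submodule (G k) real_scalars V" for k
  proof -
    have closed: "\<zero>\<^bsub>V\<^esub> \<in> G k \<and> (\<forall>x\<in>G k. \<forall>y\<in>G k. x \<oplus>\<^bsub>V\<^esub> y \<in> G k) \<and> (\<forall>r. \<forall>x\<in>G k. r \<odot>\<^bsub>V\<^esub> x \<in> G k)"
    proof -
      consider "k = 0" | "k = 1" | "k \<noteq> 0" "k \<noteq> 1" by blast
      then show ?thesis
      proof cases
        case 1
        show ?thesis unfolding 1
        proof (intro conjI ballI allI)
          show "\<zero>\<^bsub>V\<^esub> \<in> G 0" unfolding G0 zero using A0(1) by blast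
          fix x assume "x \<in> G 0"
          then obtain a where a: "a \<in> A0" "x = \<Psi> a 0" unfolding G0 by blast
          show "r \<odot>\<^bsub>V\<^esub> x \<in> G 0" for r
            unfolding G0 a(2) smult[OF a(1) A1(1)] tscale_simps using A0(3)[OF a(1)] by blast
          fix y assume "y \<in> G 0"
          then obtain a' where a': "a' \<in> A0" "y = \<Psi> a' 0" unfolding G0 by blast
          show "x \<oplus>\<^bsub>V\<^esub> y \<in> G 0"
            unfolding G0 a(2) a'(2) add[OF a(1) A1(1) a'(1) A1(1)] add_0_left using A0(2)[OF a(1) a'(1)] by blast
        qed
      next
        case 2
        show ?thesis unfolding 2
        proof (intro conjI ballI allI)
          show "\<zero>\<^bsub>V\<^esub> \<in> G 1" unfolding G1 zero using A1(1) by blast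
          fix x assume "x \<in> G 1"
          then obtain b where b: "b \<in> A1" "x = \<Psi> 0 b" unfolding G1 by blast
          show "r \<odot>\<^bsub>V\<^esub> x \<in> G 1" for r
            unfolding G1 b(2) smult[OF A0(1) b(1)] tscale_simps using A1(3)[OF b(1)] by blast
          fix y assume "y \<in> G 1"
          then obtain b' where b': "b' \<in> A1" "y = \<Psi> 0 b'" unfolding G1 by blast
          show "x \<oplus>\<^bsub>V\<^esub> y \<in> G 1"
            unfolding G1 b(2) b'(2) add[OF A0(1) b(1) A0(1) b'(1)] add_0_left using A1(2)[OF b(1) b'(1)] by blast
        qed
      next
        case 3
        have "r \<odot>\<^bsub>V\<^esub> \<zero>\<^bsub>V\<^esub> = \<zero>\<^bsub>V\<^esub>" for r
          unfolding zero smult[OF A0(1) A1(1)] tscale_simps ..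
        then show ?thesis unfolding Gk[OF 3] by simp
      qed
    qed
    show ?thesis
    proof (rule V.submoduleI)
      show "G k \<subseteq> carrier V" using Gsub by blast
      fix x assume x: "x \<in> G k"
      have "(-1) \<odot>\<^bsub>V\<^esub> x \<oplus>\<^bsub>V\<^esub> x = \<zero>\<^bsub>V\<^esub>"
      proof -
        obtain a b where a: "a \<in> A0" "b \<in> A1" "x = \<Psi> a b" by (rule elim[OF Gsub[OF x]])
        show ?thesis unfolding zero a(3) smult[OF a(1,2)] add[OF A0(3)[OF a(1)] A1(3)[OF a(2)] a(1,2)]
          by (simp only: tscale_minus_one add.left_inverse)
      qed
      moreover have "(-1) \<odot>\<^bsub>V\<^esub> x \<in> G k" using closed x by blast
      ultimately show "\<ominus>\<^bsub>V\<^esub> x \<in> G k" using V.minus_equality Gsub x by metis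
    qed (use closed in blast)+
  qed
  have sum: "finite {k. w k \<noteq> \<zero>\<^bsub>V\<^esub>} \<and> finsum V w {k. w k \<noteq> \<zero>\<^bsub>V\<^esub>} = w 0 \<oplus>\<^bsub>V\<^esub> w 1"
    if w: "\<forall>k. w k \<in> G k" for w
  proof -
    have wc: "w k \<in> carrier V" for k using w Gsub by blast
    have wz: "w k = \<zero>\<^bsub>V\<^esub>" if "k \<noteq> 0" "k \<noteq> 1" for k using w Gk[OF that] by blast
    have S: "{k. w k \<noteq> \<zero>\<^bsub>V\<^esub>} = (if w 0 = \<zero>\<^bsub>V\<^esub> then {} else {0}) \<union> (if w 1 = \<zero>\<^bsub>V\<^esub> then {} else {1})"
      (is "_ = ?S")
    proof (rule Set.set_eqI)
      fix k show "k \<in> {k. w k \<noteq> \<zero>\<^bsub>V\<^esub>} \<longleftrightarrow> k \<in> ?S"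
        using wz[of k] by (cases "k = 0"; cases "k = 1") simp_all
    qed
    show ?thesis unfolding S using wc
      by (cases "w 0 = \<zero>\<^bsub>V\<^esub>"; cases "w 1 = \<zero>\<^bsub>V\<^esub>") (simp_all add: V.a_comm)
  qed
  have dec: "\<exists>!w. (\<forall>k. w k \<in> G k) \<and> finite {k. w k \<noteq> \<zero>\<^bsub>V\<^esub>} \<and> x = finsum V w {k. w k \<noteq> \<zero>\<^bsub>V\<^esub>}"
    if x: "x \<in> carrier V" for x
  proof -
    obtain a b where a: "a \<in> A0" "b \<in> A1" "x = \<Psi> a b" by (rule elim[OF x])
    let ?w = "\<lambda>k::int. if k = 0 then \<Psi> a 0 else if k = 1 then \<Psi> 0 b else \<zero>\<^bsub>V\<^esub>"
    have w: "\<forall>k. ?w k \<in> G k" using a Gk G0 G1 by auto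
    show ?thesis
    proof (rule ex1I[of _ ?w])
      have "?w 0 \<oplus>\<^bsub>V\<^esub> ?w 1 = x"
        using add[OF a(1) A1(1) A0(1) a(2)] a(3) by (simp only: add_0_left add_0_right if_True if_False one_neq_zero refl)
      then show "(\<forall>k. ?w k \<in> G k) \<and> finite {k. ?w k \<noteq> \<zero>\<^bsub>V\<^esub>} \<and> x = finsum V ?w {k. ?w k \<noteq> \<zero>\<^bsub>V\<^esub>}"
        using w sum[OF w] by simp
    next
      fix w' assume "(\<forall>k. w' k \<in> G k) \<and> finite {k. w' k \<noteq> \<zero>\<^bsub>V\<^esub>} \<and> x = finsum V w' {k. w' k \<noteq> \<zero>\<^bsub>V\<^esub>}"
      then have w': "\<forall>k. w' k \<in> G k" and x': "x = w' 0 \<oplus>\<^bsub>V\<^esub> w' 1" using sum by auto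
      obtain a' where a': "a' \<in> A0" "w' 0 = \<Psi> a' 0" using w' G0 by blast
      obtain b' where b': "b' \<in> A1" "w' 1 = \<Psi> 0 b'" using w' G1 by blast
      have "\<Psi> a b = \<Psi> a' b'"
        using x' add[OF a'(1) A1(1) A0(1) b'(1)] by (simp only: a(3) a'(2) b'(2) add_0_left add_0_right)
      from split[OF a(1,2) a'(1) b'(1) this] have "w' 0 = ?w 0" "w' 1 = ?w 1" using a' b' by simp_all
      moreover have "w' k = ?w k" if "k \<noteq> 0" "k \<noteq> 1" for k using w' Gk[OF that] that by auto
      ultimately show "w' = ?w" by (intro ext) metis
    qed
  qed
  show ?thesis unfolding graded_vector_space_def using mod sub dec by blast
qed

context principal_bundle_with_connection
begin

interpretation q0: quasi_action X H B "tangent_space P" \<tau>0 by (rule quasi_action_tau0)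
interpretation q1: quasi_action X H B TX \<tau>1 by (rule quasi_action_tau1)

abbreviation "cpt \<equiv> At_component X H B"
abbreviation "fiso \<equiv> fibre_iso At (At_proj_obj B) (At_proj_arr B)"
abbreviation "Fib \<equiv> At_fibre X H B"

text \<open>
  The action preserves \<open>\<pi>\<close>, so each arrow which starts over \<open>m\<close> belongs to the fibre over \<open>m\<close>.
\<close>

lemma iso_iff:
  assumes z: "z \<in> Tot" "pproj B (fst z) = m" and z': "z' \<in> Tot" "pproj B (fst z') = m"
  shows "(cls z, cls z') \<in> fiso m \<longleftrightarrow> (\<exists>g. (fst z, g) \<in> action_domain X B \<and> (shift z g, z') \<in> Rel)"
proof
  assume "(cls z, cls z') \<in> fiso m"
  then obtain \<gamma> where \<gamma>: "\<gamma> \<in> dcarrier (At_arr X H B)" "fst \<gamma> = cls z" "gtgt At \<gamma> = cls z'"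
    unfolding fibre_iso_def At_simps by blast
  obtain z1 g where z1: "\<gamma> = (cls z1, g)" "z1 \<in> Tot" "(fst z1, g) \<in> action_domain X B" using arrE[OF \<gamma>(1)] .
  have eq: "cls z1 = cls z" using \<gamma>(2) z1(1) by simp
  then have "fst z1 = fst z" using At_point_cls[OF z(1)] At_point_cls[OF z1(2)] by simp
  then have g: "(fst z, g) \<in> action_domain X B" using z1(3) by simp
  have "cls (shift z g) = cls z'" using gtgt_cls[OF z(1) g] \<gamma>(3) z1(1) eq by simp
  then have "(shift z g, z') \<in> Rel" using cls_eq_iff[OF shift_in[OF z(1) g] z'(1)] by simp
  then show "\<exists>g. (fst z, g) \<in> action_domain X B \<and> (shift z g, z') \<in> Rel" using g by blast
next
  assume "\<exists>g. (fst z, g) \<in> action_domain X B \<and> (shift z g, z') \<in> Rel"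
  then obtain g where g: "(fst z, g) \<in> action_domain X B" "(shift z g, z') \<in> Rel" by blast
  have "(cls z, g) \<in> dcarrier (At_arr X H B)" by (rule cls_arr[OF z(1) g(1)])
  moreover have "gtgt At (cls z, g) = cls z'" unfolding gtgt_cls[OF z(1) g(1)] by (rule cls_eqI[OF g(2)])
  moreover have "At_proj_arr B (cls z, g) = m" by (simp add: At_proj_arr_eq At_proj_obj_cls z)
  ultimately show "(cls z, cls z') \<in> fiso m"
    unfolding fibre_iso_def At_simps mem_Collect_eq split_conv
    by (intro conjI cls_obj z z' bexI[of _ "(cls z, g)"]) (simp_all add: At_proj_obj_cls z z')
qed

lemma fibre_objE:
  assumes "w \<in> {w \<in> dcarrier (gobj At). At_proj_obj B w = m}"
  obtains z where "z \<in> Tot" "pproj B (fst z) = m" "w = cls z"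
proof -
  obtain z where z: "z \<in> Tot" "w = cls z" using assms unfolding At_simps by (auto simp: obj_iff)
  show thesis by (rule that[OF z(1) _ z(2)]) (use assms z in \<open>simp add: At_proj_obj_cls\<close>)
qed

lemma equiv_iso: "equiv {w \<in> dcarrier (gobj At). At_proj_obj B w = m} (fiso m)"
proof (rule equivI)
  let ?F = "{w \<in> dcarrier (gobj At). At_proj_obj B w = m}"
  show sub: "fiso m \<subseteq> ?F \<times> ?F" by (auto simp: fibre_iso_def)
  show "refl_on ?F (fiso m)"
  proof (rule refl_onI)
    fix w assume "w \<in> ?F"
    then obtain z where z: "z \<in> Tot" "pproj B (fst z) = m" "w = cls z" by (rule fibre_objE)
    show "(w, w) \<in> fiso m"
      unfolding z(3) iso_iff[OF z(1,2) z(1,2)]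
      by (rule exI[of _ "lunit X (panchor B (fst z))"])
        (simp add: unit_in_domain totalD(1)[OF z(1)] shift_unit[OF z(1)] rel_refl[OF z(1)])
  qed
  show "sym (fiso m)"
  proof (rule symI)
    fix w w' assume a: "(w, w') \<in> fiso m"
    then have "w \<in> ?F" "w' \<in> ?F" using sub by auto
    obtain z where z: "z \<in> Tot" "pproj B (fst z) = m" "w = cls z" by (rule fibre_objE[OF \<open>w \<in> ?F\<close>])
    obtain z' where z': "z' \<in> Tot" "pproj B (fst z') = m" "w' = cls z'" by (rule fibre_objE[OF \<open>w' \<in> ?F\<close>])
    obtain g where g: "(fst z, g) \<in> action_domain X B" "(shift z g, z') \<in> Rel"
      using a unfolding z(3) z'(3) iso_iff[OF z(1,2) z'(1,2)] by blast
    have gX: "g \<in> mcarrier X1" "panchor B (fst z) = ltgt X g" using g(1) by (simp_all add: action_domain_iff)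
    have gi: "(g, linv X g) \<in> composable X" by (rule composableI[OF gX(1) inv_in[OF gX(1)]]) (simp add: tgt_inv[OF gX(1)])
    have d: "(fst (shift z g), linv X g) \<in> action_domain X B" unfolding fst_shift by (rule inv_in_domain[OF g(1)])
    have "(shift (shift z g) (linv X g), z) \<in> Rel"
      using shift_shift[OF z(1) g(1) gi] by (simp add: mul_inv[OF gX(1)] gX(2)[symmetric] shift_unit[OF z(1)])
    moreover have "(shift z' (linv X g), shift (shift z g) (linv X g)) \<in> Rel"
      by (rule rel_sym[OF shift_rel[OF g(2) d]])
    ultimately have "(shift z' (linv X g), z) \<in> Rel" using rel_trans by blast
    moreover have "(fst z', linv X g) \<in> action_domain X B" using d At_relD(3)[OF g(2)] by simp
    ultimately show "(w', w) \<in> fiso m" unfolding z(3) z'(3) iso_iff[OF z'(1,2) z(1,2)] by blast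
  qed
  show "trans (fiso m)"
  proof (rule transI)
    fix w w' w'' assume a: "(w, w') \<in> fiso m" and b: "(w', w'') \<in> fiso m"
    then have "w \<in> ?F" "w' \<in> ?F" "w'' \<in> ?F" using sub by auto
    obtain z where z: "z \<in> Tot" "pproj B (fst z) = m" "w = cls z" by (rule fibre_objE[OF \<open>w \<in> ?F\<close>])
    obtain z' where z': "z' \<in> Tot" "pproj B (fst z') = m" "w' = cls z'" by (rule fibre_objE[OF \<open>w' \<in> ?F\<close>])
    obtain z'' where z'': "z'' \<in> Tot" "pproj B (fst z'') = m" "w'' = cls z''" by (rule fibre_objE[OF \<open>w'' \<in> ?F\<close>])
    obtain g where g: "(fst z, g) \<in> action_domain X B" "(shift z g, z') \<in> Rel"
      using a unfolding z(3) z'(3) iso_iff[OF z(1,2) z'(1,2)] by blast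
    obtain h where h: "(fst z', h) \<in> action_domain X B" "(shift z' h, z'') \<in> Rel"
      using b unfolding z'(3) z''(3) iso_iff[OF z'(1,2) z''(1,2)] by blast
    have d: "(fst (shift z g), h) \<in> action_domain X B" using h(1) At_relD(3)[OF g(2)] by simp
    then have gh: "(g, h) \<in> composable X" using composable_of_domain[OF g(1)] by (simp add: fst_shift)
    have "(shift z (lmul X g h), z'') \<in> Rel"
      by (rule rel_trans[OF rel_sym[OF shift_shift[OF z(1) g(1) gh]] rel_trans[OF shift_rel[OF g(2) d] h(2)]])
    then show "(w, w'') \<in> fiso m"
      unfolding z(3) z''(3) iso_iff[OF z(1,2) z''(1,2)] using mul_in_domain[OF g(1) gh] by blast
  qed
qed

lemma comp_eq_iff:
  assumes z: "z \<in> Tot" and z': "z' \<in> Tot" and m: "pproj B (fst z) = pproj B (fst z')"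
  shows "cpt z = cpt z' \<longleftrightarrow> (\<exists>g. (fst z, g) \<in> action_domain X B \<and> (shift z g, z') \<in> Rel)"
proof -
  have "cpt z = cpt z' \<longleftrightarrow> (cls z, cls z') \<in> fiso (pproj B (fst z))"
    unfolding At_component_def m
    by (rule eq_equiv_class_iff[OF equiv_iso]) (simp_all add: At_simps cls_obj At_proj_obj_cls z z' m)
  then show ?thesis by (simp only: iso_iff[OF z refl z' m[symmetric]])
qed

lemma comp_shift:
  assumes z: "z \<in> Tot" and g: "(fst z, g) \<in> action_domain X B"
  shows "cpt (shift z g) = cpt z"
proof -
  have m: "pproj B (fst z) = pproj B (fst (shift z g))" by (simp add: fst_shift proj_act[OF g])
  have "\<exists>g'. (fst z, g') \<in> action_domain X B \<and> (shift z g', shift z g) \<in> Rel"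
    using g rel_refl[OF shift_in[OF z g]] by blast
  then show ?thesis by (rule comp_eq_iff[OF z shift_in[OF z g] m, THEN iffD2, symmetric])
qed

lemma carrier_fibre: "C \<in> carrier (Fib m) \<longleftrightarrow> (\<exists>z\<in>Tot. pproj B (fst z) = m \<and> C = cpt z)"
proof -
  have "C \<in> carrier (Fib m) \<longleftrightarrow> (\<exists>w\<in>{w \<in> dcarrier (gobj At). At_proj_obj B w = m}. C = fiso m `` {w})"
    by (simp add: At_fibre_def fibre_components_def quotient_def)
  also have "\<dots> \<longleftrightarrow> (\<exists>z\<in>Tot. pproj B (fst z) = m \<and> C = cpt z)"
  proof
    assume "\<exists>w\<in>{w \<in> dcarrier (gobj At). At_proj_obj B w = m}. C = fiso m `` {w}"
    then obtain w where w: "w \<in> {w \<in> dcarrier (gobj At). At_proj_obj B w = m}" "C = fiso m `` {w}" by blast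
    obtain z where "z \<in> Tot" "pproj B (fst z) = m" "w = cls z" by (rule fibre_objE[OF w(1)])
    then show "\<exists>z\<in>Tot. pproj B (fst z) = m \<and> C = cpt z"
      by (intro bexI[of _ z] conjI) (simp_all add: At_component_def w(2))
  next
    assume "\<exists>z\<in>Tot. pproj B (fst z) = m \<and> C = cpt z"
    then obtain z where "z \<in> Tot" "pproj B (fst z) = m" "C = cpt z" by blast
    then show "\<exists>w\<in>{w \<in> dcarrier (gobj At). At_proj_obj B w = m}. C = fiso m `` {w}"
      by (intro bexI[of _ "cls z"]) (simp_all add: At_component_def At_simps cls_obj At_proj_obj_cls)
  qed
  finally show ?thesis .
qed

text \<open>
  The action is free, so over a fixed point \<open>p0\<close> the only isomorphisms are the units; it is transitive
  on the fibres of \<open>\<pi>\<close>, so every component has a representative over \<open>p0\<close>.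
\<close>

lemma comp_eq_at_point:
  assumes z: "(p, a, b) \<in> Tot" and z': "(p, a', b') \<in> Tot"
  shows "cpt (p, a, b) = cpt (p, a', b') \<longleftrightarrow> a - a' \<in> q0.defects p \<and> b - b' \<in> q1.defects p"
proof -
  have p: "p \<in> mcarrier P" using totalD(1)[OF z] by simp
  let ?e = "lunit X (panchor B p)"
  have e: "shift (p, a, b) ?e = (p, a, b)" using shift_unit[OF z] by simp
  have "cpt (p, a, b) = cpt (p, a', b') \<longleftrightarrow> (\<exists>g. (p, g) \<in> action_domain X B \<and> (shift (p, a, b) g, (p, a', b')) \<in> Rel)"
    using comp_eq_iff[OF z z'] by simp
  also have "\<dots> \<longleftrightarrow> ((p, a, b), (p, a', b')) \<in> Rel"
  proof
    assume "\<exists>g. (p, g) \<in> action_domain X B \<and> (shift (p, a, b) g, (p, a', b')) \<in> Rel"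
    then obtain g where g: "(p, g) \<in> action_domain X B" "(shift (p, a, b) g, (p, a', b')) \<in> Rel" by blast
    have "pact B p g = p" using At_relD(3)[OF g(2)] by (simp add: fst_shift)
    then have "g = ?e" using act_free[OF g(1) unit_in_domain[OF p]] act_unit[OF p] by simp
    then show "((p, a, b), (p, a', b')) \<in> Rel" using g(2) e by simp
  next
    assume "((p, a, b), (p, a', b')) \<in> Rel"
    then show "\<exists>g. (p, g) \<in> action_domain X B \<and> (shift (p, a, b) g, (p, a', b')) \<in> Rel"
      using e unit_in_domain[OF p] by (intro exI[of _ ?e]) simp
  qed
  finally show ?thesis using z z' by (simp add: At_rel_iff)
qed

lemma comp_at_point:
  assumes z: "(p, u, v) \<in> Tot" and k: "(p, k) \<in> action_domain X B" "pact B p k = p0"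
  shows "cpt (p, u, v) = cpt (p0, \<tau>0 p k u, tau1 X H k v)" "(p0, \<tau>0 p k u, tau1 X H k v) \<in> Tot"
proof -
  have k': "(fst (p, u, v), k) \<in> action_domain X B" using k by simp
  have "shift (p, u, v) k = (p0, \<tau>0 p k u, tau1 X H k v)" by (simp add: shift_def k)
  then show "cpt (p, u, v) = cpt (p0, \<tau>0 p k u, tau1 X H k v)" "(p0, \<tau>0 p k u, tau1 X H k v) \<in> Tot"
    using comp_shift[OF z k'] shift_in[OF z k'] by simp_all
qed

text \<open>
  Both summands are moved to \<open>p0\<close>. The vector \<open>u\<close> arrives there along the product \<open>gl\<close>, its image under
  \<open>\<tau>\<^sub>g\<close> along \<open>l\<close>; the results differ by a defect, which does not change the component.
\<close>

lemma comp_add_well_defined: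
  assumes p0: "p0 \<in> mcarrier P" "pproj B p0 = pproj B p" and pg: "(p, g) \<in> action_domain X B"
    and z: "(p, u, v) \<in> Tot" and z': "(pact B p g, u', v') \<in> Tot"
    and a: "(p0, a, b) \<in> Tot" "cpt (p, u, v) = cpt (p0, a, b)"
    and a': "(p0, a', b') \<in> Tot" "cpt (pact B p g, u', v') = cpt (p0, a', b')"
  shows "cpt (pact B p g, \<tau>0 p g u + u', tau1 X H g v + v') = cpt (p0, a + a', b + b')"
proof -
  let ?q = "pact B p g"
  have q: "?q \<in> mcarrier P" by (rule act_in[OF pg])
  obtain l where l: "(?q, l) \<in> action_domain X B" "pact B ?q l = p0"
    using act_transitive[OF q p0(1)] p0(2) proj_act[OF pg] by metis
  have gl: "(g, l) \<in> composable X" by (rule composable_of_domain[OF pg l(1)])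
  let ?k = "lmul X g l"
  have k: "(p, ?k) \<in> action_domain X B" "pact B p ?k = p0"
    using mul_in_domain[OF pg gl] act_act[OF pg gl] l(2) by simp_all
  have zT: "u \<in> tangent_space P p" "v \<in> TX p" "u' \<in> tangent_space P ?q" "v' \<in> TX ?q"
    using z z' by (simp_all add: At_total_iff)
  have gT: "\<tau>0 p g u \<in> tangent_space P ?q" "tau1 X H g v \<in> TX ?q"
    by (rule q0.tau_in[OF pg zT(1)], rule q1.tau_in[OF pg zT(2)])
  have sum: "(?q, \<tau>0 p g u + u', tau1 X H g v + v') \<in> Tot"
    unfolding At_total_iff by (intro conjI q tangent_space_add gT zT)
  note c1 = comp_at_point[OF z k] and c2 = comp_at_point[OF z' l] and c3 = comp_at_point[OF sum l]
  have d1: "\<tau>0 p ?k u - a \<in> q0.defects p0" "tau1 X H ?k v - b \<in> q1.defects p0"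
    using a(2) unfolding c1(1) comp_eq_at_point[OF c1(2) a(1)] by simp_all
  have d2: "\<tau>0 ?q l u' - a' \<in> q0.defects p0" "tau1 X H l v' - b' \<in> q1.defects p0"
    using a'(2) unfolding c2(1) comp_eq_at_point[OF c2(2) a'(1)] by simp_all
  have d3: "\<tau>0 p ?k u - \<tau>0 ?q l (\<tau>0 p g u) \<in> q0.defects p0" "tau1 X H ?k v - tau1 X H l (tau1 X H g v) \<in> q1.defects p0"
    using q0.tau_mul[OF pg gl zT(1)] q1.tau_mul[OF pg gl zT(2)] unfolding l(2) .
  have sT: "(p0, a + a', b + b') \<in> Tot"
    using a(1) a'(1) unfolding At_total_iff by (simp add: tangent_space_add)
  have "\<tau>0 ?q l (\<tau>0 p g u + u') - (a + a') =
      (\<tau>0 p ?k u - a) + (\<tau>0 ?q l u' - a') - (\<tau>0 p ?k u - \<tau>0 ?q l (\<tau>0 p g u))"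
    unfolding q0.tau_add[OF l(1) gT(1) zT(3)] by (simp only: algebra_simps)
  then have e0: "\<tau>0 ?q l (\<tau>0 p g u + u') - (a + a') \<in> q0.defects p0"
    using q0.defects_diff[OF q0.defects_add[OF d1(1) d2(1)] d3(1)] by (simp only:)
  have "tau1 X H l (tau1 X H g v + v') - (b + b') =
      (tau1 X H ?k v - b) + (tau1 X H l v' - b') - (tau1 X H ?k v - tau1 X H l (tau1 X H g v))"
    unfolding q1.tau_add[OF l(1) gT(2) zT(4)] by (simp only: algebra_simps)
  then have e1: "tau1 X H l (tau1 X H g v + v') - (b + b') \<in> q1.defects p0"
    using q1.defects_diff[OF q1.defects_add[OF d1(2) d2(2)] d3(2)] by (simp only:)
  show ?thesis unfolding c3(1) comp_eq_at_point[OF c3(2) sT] by (rule conjI[OF e0 e1])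
qed

text \<open>
  The unit arrow at \<open>p0\<close> is one of the arrows admitted in the definition of the sum.
\<close>

lemma fibre_add_at_point:
  assumes m: "pproj B p0 = m" and a: "(p0, a, b) \<in> Tot" "(p0, a', b') \<in> Tot"
  shows "cpt (p0, a, b) \<oplus>\<^bsub>Fib m\<^esub> cpt (p0, a', b') = cpt (p0, a + a', b + b')"
proof -
  have p0: "p0 \<in> mcarrier P" using totalD(1)[OF a(1)] by simp
  let ?e = "lunit X (panchor B p0)"
  have "(THE D. \<exists>p u v g u' v'.
        (p, g) \<in> action_domain X B \<and> pproj B p = m \<and>
        (p, u, v) \<in> Tot \<and> (pact B p g, u', v') \<in> Tot \<and>
        cpt (p0, a, b) = cpt (p, u, v) \<and> cpt (p0, a', b') = cpt (pact B p g, u', v') \<and>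
        D = cpt (pact B p g, \<tau>0 p g u + u', tau1 X H g v + v')) = cpt (p0, a + a', b + b')"
  proof (rule the_equality)
    have "a \<in> tangent_space P p0" "b \<in> TX p0" using a(1) by (simp_all add: At_total_iff)
    then have "\<tau>0 p0 ?e a = a" "tau1 X H ?e b = b" using p0 by (simp_all add: tau0_unit tau1_unit anchor_in)
    then show "\<exists>p u v g u' v'.
        (p, g) \<in> action_domain X B \<and> pproj B p = m \<and>
        (p, u, v) \<in> Tot \<and> (pact B p g, u', v') \<in> Tot \<and>
        cpt (p0, a, b) = cpt (p, u, v) \<and> cpt (p0, a', b') = cpt (pact B p g, u', v') \<and>
        cpt (p0, a + a', b + b') = cpt (pact B p g, \<tau>0 p g u + u', tau1 X H g v + v')"
      by (intro exI[of _ p0] exI[of _ a] exI[of _ b] exI[of _ ?e] exI[of _ a'] exI[of _ b'])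
        (simp only: unit_in_domain[OF p0] m a act_unit[OF p0] simp_thms)
    fix D assume "\<exists>p u v g u' v'.
        (p, g) \<in> action_domain X B \<and> pproj B p = m \<and>
        (p, u, v) \<in> Tot \<and> (pact B p g, u', v') \<in> Tot \<and>
        cpt (p0, a, b) = cpt (p, u, v) \<and> cpt (p0, a', b') = cpt (pact B p g, u', v') \<and>
        D = cpt (pact B p g, \<tau>0 p g u + u', tau1 X H g v + v')"
    then obtain p u v g u' v' where d: "(p, g) \<in> action_domain X B" "pproj B p = m"
      "(p, u, v) \<in> Tot" "(pact B p g, u', v') \<in> Tot"
      "cpt (p0, a, b) = cpt (p, u, v)" "cpt (p0, a', b') = cpt (pact B p g, u', v')"
      and D: "D = cpt (pact B p g, \<tau>0 p g u + u', tau1 X H g v + v')"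
      by (elim exE conjE)
    show "D = cpt (p0, a + a', b + b')"
      unfolding D by (rule comp_add_well_defined[OF p0 _ d(1,3,4) a(1) d(5)[symmetric] a(2) d(6)[symmetric]]) (simp add: m d(2))
  qed
  then show ?thesis by (simp add: At_fibre_def)
qed

lemma fibre_add:
  assumes pg: "(p, g) \<in> action_domain X B" and m: "pproj B p = m" and z: "(p, u, v) \<in> Tot" and z': "(pact B p g, u', v') \<in> Tot"
  shows "cpt (p, u, v) \<oplus>\<^bsub>Fib m\<^esub> cpt (pact B p g, u', v') = cpt (pact B p g, \<tau>0 p g u + u', tau1 X H g v + v')"
proof -
  have q: "pact B p g \<in> mcarrier P" by (rule act_in[OF pg])
  note c = comp_at_point[OF z pg refl]
  have "cpt (p, u, v) \<oplus>\<^bsub>Fib m\<^esub> cpt (pact B p g, u', v') =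
      cpt (pact B p g, \<tau>0 p g u, tau1 X H g v) \<oplus>\<^bsub>Fib m\<^esub> cpt (pact B p g, u', v')"
    unfolding c(1) ..
  also have "\<dots> = cpt (pact B p g, \<tau>0 p g u + u', tau1 X H g v + v')"
    by (rule fibre_add_at_point[OF _ c(2) z']) (simp add: proj_act[OF pg] m)
  finally show ?thesis .
qed

lemma total_scale: "(p, u, v) \<in> Tot \<Longrightarrow> (p, tscale r u, tscale r v) \<in> Tot"
  by (simp add: At_total_iff tangent_space_scale)

lemma comp_scale_well_defined:
  assumes z: "(p, u, v) \<in> Tot" and z': "(q, u', v') \<in> Tot" and m: "pproj B p = pproj B q"
    and eq: "cpt (p, u, v) = cpt (q, u', v')"
  shows "cpt (p, tscale r u, tscale r v) = cpt (q, tscale r u', tscale r v')"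
proof -
  have p: "p \<in> mcarrier P" "q \<in> mcarrier P" using totalD(1)[OF z] totalD(1)[OF z'] by simp_all
  obtain g where g: "(p, g) \<in> action_domain X B" "pact B p g = q" using act_transitive[OF p m] .
  have zT: "u \<in> tangent_space P p" "v \<in> TX p" using z by (simp_all add: At_total_iff)
  note c = comp_at_point[OF z g] and cr = comp_at_point[OF total_scale[OF z, of r] g]
  have d: "\<tau>0 p g u - u' \<in> q0.defects q" "tau1 X H g v - v' \<in> q1.defects q"
    using eq unfolding c(1) comp_eq_at_point[OF c(2) z'] by simp_all
  have "\<tau>0 p g (tscale r u) - tscale r u' \<in> q0.defects q"
    using q0.defects_scale[OF d(1), of r] unfolding q0.tscale_diff q0.tau_scale[OF g(1) zT(1)] .
  moreover have "tau1 X H g (tscale r v) - tscale r v' \<in> q1.defects q"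
    using q1.defects_scale[OF d(2), of r] unfolding q1.tscale_diff q1.tau_scale[OF g(1) zT(2)] .
  ultimately show ?thesis unfolding cr(1) comp_eq_at_point[OF cr(2) total_scale[OF z']] by (rule conjI)
qed

lemma fibre_smult:
  assumes z: "(p, u, v) \<in> Tot" and m: "pproj B p = m"
  shows "r \<odot>\<^bsub>Fib m\<^esub> cpt (p, u, v) = cpt (p, tscale r u, tscale r v)"
proof -
  have "(THE D. \<exists>q u' v'. (q, u', v') \<in> Tot \<and> pproj B q = m \<and>
        cpt (p, u, v) = cpt (q, u', v') \<and> D = cpt (q, tscale r u', tscale r v')) = cpt (p, tscale r u, tscale r v)"
  proof (rule the_equality)
    show "\<exists>q u' v'. (q, u', v') \<in> Tot \<and> pproj B q = m \<and>
        cpt (p, u, v) = cpt (q, u', v') \<and> cpt (p, tscale r u, tscale r v) = cpt (q, tscale r u', tscale r v')"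
      by (intro exI[of _ p] exI[of _ u] exI[of _ v]) (simp only: z m simp_thms)
    fix D assume "\<exists>q u' v'. (q, u', v') \<in> Tot \<and> pproj B q = m \<and>
        cpt (p, u, v) = cpt (q, u', v') \<and> D = cpt (q, tscale r u', tscale r v')"
    then obtain q u' v' where q: "(q, u', v') \<in> Tot" "pproj B q = m" "cpt (p, u, v) = cpt (q, u', v')"
      and D: "D = cpt (q, tscale r u', tscale r v')" by (elim exE conjE)
    show "D = cpt (p, tscale r u, tscale r v)"
      unfolding D by (rule comp_scale_well_defined[OF z q(1) _ q(3), symmetric]) (simp add: m q(2))
  qed
  then show ?thesis by (simp add: At_fibre_def)
qed

lemma comp_zero:
  assumes "p \<in> mcarrier P" "p0 \<in> mcarrier P" "pproj B p = pproj B p0"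
  shows "cpt (p, 0, 0) = cpt (p0, 0, 0)"
proof -
  obtain k where k: "(p, k) \<in> action_domain X B" "pact B p k = p0" using act_transitive[OF assms] .
  show ?thesis
    using comp_at_point(1)[OF zero_in_total[OF assms(1)] k] unfolding q0.tau_zero[OF k(1)] q1.tau_zero[OF k(1)] .
qed

lemma fibre_zero:
  assumes p0: "p0 \<in> mcarrier P" "pproj B p0 = m"
  shows "\<zero>\<^bsub>Fib m\<^esub> = cpt (p0, 0, 0)"
proof -
  have "(THE C. \<exists>p\<in>mcarrier P. pproj B p = m \<and> C = cpt (p, 0, 0)) = cpt (p0, 0, 0)"
  proof (rule the_equality)
    show "\<exists>p\<in>mcarrier P. pproj B p = m \<and> cpt (p0, 0, 0) = cpt (p, 0, 0)" using p0 by blast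
    fix C assume "\<exists>p\<in>mcarrier P. pproj B p = m \<and> C = cpt (p, 0, 0)"
    then obtain p where p: "p \<in> mcarrier P" "pproj B p = m" and C: "C = cpt (p, 0, 0)" by blast
    show "C = cpt (p0, 0, 0)" unfolding C by (rule comp_zero[OF p(1) p0(1)]) (simp add: p p0)
  qed
  then show ?thesis by (simp add: At_fibre_def)
qed

text \<open>
  The pairs \<open>(a, b)\<close> at one point \<open>p0\<close> over \<open>m\<close> parametrize the components, by transitivity of the
  action; by freeness their identifications split into \<open>a\<close> and \<open>b\<close>.
\<close>

lemma graded_vector_space_fibre:
  assumes "m \<in> mcarrier (pbase B)"
  shows "graded_vector_space (Fib m) (At_grading X H B m)"
proof -
  obtain p0 where p0: "p0 \<in> mcarrier P" "pproj B p0 = m" using base_point[OF assms] .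
  let ?A0 = "tangent_space P p0" let ?A1 = "TX p0" let ?\<Psi> = "\<lambda>a b. cpt (p0, a, b)"
  have tot: "(p0, a, b) \<in> Tot" if "a \<in> ?A0" "b \<in> ?A1" for a b
    using that p0(1) by (simp add: At_total_iff)
  have base: "\<exists>k. (p, k) \<in> action_domain X B \<and> pact B p k = p0" if "(p, u, v) \<in> Tot" "pproj B p = m" for p u v
    using act_transitive[OF _ p0(1), of p] totalD(1)[OF that(1)] that(2) p0(2) by (metis fst_conv)
  show ?thesis
  proof (rule graded_vector_space_of_parametrization[of ?A0 ?A1 _ ?\<Psi>])
    show "0 \<in> ?A0" "0 \<in> ?A1" by (rule tangent_space_zero)+
    show "\<zero>\<^bsub>Fib m\<^esub> = ?\<Psi> 0 0" by (rule fibre_zero[OF p0])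
    show "C \<in> carrier (Fib m) \<longleftrightarrow> (\<exists>a\<in>?A0. \<exists>b\<in>?A1. C = ?\<Psi> a b)" for C
    proof
      assume "C \<in> carrier (Fib m)"
      then obtain z where z: "z \<in> Tot" "pproj B (fst z) = m" "C = cpt z" unfolding carrier_fibre by blast
      obtain p u v where puv: "z = (p, u, v)" by (cases z)
      obtain k where k: "(p, k) \<in> action_domain X B" "pact B p k = p0" using base[of p u v] z puv by auto
      have zT: "(p, u, v) \<in> Tot" using z(1) puv by simp
      note c = comp_at_point[OF zT k]
      show "\<exists>a\<in>?A0. \<exists>b\<in>?A1. C = ?\<Psi> a b"
        using c(2) unfolding z(3) puv c(1) At_total_iff by blast
    next
      assume "\<exists>a\<in>?A0. \<exists>b\<in>?A1. C = ?\<Psi> a b"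
      then obtain a b where "a \<in> ?A0" "b \<in> ?A1" "C = ?\<Psi> a b" by blast
      then show "C \<in> carrier (Fib m)" unfolding carrier_fibre using tot p0(2) by (intro bexI[of _ "(p0, a, b)"]) simp_all
    qed
    show "?\<Psi> a b \<oplus>\<^bsub>Fib m\<^esub> ?\<Psi> a' b' = ?\<Psi> (a + a') (b + b')"
      if "a \<in> ?A0" "b \<in> ?A1" "a' \<in> ?A0" "b' \<in> ?A1" for a b a' b'
      by (rule fibre_add_at_point[OF p0(2) tot[OF that(1,2)] tot[OF that(3,4)]])
    show "r \<odot>\<^bsub>Fib m\<^esub> ?\<Psi> a b = ?\<Psi> (tscale r a) (tscale r b)" if "a \<in> ?A0" "b \<in> ?A1" for r a b
      by (rule fibre_smult[OF tot[OF that] p0(2)])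
    show "?\<Psi> a 0 = ?\<Psi> a' 0 \<and> ?\<Psi> 0 b = ?\<Psi> 0 b'"
      if "a \<in> ?A0" "b \<in> ?A1" "a' \<in> ?A0" "b' \<in> ?A1" and eq: "?\<Psi> a b = ?\<Psi> a' b'" for a b a' b'
    proof -
      have d: "a - a' \<in> q0.defects p0" "b - b' \<in> q1.defects p0"
        using eq unfolding comp_eq_at_point[OF tot[OF that(1,2)] tot[OF that(3,4)]] by simp_all
      show ?thesis
        unfolding comp_eq_at_point[OF tot[OF that(1) tangent_space_zero] tot[OF that(3) tangent_space_zero]]
          comp_eq_at_point[OF tot[OF tangent_space_zero that(2)] tot[OF tangent_space_zero that(4)]]
        using d q0.defects_zero q1.defects_zero by (simp only: diff_self simp_thms)
    qed
    show "C \<in> At_grading X H B m 0 \<longleftrightarrow> (\<exists>a\<in>?A0. C = ?\<Psi> a 0)" for C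
    proof
      assume "C \<in> At_grading X H B m 0"
      then obtain p u where z: "(p, u, 0) \<in> Tot" "pproj B p = m" and C: "C = cpt (p, u, 0)"
        unfolding At_grading_def by auto
      obtain k where k: "(p, k) \<in> action_domain X B" "pact B p k = p0" using base[OF z] by blast
      note c = comp_at_point[OF z(1) k, unfolded q1.tau_zero[OF k(1)]]
      show "\<exists>a\<in>?A0. C = ?\<Psi> a 0" using c(2) unfolding C c(1) At_total_iff by blast
    next
      assume "\<exists>a\<in>?A0. C = ?\<Psi> a 0"
      then show "C \<in> At_grading X H B m 0"
        unfolding At_grading_def using tot[OF _ tangent_space_zero] p0(2) by auto
    qed
    show "C \<in> At_grading X H B m 1 \<longleftrightarrow> (\<exists>b\<in>?A1. C = ?\<Psi> 0 b)" for C
    proof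
      assume "C \<in> At_grading X H B m 1"
      then obtain p v where z: "(p, 0, v) \<in> Tot" "pproj B p = m" and C: "C = cpt (p, 0, v)"
        unfolding At_grading_def by auto
      obtain k where k: "(p, k) \<in> action_domain X B" "pact B p k = p0" using base[OF z] by blast
      note c = comp_at_point[OF z(1) k, unfolded q0.tau_zero[OF k(1)]]
      show "\<exists>b\<in>?A1. C = ?\<Psi> 0 b" using c(2) unfolding C c(1) At_total_iff by blast
    next
      assume "\<exists>b\<in>?A1. C = ?\<Psi> 0 b"
      then show "C \<in> At_grading X H B m 1"
        unfolding At_grading_def using tot[OF tangent_space_zero] p0(2) by auto
    qed
    show "At_grading X H B m k = {\<zero>\<^bsub>Fib m\<^esub>}" if "k \<noteq> 0" "k \<noteq> 1" for k
      using that by (simp add: At_grading_def)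
  qed (rule tangent_space_add tangent_space_scale; assumption)+
qed

end

theorem proposition10:
  fixes X :: "('x, 'g) lgroupoid"
    and H :: "'g \<Rightarrow> 'g tvec set"
    and B :: "('x, 'g, 'p, 'm) pbundle"
  assumes "lie_groupoid X"
    and "ehresmann_connection X H"
    and "principal_bundle X B"
  shows "equiv (At_total X B) (At_rel X H B) \<and>
    (\<forall>p u v g. (p, u, v) \<in> At_total X B \<and> (p, g) \<in> action_domain X B \<longrightarrow>
       gtgt (At_groupoid X H B) (At_class X H B (p, u, v), g) =
         At_class X H B (pact B p g, tau0 X H B p g u, tau1 X H g v)) \<and>
    diffeological_groupoid (At_groupoid X H B) \<and>
    smooth_functor (At_groupoid X H B) (discrete_dgroupoid (mfd_diffeology (pbase B)))
      (At_proj_obj B) (At_proj_arr B) \<and>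
    (\<forall>p u v. (p, u, v) \<in> At_total X B \<longrightarrow>
       At_proj_obj B (At_class X H B (p, u, v)) = pproj B p \<and>
       (\<forall>g. (p, g) \<in> action_domain X B \<longrightarrow>
          At_proj_arr B (At_class X H B (p, u, v), g) = pproj B p)) \<and>
    At_proj_obj B ` dcarrier (gobj (At_groupoid X H B)) = mcarrier (pbase B) \<and>
    At_proj_arr B ` dcarrier (garr (At_groupoid X H B)) = mcarrier (pbase B) \<and>
    (\<forall>m\<in>mcarrier (pbase B).
       graded_vector_space (At_fibre X H B m) (At_grading X H B m) \<and>
       (\<forall>p u v g u' v'. (p, g) \<in> action_domain X B \<and> pproj B p = m \<and>
          (p, u, v) \<in> At_total X B \<and> (pact B p g, u', v') \<in> At_total X B \<longrightarrow>
          At_component X H B (p, u, v) \<oplus>\<^bsub>At_fibre X H B m\<^esub>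
            At_component X H B (pact B p g, u', v') =
          At_component X H B (pact B p g, tau0 X H B p g u + u', tau1 X H g v + v')) \<and>
       (\<forall>p u v c. (p, u, v) \<in> At_total X B \<and> pproj B p = m \<longrightarrow>
          c \<odot>\<^bsub>At_fibre X H B m\<^esub> At_component X H B (p, u, v) =
          At_component X H B (p, tscale c u, tscale c v)))"
proof -
  interpret principal_bundle_with_connection X H B by unfold_locales (rule assms)+
  show ?thesis
  proof (intro conjI allI impI ballI)
    fix p u v g assume z: "(p, u, v) \<in> At_total X B \<and> (p, g) \<in> action_domain X B"
    then show "gtgt (At_groupoid X H B) (At_class X H B (p, u, v), g) =
         At_class X H B (pact B p g, tau0 X H B p g u, tau1 X H g v)"
      using gtgt_cls[of "(p, u, v)" g] by (simp add: shift_def)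
  next
    fix m p u v g u' v'
    assume "(p, g) \<in> action_domain X B \<and> pproj B p = m \<and>
          (p, u, v) \<in> At_total X B \<and> (pact B p g, u', v') \<in> At_total X B"
    then show "At_component X H B (p, u, v) \<oplus>\<^bsub>At_fibre X H B m\<^esub>
            At_component X H B (pact B p g, u', v') =
          At_component X H B (pact B p g, tau0 X H B p g u + u', tau1 X H g v + v')"
      by (elim conjE) (rule fibre_add)
  next
    fix m p u v c assume "(p, u, v) \<in> At_total X B \<and> pproj B p = m"
    then show "c \<odot>\<^bsub>At_fibre X H B m\<^esub> At_component X H B (p, u, v) =
          At_component X H B (p, tscale c u, tscale c v)"
      by (elim conjE) (rule fibre_smult)
  qed (simp_all only: equiv_At_rel diffeological_groupoid_At smooth_functor_At At_proj_surj graded_vector_space_fibre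
      At_proj_obj_cls At_proj_arr_eq fst_conv)
qed

end
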